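(* Let $G_1$ and $G_2$ be internally $4$-connected graphs such that $|E(G_1)|\le15$ and $G_1$ has a proper $G_2$-minor. Assume also that whenever $G$ is an internally $4$-connected graph such that $G_1$ has a proper $G$-minor and $G$ has a $G_2$-minor, then $|E(G_1)|-|E(G)|>3$. Then, up to isomorphism, one of the following holds: (i) $G_1$ is one of $K_5$, $Q_3$, $O$, $\mathrm{QML}_7$, and $G_2$ is $K_4$; (ii) $G_1$ is one of $H_1,H_2,H_3,\mathrm{QML}_7$, and $G_2$ is $K_{3,3}$; (iii) $G_1$ is one of $Q_3^{\times}$, $Y_9$, $\mathrm{QML}_7$, $\mathrm{CML}_{10}$, and $G_2$ is $K_5$.
   Context: Let $G$ be a simple $3$-connected graph. For a partition $(X,Y)$ of $E(G)$, let $V(X,Y)$ be the set of vertices incident with edges of both $X$ and $Y$. $G$ is internally $4$-connected if, whenever $3\le|X|\le|Y|$, we have $|V(X,Y)|\ge3$, and equality implies that $X$ is a triangle or the set of edges incident with a vertex of degree $3$. $Q_3$ is the cube graph and $O$ the octahedron graph. $\mathrm{QML}_7$ has vertex set $\mathbb{Z}_7$ with $i$ adjacent to $i\pm1$ and $i\pm3$. $\mathrm{CML}_{10}$ has vertex set $\mathbb{Z}_{10}$ with $i$ adjacent to $i\pm1$ and $i+5$. $H_1$ has vertices $0,\dots,5$ and edges $01,02,04,05,12,13,14,15,23,24,34,35,45$. $H_2$ has vertices $0,\dots,6$ and edges $01,03,05,12,14,16,23,25,26,34,36,45,46$. $H_3$ has vertices $0,\dots,7$ and edges $01,03,07,12,16,23,25,27,34,45,47,56,67$.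 $Q_3^{\times}$ has vertices $0,\dots,7$ and edges $01,05,07,12,14,23,26,27,34,36,37,45,56,67$. $Y_9$ has vertices $0,\dots,8$ and edges $01,03,05,07,12,18,23,26,34,45,48,56,67,78$. *)

theory Defs
  imports Main
begin

record 'a graph =
  verts :: "'a set"
  edges :: "'a set set"

definition simple_graph :: "'a graph \<Rightarrow> bool" where
  "simple_graph G \<longleftrightarrow> finite (verts G) \<and> (\<forall>e\<in>edges G. e \<subseteq> verts G \<and> card e = 2)"

definition graph_iso :: "'a graph \<Rightarrow> 'b graph \<Rightarrow> bool" (infix "\<cong>\<^sub>G" 50) where
  "G \<cong>\<^sub>G H \<longleftrightarrow> (\<exists>f. bij_betw f (verts G) (verts H) \<and> edges H = (\<lambda>e. f ` e) ` edges G)"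

definition delete_edge :: "'a graph \<Rightarrow> 'a set \<Rightarrow> 'a graph" where
  "delete_edge G e = \<lparr>verts = verts G, edges = edges G - {e}\<rparr>"

definition delete_verts :: "'a graph \<Rightarrow> 'a set \<Rightarrow> 'a graph" where
  "delete_verts G S = \<lparr>verts = verts G - S, edges = {e \<in> edges G. e \<inter> S = {}}\<rparr>"

text \<open>Contracting the edge \<open>uv\<close> merges \<open>v\<close> into \<open>u\<close>. Since edges form a set, parallel edges that
  arise are identified; this does not affect which simple graphs can be reached as minors.\<close>

definition contract_edge :: "'a graph \<Rightarrow> 'a \<Rightarrow> 'a \<Rightarrow> 'a graph" where
  "contract_edge G u v =
     \<lparr>verts = verts G - {v},
      edges = (\<lambda>e. (\<lambda>x. if x = v then u else x) ` e) ` (edges G - {{u, v}})\<rparr>"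

inductive minor_step :: "'a graph \<Rightarrow> 'a graph \<Rightarrow> bool" where
  del_edge: "e \<in> edges G \<Longrightarrow> minor_step G (delete_edge G e)"
| del_vert: "v \<in> verts G \<Longrightarrow> minor_step G (delete_verts G {v})"
| contract: "{u, v} \<in> edges G \<Longrightarrow> u \<noteq> v \<Longrightarrow> minor_step G (contract_edge G u v)"

text \<open>\<open>G\<close> has an \<open>H\<close>-minor if some minor of \<open>G\<close> is isomorphic to \<open>H\<close>; the minor is proper if at
  least one operation is used to obtain it.\<close>

definition has_minor :: "'a graph \<Rightarrow> 'b graph \<Rightarrow> bool" where
  "has_minor G H \<longleftrightarrow> (\<exists>G'. minor_step\<^sup>*\<^sup>* G G' \<and> G' \<cong>\<^sub>G H)"

definition has_proper_minor :: "'a graph \<Rightarrow> 'b graph \<Rightarrow> bool" where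
  "has_proper_minor G H \<longleftrightarrow> (\<exists>G'. minor_step\<^sup>+\<^sup>+ G G' \<and> G' \<cong>\<^sub>G H)"

definition connected_graph :: "'a graph \<Rightarrow> bool" where
  "connected_graph G \<longleftrightarrow> verts G \<noteq> {} \<and>
     (\<forall>u\<in>verts G. \<forall>v\<in>verts G. (u, v) \<in> {(x, y). {x, y} \<in> edges G}\<^sup>*)"

definition k_connected :: "nat \<Rightarrow> 'a graph \<Rightarrow> bool" where
  "k_connected k G \<longleftrightarrow> k < card (verts G) \<and>
     (\<forall>S \<subseteq> verts G. card S < k \<longrightarrow> connected_graph (delete_verts G S))"

definition incident_edges :: "'a graph \<Rightarrow> 'a \<Rightarrow> 'a set set" where
  "incident_edges G v = {e \<in> edges G. v \<in> e}"

definition degree :: "'a graph \<Rightarrow> 'a \<Rightarrow> nat" where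
  "degree G v = card (incident_edges G v)"

definition boundary :: "'a set set \<Rightarrow> 'a set set \<Rightarrow> 'a set" where
  "boundary X Y = {v. (\<exists>e\<in>X. v \<in> e) \<and> (\<exists>e\<in>Y. v \<in> e)}"

definition is_triangle :: "'a set set \<Rightarrow> bool" where
  "is_triangle X \<longleftrightarrow>
     (\<exists>a b c. a \<noteq> b \<and> b \<noteq> c \<and> a \<noteq> c \<and> X = {{a, b}, {b, c}, {a, c}})"

definition internally_4_connected :: "'a graph \<Rightarrow> bool" where
  "internally_4_connected G \<longleftrightarrow> simple_graph G \<and> k_connected 3 G \<and>
     (\<forall>X Y. X \<union> Y = edges G \<and> X \<inter> Y = {} \<and> 3 \<le> card X \<and> card X \<le> card Y \<longrightarrow>
        3 \<le> card (boundary X Y) \<and>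
        (card (boundary X Y) = 3 \<longrightarrow>
           is_triangle X \<or> (\<exists>v\<in>verts G. degree G v = 3 \<and> X = incident_edges G v)))"

definition complete_graph :: "nat \<Rightarrow> nat graph" where
  "complete_graph n = \<lparr>verts = {..<n}, edges = {{i, j} | i j. i < n \<and> j < n \<and> i \<noteq> j}\<rparr>"

definition complete_bipartite :: "nat \<Rightarrow> nat \<Rightarrow> nat graph" where
  "complete_bipartite m n =
     \<lparr>verts = {..<m + n}, edges = {{i, j} | i j. i < m \<and> m \<le> j \<and> j < m + n}\<rparr>"

text \<open>The vertices of the cube are the subsets of a 3-element set.\<close>

definition cube :: "nat set graph" where
  "cube = \<lparr>verts = Pow {..<3}, edges = {{A, insert i A} | A i. A \<subseteq> {..<3} \<and> i < 3 \<and> i \<notin> A}\<rparr>"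

text \<open>The antipodal pairs of the octahedron are \<open>{i, i + 3}\<close>.\<close>

definition octahedron :: "nat graph" where
  "octahedron = \<lparr>verts = {..<6}, edges = {{i, j} | i j. i < 6 \<and> j < 6 \<and> i mod 3 \<noteq> j mod 3}\<rparr>"

text \<open>The graph on \<open>\<int>\<^sub>n\<close> in which \<open>i\<close> is adjacent to \<open>i \<plusminus> d\<close> for \<open>d \<in> D\<close>.\<close>

definition circulant :: "nat \<Rightarrow> nat set \<Rightarrow> nat graph" where
  "circulant n D = \<lparr>verts = {..<n}, edges = {{i, (i + d) mod n} | i d. i < n \<and> d \<in> D}\<rparr>"

definition QML7 :: "nat graph" where
  "QML7 = circulant 7 {1, 3}"

definition CML10 :: "nat graph" where
  "CML10 = circulant 10 {1, 5}"

definition graph_of_list :: "nat \<Rightarrow> (nat \<times> nat) list \<Rightarrow> nat graph" where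
  "graph_of_list n es = \<lparr>verts = {..<n}, edges = {{i, j} | i j. (i, j) \<in> set es}\<rparr>"

definition H1 :: "nat graph" where
  "H1 = graph_of_list 6
     [(0, 1), (0, 2), (0, 4), (0, 5), (1, 2), (1, 3), (1, 4),
      (1, 5), (2, 3), (2, 4), (3, 4), (3, 5), (4, 5)]"

definition H2 :: "nat graph" where
  "H2 = graph_of_list 7
     [(0, 1), (0, 3), (0, 5), (1, 2), (1, 4), (1, 6), (2, 3),
      (2, 5), (2, 6), (3, 4), (3, 6), (4, 5), (4, 6)]"

definition H3 :: "nat graph" where
  "H3 = graph_of_list 8
     [(0, 1), (0, 3), (0, 7), (1, 2), (1, 6), (2, 3), (2, 5),
      (2, 7), (3, 4), (4, 5), (4, 7), (5, 6), (6, 7)]"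

definition Q3_times :: "nat graph" where
  "Q3_times = graph_of_list 8
     [(0, 1), (0, 5), (0, 7), (1, 2), (1, 4), (2, 3), (2, 6),
      (2, 7), (3, 4), (3, 6), (3, 7), (4, 5), (5, 6), (6, 7)]"

definition Y9 :: "nat graph" where
  "Y9 = graph_of_list 9
     [(0, 1), (0, 3), (0, 5), (0, 7), (1, 2), (1, 8), (2, 3),
      (2, 6), (3, 4), (4, 5), (4, 8), (5, 6), (6, 7), (7, 8)]"

end

theory Submission
  imports Defs
begin

text \<open>
  An internally 4-connected graph with at least eight edges has minimum degree three, no triangle
  through a cubic vertex, and no separation of order at most three with two or more vertices on each
  side. Together with the handshake identity these constraints are so strong that a branching search
  over the adjacency matrix is short, provided a state is closed as soon as it is, up to a permutation
  of the vertices, an instance of a state refuted before. For each number \<open>m \<le> 15\<close> of edges the search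
  shows that the graph has a minor in a short list: the graphs with \<open>m\<close> edges in the statement, a few
  more with \<open>m\<close> edges, and, for \<open>m \<ge> 14\<close>, also \<open>H\<^sub>1\<close>, \<open>H\<^sub>2\<close>, \<open>H\<^sub>3\<close> and (for \<open>m = 15\<close>) \<open>Y\<^sub>9\<close>. The last four
  have all of \<open>K\<^sub>4\<close>, \<open>K\<^bsub>3,3\<^esub>\<close>, \<open>K\<^sub>5\<close> as minors, and these three are the only internally 4-connected graphs with
  at most 11 edges; so they violate the gap. A listed minor with \<open>m\<close> edges is the graph itself, and then
  one of \<open>K\<^bsub>3,3\<^esub>\<close>, \<open>O\<close>, \<open>Q\<^sub>3\<close>, \<open>V\<^sub>8\<close> (the Wagner graph) is an intermediate graph in all cases but those of the
  statement. For the two planar graphs with 15 edges one also needs that they have no \<open>K\<^bsub>3,3\<^esub>\<close>- or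
  \<open>K\<^sub>5\<close>-minor, which is decided by trying all contractions.
\<close>

section \<open>Isomorphism and minors\<close>

text \<open>The bound on \<open>G2\<close> comes from the gap itself: \<open>G2\<close> is a minor
  of itself, so it may serve as the intermediate graph, whence |E(G2)| + 4 \<le> |E(G1)| \<le> 15.
  Minimum degree three and the handshake identity leave at most ten vertices, so every search lives
  on ten fixed letters. A search never has to identify a graph: a leaf only exhibits one listed
  minor, which is cheap to verify, and comparing numbers of edges decides afterwards whether that
  minor is the whole graph. Closing states up to a permutation needs no symmetry breaking, because a
  state is refuted for every labelling of the vertices, and a labelling composed with a permutation
  is again one. The two planar graphs resist the gap argument when \<open>G2\<close> is K33 or K5:
  they have no such minor, so no chain of minors can be exhibited. Only there must the absence of a
  minor be proved, which is why minor models appear besides sequences of operations.\<close>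

definition wf_graph :: "'a graph \<Rightarrow> bool" where
  "wf_graph G \<longleftrightarrow> (\<forall>e\<in>edges G. e \<subseteq> verts G)"

lemma graph_eta: "\<lparr>verts = verts G, edges = edges G\<rparr> = (G :: 'a graph)"
  by (cases G) simp

lemma simple_graph_wf: "simple_graph G \<Longrightarrow> wf_graph G"
  by (simp add: simple_graph_def wf_graph_def)

lemma simple_graph_finite_edges: "simple_graph G \<Longrightarrow> finite (edges G)"
  unfolding simple_graph_def by (meson PowI finite_Pow_iff finite_subset subsetI)

lemma graph_isoI:
  "bij_betw f (verts G) (verts H) \<Longrightarrow> edges H = (\<lambda>e. f ` e) ` edges G \<Longrightarrow> G \<cong>\<^sub>G H"
  unfolding graph_iso_def by blast

lemma graph_iso_trans: "G \<cong>\<^sub>G H \<Longrightarrow> H \<cong>\<^sub>G K \<Longrightarrow> G \<cong>\<^sub>G K"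
  unfolding graph_iso_def
proof (elim exE conjE)
  fix f g assume "bij_betw f (verts G) (verts H)" "edges H = (`) f ` edges G"
    "bij_betw g (verts H) (verts K)" "edges K = (`) g ` edges H"
  then show "\<exists>f. bij_betw f (verts G) (verts K) \<and> edges K = (`) f ` edges G"
    by (intro exI[of _ "g \<circ> f"]) (auto intro: bij_betw_trans simp: image_comp)
qed

text \<open>\<open>graph_iso\<close> reaches edges only through a bijection of the vertices; the
  inverse map undoes it on an edge only if the edge lies inside the vertex set. Hence
  \<open>wf_graph\<close> accompanies transport along isomorphisms.\<close>

lemma graph_iso_sym:
  assumes "wf_graph G" "G \<cong>\<^sub>G H" shows "H \<cong>\<^sub>G G"
proof -
  obtain f where f: "bij_betw f (verts G) (verts H)" "edges H = (`) f ` edges G"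
    using assms(2) unfolding graph_iso_def by blast
  let ?g = "inv_into (verts G) f"
  have inj: "inj_on f (verts G)" using f(1) by (simp add: bij_betw_def)
  have "?g ` f ` e = e" if "e \<in> edges G" for e
    using that assms(1) inj unfolding wf_graph_def by (meson inv_into_image_cancel)
  then have "edges G = (`) ?g ` edges H" unfolding f(2) by (force simp: image_iff)
  then show ?thesis using bij_betw_inv_into[OF f(1)] by (intro graph_isoI) auto
qed

lemma graph_iso_wf: "G \<cong>\<^sub>G H \<Longrightarrow> wf_graph G \<Longrightarrow> wf_graph H"
  unfolding graph_iso_def wf_graph_def bij_betw_def
  by (elim exE conjE) (simp add: ball_simps(9), metis image_mono)

lemma graph_iso_card_edges:
  assumes "wf_graph G" "G \<cong>\<^sub>G H" shows "card (edges H) = card (edges G)"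
proof -
  obtain f where f: "bij_betw f (verts G) (verts H)" "edges H = (`) f ` edges G"
    using assms(2) unfolding graph_iso_def by blast
  have "inj_on ((`) f) (edges G)"
    using f(1) assms(1) unfolding wf_graph_def bij_betw_def
    by (meson PowI inj_on_image_Pow inj_on_subset subsetI)
  then show ?thesis by (simp add: f(2) card_image)
qed

lemma minor_step_wf:
  assumes "minor_step G G'" "wf_graph G" shows "wf_graph G'"
  using assms
proof cases
  case (contract u v)
  have "e \<subseteq> verts G" if "e \<in> edges G" for e using that assms(2) by (auto simp: wf_graph_def)
  moreover have "u \<in> verts G" using contract assms(2) by (auto simp: wf_graph_def)
  ultimately show ?thesis using contract unfolding wf_graph_def contract_edge_def by fastforce
qed (auto simp: wf_graph_def delete_edge_def delete_verts_def)

lemma minor_steps_wf: "minor_step\<^sup>*\<^sup>* G G' \<Longrightarrow> wf_graph G \<Longrightarrow> wf_graph G'"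
  by (induction rule: rtranclp_induct) (auto intro: minor_step_wf)

text \<open>Injectivity on the vertices makes taking images injective on edges, so each of the three
  operations commutes with relabelling.\<close>

lemma minor_step_iso:
  assumes "minor_step G G'" "wf_graph G" "G \<cong>\<^sub>G H"
  shows "\<exists>H'. minor_step H H' \<and> G' \<cong>\<^sub>G H'"
proof -
  obtain f where f: "bij_betw f (verts G) (verts H)" "edges H = (`) f ` edges G"
    using assms(3) unfolding graph_iso_def by blast
  have inj: "inj_on f (verts G)" using f(1) by (simp add: bij_betw_def)
  have sub: "e \<subseteq> verts G" if "e \<in> edges G" for e using that assms(2) by (auto simp: wf_graph_def)
  have eq: "f ` e = f ` e' \<longleftrightarrow> e = e'" if "e \<subseteq> verts G" "e' \<subseteq> verts G" for e e'
    using inj that by (rule inj_on_image_eq_iff)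
  have bij: "bij_betw f (verts G - {v}) (verts H - {f v})" if "v \<in> verts G" for v
    using f(1) that by (auto simp: bij_betw_def inj_on_def)
  show ?thesis using assms(1)
  proof cases
    case (del_edge e)
    have "(`) f ` (edges G - {e}) = edges H - {f ` e}"
      unfolding f(2) using eq sub del_edge(2) by blast
    then have "G' \<cong>\<^sub>G delete_edge H (f ` e)" using del_edge(1) f(1)
      by (intro graph_isoI[of f]) (simp_all add: delete_edge_def)
    moreover have "f ` e \<in> edges H" using del_edge(2) f(2) by simp
    ultimately show ?thesis
      using minor_step.del_edge[of "f ` e" H] by (intro exI[of _ "delete_edge H (f ` e)"]) simp
  next
    case (del_vert v)
    have "f v \<in> f ` e \<longleftrightarrow> v \<in> e" if "e \<in> edges G" for e
      using inj sub[OF that] del_vert(2) by (auto simp: inj_on_def)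
    then have "(`) f ` {e \<in> edges G. e \<inter> {v} = {}} = {e \<in> edges H. e \<inter> {f v} = {}}"
      unfolding f(2) by auto
    then have "G' \<cong>\<^sub>G delete_verts H {f v}" using del_vert bij
      by (intro graph_isoI[of f]) (simp_all add: delete_verts_def)
    moreover have "f v \<in> verts H" using del_vert(2) f(1) by (auto simp: bij_betw_def)
    ultimately show ?thesis
      using minor_step.del_vert[of "f v" H] by (intro exI[of _ "delete_verts H {f v}"]) simp
  next
    case (contract u v)
    have uv: "u \<in> verts G" "v \<in> verts G" using sub[OF contract(2)] by auto
    let ?r = "\<lambda>x. if x = v then u else x" and ?s = "\<lambda>y. if y = f v then f u else y"
    \<comment> \<open>Merging commutes with relabelling because no vertex of \<open>e\<close> other
      than \<open>v\<close> is sent to \<open>f v\<close>.\<close>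
    have r: "f ` ?r ` e = ?s ` f ` e" if "e \<in> edges G" for e
    proof -
      have "f (?r x) = ?s (f x)" if "x \<in> e" for x
        using that sub[OF \<open>e \<in> edges G\<close>] uv(2) inj by (auto simp: inj_on_def)
      then show ?thesis unfolding image_image by (rule image_cong[OF refl])
    qed
    have E: "edges H - {{f u, f v}} = (`) f ` (edges G - {{u, v}})"
    proof -
      have "f ` e = {f u, f v} \<longleftrightarrow> e = {u, v}" if "e \<in> edges G" for e
        using eq[of e "{u, v}"] sub[OF that] uv by simp
      then show ?thesis unfolding f(2) by blast
    qed
    have "(`) ?s ` (edges H - {{f u, f v}}) = (\<lambda>e. ?s ` f ` e) ` (edges G - {{u, v}})"
      unfolding E image_image ..
    also have "\<dots> = (\<lambda>e. f ` ?r ` e) ` (edges G - {{u, v}})"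
      by (rule image_cong[OF refl]) (use r in simp)
    also have "\<dots> = (`) f ` (`) ?r ` (edges G - {{u, v}})"
      by (simp add: image_image)
    finally have "(`) ?s ` (edges H - {{f u, f v}}) = (`) f ` (`) ?r ` (edges G - {{u, v}})" .
    then have "G' \<cong>\<^sub>G contract_edge H (f u) (f v)" using contract(1) bij[OF uv(2)]
      by (intro graph_isoI[of f]) (simp_all add: contract_edge_def)
    moreover have "{f u, f v} \<in> edges H" using imageI[OF contract(2), of "(`) f"] f(2) by simp
    moreover have "f u \<noteq> f v" using contract(3) uv inj by (auto simp: inj_on_def)
    ultimately show ?thesis
      using minor_step.contract[of "f u" "f v" H] by (intro exI[of _ "contract_edge H (f u) (f v)"]) simp
  qed
qed

lemma minor_steps_iso:
  assumes "minor_step\<^sup>*\<^sup>* G G'" "wf_graph G" "G \<cong>\<^sub>G H"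
  shows "\<exists>H'. minor_step\<^sup>*\<^sup>* H H' \<and> G' \<cong>\<^sub>G H'"
  using assms
proof (induction rule: rtranclp_induct)
  case (step G' G'')
  then obtain H' where H': "minor_step\<^sup>*\<^sup>* H H'" "G' \<cong>\<^sub>G H'" by blast
  obtain H'' where "minor_step H' H''" "G'' \<cong>\<^sub>G H''"
    using minor_step_iso[OF step.hyps(2) minor_steps_wf[OF step.hyps(1) step.prems(1)] H'(2)] by blast
  then show ?case using rtranclp.rtrancl_into_rtrancl[OF H'(1)] by blast
next
  case base
  then show ?case by (meson rtranclp.rtrancl_refl)
qed

text \<open>The second chain of operations starts at \<open>H\<close>, whereas the first ends at a
  graph only isomorphic to \<open>H\<close>. The second chain is therefore replayed along the
  inverse isomorphism.\<close>

lemma has_minor_trans: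
  assumes "wf_graph G" "has_minor G H" "has_minor H K"
  shows "has_minor G K"
proof -
  obtain G' H' where G': "minor_step\<^sup>*\<^sup>* G G'" "G' \<cong>\<^sub>G H" and H': "minor_step\<^sup>*\<^sup>* H H'" "H' \<cong>\<^sub>G K"
    using assms(2,3) unfolding has_minor_def by blast
  have wf: "wf_graph G'" "wf_graph H"
    using minor_steps_wf[OF G'(1) assms(1)] graph_iso_wf[OF G'(2)] by auto
  obtain G'' where G'': "minor_step\<^sup>*\<^sup>* G' G''" "H' \<cong>\<^sub>G G''"
    using minor_steps_iso[OF H'(1) wf(2) graph_iso_sym[OF wf(1) G'(2)]] by blast
  have "G'' \<cong>\<^sub>G K"
    using graph_iso_trans[OF graph_iso_sym[OF minor_steps_wf[OF H'(1) wf(2)] G''(2)] H'(2)] .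
  then show ?thesis using G'(1) G''(1) unfolding has_minor_def by (meson rtranclp_trans)
qed

lemma graph_iso_has_minor: "G \<cong>\<^sub>G H \<Longrightarrow> has_minor G H"
  unfolding has_minor_def by blast

section \<open>Numbers of edges along minors\<close>

lemma minor_step_card_edges:
  assumes "minor_step G G'" "finite (edges G)"
  shows "finite (edges G') \<and> card (edges G') \<le> card (edges G)"
  using assms
proof cases
  case (contract u v)
  show ?thesis using assms(2) contract(1)
    by (simp add: contract_edge_def) (meson card_Diff1_le card_image_le dual_order.trans finite_Diff)
qed (auto simp: delete_edge_def delete_verts_def intro: card_mono)

lemma minor_steps_card_edges:
  "minor_step\<^sup>*\<^sup>* G G' \<Longrightarrow> finite (edges G) \<Longrightarrow> finite (edges G') \<and> card (edges G') \<le> card (edges G)"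
proof (induction rule: rtranclp_induct)
  case (step G' G'')
  then show ?case using minor_step_card_edges[OF step.hyps(2)] by fastforce
qed simp

text \<open>Deleting an isolated vertex is the only operation that keeps the number of edges; the
  last assumption excludes it.\<close>

lemma minor_step_card_edges_less:
  assumes "minor_step G G'" "finite (edges G)" "\<forall>v\<in>verts G. \<exists>e\<in>edges G. v \<in> e"
  shows "card (edges G') < card (edges G)"
  using assms(1)
proof cases
  case (del_edge e)
  then show ?thesis using card_Diff1_less[OF assms(2), of e] by (simp add: delete_edge_def)
next
  case (del_vert v)
  then obtain e where "e \<in> edges G" "v \<in> e" using assms(3) by blast
  then have "{e \<in> edges G. e \<inter> {v} = {}} \<subset> edges G" by blast
  then show ?thesis using del_vert(1) assms(2) by (simp add: delete_verts_def psubset_card_mono)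
next
  case (contract u v)
  have "card (edges G') \<le> card (edges G - {{u, v}})"
    using contract(1) assms(2) by (simp add: contract_edge_def card_image_le)
  also have "\<dots> < card (edges G)" using contract(2) assms(2) by (rule card_Diff1_less[rotated])
  finally show ?thesis .
qed

lemma has_proper_minor_card_edges:
  assumes "has_proper_minor G H" "wf_graph G" "finite (edges G)" "\<forall>v\<in>verts G. \<exists>e\<in>edges G. v \<in> e"
  shows "card (edges H) < card (edges G)"
proof -
  obtain G' where G': "minor_step\<^sup>+\<^sup>+ G G'" "G' \<cong>\<^sub>G H" using assms(1) unfolding has_proper_minor_def by blast
  obtain G1 where G1: "minor_step G G1" "minor_step\<^sup>*\<^sup>* G1 G'" using tranclpD[OF G'(1)] by blast
  have "card (edges G') < card (edges G)"
    using minor_step_card_edges_less[OF G1(1) assms(3,4)] minor_step_card_edges[OF G1(1) assms(3)]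
      minor_steps_card_edges[OF G1(2)] by linarith
  moreover have "wf_graph G'" using minor_steps_wf[OF tranclp_into_rtranclp[OF G'(1)] assms(2)] .
  ultimately show ?thesis using graph_iso_card_edges[OF _ G'(2)] by simp
qed

lemma has_minor_cases:
  "has_minor G H \<Longrightarrow> G \<cong>\<^sub>G H \<or> has_proper_minor G H"
  unfolding has_minor_def has_proper_minor_def by (metis rtranclpD)

lemma has_proper_minor_has_minor: "has_proper_minor G H \<Longrightarrow> has_minor G H"
  unfolding has_minor_def has_proper_minor_def by (meson tranclp_into_rtranclp)

section \<open>Subgraphs and embedded copies as minors\<close>

lemma delete_verts_steps:
  assumes "finite S" "S \<subseteq> verts G" shows "minor_step\<^sup>*\<^sup>* G (delete_verts G S)"
  using assms
proof (induction S)
  case empty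
  show ?case by (simp add: delete_verts_def graph_eta)
next
  case (insert v S)
  have "minor_step (delete_verts G S) (delete_verts (delete_verts G S) {v})"
    using insert by (intro minor_step.del_vert) (auto simp: delete_verts_def)
  moreover have "delete_verts (delete_verts G S) {v} = delete_verts G (insert v S)"
    by (auto simp: delete_verts_def)
  ultimately show ?case using insert by (metis insert_subset rtranclp.rtrancl_into_rtrancl)
qed

lemma delete_edges_steps:
  assumes "finite D" "D \<subseteq> edges G"
  shows "minor_step\<^sup>*\<^sup>* G \<lparr>verts = verts G, edges = edges G - D\<rparr>"
  using assms
proof (induction D)
  case empty
  show ?case by (simp add: graph_eta)
next
  case (insert e D)
  let ?H = "\<lparr>verts = verts G, edges = edges G - D\<rparr>"
  have "minor_step ?H (delete_edge ?H e)" using insert by (intro minor_step.del_edge) auto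
  moreover have "delete_edge ?H e = \<lparr>verts = verts G, edges = edges G - insert e D\<rparr>"
    by (auto simp: delete_edge_def)
  ultimately show ?case using insert by (metis insert_subset rtranclp.rtrancl_into_rtrancl)
qed

text \<open>Vertices go before edges: as \<open>H\<close> is well formed, none of its edges is lost
  with a deleted vertex, and the surplus edges are removed afterwards.\<close>

lemma subgraph_steps:
  assumes "finite (verts G)" "finite (edges G)" "verts H \<subseteq> verts G" "edges H \<subseteq> edges G" "wf_graph H"
  shows "minor_step\<^sup>*\<^sup>* G H"
proof -
  let ?S = "verts G - verts H" let ?G' = "delete_verts G ?S"
  have V: "verts ?G' = verts H" using assms(3) by (auto simp: delete_verts_def)
  have E: "edges H \<subseteq> edges ?G'" using assms(4,5) by (auto simp: delete_verts_def wf_graph_def)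
  have "finite (edges ?G')" using assms(2) by (simp add: delete_verts_def)
  then have "minor_step\<^sup>*\<^sup>* ?G' \<lparr>verts = verts ?G', edges = edges ?G' - (edges ?G' - edges H)\<rparr>"
    by (intro delete_edges_steps) auto
  also have "\<dots> = H" using V E by (simp add: double_diff)
  finally show ?thesis using delete_verts_steps[of ?S G] assms(1)
    by (meson Diff_subset finite_Diff rtranclp_trans)
qed

lemma has_minor_embedding:
  assumes "finite (verts G)" "finite (edges G)" "inj_on f (verts H)" "f ` verts H \<subseteq> verts G"
    "(`) f ` edges H \<subseteq> edges G" "wf_graph H"
  shows "has_minor G H"
proof -
  let ?K = "\<lparr>verts = f ` verts H, edges = (`) f ` edges H\<rparr>"
  have iso: "H \<cong>\<^sub>G ?K" using assms(3) by (intro graph_isoI[of f]) (auto simp: bij_betw_def)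
  have "minor_step\<^sup>*\<^sup>* G ?K"
    using assms graph_iso_wf[OF iso] by (intro subgraph_steps) auto
  then show ?thesis using graph_iso_sym[OF assms(6) iso] unfolding has_minor_def by blast
qed

lemma has_minor_step: "minor_step G G' \<Longrightarrow> has_minor G' H \<Longrightarrow> has_minor G H"
  unfolding has_minor_def by (meson converse_rtranclp_into_rtranclp)

section \<open>Internal 4-connectivity\<close>

definition nbr :: "'a graph \<Rightarrow> 'a \<Rightarrow> 'a set" where
  "nbr G v = {w. {v, w} \<in> edges G}"

lemma simple_graph_edgeD:
  assumes "simple_graph G" "{u, v} \<in> edges G" shows "u \<in> verts G" "v \<in> verts G" "u \<noteq> v"
  using assms unfolding simple_graph_def by fastforce+

lemma simple_graph_edgeE:
  assumes "simple_graph G" "e \<in> edges G" "v \<in> e" obtains w where "e = {v, w}" "w \<noteq> v" "w \<in> nbr G v"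
proof -
  have "card e = 2" using assms by (auto simp: simple_graph_def)
  then obtain x y where "e = {x, y}" "x \<noteq> y" by (auto simp: card_2_iff)
  then show ?thesis using assms that[of "if v = x then y else x"] by (auto simp: nbr_def insert_commute)
qed

lemma nbr_subset: "simple_graph G \<Longrightarrow> nbr G v \<subseteq> verts G - {v}"
  using simple_graph_edgeD[of G v] by (auto simp: nbr_def)

lemma finite_nbr: "simple_graph G \<Longrightarrow> finite (nbr G v)"
  by (meson finite_Diff finite_subset nbr_subset simple_graph_def)

lemma incident_edges_eq:
  assumes "simple_graph G" shows "incident_edges G v = (\<lambda>w. {v, w}) ` nbr G v"
proof
  show "incident_edges G v \<subseteq> (\<lambda>w. {v, w}) ` nbr G v"
  proof
    fix e assume "e \<in> incident_edges G v"
    then have "e \<in> edges G" "v \<in> e" by (simp_all add: incident_edges_def)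
    then show "e \<in> (\<lambda>w. {v, w}) ` nbr G v" using simple_graph_edgeE[OF assms, of e v] by blast
  qed
qed (auto simp: incident_edges_def nbr_def)

lemma degree_eq: "simple_graph G \<Longrightarrow> degree G v = card (nbr G v)"
  unfolding degree_def
  by (simp add: incident_edges_eq) (rule card_image, auto simp: inj_on_def doubleton_eq_iff)

lemma handshake:
  assumes "simple_graph G" shows "(\<Sum>v\<in>verts G. card (nbr G v)) = 2 * card (edges G)"
proof -
  have "{v \<in> verts G. v \<in> e} = e" "card e = 2" if "e \<in> edges G" for e
    using that assms by (auto simp: simple_graph_def)
  then have "(\<Sum>v\<in>verts G. card {e \<in> edges G. v \<in> e}) = 2 * card (edges G)"
    using assms by (intro sum_multicount simple_graph_finite_edges) (auto simp: simple_graph_def)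
  then show ?thesis using degree_eq[OF assms] by (simp add: degree_def incident_edges_def)
qed

lemma k_connectedD:
  "k_connected k G \<Longrightarrow> S \<subseteq> verts G \<Longrightarrow> card S < k \<Longrightarrow> connected_graph (delete_verts G S)"
  by (simp add: k_connected_def)

lemma connected_graphD:
  "connected_graph G \<Longrightarrow> u \<in> verts G \<Longrightarrow> v \<in> verts G \<Longrightarrow> (u, v) \<in> {(x, y). {x, y} \<in> edges G}\<^sup>*"
  by (simp add: connected_graph_def)

lemma k_connected_card: "k_connected k G \<Longrightarrow> k < card (verts G)"
  by (simp add: k_connected_def)

text \<open>Deleting the neighbours of a vertex of smaller degree would isolate it, while
  \<open>k < card (verts G)\<close> guarantees that another vertex remains.\<close>

lemma k_connected_min_degree:
  assumes "simple_graph G" "k_connected k G" "v \<in> verts G" shows "k \<le> card (nbr G v)"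
proof (rule ccontr)
  assume less: "\<not> k \<le> card (nbr G v)"
  let ?S = "nbr G v"
  have S: "finite ?S" "?S \<subseteq> verts G" "v \<notin> ?S" using finite_nbr[OF assms(1)] nbr_subset[OF assms(1), of v] by auto
  have "k < card (verts G)" using k_connected_card[OF assms(2)] .
  then have "card (insert v ?S) < card (verts G)" using less S(1,3) by simp
  then obtain w where w: "w \<in> verts G" "w \<notin> insert v ?S"
    by (metis assms(1) S(1) card_mono finite_insert linorder_not_less subsetI)
  have "connected_graph (delete_verts G ?S)" using k_connectedD[OF assms(2) S(2)] less by linarith
  then have "(v, w) \<in> {(x, y). {x, y} \<in> edges (delete_verts G ?S)}\<^sup>*"
    using assms(3) S w by (intro connected_graphD) (simp_all add: delete_verts_def)
  then show False
  proof (cases rule: converse_rtranclE)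
    case base
    then show False using w(2) by blast
  next
    case (step y)
    then show False by (auto simp: delete_verts_def nbr_def)
  qed
qed

section \<open>What internal 4-connectivity forbids\<close>

lemma card_triangle_le: "card {{a, b}, {b, c}, {a, c}} \<le> 3"
  using card_length[of "[{a, b}, {b, c}, {a, c}]"] by simp

text \<open>A side with at least four edges is neither a triangle nor the star of a cubic vertex, so
  the equality case of the definition is void. The boundary is symmetric, which removes the order
  between the two sides.\<close>

lemma internally_4_connected_boundary:
  assumes "internally_4_connected G" "X \<union> Y = edges G" "X \<inter> Y = {}" "4 \<le> card X" "4 \<le> card Y"
  shows "3 < card (boundary X Y)"
proof -
  have *: "3 < card (boundary X Y)"
    if "X \<union> Y = edges G" "X \<inter> Y = {}" "4 \<le> card X" "card X \<le> card Y" for X Y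
  proof -
    have "3 \<le> card (boundary X Y) \<and> (card (boundary X Y) = 3 \<longrightarrow>
        is_triangle X \<or> (\<exists>v\<in>verts G. degree G v = 3 \<and> X = incident_edges G v))"
      using assms(1) that unfolding internally_4_connected_def by auto
    moreover have "\<not> is_triangle X"
      using that(3) card_triangle_le unfolding is_triangle_def by (metis le_trans numeral_le_iff semiring_norm(69) semiring_norm(71) semiring_norm(72))
    ultimately show ?thesis using that(3) by (auto simp: degree_def)
  qed
  have "boundary X Y = boundary Y X" unfolding boundary_def by blast
  then show ?thesis using *[of X Y] *[of Y X] assms(2-) by (cases "card X \<le> card Y") (auto simp: Un_commute Int_commute)
qed

text \<open>The star of \<open>v\<close> together with \<open>{a, b}\<close> has four edges, and its
  boundary lies in the three neighbours of \<open>v\<close>. The bound 8 leaves at least four edges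
  for the other side.\<close>

lemma internally_4_connected_no_triangle:
  assumes "internally_4_connected G" "8 \<le> card (edges G)" "v \<in> verts G" "card (nbr G v) = 3"
    "a \<in> nbr G v" "b \<in> nbr G v"
  shows "{a, b} \<notin> edges G"
proof
  assume ab: "{a, b} \<in> edges G"
  have G: "simple_graph G" using assms(1) by (simp add: internally_4_connected_def)
  have fin: "finite (edges G)" using simple_graph_finite_edges[OF G] .
  let ?I = "incident_edges G v"
  let ?X = "insert {a, b} ?I" and ?Y = "edges G - insert {a, b} (incident_edges G v)"
  have I: "card ?I = 3" "finite ?I" using degree_eq[OF G, of v] assms(4) fin by (auto simp: degree_def incident_edges_def)
  have "v \<notin> {a, b}" using assms(5,6) simple_graph_edgeD(3)[OF G] by (auto simp: nbr_def)
  then have X: "card ?X = 4" using I by (simp add: incident_edges_def)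
  moreover have sub: "?X \<subseteq> edges G" using ab by (auto simp: incident_edges_def)
  moreover have "4 \<le> card ?Y" using card_Diff_subset[OF finite_subset[OF sub fin] sub] X assms(2) by linarith
  ultimately have "3 < card (boundary ?X ?Y)"
    using assms(1) by (intro internally_4_connected_boundary) auto
  moreover have "boundary ?X ?Y \<subseteq> nbr G v"
  proof
    fix z assume "z \<in> boundary ?X ?Y"
    then obtain e f where e: "e \<in> ?X" "z \<in> e" and f: "f \<in> ?Y" "z \<in> f" unfolding boundary_def by blast
    have "z \<noteq> v" using f by (auto simp: incident_edges_def)
    then show "z \<in> nbr G v" using e assms(5,6) by (auto simp: incident_edges_eq[OF G])
  qed
  ultimately show False using card_mono[OF finite_nbr[OF G]] assms(4) by (metis linorder_not_less)
qed

text \<open>The two stars share at most the edge joining their centres, which leaves 3 + 3 - 1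
  edges.\<close>

lemma card_incident_pair:
  assumes "simple_graph G" "a \<noteq> b" "3 \<le> card (nbr G a)" "3 \<le> card (nbr G b)"
  shows "5 \<le> card (incident_edges G a \<union> incident_edges G b)"
proof -
  have fin: "finite (incident_edges G x)" for x
    using simple_graph_finite_edges[OF assms(1)] by (simp add: incident_edges_def)
  have "incident_edges G a \<inter> incident_edges G b \<subseteq> {{a, b}}"
    using assms(1,2) by (auto simp: incident_edges_def elim!: simple_graph_edgeE[of G _ a])
  then have "card (incident_edges G a \<inter> incident_edges G b) \<le> 1"
    using card_mono[of "{{a, b}}"] by simp
  then show ?thesis using card_Un_Int[OF fin fin, of a b] assms(3,4) degree_eq[OF assms(1)]
    by (simp add: degree_def)
qed

text \<open>The edges meeting \<open>A\<close> and the remaining ones form an edge partition whose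
  boundary avoids \<open>A\<close> and \<open>B\<close>. Two vertices on a side provide five edges
  there, so both sides are large enough.\<close>

lemma internally_4_connected_separation:
  assumes "internally_4_connected G" "A \<subseteq> verts G" "B \<subseteq> verts G" "A \<inter> B = {}"
    "\<And>a b. a \<in> A \<Longrightarrow> b \<in> B \<Longrightarrow> {a, b} \<notin> edges G" "2 \<le> card A" "2 \<le> card B"
  shows "3 < card (verts G - A - B)"
proof -
  have G: "simple_graph G" "k_connected 3 G" using assms(1) by (simp_all add: internally_4_connected_def)
  have fin: "finite (edges G)" "finite (verts G)"
    using simple_graph_finite_edges G(1) by (auto simp: simple_graph_def)
  let ?X = "{e \<in> edges G. e \<inter> A \<noteq> {}}" and ?Y = "{e \<in> edges G. e \<inter> A = {}}"
  have big: "4 \<le> card X" if "C \<subseteq> verts G" "2 \<le> card C" "{e \<in> edges G. e \<inter> C \<noteq> {}} \<subseteq> X" "X \<subseteq> edges G" for C X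
  proof -
    obtain T where "T \<subseteq> C" "card T = 2" using obtain_subset_with_card_n[OF \<open>2 \<le> card C\<close>] by blast
    then obtain a b where ab: "a \<in> C" "b \<in> C" "a \<noteq> b" by (auto simp: card_2_iff)
    have "5 \<le> card (incident_edges G a \<union> incident_edges G b)"
      using card_incident_pair[OF G(1) ab(3)] k_connected_min_degree[OF G] ab that(1) by blast
    also have "\<dots> \<le> card X"
      using ab that(3,4) fin(1) by (intro card_mono) (auto simp: incident_edges_def finite_subset)
    finally show ?thesis by simp
  qed
  have "4 \<le> card ?X" using big[OF assms(2,6)] by blast
  \<comment> \<open>All edges at \<open>B\<close> fall into \<open>?Y\<close>, which is what makes
    \<open>?Y\<close> large.\<close>
  moreover have "e \<inter> A = {}" if "e \<in> edges G" "e \<inter> B \<noteq> {}" for e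
  proof -
    obtain b where "b \<in> B" "b \<in> e" using \<open>e \<inter> B \<noteq> {}\<close> by blast
    then obtain w where "e = {b, w}"
      using simple_graph_edgeE[OF G(1) \<open>e \<in> edges G\<close>] by metis
    then have "{w, b} \<in> edges G" using \<open>e \<in> edges G\<close> by (simp add: insert_commute)
    then show ?thesis using assms(4,5) \<open>b \<in> B\<close> \<open>e = {b, w}\<close> by blast
  qed
  then have "4 \<le> card ?Y" by (intro big[OF assms(3,7)]) auto
  ultimately have "3 < card (boundary ?X ?Y)"
    by (intro internally_4_connected_boundary[OF assms(1)]) auto
  also have "boundary ?X ?Y \<subseteq> verts G - A - B"
  proof
    fix z assume "z \<in> boundary ?X ?Y"
    then obtain e f where ef: "e \<in> edges G" "z \<in> e" "e \<inter> A = {}" "f \<in> edges G" "z \<in> f" "f \<inter> A \<noteq> {}"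
      unfolding boundary_def by blast
    obtain w where w: "f = {z, w}" using simple_graph_edgeE[OF G(1) ef(4,5)] by metis
    have "z \<notin> A" using ef(2,3) by blast
    then have "w \<in> A" using ef(6) w by blast
    moreover have wz: "{w, z} \<in> edges G" using ef(4) w by (simp add: insert_commute)
    ultimately show "z \<in> verts G - A - B"
      using \<open>z \<notin> A\<close> assms(5) simple_graph_edgeD(2)[OF G(1) wz] by blast
  qed
  then have "card (boundary ?X ?Y) \<le> card (verts G - A - B)" using fin(2) by (intro card_mono) auto
  finally show ?thesis .
qed

section \<open>A criterion for internal 4-connectivity in terms of vertices\<close>

lemma edges_within_three:
  assumes "finite D" "card D \<le> 3" "X \<subseteq> {e. e \<subseteq> D \<and> card e = 2}"
  shows "card X \<le> 3" "card X = 3 \<Longrightarrow> card D = 3 \<and> is_triangle X"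
proof -
  let ?P = "{e. e \<subseteq> D \<and> card e = 2}"
  have P: "finite ?P" "card ?P = card D choose 2" using n_subsets[OF assms(1)] assms(1) by auto
  have le: "card X \<le> card D choose 2" using card_mono[OF P(1) assms(3)] P(2) by simp
  have D: "card D = 0 \<or> card D = 1 \<or> card D = 2 \<or> card D = 3" using assms(2) by linarith
  show "card X \<le> 3" using le D by (auto simp: choose_two)
  assume X: "card X = 3"
  then have D3: "card D = 3" using le D by (auto simp: choose_two)
  then have "X = ?P" using card_subset_eq[OF P(1) assms(3)] X P(2) by (simp add: choose_two)
  obtain a b c where abc: "D = {a, b, c}" "a \<noteq> b" "b \<noteq> c" "a \<noteq> c"
    using D3 by (auto simp: card_3_iff)
  let ?T = "{{a, b}, {b, c}, {a, c}}"
  have "?T \<subseteq> ?P" using abc by simp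
  moreover have "card ?T = card ?P" using abc(2-) P(2) D3 by (simp add: choose_two doubleton_eq_iff)
  ultimately have "?T = ?P" by (rule card_subset_eq[OF P(1)])
  then have "is_triangle X" unfolding is_triangle_def using \<open>X = ?P\<close> abc(2-) by metis
  then show "card D = 3 \<and> is_triangle X" using D3 by blast
qed

text \<open>For a partition with boundary D of at most three vertices, let A and B be the vertices
  met only by X and only by Y. If one of them is empty, that side lies within D and has at most
  three edges. Otherwise D separates A from B, so |D| = 3 and one of A, B is a single cubic vertex
  whose star is that side. The resulting vertex conditions can be evaluated on concrete graphs and
  pulled back along isomorphisms, unlike the quantification over edge partitions.\<close>

lemma internally_4_connectedI:
  assumes G: "simple_graph G" "k_connected 3 G" and m: "7 \<le> card (edges G)"
    and tri: "\<And>v a b. card (nbr G v) = 3 \<Longrightarrow> a \<in> nbr G v \<Longrightarrow> b \<in> nbr G v \<Longrightarrow> {a, b} \<notin> edges G"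
    and sep: "\<And>A B. A \<subseteq> verts G \<Longrightarrow> B \<subseteq> verts G \<Longrightarrow> A \<inter> B = {} \<Longrightarrow>
      (\<And>a b. a \<in> A \<Longrightarrow> b \<in> B \<Longrightarrow> {a, b} \<notin> edges G) \<Longrightarrow> card (verts G - A - B) = 3 \<Longrightarrow>
      card A \<le> 1 \<or> card B \<le> 1"
  shows "internally_4_connected G"
proof -
  have fin: "finite (edges G)" "finite (verts G)"
    using simple_graph_finite_edges G(1) by (auto simp: simple_graph_def)
  have "3 \<le> card (boundary X Y) \<and> (card (boundary X Y) = 3 \<longrightarrow>
      is_triangle X \<or> (\<exists>v\<in>verts G. degree G v = 3 \<and> X = incident_edges G v))"
    if XY: "X \<union> Y = edges G" "X \<inter> Y = {}" "3 \<le> card X" "card X \<le> card Y" for X Y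
  proof (cases "card (boundary X Y) \<le> 3")
    case small: True
    let ?D = "boundary X Y"
    define A where "A = {v \<in> \<Union>X. v \<notin> \<Union>Y}"
    define B where "B = {v \<in> \<Union>Y. v \<notin> \<Union>X}"
    have D: "?D = \<Union>X \<inter> \<Union>Y" unfolding boundary_def by blast
    have sub: "\<Union>X \<subseteq> verts G" "\<Union>Y \<subseteq> verts G" using XY(1) G(1) by (auto simp: simple_graph_def)
    have c2: "card e = 2" if "e \<in> X \<union> Y" for e using that XY(1) G(1) by (auto simp: simple_graph_def)
    have finD: "finite ?D" unfolding D using sub fin(2) by (meson finite_Int finite_subset)
    have sum: "card X + card Y = card (edges G)" using XY(1,2) fin(1) card_Un_disjoint[of X Y] by (metis finite_Un)
    have deg: "3 \<le> card (nbr G v)" if "v \<in> verts G" for v using k_connected_min_degree[OF G that] .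
    have V: "v \<in> \<Union>X \<union> \<Union>Y" if "v \<in> verts G" for v
    proof -
      have "nbr G v \<noteq> {}" using deg[OF that] by auto
      then obtain w where "{v, w} \<in> X \<union> Y" unfolding XY(1) by (auto simp: nbr_def)
      then show ?thesis by blast
    qed
    have VAB: "verts G - A - B = ?D" using V sub D by (auto simp: A_def B_def)
    have noE: "{a, b} \<notin> edges G" if "a \<in> A" "b \<in> B" for a b
    proof
      assume "{a, b} \<in> edges G"
      then have "{a, b} \<in> X \<or> {a, b} \<in> Y" using XY(1) by blast
      then show False using that unfolding A_def B_def by blast
    qed
    have step: "y \<in> A" if "x \<in> A" "{x, y} \<in> edges G" "y \<notin> ?D" for x y
    proof -
      have "{x, y} \<in> X" using that(1,2) XY(1) unfolding A_def by blast
      then show ?thesis using that(3) unfolding A_def D by blast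
    qed
    have AD: "e \<subseteq> A \<union> ?D" if "e \<in> X" for e using that D by (auto simp: A_def)
    have BD: "e \<subseteq> B \<union> ?D" if "e \<in> Y" for e using that D by (auto simp: B_def)
    show ?thesis
    proof (cases "A = {} \<or> B = {}")
      case True
      then show ?thesis
      proof
        assume "A = {}"
        then have "X \<subseteq> {e. e \<subseteq> ?D \<and> card e = 2}" using AD c2 by blast
        from edges_within_three[OF finD small this] show ?thesis using XY(3) by linarith
      next
        assume "B = {}"
        then have "Y \<subseteq> {e. e \<subseteq> ?D \<and> card e = 2}" using BD c2 by blast
        \<comment> \<open>The larger side would have at most three edges, hence the graph at most
          six; this is where 7 edges are required.\<close>
        then have "card Y \<le> 3" using edges_within_three[OF finD small] by blast
        then show ?thesis using sum m XY(4) by linarith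
      qed
    next
      case False
      then obtain a b where ab: "a \<in> A" "b \<in> B" by blast
      \<comment> \<open>A boundary of fewer than three vertices cannot disconnect the graph, yet no
        path leaves \<open>A\<close> without meeting the boundary.\<close>
      have D3: "card ?D = 3"
      proof (rule ccontr)
        assume "card ?D \<noteq> 3"
        then have "connected_graph (delete_verts G ?D)"
          using small D sub by (intro k_connectedD[OF G(2)]) auto
        moreover have "a \<in> verts G - ?D" "b \<in> verts G - ?D"
          using ab D sub by (auto simp: A_def B_def)
        ultimately have "(a, b) \<in> {(x, y). {x, y} \<in> edges (delete_verts G ?D)}\<^sup>*"
          by (intro connected_graphD) (simp_all add: delete_verts_def)
        then have "b \<in> A"
        proof (induction rule: rtrancl_induct)
          case (step y z)
          then show ?case using \<open>\<And>y x. x \<in> A \<Longrightarrow> {x, y} \<in> edges G \<Longrightarrow> y \<notin> ?D \<Longrightarrow> y \<in> A\<close>[of y z]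
            by (auto simp: delete_verts_def)
        qed (rule ab)
        then show False using ab by (auto simp: A_def B_def)
      qed
      have AB: "A \<subseteq> verts G" "B \<subseteq> verts G" "A \<inter> B = {}" using sub unfolding A_def B_def by blast+
      have "card A \<le> 1 \<or> card B \<le> 1"
      proof (rule sep)
        show "A \<subseteq> verts G" "B \<subseteq> verts G" "A \<inter> B = {}" by (fact AB)+
        show "card (verts G - A - B) = 3" using VAB D3 by simp
      qed (rule noE)
      moreover have finAB: "finite A" "finite B" using AB(1,2) fin(2) finite_subset by blast+
      ultimately have "A = {a} \<or> B = {b}" using ab card_le_Suc0_iff_eq[of A] card_le_Suc0_iff_eq[of B] by auto
      \<comment> \<open>Stated once for both sides. An edge of the side that lies inside
        \<open>?D\<close> would join two neighbours of the cubic vertex \<open>v\<close>, so every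
        edge of the side is at \<open>v\<close>.\<close>
      have single: "nbr G v = ?D \<and> card (nbr G v) = 3 \<and> (\<forall>e\<in>Z. v \<in> e)"
        if Z: "v \<in> verts G" "v \<notin> ?D" "\<And>w. {v, w} \<in> edges G \<Longrightarrow> w \<in> ?D" "Z \<subseteq> edges G" "\<And>e. e \<in> Z \<Longrightarrow> e \<subseteq> insert v ?D" for v Z
      proof -
        have "nbr G v \<subseteq> ?D" using Z(3) by (auto simp: nbr_def)
        then have n: "nbr G v = ?D" using card_seteq[OF finD] deg[OF Z(1)] D3 by simp
        moreover have "v \<in> e" if e: "e \<in> Z" for e
        proof (rule ccontr)
          assume "v \<notin> e"
          then have "e \<subseteq> ?D" using Z(5)[OF e] by blast
          moreover have "card e = 2" using e Z(4) G(1) by (auto simp: simple_graph_def)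
          then obtain x y where "e = {x, y}" by (auto simp: card_2_iff)
          ultimately show False using tri[of v x y] n D3 e Z(4) by auto
        qed
        ultimately show ?thesis using D3 by simp
      qed
      from \<open>A = {a} \<or> B = {b}\<close> show ?thesis
      proof
        assume A: "A = {a}"
        have a: "a \<in> verts G" "a \<notin> ?D" "a \<notin> \<Union>Y" using ab D sub by (auto simp: A_def)
        have nbD: "w \<in> ?D" if "{a, w} \<in> edges G" for w
          using step[OF ab(1) that] A simple_graph_edgeD(3)[OF G(1) that] by auto
        have s: "nbr G a = ?D \<and> card (nbr G a) = 3 \<and> (\<forall>e\<in>X. a \<in> e)"
          using a nbD XY(1) AD A by (intro single) auto
        have "X = incident_edges G a"
        proof
          show "X \<subseteq> incident_edges G a" using s XY(1) by (auto simp: incident_edges_def)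
          show "incident_edges G a \<subseteq> X" using a(3) XY(1) unfolding incident_edges_def by blast
        qed
        then show ?thesis using D3 a(1) s degree_eq[OF G(1)] by auto
      next
        assume B: "B = {b}"
        have b: "b \<in> verts G" "b \<notin> ?D" "b \<notin> \<Union>X" using ab D sub by (auto simp: B_def)
        have nbD: "w \<in> ?D" if "{b, w} \<in> edges G" for w
        proof -
          have "{b, w} \<in> Y" using that XY(1) b(3) by blast
          then show ?thesis using BD[of "{b, w}"] B simple_graph_edgeD(3)[OF G(1) that] by auto
        qed
        have s: "nbr G b = ?D \<and> card (nbr G b) = 3 \<and> (\<forall>e\<in>Y. b \<in> e)"
          using b nbD XY(1) BD B by (intro single) auto
        then have "Y \<subseteq> incident_edges G b" using XY(1) by (auto simp: incident_edges_def)
        then have "card Y \<le> 3" using s degree_eq[OF G(1), of b] fin(1)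
          by (metis (no_types, lifting) card_mono degree_def finite_subset incident_edges_def mem_Collect_eq subsetI)
        then show ?thesis using sum m XY(4) by linarith
      qed
    qed
  qed auto
  then show ?thesis using G unfolding internally_4_connected_def by blast
qed

section \<open>Invariance under isomorphism\<close>

lemma graph_iso_simple:
  assumes "simple_graph G" "G \<cong>\<^sub>G H" shows "simple_graph H"
proof -
  obtain f where f: "bij_betw f (verts G) (verts H)" "edges H = (`) f ` edges G"
    using assms(2) unfolding graph_iso_def by blast
  have "card (f ` e) = card e" if "e \<in> edges G" for e
    using that assms(1) f(1) unfolding simple_graph_def bij_betw_def by (meson card_image inj_on_subset)
  moreover have "finite (verts H)" using f(1) assms(1) bij_betw_finite by (auto simp: simple_graph_def)
  ultimately show ?thesis
    using graph_iso_wf[OF assms(2) simple_graph_wf[OF assms(1)]] f(2) assms(1)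
    by (auto simp: simple_graph_def wf_graph_def)
qed

lemma connected_graph_image:
  assumes "connected_graph G" "f ` verts G = verts H" "\<And>x y. {x, y} \<in> edges G \<Longrightarrow> {f x, f y} \<in> edges H"
  shows "connected_graph H"
  unfolding connected_graph_def
proof (intro conjI ballI)
  show "verts H \<noteq> {}" using assms(1,2) unfolding connected_graph_def by blast
  fix u v assume "u \<in> verts H" "v \<in> verts H"
  then obtain a b where ab: "a \<in> verts G" "b \<in> verts G" "u = f a" "v = f b"
    unfolding assms(2)[symmetric] by blast
  show "(u, v) \<in> {(x, y). {x, y} \<in> edges H}\<^sup>*"
    using connected_graphD[OF assms(1) ab(1,2)] unfolding ab(3,4)
  proof (induction rule: rtrancl_induct)
    case (step y z)
    then have "(f y, f z) \<in> {(x, y). {x, y} \<in> edges H}" using assms(3) by blast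
    then show ?case using step.IH by (rule rtrancl_into_rtrancl[rotated])
  qed simp
qed

text \<open>The vertex criterion is pulled back along \<open>f\<close> instead of edge partitions.
  The bound 8 is the one under which cubic vertices of \<open>G\<close> lie in no triangle.\<close>

lemma graph_iso_i4c:
  assumes i4c: "internally_4_connected G" and m: "8 \<le> card (edges G)" and iso: "G \<cong>\<^sub>G H"
  shows "internally_4_connected H"
proof -
  have G: "simple_graph G" "k_connected 3 G" using i4c by (simp_all add: internally_4_connected_def)
  obtain f where f: "bij_betw f (verts G) (verts H)" "edges H = (`) f ` edges G"
    using iso unfolding graph_iso_def by blast
  have H: "simple_graph H" using graph_iso_simple[OF G(1) iso] .
  have inj: "inj_on f (verts G)" and img: "f ` verts G = verts H" using f(1) by (auto simp: bij_betw_def)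
  have edge: "{f x, f y} \<in> edges H \<longleftrightarrow> {x, y} \<in> edges G" if "x \<in> verts G" "y \<in> verts G" for x y
  proof
    assume "{x, y} \<in> edges G"
    then show "{f x, f y} \<in> edges H" unfolding f(2) by (intro image_eqI[of _ _ "{x, y}"]) auto
  next
    assume "{f x, f y} \<in> edges H"
    then obtain e where e: "e \<in> edges G" "f ` {x, y} = f ` e" unfolding f(2) by auto
    then have "e \<subseteq> verts G" using G(1) by (simp add: simple_graph_def)
    then have "e = {x, y}" using inj_on_image_eq_iff[OF inj, of "{x, y}" e] e(2) that by auto
    then show "{x, y} \<in> edges G" using e(1) by simp
  qed
  have nbr: "nbr H (f v) = f ` nbr G v" if "v \<in> verts G" for v
  proof
    show "nbr H (f v) \<subseteq> f ` nbr G v"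
    proof
      fix w assume w: "w \<in> nbr H (f v)"
      then have "w \<in> f ` verts G" using nbr_subset[OF H] img by blast
      then show "w \<in> f ` nbr G v" using w edge that by (auto simp: nbr_def)
    qed
    show "f ` nbr G v \<subseteq> nbr H (f v)"
      using edge that nbr_subset[OF G(1), of v] by (auto simp: nbr_def)
  qed
  have card_nbr: "card (nbr H (f v)) = card (nbr G v)" if "v \<in> verts G" for v
    unfolding nbr[OF that] using nbr_subset[OF G(1), of v] inj by (meson Diff_subset card_image inj_on_subset order_trans)
  have preim: "\<exists>A. A \<subseteq> verts G \<and> U = f ` A \<and> card A = card U" if "U \<subseteq> verts H" for U
  proof -
    have "U \<subseteq> f ` verts G" using that img by simp
    then obtain A where A: "A \<subseteq> verts G" "U = f ` A" by (rule subset_imageE)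
    then have "card A = card U" using card_image[OF inj_on_subset[OF inj A(1)]] by simp
    then show ?thesis using A by blast
  qed
  have diff: "f ` X - f ` Y = f ` (X - Y)" if "X \<subseteq> verts G" "Y \<subseteq> verts G" for X Y
    using inj_on_image_set_diff[OF inj, of X Y] that by auto
  show ?thesis
  proof (rule internally_4_connectedI[OF H])
    have "connected_graph (delete_verts H U)" if U: "U \<subseteq> verts H" "card U < 3" for U
    proof -
      obtain A where A: "A \<subseteq> verts G" "U = f ` A" "card A = card U" using preim[OF U(1)] by blast
      have "connected_graph (delete_verts G A)" using k_connectedD[OF G(2) A(1)] A(3) U(2) by simp
      then show ?thesis
      proof (rule connected_graph_image)
        show "f ` verts (delete_verts G A) = verts (delete_verts H U)"
          unfolding delete_verts_def graph.simps A(2) img[symmetric] using diff[OF subset_refl A(1)] by simp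
        fix x y assume "{x, y} \<in> edges (delete_verts G A)"
        then have xy: "{x, y} \<in> edges G" "x \<notin> A" "y \<notin> A" by (auto simp: delete_verts_def)
        have V: "x \<in> verts G" "y \<in> verts G" using simple_graph_edgeD[OF G(1) xy(1)] by auto
        have "f z \<notin> f ` A" if "z \<in> verts G" "z \<notin> A" for z
          using inj_on_image_mem_iff[OF inj that(1) A(1)] that(2) by simp
        then show "{f x, f y} \<in> edges (delete_verts H U)"
          using edge V xy A(2) by (simp add: delete_verts_def)
      qed
    qed
    moreover have "3 < card (verts H)" using k_connected_card[OF G(2)] bij_betw_same_card[OF f(1)] by simp
    ultimately show "k_connected 3 H" by (simp add: k_connected_def)
    show "7 \<le> card (edges H)" using m graph_iso_card_edges[OF simple_graph_wf[OF G(1)] iso] by simp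
  next
    fix v a b assume v: "card (nbr H v) = 3" "a \<in> nbr H v" "b \<in> nbr H v"
    then have "v \<in> verts H" using simple_graph_edgeD(1)[OF H] by (auto simp: nbr_def)
    then obtain x where x: "x \<in> verts G" "v = f x" using img by blast
    obtain c d where cd: "a = f c" "b = f d" "c \<in> nbr G x" "d \<in> nbr G x"
      using v(2,3) unfolding x(2) nbr[OF x(1)] by blast
    have "{c, d} \<notin> edges G"
      using internally_4_connected_no_triangle[OF i4c m x(1)] v(1) card_nbr[OF x(1)] x(2) cd(3,4) by simp
    moreover have "c \<in> verts G" "d \<in> verts G" using nbr_subset[OF G(1)] cd(3,4) by blast+
    ultimately show "{a, b} \<notin> edges H" using edge cd(1,2) by simp
  next
    fix X Y assume XY: "X \<subseteq> verts H" "Y \<subseteq> verts H" "X \<inter> Y = {}"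
      "\<And>a b. a \<in> X \<Longrightarrow> b \<in> Y \<Longrightarrow> {a, b} \<notin> edges H" "card (verts H - X - Y) = 3"
    obtain A where A: "A \<subseteq> verts G" "X = f ` A" "card A = card X" using preim[OF XY(1)] by blast
    obtain B where B: "B \<subseteq> verts G" "Y = f ` B" "card B = card Y" using preim[OF XY(2)] by blast
    have "verts H - X - Y = f ` (verts G - A - B)"
      unfolding img[symmetric] A(2) B(2) using diff A(1) B(1) by (metis Diff_subset subset_refl)
    then have "card (verts G - A - B) = 3"
      using XY(5) card_image[OF inj_on_subset[OF inj], of "verts G - A - B"] by auto
    moreover have "A \<inter> B = {}" using XY(3) A(2) B(2) by blast
    moreover have "{a, b} \<notin> edges G" if "a \<in> A" "b \<in> B" for a b
      using XY(4)[of "f a" "f b"] edge that A B by blast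
    ultimately have "\<not> (2 \<le> card A \<and> 2 \<le> card B)"
      using internally_4_connected_separation[OF i4c A(1) B(1)] by fastforce
    then show "card X \<le> 1 \<or> card Y \<le> 1" using A(3) B(3) by linarith
  qed
qed

text \<open>The gap hypothesis ranges over graphs on the natural numbers, whereas \<open>G2\<close>
  has an arbitrary vertex type; such a copy makes \<open>G2\<close> eligible as an intermediate
  graph.\<close>

lemma nat_copy:
  assumes "finite (verts G)" shows "\<exists>H :: nat graph. G \<cong>\<^sub>G H"
proof -
  obtain f where "bij_betw f (verts G) {..<card (verts G)}"
    using finite_same_card_bij[OF assms, of "{..<card (verts G)}"] by auto
  then have "G \<cong>\<^sub>G \<lparr>verts = {..<card (verts G)}, edges = (`) f ` edges G\<rparr>"
    by (intro graph_isoI[of f]) auto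
  then show ?thesis by blast
qed

section \<open>A checker for search certificates\<close>

text \<open>All functions below are evaluated by rewriting. They avoid \<open>if\<close> and \<open>case\<close>, whose weak congruence
  rules would make the simplifier traverse all data again after every step.\<close>

datatype vx = A | B | C | D | E | F | G | H | I | J

datatype mark = Open | Edge | Non

text \<open>Ten entries suffice: minimum degree three gives 3n \<le> 2m \<le> 30 for n vertices and
  m edges.\<close>

datatype 'a vec = V 'a 'a 'a 'a 'a 'a 'a 'a 'a 'a

type_synonym mat = "mark vec vec"

fun get :: "'a vec \<Rightarrow> vx \<Rightarrow> 'a" where
  "get (V a b c d e f g h i j) A = a"
| "get (V a b c d e f g h i j) B = b"
| "get (V a b c d e f g h i j) C = c"
| "get (V a b c d e f g h i j) D = d"
| "get (V a b c d e f g h i j) E = e"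
| "get (V a b c d e f g h i j) F = f"
| "get (V a b c d e f g h i j) G = g"
| "get (V a b c d e f g h i j) H = h"
| "get (V a b c d e f g h i j) I = i"
| "get (V a b c d e f g h i j) J = j"

fun upd :: "'a vec \<Rightarrow> vx \<Rightarrow> 'a \<Rightarrow> 'a vec" where
  "upd (V a b c d e f g h i j) A z = V z b c d e f g h i j"
| "upd (V a b c d e f g h i j) B z = V a z c d e f g h i j"
| "upd (V a b c d e f g h i j) C z = V a b z d e f g h i j"
| "upd (V a b c d e f g h i j) D z = V a b c z e f g h i j"
| "upd (V a b c d e f g h i j) E z = V a b c d z f g h i j"
| "upd (V a b c d e f g h i j) F z = V a b c d e z g h i j"
| "upd (V a b c d e f g h i j) G z = V a b c d e f z h i j"
| "upd (V a b c d e f g h i j) H z = V a b c d e f g z i j"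
| "upd (V a b c d e f g h i j) I z = V a b c d e f g h z j"
| "upd (V a b c d e f g h i j) J z = V a b c d e f g h i z"

fun possible_add :: "vx \<Rightarrow> mark \<Rightarrow> vx list \<Rightarrow> vx list" where
  "possible_add x Open l = x # l"
| "possible_add x Edge l = x # l"
| "possible_add x Non l = l"

fun possible :: "mark vec \<Rightarrow> vx list" where
  "possible (V a b c d e f g h i j) = possible_add A a (possible_add B b (possible_add C c (possible_add D d (possible_add E e (possible_add F f (possible_add G g (possible_add H h (possible_add I i (possible_add J j [])))))))))"

fun present_add :: "vx \<Rightarrow> mark \<Rightarrow> vx list \<Rightarrow> vx list" where
  "present_add x Open l = l"
| "present_add x Edge l = x # l"
| "present_add x Non l = l"

fun present :: "mark vec \<Rightarrow> vx list" where
  "present (V a b c d e f g h i j) = present_add A a (present_add B b (present_add C c (present_add D d (present_add E e (present_add F f (present_add G g (present_add H h (present_add I i (present_add J j [])))))))))"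

fun undecided_add :: "vx \<Rightarrow> mark \<Rightarrow> vx list \<Rightarrow> vx list" where
  "undecided_add x Open l = x # l"
| "undecided_add x Edge l = l"
| "undecided_add x Non l = l"

fun undecided :: "mark vec \<Rightarrow> vx list" where
  "undecided (V a b c d e f g h i j) = undecided_add A a (undecided_add B b (undecided_add C c (undecided_add D d (undecided_add E e (undecided_add F f (undecided_add G g (undecided_add H h (undecided_add I i (undecided_add J j [])))))))))"

definition get2 :: "mat \<Rightarrow> vx \<Rightarrow> vx \<Rightarrow> mark" where "get2 M x y = get (get M x) y"

definition set1 :: "mat \<Rightarrow> vx \<Rightarrow> vx \<Rightarrow> mark \<Rightarrow> mat" where "set1 M x y a = upd M x (upd (get M x) y a)"

definition set2 :: "mat \<Rightarrow> vx \<Rightarrow> vx \<Rightarrow> mark \<Rightarrow> mat" where "set2 M x y a = set1 (set1 M x y a) y x a"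

section \<open>Propagation rules\<close>

text \<open>\<open>Closed\<close> records a contradiction, which finishes the branch.
  \<open>Stuck\<close> records that a rule does not apply, and then the certificate is
  rejected.\<close>

datatype outcome = Closed | Stuck | Go mat

fun put1 :: "mark \<Rightarrow> mark \<Rightarrow> vx \<Rightarrow> vx \<Rightarrow> mat \<Rightarrow> outcome" where
  "put1 a Open x y M = Go (set2 M x y a)"
| "put1 Edge Edge x y M = Go M"
| "put1 Edge Non x y M = Closed"
| "put1 Non Non x y M = Go M"
| "put1 Non Edge x y M = Closed"
| "put1 Open Edge x y M = Go M"
| "put1 Open Non x y M = Go M"

fun put :: "mark \<Rightarrow> vx \<Rightarrow> vx \<Rightarrow> outcome \<Rightarrow> outcome" where
  "put a x y Closed = Closed"
| "put a x y Stuck = Stuck"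
| "put a x y (Go M) = put1 a (get2 M x y) x y M"

text \<open>Lists shorter than three contradict the minimum degree; four or more candidates decide
  nothing.\<close>

fun deg_step :: "vx \<Rightarrow> vx list \<Rightarrow> mat \<Rightarrow> outcome" where
  "deg_step v [] M = Closed"
| "deg_step v [x] M = Closed"
| "deg_step v [x,y] M = Closed"
| "deg_step v [x,y,z] M = put Non x y (put Non x z (put Non y z (put Edge v x (put Edge v y (put Edge v z (Go M))))))"
| "deg_step v (x # y # z # w # l) M = Stuck"

text \<open>Subtracts the length of a list from a counter, failing on underflow. One successor is
  consumed per element, so no arithmetic has to be evaluated.\<close>

fun eat :: "vx list \<Rightarrow> nat \<Rightarrow> nat option" where
  "eat [] b = Some b"
| "eat (x # l) (Suc b) = eat l b"
| "eat (x # l) 0 = None"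

fun set_all :: "mark \<Rightarrow> vx \<Rightarrow> vx list \<Rightarrow> mat \<Rightarrow> mat" where
  "set_all a v [] M = M"
| "set_all a v (y # l) M = set_all a v l (set2 M v y a)"

fun saturate :: "mark \<Rightarrow> vx list \<Rightarrow> mat \<Rightarrow> mat" where
  "saturate a [] M = M"
| "saturate a (v # l) M = saturate a l (set_all a v (undecided (get M v)) M)"

text \<open>The counter starts at 2m - 3n, the sum over all vertices of the degree minus three. Each
  vertex with at least three known edges pays its known excess and is collected; \<open>Over\<close>
  means that more excess is known than exists. At counter 0 the collected vertices have no further
  neighbours.\<close>

datatype scan_state = Over | Scan nat "vx list"

fun scan1 :: "vx \<Rightarrow> vx list \<Rightarrow> nat option \<Rightarrow> scan_state" where
  "scan1 v acc None = Over"
| "scan1 v acc (Some b) = Scan b (v # acc)"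

fun scan2 :: "vx \<Rightarrow> vx list \<Rightarrow> scan_state \<Rightarrow> scan_state" where
  "scan2 v es Over = Over"
| "scan2 v [] (Scan b acc) = Scan b acc"
| "scan2 v [x] (Scan b acc) = Scan b acc"
| "scan2 v [x,y] (Scan b acc) = Scan b acc"
| "scan2 v (x # y # z # l) (Scan b acc) = scan1 v acc (eat l b)"

fun scan :: "vx list \<Rightarrow> mat \<Rightarrow> scan_state \<Rightarrow> scan_state" where
  "scan [] M s = s"
| "scan (v # l) M s = scan l M (scan2 v (present (get M v)) s)"

fun sat_step :: "mat \<Rightarrow> scan_state \<Rightarrow> outcome" where
  "sat_step M Over = Closed"
| "sat_step M (Scan 0 acc) = Go (saturate Non acc M)"
| "sat_step M (Scan (Suc b) acc) = Stuck"

fun mapv :: "('a \<Rightarrow> 'b) \<Rightarrow> 'a vec \<Rightarrow> 'b vec" where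
  "mapv q (V a b c d e f g h i j) = V (q a) (q b) (q c) (q d) (q e) (q f) (q g) (q h) (q i) (q j)"

text \<open>The counter starts at 2m and pays the possible neighbours of every vertex. A remainder 0
  forces all possible pairs to be edges, a positive remainder means too few possible pairs, and
  underflow means that there is still slack.\<close>

fun need :: "mat \<Rightarrow> vx list \<Rightarrow> nat option \<Rightarrow> nat option" where
  "need M vs None = None"
| "need M [] (Some b) = Some b"
| "need M (v # l) (Some b) = need M l (eat (possible (get M v)) b)"

fun full_step :: "vx list \<Rightarrow> mat \<Rightarrow> nat option \<Rightarrow> outcome" where
  "full_step vs M None = Stuck"
| "full_step vs M (Some 0) = Go (saturate Edge vs M)"
| "full_step vs M (Some (Suc b)) = Closed"

fun run :: "(mat \<Rightarrow> bool) \<Rightarrow> outcome \<Rightarrow> bool" where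
  "run f Closed = True"
| "run f Stuck = False"
| "run f (Go M) = f M"

section \<open>Tests at the leaves of a search\<close>

fun is_mark :: "mark \<Rightarrow> mark \<Rightarrow> bool" where
  "is_mark Edge Edge = True" | "is_mark Edge Open = False" | "is_mark Edge Non = False"
| "is_mark Non Non = True" | "is_mark Non Open = False" | "is_mark Non Edge = False" | "is_mark Open x = False"

fun all_marked :: "mark \<Rightarrow> vx vec \<Rightarrow> mat \<Rightarrow> (vx \<times> vx) list \<Rightarrow> bool" where
  "all_marked a p M [] = True"
| "all_marked a p M ((x, y) # l) = (is_mark a (get2 M (get p x) (get p y)) \<and> all_marked a p M l)"

text \<open>\<open>w\<close> marks the values still available, and each image is struck off once
  used.\<close>

fun injective :: "vx list \<Rightarrow> vx vec \<Rightarrow> bool vec \<Rightarrow> bool" where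
  "injective [] p w = True"
| "injective (v # l) p w = (get w (get p v) \<and> injective l p (upd w (get p v) False))"

text \<open>\<open>l\<close> is the neighbourhood of the vertex merged into \<open>u\<close> and so
  contains \<open>u\<close> itself; the loop that arises is cleared.\<close>

fun join :: "vx \<Rightarrow> vx list \<Rightarrow> mat \<Rightarrow> mat" where "join u l M = set2 (set_all Edge u l M) u u Non"

fun contr :: "(vx \<times> vx) list \<Rightarrow> mat \<Rightarrow> outcome" and contr1 :: "mark \<Rightarrow> vx \<Rightarrow> vx \<Rightarrow> (vx \<times> vx) list \<Rightarrow> mat \<Rightarrow> outcome" where
  "contr [] M = Go M"
| "contr ((u, v) # l) M = contr1 (get2 M u v) u v l M"
| "contr1 Edge u v l M = contr l (set_all Non v [A,B,C,D,E,F,G,H,I,J] (join u (present (get M v)) M))"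
| "contr1 Non u v l M = Stuck"
| "contr1 Open u v l M = Stuck"

fun mem :: "vx \<Rightarrow> vx list \<Rightarrow> bool" where "mem x [] = False" | "mem x (y # l) = (x = y \<or> mem x l)"

fun sub :: "vx list \<Rightarrow> vx list \<Rightarrow> bool" where "sub [] m = True" | "sub (x # l) m = (mem x m \<and> sub l m)"

fun row_non :: "mat \<Rightarrow> vx \<Rightarrow> vx list \<Rightarrow> bool" where "row_non M x [] = True" | "row_non M x (y # l) = (is_mark Non (get2 M x y) \<and> x \<noteq> y \<and> row_non M x l)"

fun block_non :: "mat \<Rightarrow> vx list \<Rightarrow> vx list \<Rightarrow> bool" where "block_non M [] m = True" | "block_non M (x # l) m = (row_non M x m \<and> block_non M l m)"

fun two :: "vx list \<Rightarrow> bool" where "two (x # y # l) = (x \<noteq> y)" | "two [] = False" | "two [x] = False"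

fun upto3 :: "vx list \<Rightarrow> bool" where "upto3 [] = True" | "upto3 [x] = True" | "upto3 [x,y] = True" | "upto3 [x,y,z] = True" | "upto3 (x # y # z # w # l) = False"

text \<open>Edges and non-edges of a refuted state. Only these pairs are matched on reuse, so a
  stored state covers every state that extends an image of it.\<close>

type_synonym lits = "(vx \<times> vx) list \<times> (vx \<times> vx) list"

text \<open>The parameters of a search are the list of vertices and its characteristic vector, \<open>2 m - 3 n\<close> and
  \<open>2 m\<close> for \<open>n\<close> vertices and \<open>m\<close> edges, the admissible minors, and a table of refuted states.\<close>

datatype target = Target "vx list" "(vx \<times> vx) list"

datatype par = Par "vx list" "bool vec" nat nat "target option vec" "lits option vec vec"

text \<open>\<open>S u v\<close> branches on whether \<open>uv\<close> is an edge. \<open>T v\<close> applies if only three neighbours of \<open>v\<close> are left: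
  they are adjacent to \<open>v\<close> but not to each other. \<open>X\<close> applies if the known edges account for all
  degrees above three, so that vertices with three known neighbours have no others; \<open>L\<close> applies if all
  undecided pairs must be edges. The leaf \<open>P\<close> is a separation of order three, \<open>R i j p\<close> an
  instance under the permutation \<open>p\<close> of the refuted state at \<open>(i, j)\<close>, and \<open>M i l p\<close> contracts the edges
  of \<open>l\<close> and embeds the \<open>i\<close>-th admissible minor by \<open>p\<close>.\<close>

datatype cert = Z | S vx vx cert cert | T vx cert | X cert | L cert
  | P "vx list" "vx list" "vx list" | R vx vx "vx vec" | M vx "(vx \<times> vx) list" "vx vec"

fun ref :: "lits option \<Rightarrow> vx list \<Rightarrow> bool vec \<Rightarrow> vx vec \<Rightarrow> mat \<Rightarrow> bool" where
  "ref None vs w p N = False"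
| "ref (Some (es, ns)) vs w p N = (all_marked Edge p N es \<and> all_marked Non p N ns \<and> injective vs p w)"

fun embeds :: "target option \<Rightarrow> bool vec \<Rightarrow> vx vec \<Rightarrow> mat \<Rightarrow> bool" where
  "embeds None w p N = False"
| "embeds (Some (Target tv te)) w p N = (all_marked Edge p N te \<and> injective tv p w)"

fun vs_of where "vs_of (Par vs w e n t tb) = vs"

fun w_of where "w_of (Par vs w e n t tb) = w"

fun e_of where "e_of (Par vs w e n t tb) = e"

fun n_of where "n_of (Par vs w e n t tb) = n"

fun t_of where "t_of (Par vs w e n t tb) = t"

fun tb_of where "tb_of (Par vs w e n t tb) = tb"

text \<open>\<open>Z\<close> is never accepted: it stands for the unreachable continuation after a
  rule that closes the branch.\<close>

primrec chk :: "par \<Rightarrow> cert \<Rightarrow> mat \<Rightarrow> bool" where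
  "chk K Z N = False"
| "chk K (S u v a b) N = (chk K a (set2 N u v Edge) \<and> chk K b (set2 N u v Non))"
| "chk K (T v c) N = (get (w_of K) v \<and> run (chk K c) (deg_step v (possible (get N v)) N))"
| "chk K (X c) N = run (chk K c) (sat_step N (scan (vs_of K) N (Scan (e_of K) [])))"
| "chk K (L c) N = run (chk K c) (full_step (vs_of K) N (need N (vs_of K) (Some (n_of K))))"
| "chk K (P as bs ss) N = (sub as (vs_of K) \<and> sub bs (vs_of K) \<and> sub (vs_of K) (as @ bs @ ss) \<and> two as \<and> two bs \<and> upto3 ss \<and> block_non N as bs)"
| "chk K (R i j p) N = ref (get (get (tb_of K) i) j) (vs_of K) (w_of K) p N"
| "chk K (M i l p) N = run (embeds (get (t_of K) i) (w_of K) p) (contr l N)"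

fun init :: "mark \<Rightarrow> (vx \<times> vx) list \<Rightarrow> mat \<Rightarrow> mat" where
  "init a [] N = N"
| "init a ((x, y) # l) N = init a l (set2 N x y a)"

text \<open>The slots form a ten by ten table that may be overwritten, so a reference means the
  latest entry and the number of lemmas is not limited by the table.\<close>

datatype lemm = Lem vx vx "(vx \<times> vx) list" "(vx \<times> vx) list" cert

fun store :: "par \<Rightarrow> vx \<Rightarrow> vx \<Rightarrow> lits \<Rightarrow> par" where
  "store (Par vs w e n t tb) i j l = Par vs w e n t (upd tb i (upd (get tb i) j (Some l)))"

text \<open>Applied to edge literals only: a non-edge literal at a letter outside the list holds
  automatically.\<close>

fun inside :: "bool vec \<Rightarrow> (vx \<times> vx) list \<Rightarrow> bool" where
  "inside w [] = True"
| "inside w ((x, y) # l) = (get w x \<and> get w y \<and> inside w l)"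

fun chks :: "par \<Rightarrow> mat \<Rightarrow> lemm list \<Rightarrow> cert \<Rightarrow> bool" where
  "chks K N [] c = chk K c N"
| "chks K N (Lem i j es ns d # ls) c = (inside (w_of K) es \<and> chk K d (init Non ns (init Edge es N)) \<and> chks (store K i j (es, ns)) N ls c)"

fun avail :: "vx list \<Rightarrow> bool vec" where
  "avail [] = V False False False False False False False False False False"
| "avail (x # l) = upd (avail l) x True"

fun cell :: "bool \<Rightarrow> bool \<Rightarrow> mark" where
  "cell True True = Open" | "cell True False = Non" | "cell False True = Non" | "cell False False = Non"

fun base_row :: "bool vec \<Rightarrow> bool \<Rightarrow> mark vec" where "base_row w b = mapv (cell b) w"

fun clear_diag :: "vx list \<Rightarrow> mat \<Rightarrow> mat" where
  "clear_diag [] N = N"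
| "clear_diag (v # l) N = clear_diag l (set2 N v v Non)"

fun const_vec :: "'a \<Rightarrow> 'a vec" where "const_vec x = V x x x x x x x x x x"

fun base :: "vx list \<Rightarrow> mat" where
  "base vs = clear_diag vs (mapv (base_row (avail vs)) (avail vs))"

fun certified :: "vx list \<Rightarrow> nat \<Rightarrow> nat \<Rightarrow> target option vec \<Rightarrow> lemm list \<Rightarrow> cert \<Rightarrow> bool" where
  "certified vs e n t ls c = chks (Par vs (avail vs) e n t (const_vec (const_vec None))) (base vs) ls c"

text \<open>The numeral rules unfold numbers into successors, the form on which \<open>eat\<close>
  and the other counters match. Inequality of letters is decided by
  \<open>vx.distinct\<close>.\<close>

lemmas check_rules = get.simps upd.simps possible_add.simps possible.simps present_add.simps present.simps undecided_add.simps undecided.simps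
  get2_def set1_def set2_def put1.simps put.simps deg_step.simps eat.simps set_all.simps saturate.simps scan1.simps scan2.simps
  scan.simps sat_step.simps mapv.simps need.simps full_step.simps run.simps is_mark.simps all_marked.simps injective.simps
  join.simps contr.simps contr1.simps mem.simps sub.simps row_non.simps block_non.simps two.simps upto3.simps append.simps
  ref.simps embeds.simps vs_of.simps w_of.simps e_of.simps n_of.simps t_of.simps tb_of.simps chk.simps init.simps inside.simps store.simps chks.simps
  avail.simps cell.simps base_row.simps clear_diag.simps const_vec.simps base.simps certified.simps
  eval_nat_numeral BitM.simps numeral_One One_nat_def simp_thms vx.distinct

section \<open>Soundness of the checker\<close>

lemma get_upd: "get (upd w x a) y = (if x = y then a else get w y)"
  by (cases w, hypsubst, cases x; hypsubst, cases y; hypsubst, simp)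

lemma get2_set1: "get2 (set1 N x y a) u v = (if x = u \<and> y = v then a else get2 N u v)"
  by (simp add: get2_def set1_def get_upd)

lemma get2_set2:
  "get2 (set2 N x y a) u v = (if u = x \<and> v = y \<or> u = y \<and> v = x then a else get2 N u v)"
  unfolding set2_def get2_set1 by argo

lemma if_if_or: "(if p then a else if q then a else b) = (if p \<or> q then a else b)"
  by simp

lemma get2_set_all:
  "get2 (set_all a v l N) x y = (if x = v \<and> y \<in> set l \<or> y = v \<and> x \<in> set l then a else get2 N x y)"
proof (induction l arbitrary: N)
  case (Cons z l)
  have eq: "get2 (set_all a v (z # l) N) x y =
    (if x = v \<and> y \<in> set l \<or> y = v \<and> x \<in> set l then a else get2 (set2 N v z a) x y)"
    by (simp only: set_all.simps Cons)
  show ?case unfolding eq get2_set2 list.set insert_iff if_if_or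
    by (rule if_cong[OF _ refl refl]) blast
qed simp

lemma get_mapv: "get (mapv q w) x = q (get w x)"
  by (cases w, hypsubst, cases x; hypsubst, simp)

lemma mem_possible_add: "y \<in> set (possible_add x k l) \<longleftrightarrow> y = x \<and> k \<noteq> Non \<or> y \<in> set l"
  by (cases k) auto

lemma mem_present_add: "y \<in> set (present_add x k l) \<longleftrightarrow> y = x \<and> k = Edge \<or> y \<in> set l"
  by (cases k) auto

lemma mem_undecided_add: "y \<in> set (undecided_add x k l) \<longleftrightarrow> y = x \<and> k = Open \<or> y \<in> set l"
  by (cases k) auto

lemma mem_possible: "y \<in> set (possible r) \<longleftrightarrow> get r y \<noteq> Non"
  by (cases r, hypsubst, cases y; hypsubst, simp add: mem_possible_add del: possible_add.simps)

lemma mem_present: "y \<in> set (present r) \<longleftrightarrow> get r y = Edge"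
  by (cases r, hypsubst, cases y; hypsubst, simp add: mem_present_add del: present_add.simps)

lemma mem_undecided: "y \<in> set (undecided r) \<longleftrightarrow> get r y = Open"
  by (cases r, hypsubst, cases y; hypsubst, simp add: mem_undecided_add del: undecided_add.simps)

lemma distinct_present_add: "distinct (present_add x k l) \<longleftrightarrow> distinct l \<and> (k = Edge \<longrightarrow> x \<notin> set l)"
  by (cases k) auto

lemma distinct_present: "distinct (present r)"
  by (cases r, hypsubst) (simp add: mem_present_add distinct_present_add del: present_add.simps)

lemma eat_Some: "eat l b = Some b' \<longleftrightarrow> b = b' + length l"
  by (induction l b rule: eat.induct) auto

lemma eat_eq: "eat l b = (if b < length l then None else Some (b - length l))"
  by (induction l b rule: eat.induct) auto

lemma need_Some: "need N l (Some b) = Some b' \<Longrightarrow> b = b' + (\<Sum>v\<leftarrow>l. length (possible (get N v)))"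
proof (induction l arbitrary: b)
  case (Cons v l)
  then show ?case by (cases "eat (possible (get N v)) b") (auto simp: eat_Some)
qed simp

definition surplus :: "mat \<Rightarrow> vx \<Rightarrow> nat" where "surplus N v = length (present (get N v)) - 3"

lemma scan_Over: "scan l N Over = Over"
  by (induction l) auto

lemma scan2_Scan:
  "scan2 v es (Scan b acc) =
     (if length es < 3 then Scan b acc
      else if b < length es - 3 then Over else Scan (b - (length es - 3)) (v # acc))"
proof (induction v es "Scan b acc" rule: scan2.induct)
  case (5 v x y z l)
  then show ?case by (simp add: eat_eq)
qed auto

text \<open>Excess is only paid, never refunded, so an overrun at one vertex already bounds the
  whole sum from below.\<close>

lemma scan_Scan:
  "(scan l N (Scan b acc) = Over \<longrightarrow> b < (\<Sum>v\<leftarrow>l. surplus N v)) \<and>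
   (\<forall>b' acc'. scan l N (Scan b acc) = Scan b' acc' \<longrightarrow>
      b = b' + (\<Sum>v\<leftarrow>l. surplus N v) \<and>
      set acc' = set acc \<union> {v \<in> set l. 3 \<le> length (present (get N v))})"
proof (induction l arbitrary: b acc)
  case (Cons v l)
  let ?k = "length (present (get N v))"
  consider "?k < 3" | "3 \<le> ?k" "b < ?k - 3" | "3 \<le> ?k" "?k - 3 \<le> b" by linarith
  then show ?case
  proof cases
    case 1
    then show ?thesis using Cons[of b acc] by (auto simp: scan2_Scan surplus_def)
  next
    case 2
    then show ?thesis by (auto simp: scan2_Scan scan_Over surplus_def)
  next
    case 3
    then show ?thesis using Cons[of "b - (?k - 3)" "v # acc"] by (auto simp: scan2_Scan surplus_def)
  qed
qed auto

text \<open>Distinctness of \<open>l\<close> comes along because a repeated letter would claim its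
  image twice.\<close>

lemma injective_sound:
  "injective l p w \<Longrightarrow> inj_on (get p) (set l) \<and> distinct l \<and> (\<forall>x\<in>set l. get w (get p x))"
proof (induction l p w rule: injective.induct)
  case (2 v l p w)
  then have "inj_on (get p) (set l)" "distinct l" "\<forall>x\<in>set l. get (upd w (get p v) False) (get p x)"
    "get w (get p v)" by auto
  then show ?case by (fastforce simp: get_upd inj_on_def split: if_splits)
qed simp

lemma is_mark_iff: "is_mark a k \<longleftrightarrow> a = k \<and> a \<noteq> Open"
  by (cases a; cases k) simp_all

lemma all_marked_iff:
  "all_marked a p N l \<longleftrightarrow> (\<forall>(x, y)\<in>set l. get2 N (get p x) (get p y) = a \<and> a \<noteq> Open)"
  by (induction l) (auto simp: is_mark_iff)

lemma mem_iff: "mem x l \<longleftrightarrow> x \<in> set l"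
  by (induction x l rule: mem.induct) auto

lemma sub_iff: "sub l m \<longleftrightarrow> set l \<subseteq> set m"
  by (induction l m rule: sub.induct) (auto simp: mem_iff)

lemma row_non_iff: "row_non N x l \<longleftrightarrow> (\<forall>y\<in>set l. get2 N x y = Non \<and> x \<noteq> y)"
  by (induction N x l rule: row_non.induct) (auto simp: is_mark_iff)

lemma block_non_iff: "block_non N l m \<longleftrightarrow> (\<forall>x\<in>set l. \<forall>y\<in>set m. get2 N x y = Non \<and> x \<noteq> y)"
  by (induction N l m rule: block_non.induct) (auto simp: row_non_iff)

lemma two_card: "two l \<Longrightarrow> 2 \<le> card (set l)"
proof (induction l rule: two.induct)
  case (1 x y l)
  then have "card {x, y} = 2" by simp
  moreover have "card {x, y} \<le> card (set (x # y # l))" by (rule card_mono) auto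
  ultimately show ?case by simp
qed auto

lemma upto3_length: "upto3 l \<Longrightarrow> length l \<le> 3"
  by (induction l rule: upto3.induct) auto

lemma get_avail: "get (avail l) x \<longleftrightarrow> x \<in> set l"
proof (induction l)
  case Nil
  show ?case by (cases x) auto
qed (auto simp: get_upd)

lemma get_const_vec: "get (const_vec a) x = a"
  by (cases x) auto

lemma clear_diag_eq: "get2 (clear_diag l N) x y = (if x = y \<and> x \<in> set l then Non else get2 N x y)"
proof (induction l arbitrary: N)
  case (Cons v l)
  have eq: "get2 (clear_diag (v # l) N) x y = (if x = y \<and> x \<in> set l then Non else get2 (set2 N v v Non) x y)"
    by (simp only: clear_diag.simps Cons)
  show ?case unfolding eq get2_set2 list.set insert_iff if_if_or
    by (rule if_cong[OF _ refl refl]) blast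
qed simp

lemma cell_eq: "cell a b = (if a \<and> b then Open else Non)"
  by (cases a; cases b) auto

lemma get2_base: "get2 (base l) x y = (if x \<in> set l \<and> y \<in> set l \<and> x \<noteq> y then Open else Non)"
proof -
  have "get2 (mapv (base_row (avail l)) (avail l)) x y = (if x \<in> set l \<and> y \<in> set l then Open else Non)"
    by (simp add: get2_def get_mapv cell_eq get_avail)
  then show ?thesis by (simp add: clear_diag_eq)
qed

section \<open>Matrices as subgraphs and the minors found in them\<close>

text \<open>Letters become the numbers that serve as vertices in the statement, so that all listed
  graphs given there on numbers can be matched by equality.\<close>

fun idx :: "vx \<Rightarrow> nat" where
  "idx A = 0" | "idx B = 1" | "idx C = 2" | "idx D = 3" | "idx E = 4"
| "idx F = 5" | "idx G = 6" | "idx H = 7" | "idx I = 8" | "idx J = 9"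

lemma inj_idx: "inj idx"
  by (rule injI) (rename_tac x y, case_tac x; hypsubst, case_tac y; hypsubst, simp)

fun target_graph :: "target \<Rightarrow> nat graph" where
  "target_graph (Target tv te) =
     \<lparr>verts = idx ` set tv, edges = (\<lambda>(x, y). {idx x, idx y}) ` set te\<rparr>"

text \<open>Isolated vertices are excluded because an embedding is checked along edges: an incident
  edge is what places the image of a vertex inside the host graph.\<close>

fun wf_target :: "target \<Rightarrow> bool" where
  "wf_target (Target tv te) \<longleftrightarrow>
     (\<forall>(x, y)\<in>set te. x \<in> set tv \<and> y \<in> set tv) \<and> (\<forall>v\<in>set tv. \<exists>(x, y)\<in>set te. v = x \<or> v = y)"

text \<open>Only the entries \<^term>\<open>Edge\<close> matter for minors: the matrix describes a subgraph.\<close>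

definition sub_of :: "(vx \<Rightarrow> 'a) \<Rightarrow> 'a graph \<Rightarrow> vx set \<Rightarrow> mat \<Rightarrow> bool" where
  "sub_of h \<Gamma> W N \<longleftrightarrow> inj_on h W \<and>
     (\<forall>x y. get2 N x y = Edge \<longrightarrow> x \<in> W \<and> y \<in> W \<and> x \<noteq> y \<and> {h x, h y} \<in> edges \<Gamma>)"

text \<open>Edges away from \<open>v\<close> survive unchanged, edges at \<open>v\<close> reappear
  at \<open>u\<close>. The matrix may know fewer edges than the graph has, which does no harm when a
  minor is exhibited.\<close>

lemma sub_of_contract:
  assumes "sub_of h \<Gamma> W N" "get2 N u v = Edge"
  shows "sub_of h (contract_edge \<Gamma> (h u) (h v)) (W - {v})
    (set_all Non v [A,B,C,D,E,F,G,H,I,J] (join u (present (get N v)) N))" (is "sub_of _ ?\<Gamma>' _ ?N'")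
proof -
  have inj: "inj_on h W" and E: "\<And>x y. get2 N x y = Edge \<Longrightarrow> x \<in> W \<and> y \<in> W \<and> x \<noteq> y \<and> {h x, h y} \<in> edges \<Gamma>"
    using assms(1) by (auto simp: sub_of_def)
  have uv: "u \<in> W" "v \<in> W" "u \<noteq> v" using E[OF assms(2)] by auto
  have all: "x \<in> set [A,B,C,D,E,F,G,H,I,J]" for x by (cases x) auto
  have red: "{h x, h y} \<in> edges ?\<Gamma>'" if "x \<in> W - {v}" "y \<in> W - {v}" "{h x, h y} \<in> edges \<Gamma>" for x y
  proof -
    have "h x \<noteq> h v" "h y \<noteq> h v" using that inj uv by (auto simp: inj_on_def)
    then have "(\<lambda>z. if z = h v then h u else z) ` {h x, h y} = {h x, h y}" "{h x, h y} \<noteq> {h u, h v}"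
      by (auto simp: doubleton_eq_iff)
    then show ?thesis using that(3) unfolding contract_edge_def
      by (auto intro!: rev_image_eqI[of "{h x, h y}"])
  qed
  have red': "{h u, h y} \<in> edges ?\<Gamma>'" if "y \<in> W - {u}" "{h v, h y} \<in> edges \<Gamma>" "y \<noteq> v" for y
  proof -
    have "h y \<noteq> h v" "h y \<noteq> h u" using that inj uv by (auto simp: inj_on_def)
    then have "(\<lambda>z. if z = h v then h u else z) ` {h v, h y} = {h u, h y}" "{h v, h y} \<noteq> {h u, h v}"
      by (auto simp: doubleton_eq_iff)
    then show ?thesis using that(2) unfolding contract_edge_def
      by (auto intro!: rev_image_eqI[of "{h v, h y}"])
  qed
  have clr: "get2 ?N' x y = (if x = v \<or> y = v then Non else get2 (join u (present (get N v)) N) x y)" for x y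
    by (simp only: get2_set_all all) auto
  have "x \<in> W - {v} \<and> y \<in> W - {v} \<and> x \<noteq> y \<and> {h x, h y} \<in> edges ?\<Gamma>'" if "get2 ?N' x y = Edge" for x y
  proof -
    have n: "x \<noteq> v" "y \<noteq> v" using that unfolding clr by (auto split: if_splits)
    then have j: "get2 (join u (present (get N v)) N) x y = Edge"
      using that unfolding clr by simp
    then have "\<not> (x = u \<and> y = u)" by (auto simp: get2_set2)
    then consider "get2 N x y = Edge" | "x = u" "get2 N v y = Edge" "y \<noteq> u" | "y = u" "get2 N v x = Edge" "x \<noteq> u"
      using j by (auto simp: get2_set2 get2_set_all mem_present get2_def[of N v] split: if_splits)
    then show ?thesis
    proof cases
      case 1
      then show ?thesis using E[OF 1] n red by auto
    next
      case 2
      then show ?thesis using E[OF 2(2)] n red'[of y] uv by auto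
    next
      case 3
      then show ?thesis using E[OF 3(2)] n red'[of x] uv by (auto simp: insert_commute)
    qed
  qed
  then show ?thesis using inj unfolding sub_of_def by (auto intro: inj_on_subset)
qed

lemma embeds_sound:
  assumes "sub_of h \<Gamma> W N" "wf_graph \<Gamma>" "finite (verts \<Gamma>)" "finite (edges \<Gamma>)"
    "embeds (Some tg) w p N" "wf_target tg"
  shows "has_minor \<Gamma> (target_graph tg)"
proof (cases tg)
  case (Target tv te)
  have inj: "inj_on (get p) (set tv)" using assms(5) injective_sound Target by auto
  have E: "get p x \<in> W \<and> get p y \<in> W \<and> {h (get p x), h (get p y)} \<in> edges \<Gamma>" if "(x, y) \<in> set te" for x y
    using assms(1,5) Target that by (auto simp: all_marked_iff sub_of_def)
  have W: "get p x \<in> W \<and> h (get p x) \<in> verts \<Gamma>" if x: "x \<in> set tv" for x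
  proof -
    obtain a b where "(a, b) \<in> set te" "x = a \<or> x = b" using assms(6) Target x by fastforce
    then show ?thesis using E[of a b] assms(2) unfolding wf_graph_def by blast
  qed
  let ?f = "\<lambda>n. h (get p (inv idx n))"
  have f: "?f (idx x) = h (get p x)" for x by (simp add: inj_idx)
  show ?thesis
  proof (rule has_minor_embedding[OF assms(3,4), of ?f])
    show "inj_on ?f (verts (target_graph tg))"
    proof (rule inj_onI)
      fix a b assume "a \<in> verts (target_graph tg)" "b \<in> verts (target_graph tg)" and eq: "?f a = ?f b"
      then obtain x y where xy: "a = idx x" "b = idx y" "x \<in> set tv" "y \<in> set tv" using Target by auto
      then have "get p x = get p y" using eq W assms(1) unfolding xy f by (auto simp: sub_of_def inj_on_def)
      then show "a = b" using inj xy by (auto simp: inj_on_def)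
    qed
    show "?f ` verts (target_graph tg) \<subseteq> verts \<Gamma>" using W Target by (auto simp: inj_idx)
    show "(`) ?f ` edges (target_graph tg) \<subseteq> edges \<Gamma>"
      using E Target by (auto simp: f)
    show "wf_graph (target_graph tg)" using assms(6) Target by (auto simp: wf_graph_def)
  qed
qed

lemma contr_not_Closed: "contr l N \<noteq> Closed"
proof (induction l arbitrary: N)
  case (Cons e l)
  obtain u v where "e = (u, v)" by fastforce
  then show ?case using Cons by (cases "get2 N u v") auto
qed simp

text \<open>Each contraction of the matrix mirrors a contraction of the graph, with the labelling
  restricted to the surviving letters; the embedding is checked in the last graph.\<close>

lemma contr_sound:
  assumes "sub_of h \<Gamma> W N" "wf_graph \<Gamma>" "finite (verts \<Gamma>)" "finite (edges \<Gamma>)"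
    "run (embeds (Some tg) w p) (contr l N)" "wf_target tg"
  shows "has_minor \<Gamma> (target_graph tg)"
  using assms
proof (induction l arbitrary: \<Gamma> W N)
  case Nil
  then show ?case using embeds_sound by auto
next
  case (Cons e l)
  obtain u v where e: "e = (u, v)" by fastforce
  have uv: "get2 N u v = Edge" using Cons.prems(5) e by (cases "get2 N u v") auto
  let ?\<Gamma>' = "contract_edge \<Gamma> (h u) (h v)"
  have edge: "{h u, h v} \<in> edges \<Gamma>" "h u \<noteq> h v"
    using uv Cons.prems(1) by (auto simp: sub_of_def inj_on_def)
  then have step: "minor_step \<Gamma> ?\<Gamma>'" by (rule minor_step.contract)
  have "has_minor ?\<Gamma>' (target_graph tg)"
  proof (rule Cons.IH[OF sub_of_contract[OF Cons.prems(1) uv]])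
    show "wf_graph ?\<Gamma>'" using minor_step_wf[OF step Cons.prems(2)] .
    show "finite (verts ?\<Gamma>')" "finite (edges ?\<Gamma>')" using Cons.prems(3,4) by (auto simp: contract_edge_def)
    show "run (embeds (Some tg) w p)
      (contr l (set_all Non v [A,B,C,D,E,F,G,H,I,J] (join u (present (get N v)) N)))"
      using Cons.prems(5) e uv by simp
  qed (rule Cons.prems(6))
  then show ?case using has_minor_step[OF step] by blast
qed

section \<open>Matrices as partial knowledge of a graph\<close>

definition adj :: "'a graph \<Rightarrow> vx list \<Rightarrow> (vx \<Rightarrow> 'a) \<Rightarrow> vx \<Rightarrow> vx \<Rightarrow> bool" where
  "adj \<Gamma> vs h x y \<longleftrightarrow> x \<in> set vs \<and> y \<in> set vs \<and> {h x, h y} \<in> edges \<Gamma>"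

text \<open>In contrast to \<open>sub_of\<close>, the entries \<open>Non\<close> are claims as well;
  \<open>Open\<close> claims nothing.\<close>

definition consistent :: "(vx \<Rightarrow> vx \<Rightarrow> bool) \<Rightarrow> mat \<Rightarrow> bool" where
  "consistent Q N \<longleftrightarrow> (\<forall>x y. (get2 N x y = Edge \<longrightarrow> Q x y) \<and> (get2 N x y = Non \<longrightarrow> \<not> Q x y))"

definition holds :: "(vx \<Rightarrow> vx \<Rightarrow> bool) \<Rightarrow> mark \<Rightarrow> vx \<Rightarrow> vx \<Rightarrow> bool" where
  "holds Q a x y \<longleftrightarrow> (a = Edge \<longrightarrow> Q x y) \<and> (a = Non \<longrightarrow> \<not> Q x y)"

lemma consistentD: "consistent Q N \<Longrightarrow> holds Q (get2 N x y) x y"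
  by (simp add: consistent_def holds_def)

lemma consistent_set2:
  assumes "consistent Q N" "holds Q a x y" "symp Q" shows "consistent Q (set2 N x y a)"
  unfolding consistent_def
proof (intro allI)
  fix u v
  have "holds Q (get2 (set2 N x y a) u v) u v"
  proof (cases "u = x \<and> v = y \<or> u = y \<and> v = x")
    case True
    have "holds Q a y x" using assms(2,3) unfolding holds_def symp_def by blast
    then have "holds Q a u v" using True assms(2) by blast
    then show ?thesis using True by (simp only: get2_set2 if_True)
  next
    case False
    then show ?thesis using consistentD[OF assms(1)] by (simp only: get2_set2 if_False)
  qed
  then show "(get2 (set2 N x y a) u v = Edge \<longrightarrow> Q u v) \<and> (get2 (set2 N x y a) u v = Non \<longrightarrow> \<not> Q u v)"
    by (simp only: holds_def)
qed

lemma consistent_set_all: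
  "consistent Q N \<Longrightarrow> (\<And>y. y \<in> set l \<Longrightarrow> holds Q a v y) \<Longrightarrow> symp Q \<Longrightarrow> consistent Q (set_all a v l N)"
proof (induction l arbitrary: N)
  case (Cons z l)
  show ?case unfolding set_all.simps
    by (rule Cons.IH) (use Cons.prems consistent_set2 in auto)
qed simp

lemma consistent_saturate:
  "consistent Q N \<Longrightarrow> (\<And>v y. v \<in> set l \<Longrightarrow> get2 N v y = Open \<Longrightarrow> holds Q a v y) \<Longrightarrow> a \<noteq> Open \<Longrightarrow>
    symp Q \<Longrightarrow> consistent Q (saturate a l N)"
proof (induction l arbitrary: N)
  case (Cons v l)
  have mono: "get2 N x y = Open" if "get2 (set_all a v (undecided (get N v)) N) x y = Open" for x y
    using that Cons.prems(3) by (simp only: get2_set_all) (metis)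
  show ?case unfolding saturate.simps
  proof (rule Cons.IH)
    show "consistent Q (set_all a v (undecided (get N v)) N)"
      by (rule consistent_set_all) (use Cons.prems in \<open>auto simp: mem_undecided get2_def\<close>)
  qed (use Cons.prems mono in auto)
qed simp

text \<open>\<open>Stuck\<close> counts as sound because \<open>run\<close> rejects it.\<close>

definition sound :: "(vx \<Rightarrow> vx \<Rightarrow> bool) \<Rightarrow> outcome \<Rightarrow> bool" where
  "sound Q r \<longleftrightarrow> r \<noteq> Closed \<and> (\<forall>N. r = Go N \<longrightarrow> consistent Q N)"

lemma sound_put:
  assumes "sound Q r" "holds Q a x y" "symp Q" shows "sound Q (put a x y r)"
proof (cases r)
  case (Go N)
  then have N: "consistent Q N" using assms(1) by (simp add: sound_def)
  have "sound Q (put1 a (get2 N x y) x y N)"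
    using assms(2) consistentD[OF N, of x y] N consistent_set2[OF N assms(2,3)]
    by (cases a; cases "get2 N x y") (auto simp: sound_def holds_def)
  then show ?thesis using Go by simp
qed (use assms in \<open>auto simp: sound_def\<close>)

lemma run_sound: "run f r \<Longrightarrow> sound Q r \<Longrightarrow> (\<And>N. consistent Q N \<Longrightarrow> f N \<Longrightarrow> p) \<Longrightarrow> p"
  by (cases r) (auto simp: sound_def)

lemma consistent_init:
  "consistent Q N \<Longrightarrow> (\<And>x y. (x, y) \<in> set l \<Longrightarrow> holds Q a x y) \<Longrightarrow> symp Q \<Longrightarrow> consistent Q (init a l N)"
proof (induction l arbitrary: N)
  case (Cons e l)
  obtain x y where "e = (x, y)" by fastforce
  then show ?case using Cons consistent_set2 by auto
qed simp

text \<open>Collects exactly those consequences of internal 4-connectivity on which the search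
  relies. The list has as many letters as the graph has vertices, but no labelling is fixed.\<close>

locale labelled_graph =
  fixes \<Gamma> :: "'a graph" and vs :: "vx list"
  assumes simple: "simple_graph \<Gamma>"
    and min_degree: "\<And>v. v \<in> verts \<Gamma> \<Longrightarrow> 3 \<le> card (nbr \<Gamma> v)"
    and no_triangle: "\<And>v a b. v \<in> verts \<Gamma> \<Longrightarrow> card (nbr \<Gamma> v) = 3 \<Longrightarrow> a \<in> nbr \<Gamma> v \<Longrightarrow> b \<in> nbr \<Gamma> v \<Longrightarrow>
      {a, b} \<notin> edges \<Gamma>"
    and separation: "\<And>U W. U \<subseteq> verts \<Gamma> \<Longrightarrow> W \<subseteq> verts \<Gamma> \<Longrightarrow> U \<inter> W = {} \<Longrightarrow>
      (\<And>a b. a \<in> U \<Longrightarrow> b \<in> W \<Longrightarrow> {a, b} \<notin> edges \<Gamma>) \<Longrightarrow> 2 \<le> card U \<Longrightarrow> 2 \<le> card W \<Longrightarrow>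
      3 < card (verts \<Gamma> - U - W)"
    and distinct_vs: "distinct vs" and length_vs: "length vs = card (verts \<Gamma>)"
begin

abbreviation "labelling h \<equiv> bij_betw h (set vs) (verts \<Gamma>)"

abbreviation "Adj \<equiv> adj \<Gamma> vs"

lemma finite_verts: "finite (verts \<Gamma>)" and finite_edges: "finite (edges \<Gamma>)" and wf: "wf_graph \<Gamma>"
  using simple simple_graph_finite_edges simple_graph_wf by (auto simp: simple_graph_def)

lemma symp_Adj: "symp (Adj h)"
  by (auto simp: symp_def adj_def insert_commute)

lemma nbr_image:
  assumes "labelling h" "x \<in> set vs" shows "h ` {y. Adj h x y} = nbr \<Gamma> (h x)"
proof
  show "h ` {y. Adj h x y} \<subseteq> nbr \<Gamma> (h x)" by (auto simp: adj_def nbr_def)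
  show "nbr \<Gamma> (h x) \<subseteq> h ` {y. Adj h x y}"
  proof
    fix w assume w: "w \<in> nbr \<Gamma> (h x)"
    then have "w \<in> h ` set vs" using nbr_subset[OF simple] assms(1) by (auto simp: bij_betw_def)
    then show "w \<in> h ` {y. Adj h x y}" using w assms(2) by (auto simp: adj_def nbr_def)
  qed
qed

lemma card_Adj:
  assumes "labelling h" "x \<in> set vs" shows "card {y. Adj h x y} = card (nbr \<Gamma> (h x))"
proof -
  have "inj_on h {y. Adj h x y}"
    using assms(1) by (auto simp: adj_def bij_betw_def inj_on_def)
  then show ?thesis using nbr_image[OF assms] card_image by metis
qed

lemma card_Adj_ge: "labelling h \<Longrightarrow> x \<in> set vs \<Longrightarrow> 3 \<le> card {y. Adj h x y}"
  using card_Adj[of h x] min_degree[of "h x"] bij_betwE by fastforce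

lemma finite_Adj: "finite {y. Adj h x y}"
  by (rule finite_subset[of _ "set vs"]) (auto simp: adj_def)

lemma sum_card_Adj:
  assumes "labelling h" shows "(\<Sum>v\<leftarrow>vs. card {y. Adj h v y}) = 2 * card (edges \<Gamma>)"
proof -
  have "(\<Sum>v\<leftarrow>vs. card {y. Adj h v y}) = (\<Sum>v\<in>set vs. card (nbr \<Gamma> (h v)))"
    using distinct_vs card_Adj[OF assms] by (simp add: sum_list_distinct_conv_sum_set)
  also have "\<dots> = (\<Sum>v\<in>verts \<Gamma>. card (nbr \<Gamma> v))" by (rule sum.reindex_bij_betw[OF assms])
  finally show ?thesis using handshake[OF simple] by simp
qed

lemma deg_step_sound:
  assumes h: "labelling h" and N: "consistent (Adj h) N" and v: "v \<in> set vs"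
  shows "sound (Adj h) (deg_step v (possible (get N v)) N)"
proof -
  let ?l = "possible (get N v)"
  have sub: "{y. Adj h v y} \<subseteq> set ?l"
    using N unfolding consistent_def mem_possible subset_iff by (auto simp: get2_def)
  have ge: "3 \<le> card (set ?l)" using card_mono[OF _ sub] card_Adj_ge[OF h v] by (meson List.finite_set le_trans)
  show ?thesis
  proof (cases "\<exists>x y z. ?l = [x, y, z]")
    case True
    then obtain x y z where l: "?l = [x, y, z]" by blast
    have "card (set ?l) \<le> card {y. Adj h v y}"
      using card_length[of ?l] card_Adj_ge[OF h v] l by simp
    then have eq: "{y. Adj h v y} = {x, y, z}" using card_seteq[OF _ sub] l by simp
    have three: "card (nbr \<Gamma> (h v)) = 3"
      using card_Adj[OF h v] eq card_length[of ?l] card_Adj_ge[OF h v] l by simp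
    have non: "holds (Adj h) Non a b" if "Adj h v a" "Adj h v b" for a b
      using no_triangle[OF _ three, of "h a" "h b"] that h v
      by (auto simp: holds_def adj_def nbr_def bij_betw_def)
    have "Adj h v x" "Adj h v y" "Adj h v z" using eq by auto
    then show ?thesis unfolding l deg_step.simps
      by (intro sound_put symp_Adj non) (auto simp: holds_def sound_def N)
  next
    case False
    have "length ?l \<noteq> 3" using False by (auto simp: length_Suc_conv numeral_eq_Suc)
    then have "4 \<le> length ?l" using ge card_length[of ?l] by linarith
    then have "\<exists>a b c d l'. ?l = a # b # c # d # l'" by (auto simp: Suc_le_length_iff numeral_eq_Suc)
    then show ?thesis by (auto simp: sound_def)
  qed
qed

text \<open>A termwise bound without loss in total is an equality in every term. Both counting rules
  rest on this.\<close>

lemma sum_list_eq_pointwise: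
  "(\<And>v. v \<in> set l \<Longrightarrow> f v \<le> g v) \<Longrightarrow> (\<Sum>v\<leftarrow>l. g v) \<le> (\<Sum>v\<leftarrow>l. f v :: nat) \<Longrightarrow> v \<in> set l \<Longrightarrow> f v = g v"
proof (induction l)
  case (Cons x l)
  have "(\<Sum>v\<leftarrow>l. f v) \<le> (\<Sum>v\<leftarrow>l. g v)" using Cons.prems(1) by (intro sum_list_mono) auto
  moreover have "f x \<le> g x" using Cons.prems(1) by simp
  ultimately have "f x = g x" "(\<Sum>v\<leftarrow>l. g v) \<le> (\<Sum>v\<leftarrow>l. f v)" using Cons.prems(2) by auto
  then show ?case using Cons by auto
qed simp

lemma sum_list_minus_const:
  "(\<And>v. v \<in> set l \<Longrightarrow> k \<le> f v) \<Longrightarrow> (\<Sum>v\<leftarrow>l. f v - k) + k * length l = (\<Sum>v\<leftarrow>l. f v :: nat)"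
proof (induction l)
  case (Cons x l)
  have "k \<le> f x" "(\<Sum>v\<leftarrow>l. f v - k) + k * length l = (\<Sum>v\<leftarrow>l. f v)" using Cons by simp_all
  then show ?case unfolding list.map sum_list.Cons list.size by (simp add: algebra_simps)
qed simp

lemma set_present_subset: "consistent Q N \<Longrightarrow> set (present (get N v)) \<subseteq> {y. Q v y}"
  unfolding consistent_def by (auto simp: mem_present get2_def)

lemma set_possible_superset: "consistent Q N \<Longrightarrow> {y. Q v y} \<subseteq> set (possible (get N v))"
  unfolding consistent_def by (auto simp: mem_possible get2_def)

text \<open>By the handshake identity the excesses over three sum to exactly \<open>e\<close>. If
  the known ones already account for \<open>e\<close>, every vertex with three known edges has no
  unknown one.\<close>

lemma sat_step_sound:
  assumes h: "labelling h" and N: "consistent (Adj h) N" and e: "e + 3 * length vs = 2 * card (edges \<Gamma>)"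
  shows "sound (Adj h) (sat_step N (scan vs N (Scan e [])))"
proof -
  let ?d = "\<lambda>v. card {y. Adj h v y}"
  have le: "length (present (get N v)) \<le> ?d v" for v
    using card_mono[OF finite_Adj set_present_subset[OF N]] distinct_card[OF distinct_present] by metis
  have sum: "(\<Sum>v\<leftarrow>vs. ?d v - 3) = e"
    using sum_list_minus_const[of vs 3 ?d] card_Adj_ge[OF h] sum_card_Adj[OF h] e by simp
  have sle: "surplus N v \<le> ?d v - 3" for v using le[of v] by (simp add: surplus_def)
  then have "(\<Sum>v\<leftarrow>vs. surplus N v) \<le> e" unfolding sum[symmetric] by (intro sum_list_mono)
  then have "scan vs N (Scan e []) \<noteq> Over" using scan_Scan[of vs N e "[]"] by linarith
  then obtain b acc where s: "scan vs N (Scan e []) = Scan b acc" by (cases "scan vs N (Scan e [])") auto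
  then have b: "e = b + (\<Sum>v\<leftarrow>vs. surplus N v)"
    and acc: "set acc = {v \<in> set vs. 3 \<le> length (present (get N v))}"
    using scan_Scan[of vs N e "[]"] by auto
  show ?thesis
  proof (cases b)
    case 0
    have full: "{y. Adj h v y} = set (present (get N v))" if "v \<in> set acc" for v
    proof -
      have "surplus N v = ?d v - 3"
        by (rule sum_list_eq_pointwise[of vs]) (use that acc sle sum b 0 in auto)
      then have "?d v = card (set (present (get N v)))"
        using that acc card_Adj_ge[OF h, of v] distinct_card[OF distinct_present]
        by (auto simp: surplus_def)
      then show ?thesis using card_subset_eq[OF finite_Adj set_present_subset[OF N]] by metis
    qed
    have "consistent (Adj h) (saturate Non acc N)"
    proof (rule consistent_saturate[OF N _ _ symp_Adj])
      fix v y assume "v \<in> set acc" "get2 N v y = Open"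
      then have "y \<notin> {y. Adj h v y}" unfolding full[OF \<open>v \<in> set acc\<close>] mem_present by (simp add: get2_def)
      then show "holds (Adj h) Non v y" by (simp add: holds_def)
    qed simp
    then show ?thesis using s 0 by (simp add: sound_def)
  qed (simp add: s sound_def)
qed

text \<open>Degrees are bounded by the numbers of possible neighbours and sum to 2m. So a positive
  remainder cannot occur, and remainder 0 means that every bound is attained.\<close>

lemma full_step_sound:
  assumes h: "labelling h" and N: "consistent (Adj h) N"
  shows "sound (Adj h) (full_step vs N (need N vs (Some (2 * card (edges \<Gamma>)))))"
proof (cases "need N vs (Some (2 * card (edges \<Gamma>)))")
  case (Some b)
  let ?d = "\<lambda>v. card {y. Adj h v y}"
  have le: "?d v \<le> length (possible (get N v))" for v
    using card_mono[OF _ set_possible_superset[OF N]] card_length by (meson List.finite_set le_trans)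
  have sum: "(\<Sum>v\<leftarrow>vs. ?d v) = b + (\<Sum>v\<leftarrow>vs. length (possible (get N v)))"
    using need_Some[OF Some] sum_card_Adj[OF h] by simp
  moreover have "(\<Sum>v\<leftarrow>vs. ?d v) \<le> (\<Sum>v\<leftarrow>vs. length (possible (get N v)))"
    using le by (intro sum_list_mono)
  ultimately have b: "b = 0" by linarith
  have full: "{y. Adj h v y} = set (possible (get N v))" if "v \<in> set vs" for v
  proof -
    have "?d v = length (possible (get N v))"
      by (rule sum_list_eq_pointwise[of vs]) (use that le sum in auto)
    then have "card (set (possible (get N v))) \<le> ?d v" using card_length[of "possible (get N v)"] by simp
    then show ?thesis using card_seteq[OF _ set_possible_superset[OF N]] by blast
  qed
  have "consistent (Adj h) (saturate Edge vs N)"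
  proof (rule consistent_saturate[OF N _ _ symp_Adj])
    fix v y assume "v \<in> set vs" "get2 N v y = Open"
    then have "y \<in> {y. Adj h v y}" unfolding full[OF \<open>v \<in> set vs\<close>] mem_possible by (simp add: get2_def)
    then show "holds (Adj h) Edge v y" by (simp add: holds_def)
  qed simp
  then show ?thesis using Some b by (simp add: sound_def)
qed (simp add: sound_def)

definition hits :: "target option vec \<Rightarrow> bool" where
  "hits t \<longleftrightarrow> (\<exists>i tg. get t i = Some tg \<and> has_minor \<Gamma> (target_graph tg))"

text \<open>The quantification over all labellings makes this a statement about the graph rather
  than about one naming of its vertices; reuse under permutations depends on it.\<close>

definition refuted :: "target option vec \<Rightarrow> (vx \<times> vx) list \<Rightarrow> (vx \<times> vx) list \<Rightarrow> bool" where
  "refuted t es ns \<longleftrightarrow> (\<forall>(x, y)\<in>set es. x \<in> set vs \<and> y \<in> set vs) \<and>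
     (\<forall>h. labelling h \<longrightarrow> (\<forall>(x, y)\<in>set es. Adj h x y) \<longrightarrow> (\<forall>(x, y)\<in>set ns. \<not> Adj h x y) \<longrightarrow> hits t)"

definition par_ok :: "par \<Rightarrow> bool" where
  "par_ok K \<longleftrightarrow> vs_of K = vs \<and> (\<forall>x. get (w_of K) x \<longleftrightarrow> x \<in> set vs) \<and>
     e_of K + 3 * length vs = 2 * card (edges \<Gamma>) \<and> n_of K = 2 * card (edges \<Gamma>) \<and>
     (\<forall>i tg. get (t_of K) i = Some tg \<longrightarrow> wf_target tg) \<and>
     (\<forall>i j es ns. get (get (tb_of K) i) j = Some (es, ns) \<longrightarrow> refuted (t_of K) es ns)"

text \<open>The stored refutation is applied to \<open>h \<circ> get p\<close>. An injective map of
  the finite set of letters into itself is a permutation, so this is again a labelling.\<close>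

lemma ref_sound:
  assumes "refuted t es ns" "labelling h" "consistent (Adj h) N" "\<And>x. get w x \<longleftrightarrow> x \<in> set vs"
    "ref (Some (es, ns)) vs w p N"
  shows "hits t"
proof -
  have es: "Adj h (get p x) (get p y)" if "(x, y) \<in> set es" for x y
    using assms(3,5) that by (auto simp: all_marked_iff consistent_def)
  have ns: "\<not> Adj h (get p x) (get p y)" if "(x, y) \<in> set ns" for x y
    using assms(3,5) that by (auto simp: all_marked_iff consistent_def)
  have p: "inj_on (get p) (set vs)" "get p ` set vs \<subseteq> set vs"
    using injective_sound[of vs p w] assms(4,5) by auto
  then have "bij_betw (get p) (set vs) (set vs)"
    using endo_inj_surj[of "set vs" "get p"] by (simp add: bij_betw_def)
  then have "labelling (h \<circ> get p)" using assms(2) by (rule bij_betw_trans)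
  moreover have "Adj (h \<circ> get p) x y" if "(x, y) \<in> set es" for x y
    using es[OF that] assms(1) that by (auto simp: adj_def refuted_def)
  moreover have "\<not> Adj (h \<circ> get p) x y" if "(x, y) \<in> set ns" for x y
    using ns[OF that] p(2) by (auto simp: adj_def)
  ultimately show ?thesis using assms(1) unfolding refuted_def by blast
qed

lemma sub_of_consistent:
  assumes "labelling h" "consistent (Adj h) N" shows "sub_of h \<Gamma> (set vs) N"
  unfolding sub_of_def
proof (intro conjI allI impI)
  show inj: "inj_on h (set vs)" using assms(1) by (simp add: bij_betw_def)
  fix x y assume "get2 N x y = Edge"
  then have a: "Adj h x y" using assms(2) by (simp add: consistent_def)
  then show "x \<in> set vs" "y \<in> set vs" "{h x, h y} \<in> edges \<Gamma>" by (simp_all add: adj_def)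
  show "x \<noteq> y" using a simple_graph_edgeD(3)[OF simple] by (auto simp: adj_def)
qed

lemma not_separated:
  assumes h: "labelling h" and N: "consistent (Adj h) N"
    and chk: "sub as vs" "sub bs vs" "sub vs (as @ bs @ ss)" "two as" "two bs" "upto3 ss" "block_non N as bs"
  shows False
proof -
  have inj: "inj_on h (set vs)" and img: "h ` set vs = verts \<Gamma>" using h by (auto simp: bij_betw_def)
  have sub: "set as \<subseteq> set vs" "set bs \<subseteq> set vs" "set vs \<subseteq> set as \<union> set bs \<union> set ss"
    using chk(1-3) by (auto simp: sub_iff)
  have non: "\<not> Adj h a b" "a \<noteq> b" if "a \<in> set as" "b \<in> set bs" for a b
    using chk(7) that N by (auto simp: block_non_iff consistent_def)
  have card: "2 \<le> card (h ` set as)" "2 \<le> card (h ` set bs)"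
    using two_card chk(4,5) card_image inj_on_subset[OF inj] sub by metis+
  have "3 < card (verts \<Gamma> - h ` set as - h ` set bs)"
  proof (rule separation)
    show "h ` set as \<inter> h ` set bs = {}" using non(2) inj sub by (auto simp: inj_on_def) (metis subsetD)
    show "{a, b} \<notin> edges \<Gamma>" if "a \<in> h ` set as" "b \<in> h ` set bs" for a b
      using that non(1) sub by (auto simp: adj_def)
    show "h ` set as \<subseteq> verts \<Gamma>" "h ` set bs \<subseteq> verts \<Gamma>"
      unfolding img[symmetric] using sub by (simp_all add: image_mono)
  qed (use card in auto)
  also have "\<dots> \<le> card (h ` set ss)" using sub(3) unfolding img[symmetric] by (intro card_mono) auto
  also have "\<dots> \<le> 3" using card_image_le[of "set ss" h] card_length[of ss] upto3_length[OF chk(6)] by simp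
  finally show False by simp
qed

lemma chk_sound:
  assumes "par_ok K" "labelling h" "consistent (Adj h) N" "chk K c N" shows "hits (t_of K)"
  using assms(3,4)
proof (induction c arbitrary: N)
  case (S u v a b)
  show ?case
  proof (cases "Adj h u v")
    case True
    then have "consistent (Adj h) (set2 N u v Edge)"
      by (intro consistent_set2 S.prems symp_Adj) (simp add: holds_def)
    then show ?thesis using S by simp
  next
    case False
    then have "consistent (Adj h) (set2 N u v Non)"
      by (intro consistent_set2 S.prems symp_Adj) (simp add: holds_def)
    then show ?thesis using S by simp
  qed
next
  case (T v c)
  have "v \<in> set vs" "run (chk K c) (deg_step v (possible (get N v)) N)"
    using T.prems(2) assms(1) by (auto simp: par_ok_def)
  then show ?case using run_sound deg_step_sound[OF assms(2) T.prems(1)] T.IH by metis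
next
  case (X c)
  have "run (chk K c) (sat_step N (scan vs N (Scan (e_of K) [])))"
    and "e_of K + 3 * length vs = 2 * card (edges \<Gamma>)"
    using X.prems(2) assms(1) by (auto simp: par_ok_def)
  then show ?case using run_sound sat_step_sound[OF assms(2) X.prems(1)] X.IH by metis
next
  case (L c)
  have "run (chk K c) (full_step vs N (need N vs (Some (2 * card (edges \<Gamma>)))))"
    using L.prems(2) assms(1) by (auto simp: par_ok_def)
  then show ?case using run_sound full_step_sound[OF assms(2) L.prems(1)] L.IH by metis
next
  case (P as bs ss)
  have "vs_of K = vs" using assms(1) by (simp add: par_ok_def)
  then show ?case using not_separated[OF assms(2) P.prems(1), of as bs ss] P.prems(2) by simp
next
  case (R i j p)
  have K: "vs_of K = vs" "\<And>x. get (w_of K) x \<longleftrightarrow> x \<in> set vs" using assms(1) by (simp_all add: par_ok_def)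
  obtain es ns where l: "get (get (tb_of K) i) j = Some (es, ns)"
    using R.prems(2) by (cases "get (get (tb_of K) i) j") auto
  then have "refuted (t_of K) es ns" using assms(1) by (simp add: par_ok_def)
  then show ?case using ref_sound[OF _ assms(2) R.prems(1) K(2)] R.prems(2) l K(1) by auto
next
  case (M i l p)
  have run: "run (embeds (get (t_of K) i) (w_of K) p) (contr l N)" using M.prems(2) by simp
  then obtain tg where tg: "get (t_of K) i = Some tg"
    using contr_not_Closed by (cases "get (t_of K) i"; cases "contr l N") auto
  then have "has_minor \<Gamma> (target_graph tg)"
    using contr_sound[OF sub_of_consistent[OF assms(2) M.prems(1)] wf finite_verts finite_edges] run assms(1)
    by (auto simp: par_ok_def)
  then show ?case using tg by (auto simp: hits_def)
qed simp

lemma inside_iff: "inside w l \<longleftrightarrow> (\<forall>(x, y)\<in>set l. get w x \<and> get w y)"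
  by (induction w l rule: inside.induct) auto

text \<open>The initial matrix has to be consistent with every labelling, since each stored lemma is
  a claim about all of them.\<close>

lemma chks_sound:
  assumes "\<And>h. labelling h \<Longrightarrow> consistent (Adj h) N" "labelling h"
  shows "par_ok K \<Longrightarrow> chks K N ls c \<Longrightarrow> hits (t_of K)"
proof (induction ls arbitrary: K)
  case Nil
  then show ?case using chk_sound[OF Nil(1) assms(2) assms(1)[OF assms(2)]] by simp
next
  case (Cons l ls)
  obtain i j es ns d where l: "l = Lem i j es ns d" by (cases l)
  obtain vs' w e n t tb where K: "K = Par vs' w e n t tb" by (cases K)
  have 1: "inside w es" "chk K d (init Non ns (init Edge es N))" "chks (store K i j (es, ns)) N ls c"
    using Cons.prems(2) l K by simp_all
  have "hits t" if "labelling h'" "\<forall>(x, y)\<in>set es. Adj h' x y" "\<forall>(x, y)\<in>set ns. \<not> Adj h' x y" for h'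
  proof -
    have "consistent (Adj h') (init Non ns (init Edge es N))"
      using that assms(1) symp_Adj by (intro consistent_init) (auto simp: holds_def)
    then show ?thesis using chk_sound[OF Cons.prems(1) that(1) _ 1(2)] K by simp
  qed
  then have "refuted t es ns"
    using 1(1) Cons.prems(1) K by (auto simp: refuted_def inside_iff par_ok_def)
  then have "par_ok (store K i j (es, ns))"
    using Cons.prems(1) K by (auto simp: par_ok_def get_upd split: if_splits)
  then show ?case using Cons.IH 1(3) K by fastforce
qed

text \<open>The base matrix asserts only non-edges on the diagonal and outside the letters, which
  hold for every labelling. One labelling exists because letters and vertices are equally
  many.\<close>

theorem certified_sound:
  assumes "certified vs e n t ls c" "e + 3 * length vs = n" "n = 2 * card (edges \<Gamma>)"
    "\<And>i tg. get t i = Some tg \<Longrightarrow> wf_target tg"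
  shows "hits t"
proof -
  obtain h where h: "labelling h"
    using finite_same_card_bij[OF List.finite_set finite_verts] distinct_card[OF distinct_vs] length_vs by metis
  let ?K = "Par vs (avail vs) e n t (const_vec (const_vec None))"
  have "par_ok ?K" using assms(2-4) by (simp add: par_ok_def get_avail get_const_vec del: const_vec.simps)
  moreover have "consistent (Adj h') (base vs)" for h'
    using simple_graph_edgeD(3)[OF simple]
    by (auto simp: consistent_def get2_base adj_def simp del: base.simps)
  ultimately show ?thesis using chks_sound[OF _ h, of "base vs" ?K] assms(1) by fastforce
qed

end

section \<open>Tests for concrete graphs\<close>

fun tmat :: "(vx \<times> vx) list \<Rightarrow> mat" where
  "tmat te = init Edge te (const_vec (const_vec Non))"

fun if_alive :: "bool \<Rightarrow> vx \<Rightarrow> vx list \<Rightarrow> vx list" where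
  "if_alive True x l = x # l" | "if_alive False x l = l"

fun alive :: "vx list \<Rightarrow> bool vec \<Rightarrow> vx list" where
  "alive [] w = []" | "alive (x # l) w = if_alive (get w x) x (alive l w)"

fun kill :: "vx list \<Rightarrow> bool vec \<Rightarrow> bool vec" where
  "kill [] w = w" | "kill (x # l) w = kill l (upd w x False)"

text \<open>\<open>l\<close> is the stack and \<open>w\<close> the set of unvisited vertices;
  vertices leave \<open>w\<close> when pushed. Running out of \<open>k\<close> leaves vertices
  unvisited and can only make the connectivity test fail.\<close>

fun dfs :: "nat \<Rightarrow> mat \<Rightarrow> vx list \<Rightarrow> bool vec \<Rightarrow> bool vec" and dfs1 where
  "dfs 0 N l w = w"
| "dfs (Suc k) N [] w = w"
| "dfs (Suc k) N (x # l) w = dfs1 k N (alive (present (get N x)) w) l w"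
| "dfs1 k N new l w = dfs k N (new @ l) (kill new w)"

fun is_nil :: "'a list \<Rightarrow> bool" where "is_nil [] = True" | "is_nil (x # l) = False"

text \<open>Every vertex is pushed at most once, so ten rounds exhaust a graph on ten
  vertices.\<close>

fun conn1 :: "mat \<Rightarrow> vx list \<Rightarrow> bool vec \<Rightarrow> vx list \<Rightarrow> bool" where
  "conn1 N tv w [] = False"
| "conn1 N tv w (x # l) = is_nil (alive tv (dfs 10 N [x] (upd w x False)))"

fun conn :: "mat \<Rightarrow> vx list \<Rightarrow> bool vec \<Rightarrow> bool" where "conn N tv w = conn1 N tv w (alive tv w)"

fun has_four :: "'a list \<Rightarrow> bool" where
  "has_four (x # y # z # v # l) = True" | "has_four [x, y, z] = False" | "has_four [x, y] = False"
| "has_four [x] = False" | "has_four [] = False"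

fun near :: "mat \<Rightarrow> vx list \<Rightarrow> vx list \<Rightarrow> bool vec \<Rightarrow> bool" where
  "near N tv [] w = False"
| "near N tv (x # l) w = (conn N tv (upd w x False) \<or> near N tv l w)"

text \<open>Used after deletion of three vertices. If one further deletion leaves a connected graph,
  no separation has two vertices on each side, since each side would keep one. With fewer than four
  vertices left, two and two do not fit.\<close>

fun near_or_few :: "mat \<Rightarrow> vx list \<Rightarrow> bool vec \<Rightarrow> bool" where
  "near_or_few N tv w = (near N tv tv w \<or> \<not> has_four (alive tv w))"

fun all_sub :: "nat \<Rightarrow> (bool vec \<Rightarrow> bool) \<Rightarrow> vx list \<Rightarrow> bool vec \<Rightarrow> bool" where
  "all_sub 0 t l w = t w"
| "all_sub (Suc k) t [] w = True"
| "all_sub (Suc k) t (x # l) w = (all_sub k t l (upd w x False) \<and> all_sub (Suc k) t l w)"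

fun no_tri :: "mat \<Rightarrow> vx list \<Rightarrow> bool" where
  "no_tri N [] = True" | "no_tri N [x] = True" | "no_tri N [x, y] = True"
| "no_tri N [x, y, z] = (is_mark Non (get2 N x y) \<and> is_mark Non (get2 N y z) \<and> is_mark Non (get2 N x z))"
| "no_tri N (x # y # z # v # l) = True"

fun no_tris :: "mat \<Rightarrow> vx list \<Rightarrow> bool" where
  "no_tris N [] = True" | "no_tris N (x # l) = (no_tri N (present (get N x)) \<and> no_tris N l)"

text \<open>Edges are counted through the degrees in the matrix, so repeated or reversed pairs in an
  edge list cannot distort the count.\<close>

fun deg_sum :: "mat \<Rightarrow> vx list \<Rightarrow> nat option \<Rightarrow> bool" where
  "deg_sum N l None = False"
| "deg_sum N [] (Some 0) = True"
| "deg_sum N [] (Some (Suc b)) = False"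
| "deg_sum N (x # l) (Some b) = deg_sum N l (eat (present (get N x)) b)"

fun loop_free :: "(vx \<times> vx) list \<Rightarrow> bool" where
  "loop_free [] = True" | "loop_free ((x, y) # l) = (x \<noteq> y \<and> loop_free l)"

fun i4c_test :: "mat \<Rightarrow> vx list \<Rightarrow> bool vec \<Rightarrow> bool" where
  "i4c_test N tv w = (has_four tv \<and> no_tris N tv \<and> all_sub 0 (conn N tv) tv w \<and> all_sub 1 (conn N tv) tv w \<and>
     all_sub 2 (conn N tv) tv w \<and> all_sub 3 (near_or_few N tv) tv w)"

text \<open>With the identity vector, \<open>injective\<close> tests that \<open>tv\<close> has no
  repetitions.\<close>

fun sizes_ok :: "target \<Rightarrow> nat \<Rightarrow> bool" where
  "sizes_ok (Target tv te) k = (injective tv (V A B C D E F G H I J) (avail tv) \<and> loop_free te \<and> deg_sum (tmat te) tv (Some k))"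

fun i4c_target :: "target \<Rightarrow> bool" where
  "i4c_target (Target tv te) = i4c_test (tmat te) tv (avail tv)"

fun target_minor :: "target \<Rightarrow> target \<Rightarrow> (vx \<times> vx) list \<Rightarrow> vx vec \<Rightarrow> bool" where
  "target_minor (Target tv te) tg l p = run (embeds (Some tg) (avail tv) p) (contr l (tmat te))"

lemmas target_rules = tmat.simps if_alive.simps alive.simps kill.simps dfs.simps dfs1.simps is_nil.simps conn1.simps
  conn.simps near.simps near_or_few.simps all_sub.simps no_tri.simps no_tris.simps deg_sum.simps loop_free.simps i4c_test.simps
  sizes_ok.simps i4c_target.simps target_minor.simps has_four.simps

section \<open>Soundness of the tests\<close>

definition joined :: "(vx \<times> vx) list \<Rightarrow> vx \<Rightarrow> vx \<Rightarrow> bool" where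
  "joined te x y \<longleftrightarrow> (x, y) \<in> set te \<or> (y, x) \<in> set te"

lemma get2_init_Edge:
  "get2 (init Edge te N) x y = (if joined te x y then Edge else get2 N x y)"
proof (induction te arbitrary: N)
  case Nil
  show ?case by (simp add: joined_def)
next
  case (Cons e l)
  obtain u v where e: "e = (u, v)" by fastforce
  have "get2 (init Edge (e # l) N) x y = (if joined l x y then Edge else get2 (set2 N u v Edge) x y)"
    by (simp only: e init.simps Cons)
  also have "\<dots> = (if joined (e # l) x y then Edge else get2 N x y)"
    unfolding get2_set2 if_if_or e joined_def list.set insert_iff prod.inject
    by (rule if_cong[OF _ refl refl]) blast
  finally show ?case .
qed

lemma get2_tmat: "get2 (tmat te) x y = (if joined te x y then Edge else Non)"
  by (simp add: get2_init_Edge del: const_vec.simps) (simp add: get2_def get_const_vec del: const_vec.simps)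

lemma mem_alive: "y \<in> set (alive l w) \<longleftrightarrow> y \<in> set l \<and> get w y"
proof (induction l)
  case (Cons x l)
  then show ?case by (cases "get w x") auto
qed simp

lemma get_kill: "get (kill l w) y \<longleftrightarrow> get w y \<and> y \<notin> set l"
  by (induction l arbitrary: w) (auto simp: get_upd)

lemma is_nil_iff: "is_nil l \<longleftrightarrow> l = []"
  by (cases l) auto

definition reach :: "(vx \<Rightarrow> vx \<Rightarrow> bool) \<Rightarrow> vx set \<Rightarrow> (vx \<times> vx) set" where
  "reach Q W = {(a, b). Q a b \<and> a \<in> W \<and> b \<in> W}\<^sup>*"

text \<open>Invariant: the vertices on the stack and all vertices of \<open>W\<close> already struck
  from \<open>w\<close> are reachable from the start \<open>x\<close>.\<close>

lemma dfs_sound: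
  assumes N: "\<And>a b. get2 N a b = Edge \<Longrightarrow> Q a b" and W: "W = {y. get w0 y}"
  shows "(\<And>y. y \<in> set l \<Longrightarrow> y \<in> W \<and> (x, y) \<in> reach Q W) \<Longrightarrow>
    (\<And>y. y \<in> W \<Longrightarrow> \<not> get w y \<Longrightarrow> (x, y) \<in> reach Q W) \<Longrightarrow> (\<And>y. get w y \<Longrightarrow> y \<in> W) \<Longrightarrow>
    y \<in> W \<Longrightarrow> \<not> get (dfs k N l w) y \<Longrightarrow> (x, y) \<in> reach Q W"
proof (induction k arbitrary: l w)
  case (Suc k)
  show ?case
  proof (cases l)
    case Nil
    then show ?thesis using Suc.prems by simp
  next
    case (Cons z m)
    let ?new = "alive (present (get N z)) w"
    have new: "u \<in> W \<and> (x, u) \<in> reach Q W" if "u \<in> set ?new" for u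
    proof -
      have "Q z u" "get w u" using that N[of z u] by (auto simp: mem_alive mem_present get2_def)
      then show ?thesis using Suc.prems(1)[of z] Suc.prems(3)[of u] Cons
        unfolding reach_def by (auto intro: rtrancl_into_rtrancl)
    qed
    show ?thesis
    proof (rule Suc.IH[of "?new @ m" "kill ?new w"])
      show "u \<in> W \<and> (x, u) \<in> reach Q W" if "u \<in> set (?new @ m)" for u
        using that new Suc.prems(1) Cons by auto
      show "(x, u) \<in> reach Q W" if "u \<in> W" "\<not> get (kill ?new w) u" for u
        using that new Suc.prems(2) by (auto simp: get_kill)
      show "u \<in> W" if "get (kill ?new w) u" for u using that Suc.prems(3) by (auto simp: get_kill)
      show "\<not> get (dfs k N (?new @ m) (kill ?new w)) y" using Suc.prems(5) Cons by simp
    qed (rule Suc.prems(4))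
  qed
qed simp

lemma conn_sound:
  assumes "conn N tv w" "\<And>a b. get2 N a b = Edge \<Longrightarrow> Q a b" "symp Q" "\<And>y. get w y \<Longrightarrow> y \<in> set tv"
  shows "{y. get w y} \<noteq> {}" "get w a \<Longrightarrow> get w b \<Longrightarrow> (a, b) \<in> reach Q {y. get w y}"
proof -
  let ?W = "{y. get w y}"
  obtain x l where x: "alive tv w = x # l" using assms(1) by (cases "alive tv w") auto
  then have gx: "get w x" using mem_alive[of x tv w] by simp
  then show "?W \<noteq> {}" by blast
  have dead: "\<not> get (dfs 10 N [x] (upd w x False)) y" if "y \<in> set tv" for y
    using assms(1) x that mem_alive[of y tv "dfs 10 N [x] (upd w x False)"] by (auto simp: is_nil_iff)
  have *: "(x, y) \<in> reach Q ?W" if "get w y" for y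
    by (rule dfs_sound[OF assms(2) refl, where l = "[x]" and w = "upd w x False" and k = 10])
      (use gx that dead assms(4) in \<open>auto simp: get_upd reach_def split: if_splits\<close>)
  have "sym (reach Q ?W)" unfolding reach_def
    using assms(3) by (intro sym_rtrancl) (auto simp: sym_def symp_def)
  then show "(a, b) \<in> reach Q ?W" if "get w a" "get w b"
    using *[OF that(1)] *[OF that(2)] unfolding reach_def sym_def by (meson rtrancl_trans)
qed

lemma all_sub_sound:
  "all_sub k t l w \<Longrightarrow> U \<subseteq> set l \<Longrightarrow> card U = k \<Longrightarrow> distinct l \<Longrightarrow>
    \<exists>w'. (\<forall>x. get w' x \<longleftrightarrow> get w x \<and> x \<notin> U) \<and> t w'"
proof (induction k t l w arbitrary: U rule: all_sub.induct)
  case (1 t l w)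
  then have "U = {}" using finite_subset[of U "set l"] by auto
  then show ?case using 1 by auto
next
  case (3 k t x l w)
  have fin: "finite U" using 3(4) finite_subset by blast
  show ?case
  proof (cases "x \<in> U")
    case True
    have "\<exists>w'. (\<forall>z. get w' z \<longleftrightarrow> get (upd w x False) z \<and> z \<notin> U - {x}) \<and> t w'"
      using 3 True fin by (intro "3.IH"(1)) auto
    then obtain w' where w': "\<forall>z. get w' z \<longleftrightarrow> get (upd w x False) z \<and> z \<notin> U - {x}" "t w'" by blast
    have "get w' z \<longleftrightarrow> get w z \<and> z \<notin> U" for z using w'(1) True by (cases "z = x") (auto simp: get_upd)
    then show ?thesis using w'(2) by blast
  next
    case False
    then show ?thesis using 3 by (intro "3.IH"(2)) auto
  qed
qed auto

lemma near_sound: "near N tv l w \<Longrightarrow> \<exists>v\<in>set l. conn N tv (upd w v False)"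
  by (induction l) auto

lemma deg_sum_sound: "deg_sum N l (Some b) \<Longrightarrow> (\<Sum>v\<leftarrow>l. length (present (get N v))) = b"
proof (induction l arbitrary: b)
  case Nil
  then show ?case by (cases b) auto
next
  case (Cons x l)
  then show ?case by (cases "eat (present (get N x)) b") (auto simp: eat_Some)
qed

lemma loop_free_iff: "loop_free l \<longleftrightarrow> (\<forall>(x, y)\<in>set l. x \<noteq> y)"
  by (induction l rule: loop_free.induct) auto

lemma no_tri_sound:
  "no_tri N l \<Longrightarrow> length l = 3 \<Longrightarrow> a \<in> set l \<Longrightarrow> b \<in> set l \<Longrightarrow> a \<noteq> b \<Longrightarrow> get2 N a b = Non \<or> get2 N b a = Non"
  by (induction N l rule: no_tri.induct) (auto simp: is_mark_iff)

lemma no_tris_iff: "no_tris N l \<longleftrightarrow> (\<forall>x\<in>set l. no_tri N (present (get N x)))"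
  by (induction l) auto

lemma has_four_length: "has_four l \<longleftrightarrow> 4 \<le> length l"
  by (induction l rule: has_four.induct) auto

lemma idx_eq: "idx x = idx y \<longleftrightarrow> x = y"
  using inj_idx by (auto simp: inj_def)

section \<open>Properties of a concrete graph from its tests\<close>

locale checked_target =
  fixes tv te
  assumes wf: "wf_target (Target tv te)" and loops: "loop_free te" and dist: "distinct tv"
begin

abbreviation "\<Gamma> \<equiv> target_graph (Target tv te)"

lemma edge_iff: "{idx x, idx y} \<in> edges \<Gamma> \<longleftrightarrow> joined te x y"
  by (auto simp: joined_def doubleton_eq_iff idx_eq image_iff)

lemma joinedD: "joined te x y \<Longrightarrow> x \<in> set tv \<and> y \<in> set tv \<and> x \<noteq> y"
  using wf loops by (auto simp: joined_def loop_free_iff)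

lemma symp_joined: "symp (joined te)"
  by (auto simp: symp_def joined_def)

lemma simple: "simple_graph \<Gamma>"
  unfolding simple_graph_def
proof (intro conjI ballI)
  fix e assume "e \<in> edges \<Gamma>"
  then obtain a b where e: "e = {idx a, idx b}" "(a, b) \<in> set te" by auto
  then have "a \<in> set tv" "b \<in> set tv" "a \<noteq> b" using wf loops by (auto simp: loop_free_iff)
  then show "e \<subseteq> verts \<Gamma>" "card e = 2" using e(1) by (auto simp: idx_eq)
qed simp

lemma nbr_eq: "nbr \<Gamma> (idx x) = idx ` {y. joined te x y}"
proof
  show "nbr \<Gamma> (idx x) \<subseteq> idx ` {y. joined te x y}"
  proof
    fix w assume w: "w \<in> nbr \<Gamma> (idx x)"
    then have "w \<in> idx ` set tv" using nbr_subset[OF simple] by fastforce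
    then obtain y where y: "w = idx y" by blast
    then have "joined te x y" using w edge_iff by (simp add: nbr_def del: target_graph.simps)
    then show "w \<in> idx ` {y. joined te x y}" using y by blast
  qed
qed (auto simp: nbr_def edge_iff simp del: target_graph.simps)

lemma set_present: "set (present (get (tmat te) x)) = {y. joined te x y}"
  by (auto simp: mem_present get2_tmat[unfolded get2_def] simp del: tmat.simps split: if_splits)

lemma card_nbr: "card (nbr \<Gamma> (idx x)) = length (present (get (tmat te) x))"
proof -
  have "card (nbr \<Gamma> (idx x)) = card {y. joined te x y}"
    unfolding nbr_eq by (rule card_image) (auto simp: inj_on_def idx_eq)
  then show ?thesis using distinct_card[OF distinct_present] set_present by metis
qed

lemma card_edges:
  assumes "deg_sum (tmat te) tv (Some k)" shows "2 * card (edges \<Gamma>) = k"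
proof -
  have "(\<Sum>v\<in>verts \<Gamma>. card (nbr \<Gamma> v)) = (\<Sum>x\<in>set tv. card (nbr \<Gamma> (idx x)))"
    by (simp, subst sum.reindex) (auto simp: inj_on_def idx_eq)
  also have "\<dots> = (\<Sum>x\<leftarrow>tv. length (present (get (tmat te) x)))"
    using dist card_nbr by (simp add: sum_list_distinct_conv_sum_set del: tmat.simps)
  finally show ?thesis using handshake[OF simple] deg_sum_sound[OF assms] by simp
qed

lemma minor:
  assumes "target_minor (Target tv te) tg l p" "wf_target tg"
  shows "has_minor \<Gamma> (target_graph tg)"
proof (rule contr_sound)
  show "sub_of idx \<Gamma> (set tv) (tmat te)"
    using joinedD by (auto simp: sub_of_def get2_tmat edge_iff inj_on_def idx_eq simp del: target_graph.simps tmat.simps split: if_splits)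
  show "wf_graph \<Gamma>" "finite (verts \<Gamma>)" "finite (edges \<Gamma>)"
    using simple_graph_wf[OF simple] simple_graph_finite_edges[OF simple] by auto
  show "run (embeds (Some tg) (avail tv) p) (contr l (tmat te))" using assms(1) by simp
qed (rule assms(2))

lemma connected_minus:
  assumes "all_sub k (conn (tmat te) tv) tv (avail tv)" "U \<subseteq> set tv" "card U = k"
  shows "connected_graph (delete_verts \<Gamma> (idx ` U))"
proof -
  obtain w where w: "\<And>x. get w x \<longleftrightarrow> x \<in> set tv \<and> x \<notin> U" "conn (tmat te) tv w"
    using all_sub_sound[OF assms dist] by (auto simp: get_avail)
  have E: "get2 (tmat te) a b = Edge \<Longrightarrow> joined te a b" for a b by (auto simp: get2_tmat simp del: tmat.simps split: if_splits)
  note c = conn_sound[OF w(2) E symp_joined]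
  have ne: "{y. get w y} \<noteq> {}" by (rule c(1)) (auto simp: w)
  have V: "verts (delete_verts \<Gamma> (idx ` U)) = idx ` {y. get w y}"
    by (auto simp: delete_verts_def w idx_eq)
  have "(idx a, idx b) \<in> {(x, y). {x, y} \<in> edges (delete_verts \<Gamma> (idx ` U))}\<^sup>*" if "get w a" "get w b" for a b
  proof -
    have "(a, b) \<in> reach (joined te) {y. get w y}" by (rule c(2)) (use w that in auto)
    then show ?thesis unfolding reach_def
    proof (induction rule: rtrancl_induct)
      case (step y z)
      have "{idx y, idx z} \<in> edges \<Gamma>" using step(2) edge_iff by blast
      then have "{idx y, idx z} \<in> edges (delete_verts \<Gamma> (idx ` U))"
        using step(2) w(1) by (auto simp: delete_verts_def idx_eq)
      then show ?case using step(3) by (auto intro: rtrancl_into_rtrancl)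
    qed simp
  qed
  then show ?thesis using ne unfolding connected_graph_def V by auto
qed

lemma separation:
  assumes "all_sub 3 (near_or_few (tmat te) tv) tv (avail tv)" "U1 \<subseteq> verts \<Gamma>" "U2 \<subseteq> verts \<Gamma>" "U1 \<inter> U2 = {}"
    "\<And>a b. a \<in> U1 \<Longrightarrow> b \<in> U2 \<Longrightarrow> {a, b} \<notin> edges \<Gamma>" "card (verts \<Gamma> - U1 - U2) = 3"
  shows "card U1 \<le> 1 \<or> card U2 \<le> 1"
proof (rule ccontr)
  assume big: "\<not> (card U1 \<le> 1 \<or> card U2 \<le> 1)"
  let ?U = "{x \<in> set tv. idx x \<notin> U1 \<and> idx x \<notin> U2}"
  have "verts \<Gamma> - U1 - U2 = idx ` ?U" by auto
  then have "card ?U = 3" using assms(6) card_image[of idx ?U] by (simp add: inj_on_def idx_eq)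
  then obtain w where w: "\<And>x. get w x \<longleftrightarrow> x \<in> set tv \<and> x \<notin> ?U" "near_or_few (tmat te) tv w"
    using all_sub_sound[OF assms(1) _ _ dist, of ?U] by (auto simp: get_avail)
  have sub: "U1 \<union> U2 \<subseteq> idx ` set (alive tv w)"
    using assms(2,3) w(1) unfolding subset_iff by (auto simp: mem_alive)
  have "finite U1" "finite U2" using sub finite_subset by blast+
  \<comment> \<open>Two vertices on each side rule out the alternative that fewer than four vertices
    remain.\<close>
  then have "4 \<le> card (U1 \<union> U2)" using big assms(4) by (simp add: card_Un_disjoint)
  also have "\<dots> \<le> length (alive tv w)"
    using card_mono[OF _ sub] card_image_le[of "set (alive tv w)" idx] card_length[of "alive tv w"] by simp
  finally have "near (tmat te) tv tv w" using w(2) by (simp add: has_four_length del: near.simps)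
  then obtain v where v: "conn (tmat te) tv (upd w v False)" using near_sound by blast
  have E: "get2 (tmat te) a b = Edge \<Longrightarrow> joined te a b" for a b by (auto simp: get2_tmat simp del: tmat.simps split: if_splits)
  have pick: "\<exists>a. a \<in> set tv \<and> idx a \<in> Z \<and> a \<noteq> v" if "Z \<subseteq> verts \<Gamma>" "\<not> card Z \<le> 1" for Z
  proof -
    have "\<not> Z \<subseteq> {idx v}" using that(2) card_mono[of "{idx v}" Z] by auto
    then show ?thesis using that(1) by auto
  qed
  obtain a b where ab: "a \<in> set tv" "idx a \<in> U1" "a \<noteq> v" "b \<in> set tv" "idx b \<in> U2" "b \<noteq> v"
    using pick[OF assms(2)] pick[OF assms(3)] big by blast
  have alive: "get (upd w v False) x \<longleftrightarrow> x \<noteq> v \<and> x \<in> set tv \<and> (idx x \<in> U1 \<or> idx x \<in> U2)" for x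
    by (auto simp: get_upd w(1))
  have "(a, b) \<in> reach (joined te) {y. get (upd w v False) y}"
    by (rule conn_sound(2)[OF v E symp_joined]) (use ab alive in auto)
  then have "idx b \<in> U1" unfolding reach_def
  proof (induction rule: rtrancl_induct)
    case (step y z)
    then have "{idx y, idx z} \<in> edges \<Gamma>" using edge_iff by blast
    then have "idx z \<notin> U2" using step(3) assms(5) by blast
    then show ?case using step(2) alive by blast
  qed (rule ab)
  then show False using ab assms(4) by blast
qed

lemma i4c:
  assumes "i4c_target (Target tv te)" "7 \<le> card (edges \<Gamma>)"
  shows "internally_4_connected \<Gamma>"
proof (rule internally_4_connectedI[OF simple _ assms(2)])
  have t: "has_four tv" "no_tris (tmat te) tv" "all_sub 0 (conn (tmat te) tv) tv (avail tv)"
    "all_sub 1 (conn (tmat te) tv) tv (avail tv)" "all_sub 2 (conn (tmat te) tv) tv (avail tv)"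
    "all_sub 3 (near_or_few (tmat te) tv) tv (avail tv)"
    using assms(1) by (simp_all del: all_sub.simps tmat.simps near_or_few.simps conn.simps no_tris.simps has_four.simps)
  have "card (verts \<Gamma>) = length tv"
    using distinct_card[OF dist] card_image[of idx "set tv"] by (simp add: inj_on_def idx_eq)
  moreover have "connected_graph (delete_verts \<Gamma> U)" if "U \<subseteq> verts \<Gamma>" "card U < 3" for U
  proof -
    have "U \<subseteq> idx ` set tv" using that(1) by simp
    then obtain U' where U': "U' \<subseteq> set tv" "U = idx ` U'" by (rule subset_imageE)
    then have "card U' = card U" using card_image[of idx U'] by (simp add: inj_on_def idx_eq)
    then have "card U' = 0 \<or> card U' = 1 \<or> card U' = 2" using that(2) by linarith
    then show ?thesis using connected_minus t(3-5) U' by blast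
  qed
  ultimately show "k_connected 3 \<Gamma>" using t(1) by (simp add: k_connected_def has_four_length del: target_graph.simps)
next
  have t: "no_tris (tmat te) tv" "all_sub 3 (near_or_few (tmat te) tv) tv (avail tv)"
    using assms(1) by (simp_all del: all_sub.simps tmat.simps near_or_few.simps conn.simps no_tris.simps has_four.simps)
  show "{a, b} \<notin> edges \<Gamma>" if v: "card (nbr \<Gamma> v) = 3" "a \<in> nbr \<Gamma> v" "b \<in> nbr \<Gamma> v" for v a b
  proof
    assume ab: "{a, b} \<in> edges \<Gamma>"
    have "v \<in> verts \<Gamma>" using v(2) simple_graph_edgeD(1)[OF simple] by (auto simp: nbr_def simp del: target_graph.simps)
    then obtain x where x: "x \<in> set tv" "v = idx x" by auto
    obtain a' b' where a: "a = idx a'" "b = idx b'" "joined te x a'" "joined te x b'"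
      using v(2,3) unfolding x(2) nbr_eq by blast
    have "joined te a' b'" using ab edge_iff a by blast
    then have "a' \<noteq> b'" "joined te b' a'" using joinedD symp_joined by (auto simp: symp_def)
    moreover have "length (present (get (tmat te) x)) = 3" using v(1) card_nbr x(2) by simp
    moreover have "no_tri (tmat te) (present (get (tmat te) x))" using t(1) x(1) unfolding no_tris_iff by blast
    ultimately have "get2 (tmat te) a' b' = Non \<or> get2 (tmat te) b' a' = Non"
      using a(3,4) set_present by (intro no_tri_sound) auto
    then show False using \<open>joined te a' b'\<close> \<open>joined te b' a'\<close> unfolding get2_tmat by simp
  qed
  show "card U1 \<le> 1 \<or> card U2 \<le> 1" if "U1 \<subseteq> verts \<Gamma>" "U2 \<subseteq> verts \<Gamma>" "U1 \<inter> U2 = {}"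
    "\<And>a b. a \<in> U1 \<Longrightarrow> b \<in> U2 \<Longrightarrow> {a, b} \<notin> edges \<Gamma>" "card (verts \<Gamma> - U1 - U2) = 3" for U1 U2
    using separation[OF t(2) that] .
qed

end

section \<open>Excluding minors by contraction\<close>

definition fibre :: "'a graph \<Rightarrow> 'a set \<Rightarrow> ('a \<Rightarrow> 'b) \<Rightarrow> ('a \<times> 'a) set" where
  "fibre \<Gamma> U f = {(a, b). a \<in> U \<and> b \<in> U \<and> {a, b} \<in> edges \<Gamma> \<and> f a = f b}\<^sup>*"

text \<open>A minor model in functional form: \<open>f\<close> sends a vertex of \<open>U\<close> to
  the vertex of \<open>\<Delta>\<close> whose branch set contains it, and \<open>fibre\<close>
  expresses connectedness of the branch sets.\<close>

definition model :: "'a graph \<Rightarrow> 'b graph \<Rightarrow> 'a set \<Rightarrow> ('a \<Rightarrow> 'b) \<Rightarrow> bool" where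
  "model \<Gamma> \<Delta> U f \<longleftrightarrow> U \<subseteq> verts \<Gamma> \<and> f ` U = verts \<Delta> \<and>
     (\<forall>x\<in>U. \<forall>y\<in>U. f x = f y \<longrightarrow> (x, y) \<in> fibre \<Gamma> U f) \<and>
     (\<forall>a b. {a, b} \<in> edges \<Delta> \<longrightarrow> (\<exists>x\<in>U. \<exists>y\<in>U. {x, y} \<in> edges \<Gamma> \<and> f x = a \<and> f y = b))"

lemma fibre_sym: "(a, b) \<in> fibre \<Gamma> U f \<Longrightarrow> (b, a) \<in> fibre \<Gamma> U f"
proof -
  have "sym (fibre \<Gamma> U f)" unfolding fibre_def by (intro sym_rtrancl) (auto simp: sym_def insert_commute)
  then show "(a, b) \<in> fibre \<Gamma> U f \<Longrightarrow> (b, a) \<in> fibre \<Gamma> U f" by (auto simp: sym_def)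
qed

lemma fibre_edge: "a \<in> U \<Longrightarrow> b \<in> U \<Longrightarrow> {a, b} \<in> edges \<Gamma> \<Longrightarrow> f a = f b \<Longrightarrow> (a, b) \<in> fibre \<Gamma> U f"
  unfolding fibre_def by blast

lemma fibre_trans: "(a, b) \<in> fibre \<Gamma> U f \<Longrightarrow> (b, c) \<in> fibre \<Gamma> U f \<Longrightarrow> (a, c) \<in> fibre \<Gamma> U f"
  unfolding fibre_def by (rule rtrancl_trans)

lemma fibre_refl: "(a, a) \<in> fibre \<Gamma> U f"
  unfolding fibre_def by simp

lemma fibre_mono:
  assumes "(a, b) \<in> fibre \<Gamma> U f"
    "\<And>x y. x \<in> U \<Longrightarrow> y \<in> U \<Longrightarrow> {x, y} \<in> edges \<Gamma> \<Longrightarrow> f x = f y \<Longrightarrow> (x, y) \<in> fibre \<Gamma>' U' f'"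
  shows "(a, b) \<in> fibre \<Gamma>' U' f'"
  using assms(1) unfolding fibre_def
proof (induction rule: rtrancl_induct)
  case (step y z)
  then show ?case using assms(2)[of y z] unfolding fibre_def by (auto intro: rtrancl_trans)
qed simp

lemma model_mono:
  assumes "model \<Gamma>' \<Delta> U f" "verts \<Gamma>' \<subseteq> verts \<Gamma>" "edges \<Gamma>' \<subseteq> edges \<Gamma>" shows "model \<Gamma> \<Delta> U f"
  unfolding model_def
proof (intro conjI ballI allI impI)
  fix x y assume "x \<in> U" "y \<in> U" "f x = f y"
  then have "(x, y) \<in> fibre \<Gamma>' U f" using assms(1) by (simp add: model_def)
  then show "(x, y) \<in> fibre \<Gamma> U f" by (rule fibre_mono) (use assms(3) in \<open>blast intro: fibre_edge\<close>)
next
  fix a b assume "{a, b} \<in> edges \<Delta>"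
  then obtain x y where "x \<in> U" "y \<in> U" "{x, y} \<in> edges \<Gamma>'" "f x = a" "f y = b"
    using assms(1) unfolding model_def by blast
  then show "\<exists>x\<in>U. \<exists>y\<in>U. {x, y} \<in> edges \<Gamma> \<and> f x = a \<and> f y = b" using assms(3) by blast
qed (use assms in \<open>auto simp: model_def\<close>)

lemma contract_edgeE:
  assumes "simple_graph \<Gamma>" "{u, v} \<in> edges \<Gamma>" "u \<noteq> v" "e \<in> edges (contract_edge \<Gamma> u v)"
  obtains "e \<in> edges \<Gamma>" "v \<notin> e" | w where "e = {u, w}" "w \<noteq> u" "w \<noteq> v" "{v, w} \<in> edges \<Gamma>"
proof -
  let ?r = "\<lambda>x. if x = v then u else x"
  obtain d where d: "d \<in> edges \<Gamma>" "d \<noteq> {u, v}" "e = ?r ` d"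
    using assms(4) by (auto simp: contract_edge_def)
  show ?thesis
  proof (cases "v \<in> d")
    case False
    then have "?r ` d = d" by (auto simp: image_iff)
    then show ?thesis using d False that(1) by simp
  next
    case True
    then obtain w where w: "d = {v, w}" "w \<noteq> v" using simple_graph_edgeE[OF assms(1) d(1)] by metis
    then have "w \<noteq> u" using d(2) by (auto simp: insert_commute)
    then show ?thesis using d w by (intro that(2)[of w]) auto
  qed
qed

lemma minor_step_simple:
  assumes "minor_step \<Gamma> \<Gamma>'" "simple_graph \<Gamma>" shows "simple_graph \<Gamma>'"
  using assms(1)
proof cases
  case (contract u v)
  have "e \<subseteq> verts \<Gamma> - {v} \<and> card e = 2" if "e \<in> edges (contract_edge \<Gamma> u v)" for e
    using assms(2) contract(2,3) that
  proof (rule contract_edgeE)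
    assume "e \<in> edges \<Gamma>" "v \<notin> e"
    then show ?thesis using assms(2) by (auto simp: simple_graph_def)
  next
    fix w assume "e = {u, w}" "w \<noteq> u" "w \<noteq> v" "{v, w} \<in> edges \<Gamma>"
    then show ?thesis using simple_graph_edgeD[OF assms(2)] contract(2,3) by auto
  qed
  then show ?thesis using assms(2) contract(1) by (auto simp: simple_graph_def contract_edge_def)
qed (use assms(2) in \<open>auto simp: simple_graph_def delete_edge_def delete_verts_def\<close>)

text \<open>The contraction is undone by putting \<open>v\<close> into the part of \<open>u\<close>.
  An edge at \<open>u\<close> may stem from one at \<open>v\<close>, and then the edge between
  \<open>u\<close> and \<open>v\<close> repairs the connection inside the part.\<close>

lemma model_contract:
  assumes M: "model (contract_edge \<Gamma> u v) \<Delta> U f" and uv: "{u, v} \<in> edges \<Gamma>" "u \<noteq> v" and sg: "simple_graph \<Gamma>"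
  shows "\<exists>U' f'. model \<Gamma> \<Delta> U' f'"
proof -
  let ?\<Gamma>' = "contract_edge \<Gamma> u v"
  \<comment> \<open>If \<open>u\<close> lies in no part, \<open>v\<close> stays outside all parts as
    well.\<close>
  define U' where "U' = (if u \<in> U then insert v U else U)"
  define f' where "f' = f(v := f u)"
  define r where "r x = (if x = v then u else x)" for x
  have v: "v \<notin> U" using M by (auto simp: model_def contract_edge_def)
  have UU: "U \<subseteq> U'" by (auto simp: U'_def)
  have V: "u \<in> verts \<Gamma>" "v \<in> verts \<Gamma>" using simple_graph_edgeD[OF sg uv(1)] by auto
  have f': "f' x = f x" if "x \<in> U" for x using that v by (auto simp: f'_def)
  have fv: "f' v = f u" by (simp add: f'_def)
  have link: "(u, v) \<in> fibre \<Gamma> U' f'" if "u \<in> U"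
    using that uv v by (intro fibre_edge) (auto simp: U'_def f'_def)
  have edge: "{a, b} \<in> edges \<Gamma> \<or> a = u \<and> {v, b} \<in> edges \<Gamma> \<or> b = u \<and> {a, v} \<in> edges \<Gamma>"
    if "{a, b} \<in> edges ?\<Gamma>'" for a b
    using sg uv that
  proof (rule contract_edgeE)
    fix w assume "{a, b} = {u, w}" "{v, w} \<in> edges \<Gamma>"
    then show ?thesis by (auto simp: doubleton_eq_iff insert_commute)
  qed blast
  have step: "(a, b) \<in> fibre \<Gamma> U' f'" if "a \<in> U" "b \<in> U" "{a, b} \<in> edges ?\<Gamma>'" "f a = f b" for a b
    using edge[OF that(3)]
  proof (elim disjE conjE)
    assume "{a, b} \<in> edges \<Gamma>"
    then show ?thesis using that f' UU by (intro fibre_edge) auto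
  next
    assume "a = u" "{v, b} \<in> edges \<Gamma>"
    then have "(v, b) \<in> fibre \<Gamma> U' f'" using that f' fv by (intro fibre_edge) (auto simp: U'_def)
    then show ?thesis using link that(1) \<open>a = u\<close> fibre_trans by metis
  next
    assume "b = u" "{a, v} \<in> edges \<Gamma>"
    then have "(a, v) \<in> fibre \<Gamma> U' f'" using that f' fv by (intro fibre_edge) (auto simp: U'_def)
    then show ?thesis using fibre_sym[OF link] that(2) \<open>b = u\<close> fibre_trans by metis
  qed
  have r: "r x \<in> U" "(x, r x) \<in> fibre \<Gamma> U' f'" "f (r x) = f' x" if "x \<in> U'" for x
    using that fibre_sym[OF link] f' fv v fibre_refl by (auto simp: r_def U'_def split: if_splits)
  have "model \<Gamma> \<Delta> U' f'"
    unfolding model_def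
  proof (intro conjI ballI allI impI)
    show "U' \<subseteq> verts \<Gamma>" using M V by (auto simp: model_def U'_def contract_edge_def)
    have "f' ` U' = f ` U" using r(1,3) f' UU by force
    then show "f' ` U' = verts \<Delta>" using M by (simp add: model_def)
    fix x y assume xy: "x \<in> U'" "y \<in> U'" "f' x = f' y"
    then have "(r x, r y) \<in> fibre ?\<Gamma>' U f" using M r(1,3) by (simp add: model_def)
    then have "(r x, r y) \<in> fibre \<Gamma> U' f'" by (rule fibre_mono) (rule step)
    then show "(x, y) \<in> fibre \<Gamma> U' f'" using r(2) xy(1,2) fibre_sym fibre_trans by metis
  next
    fix a b assume "{a, b} \<in> edges \<Delta>"
    then obtain x y where xy: "x \<in> U" "y \<in> U" "{x, y} \<in> edges ?\<Gamma>'" "f x = a" "f y = b"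
      using M unfolding model_def by blast
    show "\<exists>x\<in>U'. \<exists>y\<in>U'. {x, y} \<in> edges \<Gamma> \<and> f' x = a \<and> f' y = b"
      using edge[OF xy(3)]
    proof (elim disjE conjE)
      assume "{x, y} \<in> edges \<Gamma>" then show ?thesis using xy f' UU by blast
    next
      assume "x = u" "{v, y} \<in> edges \<Gamma>"
      moreover have "v \<in> U'" using xy(1) \<open>x = u\<close> by (simp add: U'_def)
      ultimately show ?thesis using xy f' fv UU by blast
    next
      assume "y = u" "{x, v} \<in> edges \<Gamma>"
      moreover have "v \<in> U'" using xy(2) \<open>y = u\<close> by (simp add: U'_def)
      ultimately show ?thesis using xy f' fv UU by blast
    qed
  qed
  then show ?thesis by blast
qed

text \<open>Induction backwards along the operations: the final isomorphism is a model with
  singleton parts, undoing a deletion only enlarges the host graph, and contractions are undone by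
  \<open>model_contract\<close>.\<close>

lemma minor_model:
  assumes "has_minor \<Gamma> \<Delta>" "simple_graph \<Gamma>" shows "\<exists>U f. model \<Gamma> \<Delta> U f"
proof -
  obtain \<Gamma>' where \<Gamma>': "minor_step\<^sup>*\<^sup>* \<Gamma> \<Gamma>'" "\<Gamma>' \<cong>\<^sub>G \<Delta>" using assms(1) unfolding has_minor_def by blast
  show ?thesis using \<Gamma>'(1) assms(2)
  proof (induction rule: converse_rtranclp_induct)
    case base
    obtain f where f: "bij_betw f (verts \<Gamma>') (verts \<Delta>)" "edges \<Delta> = (`) f ` edges \<Gamma>'"
      using \<Gamma>'(2) unfolding graph_iso_def by blast
    have "model \<Gamma>' \<Delta> (verts \<Gamma>') f"
      unfolding model_def
    proof (intro conjI ballI allI impI)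
      fix x y assume "x \<in> verts \<Gamma>'" "y \<in> verts \<Gamma>'" "f x = f y"
      then have "x = y" using f(1) by (auto simp: bij_betw_def inj_on_def)
      then show "(x, y) \<in> fibre \<Gamma>' (verts \<Gamma>') f" by (simp add: fibre_refl)
    next
      fix a b assume "{a, b} \<in> edges \<Delta>"
      then obtain e where e: "e \<in> edges \<Gamma>'" "{a, b} = f ` e" using f(2) by blast
      then obtain x where x: "x \<in> e" "f x = a" by (metis imageE insertI1)
      obtain y where y: "e = {x, y}" using simple_graph_edgeE[OF base e(1) x(1)] by metis
      have "f y = b" using e(2) x(2) unfolding y by (auto simp: doubleton_eq_iff)
      then show "\<exists>x\<in>verts \<Gamma>'. \<exists>y\<in>verts \<Gamma>'. {x, y} \<in> edges \<Gamma>' \<and> f x = a \<and> f y = b"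
        using e(1) x(2) y simple_graph_edgeD[OF base, of x y] by auto
    qed (use f(1) in \<open>auto simp: bij_betw_def\<close>)
    then show ?case by blast
  next
    case (step y z)
    then obtain U f where M: "model z \<Delta> U f" using minor_step_simple by blast
    show ?case using step(1)
    proof cases
      case (del_edge e)
      then show ?thesis using model_mono[OF M] by (auto simp: delete_edge_def)
    next
      case (del_vert v)
      then show ?thesis using model_mono[OF M] by (auto simp: delete_verts_def)
    next
      case (contract u v)
      then show ?thesis using model_contract M step.prems by metis
    qed
  qed
qed

lemma spanning_model:
  assumes "model \<Gamma> \<Delta> U f" "simple_graph \<Gamma>" "connected_graph \<Gamma>" "verts \<Delta> \<noteq> {}"
  shows "\<exists>f. model \<Gamma> \<Delta> (verts \<Gamma>) f"
  using assms(1)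
proof (induction "card (verts \<Gamma> - U)" arbitrary: U f rule: less_induct)
  case less
  have fin: "finite (verts \<Gamma>)" using assms(2) by (simp add: simple_graph_def)
  have U: "U \<subseteq> verts \<Gamma>" "U \<noteq> {}" using less.prems assms(4) by (auto simp: model_def)
  show ?case
  proof (cases "verts \<Gamma> \<subseteq> U")
    case True
    then show ?thesis using less.prems U by (metis subset_antisym)
  next
    case False
    then obtain u w where uw: "u \<in> U" "w \<in> verts \<Gamma>" "w \<notin> U" using U by blast
    have "(u, w) \<in> {(x, y). {x, y} \<in> edges \<Gamma>}\<^sup>*" using connected_graphD[OF assms(3)] uw U by blast
    then have "w \<notin> U \<longrightarrow> (\<exists>x y. x \<in> U \<and> y \<notin> U \<and> {x, y} \<in> edges \<Gamma>)"
    proof (induction rule: rtrancl_induct)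
      case (step y z)
      then show ?case by (cases "y \<in> U") auto
    qed (use uw in simp)
    then obtain x y where xy: "x \<in> U" "y \<notin> U" "{x, y} \<in> edges \<Gamma>" using uw by blast
    let ?U = "insert y U" and ?f = "f(y := f x)"
    have y: "y \<in> verts \<Gamma>" using simple_graph_edgeD[OF assms(2) xy(3)] by simp
    have link: "(x, y) \<in> fibre \<Gamma> ?U ?f" using xy by (intro fibre_edge) auto
    have old: "(a, b) \<in> fibre \<Gamma> ?U ?f" if "a \<in> U" "b \<in> U" "f a = f b" for a b
    proof -
      have "(a, b) \<in> fibre \<Gamma> U f" using that less.prems by (simp add: model_def)
      then show ?thesis by (rule fibre_mono) (use xy(2) in \<open>auto intro!: fibre_edge\<close>)
    qed
    have "model \<Gamma> \<Delta> ?U ?f"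
      unfolding model_def
    proof (intro conjI ballI allI impI)
      fix a b assume ab: "a \<in> ?U" "b \<in> ?U" "?f a = ?f b"
      consider "a = b" | "a = y" "b \<in> U" "b \<noteq> y" | "b = y" "a \<in> U" "a \<noteq> y" | "a \<in> U" "b \<in> U" "a \<noteq> y" "b \<noteq> y"
        using ab by blast
      then show "(a, b) \<in> fibre \<Gamma> ?U ?f"
      proof cases
        case 2
        then have "(x, b) \<in> fibre \<Gamma> ?U ?f" using old xy(1) ab by auto
        then show ?thesis using fibre_sym[OF link] 2(1) fibre_trans by metis
      next
        case 3
        then have "(a, x) \<in> fibre \<Gamma> ?U ?f" using old xy(1) ab by auto
        then show ?thesis using link 3(1) fibre_trans by metis
      qed (use old ab in \<open>auto simp: fibre_refl\<close>)
    next
      fix a b assume "{a, b} \<in> edges \<Delta>"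
      then obtain c d where "c \<in> U" "d \<in> U" "{c, d} \<in> edges \<Gamma>" "f c = a" "f d = b"
        using less.prems unfolding model_def by blast
      then show "\<exists>x\<in>?U. \<exists>y\<in>?U. {x, y} \<in> edges \<Gamma> \<and> ?f x = a \<and> ?f y = b"
        using xy(2) by (metis fun_upd_other insertI2)
    next
      show "?f ` ?U = verts \<Delta>" using less.prems xy(1,2) by (auto simp: model_def)
      show "?U \<subseteq> verts \<Gamma>" using U y by simp
    qed
    moreover have "card (verts \<Gamma> - ?U) < card (verts \<Gamma> - U)"
      using y xy(2) fin by (intro psubset_card_mono) auto
    ultimately show ?thesis using less.hyps by blast
  qed
qed

section \<open>Enumeration of quotients\<close>

fun subst1 :: "bool \<Rightarrow> vx \<Rightarrow> vx \<Rightarrow> vx" where "subst1 True a x = a" | "subst1 False a x = x"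

fun subst :: "vx \<Rightarrow> vx \<Rightarrow> vx \<Rightarrow> vx" where "subst a b x = subst1 (x = b) a x"

fun merge :: "vx \<Rightarrow> vx \<Rightarrow> vx vec \<Rightarrow> vx vec" where "merge a b c = mapv (subst a b) c"

text \<open>A model is determined by the set of edges inside its parts, so it suffices to decide for every edge
  in turn whether it is contracted: \<open>c\<close> maps each vertex to a representative of its part so far, and
  \<open>k\<close> contractions remain.\<close>

fun no_model :: "(vx vec \<Rightarrow> bool) \<Rightarrow> nat \<Rightarrow> (vx \<times> vx) list \<Rightarrow> vx vec \<Rightarrow> bool"
  and no_model1 :: "bool \<Rightarrow> (vx vec \<Rightarrow> bool) \<Rightarrow> nat \<Rightarrow> vx \<Rightarrow> vx \<Rightarrow> (vx \<times> vx) list \<Rightarrow> vx vec \<Rightarrow> bool" where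
  "no_model t 0 es c = t c"
| "no_model t (Suc k) [] c = True"
| "no_model t (Suc k) ((u, v) # es) c = no_model1 (get c u = get c v) t k (get c u) (get c v) es c"
| "no_model1 True t k a b es c = no_model t (Suc k) es c"
| "no_model1 False t k a b es c = (no_model t k es (merge a b c) \<and> no_model t (Suc k) es c)"

text \<open>Adjacency of the classes of \<open>c\<close>, recorded at their representatives:
  \<open>Non\<close> between two representatives certifies that no edge joins their classes.\<close>

fun qmat :: "(vx \<times> vx) list \<Rightarrow> vx vec \<Rightarrow> mat" where
  "qmat [] c = const_vec (const_vec Non)"
| "qmat ((x, y) # l) c = set2 (qmat l c) (get c x) (get c y) Edge"

fun reps :: "vx list \<Rightarrow> vx vec \<Rightarrow> vx list" where
  "reps [] c = []" | "reps (x # l) c = if_alive (get c x = x) x (reps l c)"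

fun gap :: "mat \<Rightarrow> vx \<Rightarrow> vx list \<Rightarrow> bool" where
  "gap N x [] = False" | "gap N x (y # l) = (is_mark Non (get2 N x y) \<or> gap N x l)"

fun gaps :: "mat \<Rightarrow> vx list \<Rightarrow> bool" where
  "gaps N [] = False" | "gaps N (x # l) = (gap N x l \<or> gaps N l)"

fun cross_gap :: "mat \<Rightarrow> vx list \<Rightarrow> vx list \<Rightarrow> bool" where
  "cross_gap N [] m = False" | "cross_gap N (x # l) m = (gap N x m \<or> cross_gap N l m)"

fun three :: "vx list \<Rightarrow> bool" where
  "three [] = False" | "three [x] = False" | "three [x, y] = False" | "three [x, y, z] = True"
| "three (x # y # z # v # l) = False"

fun leaf :: "bool \<Rightarrow> bool \<Rightarrow> mat \<Rightarrow> vx list \<Rightarrow> vx list \<Rightarrow> bool" where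
  "leaf True True N l m = cross_gap N l m" | "leaf True False N l m = True" | "leaf False b N l m = True"

text \<open>Tries all distributions of the representatives on two sides. Distributions other than
  three and three pass in \<open>leaf\<close>, as they are no sides of a K33.\<close>

fun splits :: "mat \<Rightarrow> vx list \<Rightarrow> vx list \<Rightarrow> vx list \<Rightarrow> bool" where
  "splits N [] l m = leaf (three l) (three m) N l m"
| "splits N (x # r) l m = (splits N r (x # l) m \<and> splits N r l (x # m))"

fun no_K5 :: "(vx \<times> vx) list \<Rightarrow> vx list \<Rightarrow> vx vec \<Rightarrow> bool" where
  "no_K5 te tv c = gaps (qmat te c) (reps tv c)"

fun no_K33 :: "(vx \<times> vx) list \<Rightarrow> vx list \<Rightarrow> vx vec \<Rightarrow> bool" where
  "no_K33 te tv c = splits (qmat te c) (reps tv c) [] []"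

fun planar5 :: "target \<Rightarrow> nat \<Rightarrow> bool" where
  "planar5 (Target tv te) k = no_model (no_K5 te tv) k te (V A B C D E F G H I J)"

fun planar33 :: "target \<Rightarrow> nat \<Rightarrow> bool" where
  "planar33 (Target tv te) k = no_model (no_K33 te tv) k te (V A B C D E F G H I J)"

lemmas planar_rules = subst1.simps subst.simps merge.simps no_model.simps no_model1.simps qmat.simps
  reps.simps gap.simps gaps.simps cross_gap.simps three.simps leaf.simps splits.simps no_K5.simps no_K33.simps
  planar5.simps planar33.simps

lemma subst_eq: "subst a b x = (if x = b then a else x)"
  by (cases "x = b") auto

lemma get_merge: "get (merge a b c) x = (if get c x = b then a else get c x)"
  by (simp add: get_mapv subst_eq del: subst.simps)

lemma get2_qmat:
  "get2 (qmat te c) x y =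
     (if \<exists>(u, v)\<in>set te. x = get c u \<and> y = get c v \<or> x = get c v \<and> y = get c u then Edge else Non)"
proof (induction te)
  case Nil
  show ?case by (simp add: get2_def get_const_vec del: const_vec.simps)
next
  case (Cons e l)
  obtain u v where e: "e = (u, v)" by fastforce
  show ?case unfolding e qmat.simps get2_set2 Cons if_if_or list.set
    by (rule if_cong[OF _ refl refl]) auto
qed

lemma mem_reps: "x \<in> set (reps l c) \<longleftrightarrow> x \<in> set l \<and> get c x = x"
proof (induction l)
  case (Cons y l)
  then show ?case by (cases "get c y = y") auto
qed simp

lemma distinct_reps: "distinct l \<Longrightarrow> distinct (reps l c)"
proof (induction l)
  case (Cons y l)
  then show ?case by (cases "get c y = y") (auto simp: mem_reps)
qed simp

lemma gap_iff: "gap N x l \<longleftrightarrow> (\<exists>y\<in>set l. get2 N x y = Non)"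
  by (induction l) (auto simp: is_mark_iff)

lemma gaps_sound: "gaps N l \<Longrightarrow> distinct l \<Longrightarrow> \<exists>x\<in>set l. \<exists>y\<in>set l. x \<noteq> y \<and> get2 N x y = Non"
proof (induction l)
  case (Cons x l)
  show ?case
  proof (cases "gap N x l")
    case True
    then obtain y where "y \<in> set l" "get2 N x y = Non" unfolding gap_iff by blast
    then show ?thesis using Cons.prems(2) by (intro bexI[of _ x] bexI[of _ y]) auto
  next
    case False
    then show ?thesis using Cons by simp blast
  qed
qed simp

lemma cross_gap_iff: "cross_gap N l m \<longleftrightarrow> (\<exists>x\<in>set l. \<exists>y\<in>set m. get2 N x y = Non)"
  by (induction l) (auto simp: gap_iff)

lemma three_iff: "three l \<longleftrightarrow> length l = 3"
  by (induction l rule: three.induct) auto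

text \<open>The two sides of a \<open>K\<^bsub>3,3\<^esub>\<close>-model are \<open>q\<close> and its complement.\<close>

lemma splits_sound:
  "splits N r l m \<Longrightarrow> \<exists>l' m'. set l' = set l \<union> {x\<in>set r. q x} \<and> set m' = set m \<union> {x\<in>set r. \<not> q x} \<and>
    length l' = length l + length (filter q r) \<and> length m' = length m + length (filter (\<lambda>x. \<not> q x) r) \<and>
    leaf (three l') (three m') N l' m'"
proof (induction r arbitrary: l m)
  case Nil
  then show ?case by (intro exI[of _ l] exI[of _ m]) auto
next
  case (Cons x r)
  show ?case
  proof (cases "q x")
    case True
    have "splits N r (x # l) m" using Cons.prems by simp
    from Cons.IH[OF this] obtain l' m' where
      lm: "set l' = set (x # l) \<union> {x\<in>set r. q x}" "set m' = set m \<union> {x\<in>set r. \<not> q x}"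
      "length l' = length (x # l) + length (filter q r)" "length m' = length m + length (filter (\<lambda>x. \<not> q x) r)"
      "leaf (three l') (three m') N l' m'" by (elim exE conjE) (rule that)
    show ?thesis
    proof (intro exI conjI)
      show "set l' = set l \<union> {y \<in> set (x # r). q y}" unfolding lm(1) using True by auto
      show "set m' = set m \<union> {y \<in> set (x # r). \<not> q y}" unfolding lm(2) using True by auto
    qed (use lm(3-5) True in simp_all)
  next
    case False
    have "splits N r l (x # m)" using Cons.prems by simp
    from Cons.IH[OF this] obtain l' m' where
      lm: "set l' = set l \<union> {x\<in>set r. q x}" "set m' = set (x # m) \<union> {x\<in>set r. \<not> q x}"
      "length l' = length l + length (filter q r)" "length m' = length (x # m) + length (filter (\<lambda>x. \<not> q x) r)"
      "leaf (three l') (three m') N l' m'" by (elim exE conjE) (rule that)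
    show ?thesis
    proof (intro exI conjI)
      show "set l' = set l \<union> {y \<in> set (x # r). q y}" unfolding lm(1) using False by auto
      show "set m' = set m \<union> {y \<in> set (x # r). \<not> q y}" unfolding lm(2) using False by auto
    qed (use lm(3-5) False in simp_all)
  qed
qed

section \<open>Following a given model through the enumeration\<close>

locale target_model = checked_target +
  fixes \<Delta> :: "'b graph" and g :: "vx \<Rightarrow> 'b"
  assumes onto: "g ` set tv = verts \<Delta>"
    and fibres: "\<And>x y. x \<in> set tv \<Longrightarrow> y \<in> set tv \<Longrightarrow> g x = g y \<Longrightarrow>
      (x, y) \<in> {(a, b). joined te a b \<and> g a = g b}\<^sup>*"
    and covers: "\<And>a b. {a, b} \<in> edges \<Delta> \<Longrightarrow> \<exists>x y. joined te x y \<and> g x = a \<and> g y = b"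
begin

text \<open>\<open>c\<close> is an idempotent choice of representatives whose classes lie within the
  parts of \<open>g\<close>.\<close>

definition refines :: "vx vec \<Rightarrow> bool" where
  "refines c \<longleftrightarrow> (\<forall>x\<in>set tv. get c x \<in> set tv \<and> get c (get c x) = get c x \<and> g (get c x) = g x)"

definition exact :: "vx vec \<Rightarrow> bool" where
  "exact c \<longleftrightarrow> refines c \<and> (\<forall>x\<in>set tv. \<forall>y\<in>set tv. g x = g y \<longrightarrow> get c x = get c y)"

lemma refines_image: "refines c \<Longrightarrow> g ` (get c ` set tv) = verts \<Delta>"
  unfolding refines_def onto[symmetric] image_image by (rule image_cong[OF refl]) blast

lemma inj_exact:
  assumes "refines c" "inj_on g (get c ` set tv)" shows "exact c"
  unfolding exact_def
proof (intro conjI ballI impI)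
  fix x y assume "x \<in> set tv" "y \<in> set tv" "g x = g y"
  then have "g (get c x) = g (get c y)" using assms(1) by (simp add: refines_def)
  then show "get c x = get c y" using assms(2) \<open>x \<in> set tv\<close> \<open>y \<in> set tv\<close> by (simp add: inj_on_def)
qed (rule assms(1))

text \<open>The branch that contracts exactly edges inside parts of \<open>g\<close> is followed.
  Invariants: there are \<open>k\<close> classes too many, and every edge already treated that lies
  inside a part has both ends in one class. At \<open>k = 0\<close> the classes are the parts, which
  the leaf test excludes. If the edges run out earlier, connectedness has already collapsed every
  part, contradicting \<open>k > 0\<close>.\<close>

lemma no_model_sound:
  assumes t: "\<And>c. t c \<Longrightarrow> \<not> exact c"
  shows "refines c \<Longrightarrow> card (get c ` set tv) = card (verts \<Delta>) + k \<Longrightarrow> set es \<subseteq> set te \<Longrightarrow>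
    (\<And>u v. (u, v) \<in> set te - set es \<Longrightarrow> g u = g v \<Longrightarrow> get c u = get c v) \<Longrightarrow> \<not> no_model t k es c"
proof (induction "length es" arbitrary: k es c rule: less_induct)
  case less
  have img: "card (g ` (get c ` set tv)) = card (verts \<Delta>)" using refines_image[OF less.prems(1)] by simp
  show ?case
  proof (cases k)
    case 0
    then have "inj_on g (get c ` set tv)" using less.prems(2) img by (intro eq_card_imp_inj_on) auto
    then have "exact c" using inj_exact less.prems(1) by blast
    then show ?thesis using t 0 by auto
  next
    case (Suc k')
    show ?thesis
    proof (cases es)
      case Nil
      have adj: "get c x = get c y" if "joined te x y" "g x = g y" for x y
        using less.prems(4)[of x y] less.prems(4)[of y x] that Nil by (auto simp: joined_def)
      have "get c x = get c y" if "(x, y) \<in> {(a, b). joined te a b \<and> g a = g b}\<^sup>*" for x y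
        using that by (induction rule: rtrancl_induct) (use adj in auto)
      then have eq: "get c x = get c y" if "x \<in> set tv" "y \<in> set tv" "g x = g y" for x y
        using fibres[OF that] by blast
      have "inj_on g (get c ` set tv)"
      proof (rule inj_onI, elim imageE)
        fix a b x y assume "a = get c x" "b = get c y" "x \<in> set tv" "y \<in> set tv" "g a = g b"
        then show "a = b" using eq[of x y] less.prems(1) by (simp add: refines_def)
      qed
      then have "card (get c ` set tv) = card (verts \<Delta>)" using img card_image by metis
      then show ?thesis using less.prems(2) Suc by simp
    next
      case (Cons e es')
      obtain u v where e: "e = (u, v)" by fastforce
      have uv: "u \<in> set tv" "v \<in> set tv" using less.prems(3) joinedD[of u v] unfolding Cons e joined_def by auto
      have skip: "\<not> no_model t k es' c" if "g u = g v \<longrightarrow> get c u = get c v"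
      proof (rule less.hyps[OF _ less.prems(1,2)])
        show "get c x = get c y" if "(x, y) \<in> set te - set es'" "g x = g y" for x y
          using less.prems(4)[of x y] that \<open>g u = g v \<longrightarrow> get c u = get c v\<close> Cons e by auto
      qed (use less.prems(3) Cons in auto)
      show ?thesis
      proof (cases "get c u = get c v")
        case True
        then show ?thesis using skip Suc Cons e by simp
      next
        case False
        let ?a = "get c u" and ?b = "get c v"
        let ?c = "merge ?a ?b c"
        show ?thesis
        proof (cases "g u = g v")
          case True
          have c: "get c x \<in> set tv" "get c (get c x) = get c x" "g (get c x) = g x" if "x \<in> set tv" for x
            using less.prems(1) that by (auto simp: refines_def)
          have "refines ?c"
            unfolding refines_def
          proof
            fix x assume x: "x \<in> set tv"
            show "get ?c x \<in> set tv \<and> get ?c (get ?c x) = get ?c x \<and> g (get ?c x) = g x"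
            proof (cases "get c x = ?b")
              case b: True
              have "g x = g u" using c(3)[OF x] c(3)[OF uv(2)] b True by simp
              then show ?thesis unfolding get_merge using b c[OF uv(1)] False by simp
            next
              case b: False
              then show ?thesis unfolding get_merge using c[OF x] by simp
            qed
          qed
          \<comment> \<open>Merging retires exactly the representative \<open>?b\<close>, so the
            surplus drops by one.\<close>
          moreover have "card (get ?c ` set tv) = card (verts \<Delta>) + k'"
          proof -
            have "get ?c ` set tv = get c ` set tv - {?b}"
              using uv False unfolding get_merge image_def by auto
            then show ?thesis using less.prems(2) Suc uv by simp
          qed
          moreover have "get ?c x = get ?c y" if "(x, y) \<in> set te - set es'" "g x = g y" for x y
          proof (cases "(x, y) = (u, v)")
            case True
            then show ?thesis using False unfolding get_merge by simp
          next
            case False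
            then have "get c x = get c y" using less.prems(4)[of x y] that Cons e by auto
            then show ?thesis unfolding get_merge by simp
          qed
          ultimately have "\<not> no_model t k' es' ?c"
            using less.hyps[of es' ?c k'] less.prems(3) Cons by auto
          then show ?thesis using False Suc Cons e by simp
        next
          case neq: False
          then show ?thesis using skip Suc Cons e False by simp
        qed
      qed
    qed
  qed
qed

lemma refines_id: "refines (V A B C D E F G H I J)" and get_id: "get (V A B C D E F G H I J) x = x"
proof -
  show get_id: "get (V A B C D E F G H I J) x = x" for x by (cases x) auto
  show "refines (V A B C D E F G H I J)" by (simp add: refines_def get_id)
qed

lemma exact_edge:
  assumes "exact c" "x \<in> set (reps tv c)" "y \<in> set (reps tv c)" "{g x, g y} \<in> edges \<Delta>"
  shows "get2 (qmat te c) x y = Edge"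
proof -
  obtain u v where uv: "joined te u v" "g u = g x" "g v = g y" using covers[OF assms(4)] by blast
  have xy: "x \<in> set tv" "get c x = x" "y \<in> set tv" "get c y = y" using assms(2,3) by (simp_all add: mem_reps)
  have "u \<in> set tv" "v \<in> set tv" using joinedD[OF uv(1)] by simp_all
  then have "get c u = x" "get c v = y"
    using assms(1) uv(2,3) xy unfolding exact_def by metis+
  then have "\<exists>(a, b)\<in>set te. x = get c a \<and> y = get c b \<or> x = get c b \<and> y = get c a"
    using uv(1) unfolding joined_def by blast
  then show ?thesis by (simp only: get2_qmat if_True)
qed

lemma exact_reps:
  assumes "exact c" shows "bij_betw g (set (reps tv c)) (verts \<Delta>)"
  unfolding bij_betw_def
proof
  show "inj_on g (set (reps tv c))"
  proof (rule inj_onI)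
    fix x y assume xy: "x \<in> set (reps tv c)" "y \<in> set (reps tv c)" "g x = g y"
    then have "get c x = get c y" using assms unfolding exact_def mem_reps by blast
    then show "x = y" using xy(1,2) by (simp add: mem_reps)
  qed
  have "get c x \<in> set (reps tv c)" "g (get c x) = g x" if "x \<in> set tv" for x
    using assms that unfolding mem_reps exact_def refines_def by blast+
  then have "g ` set tv \<subseteq> g ` set (reps tv c)" by (metis image_eqI image_subsetI)
  moreover have "set (reps tv c) \<subseteq> set tv" using mem_reps by blast
  ultimately show "g ` set (reps tv c) = verts \<Delta>" unfolding onto[symmetric] by blast
qed

end

lemma (in checked_target) spanning_target_model:
  fixes \<Delta> :: "'b graph"
  assumes "has_minor \<Gamma> \<Delta>" "connected_graph \<Gamma>" "verts \<Delta> \<noteq> {}"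
  shows "\<exists>g. target_model tv te \<Delta> g"
proof -
  obtain f where f: "model \<Gamma> \<Delta> (verts \<Gamma>) f"
    using minor_model[OF assms(1) simple] spanning_model[OF _ simple assms(2,3)] by blast
  let ?g = "\<lambda>x. f (idx x)"
  have V: "verts \<Gamma> = idx ` set tv" by simp
  have "target_model tv te \<Delta> ?g"
  proof
    show "?g ` set tv = verts \<Delta>" using f unfolding model_def V by (simp add: image_image)
    fix x y assume xy: "x \<in> set tv" "y \<in> set tv" "?g x = ?g y"
    then have "(idx x, idx y) \<in> fibre \<Gamma> (verts \<Gamma>) f" using f unfolding model_def V by blast
    then have "\<forall>z. idx z = idx y \<longrightarrow> (x, z) \<in> {(a, b). joined te a b \<and> ?g a = ?g b}\<^sup>*"
      unfolding fibre_def
    proof (induction rule: rtrancl_induct)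
      case base
      then show ?case by (simp add: idx_eq)
    next
      case (step b c)
      obtain b' c' where "b = idx b'" "c = idx c'" using step(2) V by blast
      then show ?case using step(2,3) edge_iff
        by (auto simp: idx_eq simp del: target_graph.simps intro: rtrancl_into_rtrancl)
    qed
    then show "(x, y) \<in> {(a, b). joined te a b \<and> ?g a = ?g b}\<^sup>*" by simp
  next
    fix a b assume "{a, b} \<in> edges \<Delta>"
    then obtain x y where "x \<in> idx ` set tv" "y \<in> idx ` set tv" "{x, y} \<in> edges \<Gamma>" "f x = a" "f y = b"
      using f unfolding model_def V by blast
    then show "\<exists>x y. joined te x y \<and> ?g x = a \<and> ?g y = b" using edge_iff by (metis imageE)
  qed
  then show ?thesis by blast
qed

text \<open>In K5 any two distinct parts are joined, so one non-adjacent pair of representatives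
  refutes a quotient.\<close>

lemma (in checked_target) not_K5_minor:
  assumes "planar5 (Target tv te) k" "length tv = 5 + k" "connected_graph \<Gamma>"
  shows "\<not> has_minor \<Gamma> (complete_graph 5)"
proof
  assume "has_minor \<Gamma> (complete_graph 5)"
  then obtain g where "target_model tv te (complete_graph 5) g"
    using spanning_target_model assms(3) by (fastforce simp: complete_graph_def)
  then interpret target_model tv te "complete_graph 5" g .
  have t: "\<not> exact c" if nk: "no_K5 te tv c" for c
  proof
    assume c: "exact c"
    obtain x y where xy: "x \<in> set (reps tv c)" "y \<in> set (reps tv c)" "x \<noteq> y" "get2 (qmat te c) x y = Non"
      using gaps_sound[OF _ distinct_reps[OF dist], of "qmat te c" c] nk by auto
    have "g x \<noteq> g y" "g x \<in> verts (complete_graph 5)" "g y \<in> verts (complete_graph 5)"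
      using exact_reps[OF c] xy by (auto simp: bij_betw_def inj_on_def)
    then have "{g x, g y} \<in> edges (complete_graph 5)" by (auto simp: complete_graph_def)
    then show False using exact_edge[OF c xy(1,2)] xy(4) by simp
  qed
  have "card (get (V A B C D E F G H I J) ` set tv) = 5 + k"
    using assms(2) distinct_card[OF dist] by (simp add: get_id)
  then show False
    using no_model_sound[where t = "no_K5 te tv" and k = k and es = te, OF t refines_id] assms(1)
    by (auto simp: complete_graph_def simp del: no_K5.simps)
qed

text \<open>A model splits the representatives into two triples according to \<open>g x < 3\<close>;
  the test has found a missing edge across every such split.\<close>

lemma (in checked_target) not_K33_minor:
  assumes "planar33 (Target tv te) k" "length tv = 6 + k" "connected_graph \<Gamma>"
  shows "\<not> has_minor \<Gamma> (complete_bipartite 3 3)"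
proof
  let ?\<Delta> = "complete_bipartite 3 3"
  assume "has_minor \<Gamma> ?\<Delta>"
  then obtain g where "target_model tv te ?\<Delta> g"
    using spanning_target_model assms(3) by (fastforce simp: complete_bipartite_def)
  then interpret target_model tv te ?\<Delta> g .
  have V: "verts ?\<Delta> = {..<6}" by (simp add: complete_bipartite_def)
  have t: "\<not> exact c" if "no_K33 te tv c" for c
  proof
    assume c: "exact c"
    let ?r = "reps tv c"
    have bij: "bij_betw g (set ?r) {..<6}" using exact_reps[OF c] V by simp
    have len: "length (filter q ?r) = card {x \<in> set ?r. q x}" for q
      using distinct_card[OF distinct_filter[OF distinct_reps[OF dist]], of q c] by simp
    have c1: "card {x \<in> set ?r. P (g x)} = card {n. n < 6 \<and> P n}" for P
    proof -
      have "g ` {x \<in> set ?r. P (g x)} = {n. n < 6 \<and> P n}"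
        using bij by (auto simp: bij_betw_def image_iff)
      moreover have "inj_on g {x \<in> set ?r. P (g x)}" using bij by (auto simp: bij_betw_def inj_on_def)
      ultimately show ?thesis using card_image by metis
    qed
    have "{n::nat. n < 6 \<and> n < 3} = {..<3}" "{n::nat. n < 6 \<and> \<not> n < 3} = {3..<6}" by auto
    then have n: "length (filter (\<lambda>x. g x < 3) ?r) = 3" "length (filter (\<lambda>x. \<not> g x < 3) ?r) = 3"
      unfolding len using c1[of "\<lambda>n. n < 3"] c1[of "\<lambda>n. \<not> n < 3"] by simp_all
    have "splits (qmat te c) ?r [] []" using that by simp
    then obtain l m where lm: "set l = {x\<in>set ?r. g x < 3}" "set m = {x\<in>set ?r. \<not> g x < 3}"
      "length l = 3" "length m = 3" "leaf (three l) (three m) (qmat te c) l m"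
      using splits_sound[of "qmat te c" ?r "[]" "[]" "\<lambda>x. g x < 3"] n by auto
    then have "cross_gap (qmat te c) l m" by (simp add: three_iff)
    then obtain x y where xy: "x \<in> set l" "y \<in> set m" "get2 (qmat te c) x y = Non"
      by (auto simp: cross_gap_iff)
    have "g y < 6" using xy(2) lm(2) bij by (auto simp: bij_betw_def)
    then have "{g x, g y} \<in> edges ?\<Delta>" using xy lm by (auto simp: complete_bipartite_def)
    then show False using exact_edge[OF c, of x y] xy lm by simp
  qed
  have "card (get (V A B C D E F G H I J) ` set tv) = 6 + k"
    using assms(2) distinct_card[OF dist] by (simp add: get_id)
  then show False
    using no_model_sound[where t = "no_K33 te tv" and k = k and es = te, OF t refines_id] assms(1) V
    by (auto simp del: no_K33.simps)
qed

section \<open>The graphs of the classification\<close>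

text \<open>\<open>tV8\<close> is the Wagner graph; \<open>tP7\<close> and \<open>tPrism\<close> (the pentagonal prism) are planar with 15 edges.\<close>

definition tK4 :: target where
  "tK4 = Target [A,B,C,D] [(A,B),(A,C),(A,D),(B,C),(B,D),(C,D)]"

definition tK33 :: target where
  "tK33 = Target [A,B,C,D,E,F] [(A,D),(A,E),(A,F),(B,D),(B,E),(B,F),(C,D),(C,E),(C,F)]"

definition tK5 :: target where
  "tK5 = Target [A,B,C,D,E] [(A,B),(A,C),(A,D),(A,E),(B,C),(B,D),(B,E),(C,D),(C,E),(D,E)]"

definition tO :: target where
  "tO = Target [A,B,C,D,E,F] [(A,B),(A,C),(A,E),(A,F),(B,C),(B,D),(B,F),(C,D),(C,E),(D,E),(D,F),(E,F)]"

definition tQ3 :: target where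
  "tQ3 = Target [A,B,C,D,E,F,G,H] [(A,B),(B,C),(C,D),(A,D),(E,F),(F,G),(G,H),(E,H),(A,E),(B,F),(C,G),(D,H)]"

definition tV8 :: target where
  "tV8 = Target [A,B,C,D,E,F,G,H] [(A,B),(B,C),(C,D),(D,E),(E,F),(F,G),(G,H),(A,H),(A,E),(B,F),(C,G),(D,H)]"

definition tH1 :: target where
  "tH1 = Target [A,B,C,D,E,F] [(A,B),(A,C),(A,E),(A,F),(B,C),(B,D),(B,E),(B,F),(C,D),(C,E),(D,E),(D,F),(E,F)]"

definition tH2 :: target where
  "tH2 = Target [A,B,C,D,E,F,G] [(A,B),(A,D),(A,F),(B,C),(B,E),(B,G),(C,D),(C,F),(C,G),(D,E),(D,G),(E,F),(E,G)]"

definition tH3 :: target where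
  "tH3 = Target [A,B,C,D,E,F,G,H] [(A,B),(A,D),(A,H),(B,C),(B,G),(C,D),(C,F),(C,H),(D,E),(E,F),(E,H),(F,G),(G,H)]"

definition tQML7 :: target where
  "tQML7 = Target [A,B,C,D,E,F,G] [(A,B),(A,D),(B,C),(B,E),(C,D),(C,F),(D,E),(D,G),(E,F),(E,A),(F,G),(F,B),(G,A),(G,C)]"

definition tQ3x :: target where
  "tQ3x = Target [A,B,C,D,E,F,G,H] [(A,B),(A,F),(A,H),(B,C),(B,E),(C,D),(C,G),(C,H),(D,E),(D,G),(D,H),(E,F),(F,G),(G,H)]"

definition tY9 :: target where
  "tY9 = Target [A,B,C,D,E,F,G,H,I] [(A,B),(A,D),(A,F),(A,H),(B,C),(B,I),(C,D),(C,G),(D,E),(E,F),(E,I),(F,G),(G,H),(H,I)]"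

definition tP7 :: target where
  "tP7 = Target [A,B,C,D,E,F,G] [(A,B),(A,C),(A,D),(A,E),(A,F),(B,C),(B,D),(B,G),(C,E),(C,G),(D,F),(D,G),(E,F),(E,G),(F,G)]"

definition tPrism :: target where
  "tPrism = Target [A,B,C,D,E,F,G,H,I,J] [(A,B),(B,C),(C,D),(D,E),(E,A),(F,G),(G,H),(H,I),(I,J),(J,F),(A,F),(B,G),(C,H),(D,I),(E,J)]"

definition tCML10 :: target where
  "tCML10 = Target [A,B,C,D,E,F,G,H,I,J] [(A,B),(B,C),(C,D),(D,E),(E,F),(F,G),(G,H),(H,I),(I,J),(J,A),(A,F),(B,G),(C,H),(D,I),(E,J)]"

lemmas target_defs = tK4_def tK33_def tK5_def tO_def tQ3_def tV8_def tH1_def tH2_def tH3_def tQML7_def tQ3x_def tY9_def tP7_def tPrism_def tCML10_def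

definition checked :: "target \<Rightarrow> nat \<Rightarrow> bool" where
  "checked tg m \<longleftrightarrow> wf_target tg \<and> sizes_ok tg (2 * m)"

lemma checkedE:
  assumes "checked tg m"
  obtains tv te where "tg = Target tv te" "checked_target tv te" "deg_sum (tmat te) tv (Some (2 * m))"
proof (cases tg)
  case (Target tv te)
  then have "checked_target tv te"
    using assms injective_sound unfolding checked_def checked_target_def by auto
  then show ?thesis using that Target assms by (simp add: checked_def)
qed

lemma checked_simple: "checked tg m \<Longrightarrow> simple_graph (target_graph tg)"
  by (elim checkedE) (simp only: checked_target.simple)

lemma checked_card_edges:
  assumes "checked tg m" shows "card (edges (target_graph tg)) = m"
  using assms
proof (rule checkedE)
  fix tv te assume "tg = Target tv te" "checked_target tv te" "deg_sum (tmat te) tv (Some (2 * m))"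
  then show ?thesis using checked_target.card_edges[of tv te "2 * m"] by simp
qed

lemma checked_i4c:
  assumes "checked tg m" "7 \<le> m" "i4c_target tg" shows "internally_4_connected (target_graph tg)"
  using assms(1)
proof (rule checkedE)
  fix tv te assume "tg = Target tv te" "checked_target tv te"
  then show ?thesis using checked_target.i4c[of tv te] assms checked_card_edges[OF assms(1)] by simp
qed

lemma checked_minor:
  assumes "checked tg m" "checked tg' m'" "target_minor tg tg' l p"
  shows "has_minor (target_graph tg) (target_graph tg')"
  using assms(1)
proof (rule checkedE)
  fix tv te assume "tg = Target tv te" "checked_target tv te"
  then show ?thesis using checked_target.minor[of tv te tg' l p] assms unfolding checked_def by simp
qed

lemma i4c_connected: "internally_4_connected \<Gamma> \<Longrightarrow> connected_graph \<Gamma>"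
  using k_connectedD[of 3 \<Gamma> "{}"]
  by (simp add: internally_4_connected_def delete_verts_def graph_eta)

lemma checked_no_K5:
  assumes "checked tg m" "7 \<le> m" "i4c_target tg" "planar5 tg k" "card (verts (target_graph tg)) = 5 + k"
  shows "\<not> has_minor (target_graph tg) (complete_graph 5)"
  using assms(1)
proof (rule checkedE)
  fix tv te assume t: "tg = Target tv te" "checked_target tv te"
  have "length tv = 5 + k" using assms(5) t(1) distinct_card[OF checked_target.dist[OF t(2)]]
    by (simp add: card_image inj_on_def idx_eq)
  then show ?thesis
    using checked_target.not_K5_minor[OF t(2)] assms(4) i4c_connected[OF checked_i4c[OF assms(1-3)]] t(1) by simp
qed

lemma checked_no_K33:
  assumes "checked tg m" "7 \<le> m" "i4c_target tg" "planar33 tg k" "card (verts (target_graph tg)) = 6 + k"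
  shows "\<not> has_minor (target_graph tg) (complete_bipartite 3 3)"
  using assms(1)
proof (rule checkedE)
  fix tv te assume t: "tg = Target tv te" "checked_target tv te"
  have "length tv = 6 + k" using assms(5) t(1) distinct_card[OF checked_target.dist[OF t(2)]]
    by (simp add: card_image inj_on_def idx_eq)
  then show ?thesis
    using checked_target.not_K33_minor[OF t(2)] assms(4) i4c_connected[OF checked_i4c[OF assms(1-3)]] t(1) by simp
qed

section \<open>Numbers of edges of the listed graphs\<close>

lemma checked_K4: "checked tK4 6"
  by (simp add: checked_def tK4_def del: sizes_ok.simps)
    (simp only: check_rules target_rules)

lemma checked_K33: "checked tK33 9"
  by (simp add: checked_def tK33_def del: sizes_ok.simps)
    (simp only: check_rules target_rules)

lemma checked_K5: "checked tK5 10"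
  by (simp add: checked_def tK5_def del: sizes_ok.simps)
    (simp only: check_rules target_rules)

lemma checked_O: "checked tO 12"
  by (simp add: checked_def tO_def del: sizes_ok.simps)
    (simp only: check_rules target_rules)

lemma checked_Q3: "checked tQ3 12"
  by (simp add: checked_def tQ3_def del: sizes_ok.simps)
    (simp only: check_rules target_rules)

lemma checked_V8: "checked tV8 12"
  by (simp add: checked_def tV8_def del: sizes_ok.simps)
    (simp only: check_rules target_rules)

lemma checked_H1: "checked tH1 13"
  by (simp add: checked_def tH1_def del: sizes_ok.simps)
    (simp only: check_rules target_rules)

lemma checked_H2: "checked tH2 13"
  by (simp add: checked_def tH2_def del: sizes_ok.simps)
    (simp only: check_rules target_rules)

lemma checked_H3: "checked tH3 13"
  by (simp add: checked_def tH3_def del: sizes_ok.simps)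
    (simp only: check_rules target_rules)

lemma checked_QML7: "checked tQML7 14"
  by (simp add: checked_def tQML7_def del: sizes_ok.simps)
    (simp only: check_rules target_rules)

lemma checked_Q3x: "checked tQ3x 14"
  by (simp add: checked_def tQ3x_def del: sizes_ok.simps)
    (simp only: check_rules target_rules)

lemma checked_Y9: "checked tY9 14"
  by (simp add: checked_def tY9_def del: sizes_ok.simps)
    (simp only: check_rules target_rules)

lemma checked_P7: "checked tP7 15"
  by (simp add: checked_def tP7_def del: sizes_ok.simps)
    (simp only: check_rules target_rules)

lemma checked_Prism: "checked tPrism 15"
  by (simp add: checked_def tPrism_def del: sizes_ok.simps)
    (simp only: check_rules target_rules)

lemma checked_CML10: "checked tCML10 15"
  by (simp add: checked_def tCML10_def del: sizes_ok.simps)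
    (simp only: check_rules target_rules)

section \<open>Internal 4-connectivity of the graphs that need it\<close>

lemma i4c_K33: "i4c_target tK33"
  by (simp only: check_rules target_rules target_defs)

lemma i4c_V8: "i4c_target tV8"
  by (simp only: check_rules target_rules target_defs)

lemma i4c_O: "i4c_target tO"
  by (simp only: check_rules target_rules target_defs)

lemma i4c_Q3: "i4c_target tQ3"
  by (simp only: check_rules target_rules target_defs)

lemma i4c_H1: "i4c_target tH1"
  by (simp only: check_rules target_rules target_defs)

lemma i4c_H2: "i4c_target tH2"
  by (simp only: check_rules target_rules target_defs)

lemma i4c_H3: "i4c_target tH3"
  by (simp only: check_rules target_rules target_defs)

lemma i4c_Y9: "i4c_target tY9"
  by (simp only: check_rules target_rules target_defs)

lemma i4c_P7: "i4c_target tP7"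
  by (simp only: check_rules target_rules target_defs)

lemma i4c_Prism: "i4c_target tPrism"
  by (simp only: check_rules target_rules target_defs)

section \<open>Minors among the listed graphs\<close>

text \<open>The witness consists of the contracted edges, where the second end is merged into the
  first, and of the images of the target letters; positions beyond the target are padded with
  \<open>A\<close>.\<close>

lemma K33_K4: "has_minor (target_graph tK33) (target_graph tK4)"
  by (rule checked_minor[OF checked_K33 checked_K4, of "[(A,D),(B,E)]" "(V A B C F A A A A A A)"])
    (simp only: check_rules target_rules target_defs)

lemma O_K4: "has_minor (target_graph tO) (target_graph tK4)"
  by (rule checked_minor[OF checked_O checked_K4, of "[(A,B)]" "(V A C D E A A A A A A)"])
    (simp only: check_rules target_rules target_defs)

text \<open>\<open>(A,C)\<close> is no edge of the cube: it arises when \<open>B\<close> has been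
  merged into \<open>A\<close>.\<close>

lemma Q3_K4: "has_minor (target_graph tQ3) (target_graph tK4)"
  by (rule checked_minor[OF checked_Q3 checked_K4, of "[(A,B),(A,C),(E,H)]" "(V A E F G A A A A A A)"])
    (simp only: check_rules target_rules target_defs)

lemma V8_K33: "has_minor (target_graph tV8) (target_graph tK33)"
  by (rule checked_minor[OF checked_V8 checked_K33, of "[(A,B),(D,E)]" "(V A D G C F H A A A A)"])
    (simp only: check_rules target_rules target_defs)

lemma H1_K33: "has_minor (target_graph tH1) (target_graph tK33)"
  by (rule checked_minor[OF checked_H1 checked_K33, of "[]" "(V A D E B C F A A A A)"])
    (simp only: check_rules target_rules target_defs)

lemma H2_K33: "has_minor (target_graph tH2) (target_graph tK33)"
  by (rule checked_minor[OF checked_H2 checked_K33, of "[]" "(V A C E B D F A A A A)"])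
    (simp only: check_rules target_rules target_defs)

lemma H3_K33: "has_minor (target_graph tH3) (target_graph tK33)"
  by (rule checked_minor[OF checked_H3 checked_K33, of "[(A,B),(A,D)]" "(V A F H C E G A A A A)"])
    (simp only: check_rules target_rules target_defs)

lemma H1_K5: "has_minor (target_graph tH1) (target_graph tK5)"
  by (rule checked_minor[OF checked_H1 checked_K5, of "[(A,C)]" "(V A B D E F A A A A A)"])
    (simp only: check_rules target_rules target_defs)

lemma H2_K5: "has_minor (target_graph tH2) (target_graph tK5)"
  by (rule checked_minor[OF checked_H2 checked_K5, of "[(A,B),(C,F)]" "(V A C D E G A A A A A)"])
    (simp only: check_rules target_rules target_defs)

lemma H3_K5: "has_minor (target_graph tH3) (target_graph tK5)"
  by (rule checked_minor[OF checked_H3 checked_K5, of "[(A,B),(D,E),(F,G)]" "(V A C D F H A A A A A)"])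
    (simp only: check_rules target_rules target_defs)

lemma Y9_K5: "has_minor (target_graph tY9) (target_graph tK5)"
  by (rule checked_minor[OF checked_Y9 checked_K5, of "[(B,C),(D,E),(F,G),(H,I)]" "(V A B D F H A A A A A)"])
    (simp only: check_rules target_rules target_defs)

lemma H1_O: "has_minor (target_graph tH1) (target_graph tO)"
  by (rule checked_minor[OF checked_H1 checked_O, of "[]" "(V A B C D E F A A A A)"])
    (simp only: check_rules target_rules target_defs)

lemma H2_O: "has_minor (target_graph tH2) (target_graph tO)"
  by (rule checked_minor[OF checked_H2 checked_O, of "[(A,F)]" "(V A B C G D E A A A A)"])
    (simp only: check_rules target_rules target_defs)

lemma P7_O: "has_minor (target_graph tP7) (target_graph tO)"
  by (rule checked_minor[OF checked_P7 checked_O, of "[(B,C)]" "(V A B D G F E A A A A)"])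
    (simp only: check_rules target_rules target_defs)

lemma H3_Q3: "has_minor (target_graph tH3) (target_graph tQ3)"
  by (rule checked_minor[OF checked_H3 checked_Q3, of "[]" "(V A B C D H G F E A A)"])
    (simp only: check_rules target_rules target_defs)

lemma Prism_Q3: "has_minor (target_graph tPrism) (target_graph tQ3)"
  by (rule checked_minor[OF checked_Prism checked_Q3, of "[(A,B),(F,G)]" "(V A C D E F H I J A A)"])
    (simp only: check_rules target_rules target_defs)

lemma Q3x_V8: "has_minor (target_graph tQ3x) (target_graph tV8)"
  by (rule checked_minor[OF checked_Q3x checked_V8, of "[]" "(V A B C G F E D H A A)"])
    (simp only: check_rules target_rules target_defs)

lemma Y9_V8: "has_minor (target_graph tY9) (target_graph tV8)"
  by (rule checked_minor[OF checked_Y9 checked_V8, of "[(B,C)]" "(V A D B G F E I H A A)"])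
    (simp only: check_rules target_rules target_defs)

lemma CML10_V8: "has_minor (target_graph tCML10) (target_graph tV8)"
  by (rule checked_minor[OF checked_CML10 checked_V8, of "[(A,B),(E,F)]" "(V A C D E G H I J A A)"])
    (simp only: check_rules target_rules target_defs)

section \<open>Absence of K5 and K33 in the two planar graphs\<close>

text \<open>The number passed on is the surplus of vertices over the excluded graph: 7 - 5 here, and
  7 - 6, 10 - 5, 10 - 6 for the three facts that follow.\<close>

lemma P7_not_K5: "\<not> has_minor (target_graph tP7) (complete_graph 5)"
  by (rule checked_no_K5[OF checked_P7 _ i4c_P7, of 2])
    (simp, simp only: check_rules target_rules target_defs planar_rules, simp add: tP7_def)

lemma P7_not_K33: "\<not> has_minor (target_graph tP7) (complete_bipartite 3 3)"
  by (rule checked_no_K33[OF checked_P7 _ i4c_P7, of 1])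
    (simp, simp only: check_rules target_rules target_defs planar_rules, simp add: tP7_def)

lemma Prism_not_K5: "\<not> has_minor (target_graph tPrism) (complete_graph 5)"
  by (rule checked_no_K5[OF checked_Prism _ i4c_Prism, of 5])
    (simp, simp only: check_rules target_rules target_defs planar_rules, simp add: tPrism_def)

lemma Prism_not_K33: "\<not> has_minor (target_graph tPrism) (complete_bipartite 3 3)"
  by (rule checked_no_K33[OF checked_Prism _ i4c_Prism, of 4])
    (simp, simp only: check_rules target_rules target_defs planar_rules, simp add: tPrism_def)

section \<open>Certificates\<close>

text \<open>Reuse of a refuted state without renaming.\<close>

abbreviation Q where "Q i j \<equiv> R i j (V A B C D E F G H I J)"

text \<open>Permutations that fix all letters after the displayed ones.\<close>

abbreviation V5 where "V5 a b c d e \<equiv> V a b c d e F G H I J"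

abbreviation V6 where "V6 a b c d e f \<equiv> V a b c d e f G H I J"

abbreviation V7 where "V7 a b c d e f g \<equiv> V a b c d e f g H I J"

abbreviation V8 where "V8 a b c d e f g h \<equiv> V a b c d e f g h I J"

abbreviation V9 where "V9 a b c d e f g h i \<equiv> V a b c d e f g h i J"

section \<open>Graphs with 8 to 11 edges\<close>

text \<open>For n = 5 and m = 8 the counters are 2m - 3n = 1 and 2m = 16. No minor is admissible, so
  the certificate refutes every graph of this size.\<close>

lemma cert_5_8: "certified [A,B,C,D,E] 1 16 (V None None None None None None None None None None) [] (S B D (S B C (S A D (S B E (S D E (S C D (X (T A Z)) (T C Z)) (T D Z)) (T B Z)) (T A Z)) (T B (T A Z))) (T B (T A Z)))"
  by (simp only: check_rules target_defs)

text \<open>K33 has six vertices and cannot occur here: every branch ends in a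
  contradiction.\<close>

lemma cert_5_9: "certified [A,B,C,D,E] 3 18 (V (Some tK33) None None None None None None None None None) [] (S C E (S A B (S A D (S D E (S C D (S A E (S B C (S B E (S A C (X (T B Z)) (T A Z)) (T B Z)) (T B Z)) (T A Z)) (T C Z)) (T D Z)) (T A Z)) (T A Z)) (T C (T A Z)))"
  by (simp only: check_rules target_defs)

text \<open>The excess is 0, so the graph is cubic and three known edges saturate a vertex.\<close>

lemma cert_6_9: "certified [A,B,C,D,E,F] 0 18 (V (Some tK33) None None None None None None None None None) [Lem A A [(A,D),(D,E)] [] (S D F (X (T D (T A (T B (T C (M A [] (V A E F B C D A A A A))))))) (S B D (X (T D (T A (T B (T E (M A [] (V A B E C D F A A A A))))))) (T D (T A (T C (T E (M A [] (V A C E B D F A A A A))))))))] (S D E (S A D (Q A A) (S A E (R A A (V5 A B C E D)) (T A (T B Z)))) (S B E (S D B (R A A (V5 D A C B E)) (T D (T A Z))) (T E (T A (T B (T D (M A [] (V A C F B D E A A A A))))))))"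
  by (simp only: check_rules target_defs)

text \<open>Ten edges on five vertices use all pairs, so \<open>L\<close> completes the matrix at
  once.\<close>

lemma cert_5_10: "certified [A,B,C,D,E] 5 20 (V (Some tK5) None None None None None None None None None) [] (L (M A [] (V A B C D E A A A A A)))"
  by (simp only: check_rules target_defs)

lemma cert_6_10: "certified [A,B,C,D,E,F] 2 20 (V (Some tK5) None None None None None None None None None) [Lem A A [(A,B),(B,C),(B,E),(B,F),(C,F)] [(A,F)] (S A E (S A C (S A D (X (T C Z)) (T A Z)) (T A Z)) (T A Z)),
Lem A A [(A,B),(B,C),(B,E),(B,F)] [] (S E F (S C F (S A F (X (T D (T A Z))) (Q A A)) (R A A (V5 C B E D A))) (S C F (R A A (V5 E B C D A)) (T F Z))),
Lem A A [(B,C),(B,E)] [] (S B F (S A B (Q A A) (S B D (R A A (V5 C B D A E)) (T B (T C (L Z))))) (S B D (S B A (R A A (V6 C B A F D E)) (T B (T C (L Z)))) (T B (T A (L Z)))))] (S B C (S B E (Q A A) (S C E (R A A (V5 A C B D E)) (T E (T A Z)))) (S A B (S A C (R A A (V5 D A B E C)) (T C (T D Z))) (T B (T D (L Z)))))"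
  by (simp only: check_rules target_defs)

lemma cert_6_11: "certified [A,B,C,D,E,F] 4 22 (V None None None None None None None None None None) [Lem A A [(A,B),(A,E),(B,D),(B,E),(C,E),(D,E)] [(A,D)] (S C D (S A C (S B C (S D F (X (T A Z)) (T D Z)) (S D F (S B F (S A F (X (T C Z)) (T A Z)) (T B Z)) (T D Z))) (T A Z)) (T D Z)),
Lem A A [(A,E),(B,E),(C,E),(D,E)] [] (S B D (S A B (S A D (S B C (S A C (S C D (X Z) (S D F (X (T C Z)) (T D Z))) (S C D (S C F (X (T A Z)) (T C Z)) (T C Z))) (S A C (S C D (S C F (X (T B Z)) (T C Z)) (T C Z)) (T C Z))) (Q A A)) (S A D (R A A (V5 A D C B E)) (T A Z))) (S A B (S D A (R A A (V5 D A C B E)) (T D Z)) (T B Z))),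
Lem A A [(C,E),(D,E)] [] (S B E (S A E (Q A A) (S E F (R A A (V6 B C D F E A)) (T E (L Z)))) (S A E (S E F (R A A (V6 A C D F E B)) (T E (L Z))) (T E (L Z))))] (S C E (S D E (Q A A) (S C D (R A A (V5 A B D E C)) (T D (T A Z)))) (S E F (S F C (R A A (V6 A B C E F D)) (T C (T A Z))) (T E (L Z))))"
  by (simp only: check_rules target_defs)

lemma cert_7_11: "certified [A,B,C,D,E,F,G] 1 22 (V None None None None None None None None None None) [Lem A A [(A,B),(A,G),(B,G),(E,G),(F,G)] [(A,E)] (S A F (X (T A Z)) (S A C (X (T A Z)) (T A Z))),
Lem A B [(A,G),(B,G),(E,G),(F,G)] [(A,B),(A,E)] (S B E (R A A (V5 B E C D A)) (S B F (R A A (V6 B F C D A E)) (S A D (S A C (X (P [A,B] [E,F] [C,D,G])) (T A Z)) (T A Z)))),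
Lem A A [(A,G),(B,G),(E,G),(F,G)] [] (S A B (S A E (X (T A Z)) (Q A A)) (S A E (R A A (V5 A E C D B)) (Q A B))),
Lem A C [(A,G)] [(A,B),(A,E),(B,E),(B,F),(F,G)] (T B (S A D (S D E (S A C (S D F (X (T F Z)) (T F Z)) (T C (T F Z))) (T E (T F Z))) (T A (T D (T F Z))))),
Lem A C [] [(C,G),(D,G),(F,G)] (T G (S B D (S B C (S B F (R A B (V7 G C A E D F B)) (Q A C)) (R A C (V6 A B D F E C))) (R A C (V6 A B C F E D)))),
Lem A B [(B,G),(E,G)] [(A,G),(D,G)] (S F G (S C G (R A A (V5 B E A D C)) (R A C (V6 B E C A F D))) (R A C (V5 B C A D E))),
Lem A D [(B,G),(E,G)] [(A,G)] (S D G (S F G (R A A (V6 B D C A F E)) (S C G (R A A (V6 B D F A C E)) (R A C (V6 B D C F E A)))) (Q A B)),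
Lem A E [(B,G)] [(E,G)] (S C G (R A D (V5 E B A D C)) (S F G (R A B (V6 C B A E F D)) (R A C (V5 A B C E D))))] (S B G (S E G (S A G (S F G (Q A A) (S D G (R A A (V6 A B C F D E)) (S C G (R A A (V6 A B D F C E)) (Q A C)))) (Q A D)) (Q A E)) (S D G (R A E (V5 A D C E B)) (S E G (S F G (R A B (V6 B E A D F C)) (R A C (V5 A E B D C))) (R A C (V6 A C B D F E)))))"
  by (simp only: check_rules target_defs)

section \<open>Graphs with 12 edges\<close>

text \<open>The list of minors is the same for every number of vertices, so that the results can be
  combined.\<close>

lemma cert_6_12: "certified [A,B,C,D,E,F] 6 24 (V (Some tO) (Some tQ3) (Some tV8) None None None None None None None) [Lem A A [(A,B),(A,D),(B,C),(B,D),(B,F),(C,D),(D,E),(D,F)] [] (S C F (S A F (S A C (X (T E Z)) (S A E (S C E (X (T E Z)) (T C Z)) (T A Z))) (S A C (S A E (S F E (X (T E Z)) (T F Z)) (T A Z)) (T A Z))) (S A C (S F A (S F E (S C E (X (T E Z)) (T C Z)) (T F Z)) (T F Z)) (T C Z))),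
Lem A B [(A,D),(C,D),(C,F),(D,E),(D,F)] [(B,D),(C,E)] (S A F (S E F (S B F (R A A (V6 A D C F B E)) (T B (T A Z))) (T E Z)) (L (M A [] (V A B C F D E A A A A)))),
Lem A B [(A,D),(C,D),(D,E),(D,F)] [(B,D)] (S A C (S C F (S C E (S B C (R A A (V5 A D E C B)) (T B (T A Z))) (Q A B)) (R A B (V6 E B C D F A))) (S A F (R A B (V5 E B A D C)) (T A Z))),
Lem A B [(A,D),(D,F)] [] (S D E (S C D (S B D (S B F (S A B (S B C (Q A A) (S B E (R A A (V5 A B E D C)) (T B Z))) (S B C (S B E (R A A (V5 C B E D A)) (T B Z)) (T B Z))) (S C F (S F A (S F E (R A A (V6 A F E D B C)) (T F Z)) (T F Z)) (T F Z))) (Q A B)) (S B D (R A B (V5 A C B D E)) (T D (L Z)))) (S C D (S B D (R A B (V5 A E B D C)) (T D (L Z))) (T D (L Z))))] (S D F (S A D (Q A B) (S A F (R A B (V6 A B C F E D)) (T A (T B Z)))) (S C F (S D C (R A B (V5 D B A C E)) (T D (T B Z))) (T F (L Z))))"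
  by (simp only: check_rules target_defs)

lemma cert_7_12: "certified [A,B,C,D,E,F,G] 3 24 (V (Some tO) (Some tQ3) (Some tV8) None None None None None None None) [Lem A A [(A,F),(B,C),(C,D),(C,E),(C,F),(C,G),(D,F),(F,G)] [(E,G)] (S A G (X (T G Z)) (S B G (X (T G Z)) (T G Z))),
Lem A B [(B,C),(C,D),(C,E),(C,F),(C,G),(D,F),(F,G)] [] (S A F (S E G (X (T G Z)) (Q A A)) (S E F (X (S A D (X (T D Z)) (T A (T B Z)))) (S B F (X (S A B (X (T B Z)) (T A (T E Z)))) (T F Z)))),
Lem A B [(B,C),(C,D),(C,E),(C,F),(C,G)] [] (S D F (S F G (Q A B) (S B F (R A B (V7 A E C B G F D)) (S E F (R A B (V7 A B C D G F E)) (T F Z)))) (S B F (S E F (R A B (V7 A G C E D F B)) (S G F (R A B (V5 A E C B D)) (T F Z))) (S E F (S G F (R A B (V5 A B C E D)) (T F Z)) (T F Z)))),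
Lem A A [(B,C),(B,E),(B,F),(B,G),(C,D),(C,E),(C,F)] [(A,C),(C,G)] (S B D (X (S A D (X (T D Z)) (T A (T G Z)))) (S A B (S G F (X (T F Z)) (R A A (V7 D A B E G C F))) (S A G (S A D (S A F (S A E (X (T D Z)) (T A (T D Z))) (T A (T D Z))) (T A (S D F (X (T D Z)) (T D Z)))) (T A (S G F (X (T G Z)) (T G Z)))))),
Lem A A [(B,C),(B,E),(B,F),(C,D),(C,E),(C,F)] [(A,C),(C,G)] (S B G (Q A A) (S A B (R A A (V7 G B C D E F A)) (P [A,G] [B,C] [D,E,F]))),
Lem A C [(B,C),(B,E),(C,D),(C,E),(C,F)] [(A,C),(B,F),(C,G)] (S B D (R A A (V6 A B C F D E)) (S E F (R A A (V5 A E C D B)) (S D E (R A A (V6 A E C F B D)) (P [B,E] [D,F] [A,C,G])))),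
Lem A D [(B,C),(C,D),(C,E),(C,F)] [(A,C),(C,G)] (S B E (S B F (Q A A) (Q A C)) (S D E (R A C (V6 A E C F D B)) (S E F (S F D (R A A (V6 A F C B E D)) (S B F (R A A (V6 A F C D E B)) (P [E,F] [B,D] [A,C,G]))) (S D F (R A C (V6 A D C B F E)) (S B F (S D B (R A A (V6 A B C E F D)) (P [F,B] [D,E] [A,C,G])) (P [B,D] [E,F] [A,C,G])))))),
Lem A E [] [(B,E),(B,F),(C,D),(D,F),(E,F)] (T F (S E G (S B G (S D G (S D E (S B D (R A A (V7 A D G F E B C)) (P [E,D] [B,F] [A,C,G])) (P [D,B] [F,E] [A,C,G])) (T D (T A Z))) (T B (T D Z))) (T E (L Z)))),
Lem A E [] [(A,C),(C,D),(C,G)] (T C (S A F (S F G (S D F (S D G (R A C (V7 B D F A G C E)) (S A G (S D A (R A A (V7 B A F C G D E)) (P [G,A] [D,C] [B,E,F])) (P [A,D] [C,G] [B,E,F]))) (Q A E)) (T F (R A E (V7 B A F G D C E)))) (T F (R A E (V7 B D F A G C E))))),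
Lem A C [(B,C),(C,E),(C,F)] [(C,D)] (S C G (S A C (R A B (V5 D A C B E)) (R A D (V7 A B C E F G D))) (S A C (R A D (V5 D A C B E)) (Q A E))),
Lem A A [(C,E),(C,F)] [(B,C),(C,G)] (S A C (S D C (R A D (V5 B D C A E)) (R A E (V5 D A C B E))) (R A E (V5 A D C B E))),
Lem A F [(C,F)] [(C,E)] (S A C (S C G (R A C (V7 B A C E F G D)) (R A A (V5 B E C D A))) (S B C (R A A (V7 D A C G B F E)) (R A E (V7 A D C B F G E))))] (S C F (S C E (S B C (S C D (S C G (Q A B) (S A C (R A B (V7 G A C B D E F)) (Q A D))) (Q A C)) (S C G (R A C (V7 A E C B F G D)) (Q A A))) (Q A F)) (S D F (R A F (V6 A B F E C D)) (S E F (S B F (R A A (V7 A C F G B E D)) (R A E (V7 C A F B E G D))) (R A E (V7 C B F D A G E)))))"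
  by (simp only: check_rules target_defs)

text \<open>Again cubic. The leaves embed the cube or the Wagner graph without contraction.\<close>

lemma cert_8_12: "certified [A,B,C,D,E,F,G,H] 0 24 (V (Some tO) (Some tQ3) (Some tV8) None None None None None None None) [Lem A A [(A,D),(B,F),(B,G),(B,H),(C,H),(D,F),(D,H)] [] (X (S E F (X (S A C (S A G (X (T E (M C [] (V A D F E C H B G A A)))) (T A (T C (T E (M B [] (V A C G E D H B F A A)))))) (T A (T C (M C [] (V A D H C E F B G A A)))))) (T E (T A Z)))),
Lem A A [(B,F),(B,G),(B,H),(C,H),(D,F),(D,H)] [(B,D),(C,D)] (S A D (Q A A) (S D G (X (P [A,E] [B,D,H] [C,F,G])) (T D (R A A (V5 E B C D A))))),
Lem A A [(B,F),(B,G),(B,H),(C,H),(D,H)] [(C,D)] (X (S D F (Q A A) (S D G (R A A (V7 A B C D E G F)) (T D (S C E (R A A (V7 F D B C G E A)) (T E (S C G (X (T A (M C [] (V A C G E D H B F A A)))) (T C (T A (M C [] (V A C F E D H B G A A))))))))))),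
Lem A A [(B,H),(C,H),(D,H)] [] (X (T H (S B F (S B G (Q A A) (S A B (R A A (V7 E B C D G A F)) (T B (R A A (V7 A B C D G E F))))) (S A B (S E B (R A A (V7 G B C D F E A)) (T B (R A A (V7 E B C D F G A)))) (T B (R A A (V6 A B C D F E))))))),
Lem A B [(B,H),(D,H)] [(C,H),(F,H)] (S A H (R A A (V5 C A B D E)) (S E H (R A A (V5 A B D E C)) (T H (R A A (V7 A B D G E F C))))),
Lem A C [(D,H)] [(B,H),(C,H),(E,H)] (S G H (S A H (R A A (V7 B D G A C E F)) (T H (R A A (V7 B D G F A E C)))) (T H (R A A (V6 B A D F E C)))),
Lem A D [(D,H)] [(B,H)] (S C H (S F H (R A A (V6 A C D F E B)) (R A B (V5 A C B D E))) (S E H (R A B (V6 A D B E F C)) (Q A C)))] (S D H (S B H (S C H (Q A A) (S F H (R A A (V6 A B D F E C)) (Q A B))) (Q A D)) (S A H (R A D (V5 B D C A E)) (S E H (S C H (R A B (V6 B E A C F D)) (R A C (V5 B A D E C))) (S C H (R A C (V5 B A D C E)) (T H (R A A (V7 A B F G E C D)))))))"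
  by (simp only: check_rules target_defs)

section \<open>Graphs with 13 edges\<close>

lemma cert_6_13: "certified [A,B,C,D,E,F] 8 26 (V (Some tH1) (Some tH2) (Some tH3) None None None None None None None) [Lem A A [(A,B),(A,C),(A,D),(A,E),(A,F),(B,D),(B,E),(B,F),(D,E),(E,F)] [] (S D F (S C E (S C F (X (T C Z)) (S C D (X (T C Z)) (T C Z))) (S C D (S C F (X (T C Z)) (T C Z)) (T C Z))) (S C F (S C E (S B C (X (T D Z)) (L (M A [] (V B A D C E F A A A A)))) (L (M A [] (V C A D E B F A A A A)))) (T F Z))),
Lem A B [(A,B),(A,C),(A,D),(A,E),(A,F),(B,D),(B,E),(D,E)] [(B,F)] (S B C (S C E (R A A (V6 A B F C E D)) (L (M A [] (V B A C F D E A A A A)))) (T B Z)),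
Lem A C [(A,B),(A,C),(A,D),(A,E),(A,F),(B,D)] [(B,E)] (S D F (S B F (R A B (V6 A B C D F E)) (T B Z)) (L (M A [] (V B A D E C F A A A A)))),
Lem A D [(A,C),(A,D)] [(A,B)] (S C D (S D E (S B D (S D F (R A C (V5 D A E C B)) (L (M A [] (V A C D B E F A A A A)))) (T B (T C Z))) (L (M A [] (V A C D B F E A A A A)))) (L (M A [] (V A E C B F D A A A A))))] (S A E (S A F (S A D (S A C (S A B (S B D (S D E (S B E (S E F (S B F (Q A A) (Q A B)) (R A B (V5 A E C B D))) (Q A C)) (R A C (V5 A D C B E))) (S D E (R A C (V5 A D C E B)) (T D Z))) (Q A D)) (R A D (V5 A C D E B))) (R A D (V6 A D E F B C))) (S A B (R A D (V6 A F B E C D)) (T A (L Z)))) (S B E (S E C (R A D (V5 E A C B D)) (T E (L Z))) (T E (L Z))))"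
  by (simp only: check_rules target_defs)

lemma cert_7_13: "certified [A,B,C,D,E,F,G] 5 26 (V (Some tH1) (Some tH2) (Some tH3) None None None None None None None) [Lem A A [(A,E),(B,C),(B,D),(B,E),(B,G),(C,E),(C,F),(C,G),(D,G),(E,F),(F,G)] [] (S A C (X (T A Z)) (S A F (X (T A Z)) (S A G (X (T A Z)) (T A Z)))),
Lem A B [(A,D),(A,E),(B,C),(B,D),(B,E),(B,G),(C,F),(C,G),(D,G),(E,F),(F,G)] [(C,E)] (S C D (S D E (X Z) (S E G (X Z) (T E (S A G (X (T A Z)) (T A Z))))) (S A C (S D E (X (T A Z)) (S D F (M B [] (V E B C F D A G A A A)) (T D Z))) (T C Z))),
Lem A C [(A,D),(A,E),(B,C),(B,D),(B,E),(B,G),(C,F),(C,G),(D,G),(E,F),(F,G)] [] (S C E (Q A A) (Q A B)),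
Lem A D [(A,D),(A,E),(B,C),(B,D),(B,E),(B,G),(C,F),(C,G),(D,G),(E,F)] [] (S F G (Q A C) (S A G (R A C (V6 F B D C E A)) (S E G (S A F (S B F (X (T A Z)) (S D F (X (T A Z)) (T F Z))) (S A B (R A C (V7 F G D C E A B)) (T A (S D F (X (P [B,G] [A,F] [C,D,E])) (T D Z))))) (T G Z)))),
Lem A A [(A,B),(A,D),(A,E),(B,D),(B,E),(B,G),(C,D),(C,F),(C,G),(D,G)] [(B,C),(C,E)] (S A C (R A A (V7 F A D E C G B)) (T C Z)),
Lem A B [(A,D),(A,E),(B,D),(B,E),(B,G),(C,F),(C,G),(D,G),(E,F)] [(B,C),(C,D)] (S C E (S A C (S B F (R A C (V7 D C F A G B E)) (S A B (R A B (V7 F A D E C G B)) (T B Z))) (T C Z)) (T C (S E G (R A D (V7 F G D E C A B)) (T G Z)))),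
Lem A D [(A,D),(A,E),(B,D),(B,E),(B,G),(C,F),(C,G),(D,G),(E,F)] [] (S B C (Q A D) (S C D (S A B (S C E (S A C (X Z) (S B F (X (T A Z)) (S A F (X (T F Z)) (P [A,B] [C,F] [D,E,G])))) (Q A A)) (S B F (S A C (R A C (V7 E C G A F B D)) (S C E (S A G (X (T A Z)) (T A Z)) (T C Z))) (T B Z))) (Q A B))),
Lem A A [(A,D),(A,E),(A,G),(B,E),(B,G),(C,F),(D,G),(E,F),(E,G)] [(D,F),(F,G)] (S B F (R A A (V7 A G F E D C B)) (T F Z)),
Lem A D [(A,D),(A,E),(B,D),(B,E),(B,G),(C,F),(D,G),(E,F)] [] (S C G (Q A D) (S F G (S C E (R A D (V6 A B F D E C)) (S A C (R A D (V6 E D F B A C)) (T C Z))) (S A G (S E G (S D F (S A C (R A C (V6 C D B A F E)) (S C D (R A B (V7 B A C G E F D)) (T C Z))) (Q A A)) (T G Z)) (T G Z)))),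
Lem A A [(A,D),(A,E),(B,D),(B,E),(B,G),(C,F),(D,G)] [] (S E F (Q A D) (S C E (R A D (V6 A B F D E C)) (S E G (S D E (S A C (R A D (V6 E D F B A C)) (S C G (R A A (V7 D B F A G C E)) (T C Z))) (T E Z)) (T E Z)))),
Lem A B [(A,E),(C,F),(C,G),(D,G)] [(A,B),(B,C),(B,G)] (T B (S F G (R A D (V7 D F A G B E C)) (T F (L (M B [] (V F A D C E B G A A A)))))),
Lem A D [(A,D),(A,E),(B,D),(C,F),(C,G),(D,G),(E,G)] [(B,G)] (S A B (R A D (V7 E D F A G C B)) (S B F (S B C (R A D (V7 G B E C D A F)) (Q A B)) (T B (S D F (S A C (S E F (S A G (X (P [A,G] [B,F] [C,D,E])) (S A F (X (P [A,F] [B,G] [C,D,E])) (P [A,B] [F,G] [C,D,E]))) (T E (L (M B [] (V E A C G D B F A A A))))) (T C (L (M B [] (V B D F E G C A A A A))))) (T D (L (M B [] (V D A C G E B F A A A)))))))),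
Lem A D [(A,D),(A,E),(B,D),(B,E),(C,F),(D,G)] [] (S B G (Q A A) (S C B (R A D (V7 A G C D E F B)) (S F B (R A D (V7 A G F D E C B)) (T B Z)))),
Lem A C [(A,D),(B,E),(C,D),(C,F),(D,G)] [(D,F)] (S F G (R A D (V7 C G B D F E A)) (S A F (R A D (V6 A C B D F E)) (T F Z))),
Lem A D [(A,D),(A,E),(B,E),(C,F),(D,G)] [] (S B D (Q A D) (S B F (S D E (R A C (V6 A C E D F B)) (S D F (S C D (R A C (V6 C B A D F E)) (R A C (V6 A B F D E C))) (T D (R A C (V6 C B A D F E))))) (S B G (S A B (R A A (V7 G A C B D F E)) (R A B (V7 F B A G C E D))) (T B Z)))),
Lem A C [(A,D),(B,E),(C,F),(D,G)] [(A,E)] (S A G (S A C (R A D (V7 A G B C D E F)) (S A F (R A C (V6 D B F A E C)) (T A Z))) (S A F (R A D (V6 A C B D F E)) (T A (R A D (V7 A F D B C G E))))),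
Lem A B [(B,E),(C,F),(D,G)] [(A,D)] (S A C (R A C (V7 A G B C D E F)) (S A B (R A C (V7 A F D B C G E)) (T A (R A D (V7 A C D E F G B))))),
Lem A D [(B,E),(C,F),(D,G)] [] (S A D (S A E (Q A D) (Q A C)) (Q A B)),
Lem A C [(B,E),(C,F),(E,G)] [(D,G)] (S B D (R A D (V5 A B C E D)) (S A D (R A C (V5 B A C E D)) (T D Z))),
Lem A C [(B,E),(C,F)] [] (S D G (Q A D) (S E G (Q A C) (S C G (R A C (V6 A F B D C E)) (T G (R A B (V7 D B C G E F A)))))),
Lem A D [(B,E)] [(C,F)] (S A F (R A C (V6 C A B D F E)) (S F G (R A C (V7 A B F D E G C)) (T F Z))),
Lem A C [(B,E)] [] (S C F (Q A C) (Q A D))] (S B E (Q A C) (S E G (R A C (V7 A E C D G F B)) (S C E (R A C (V5 A C B D E)) (T E (R A D (V5 B A D C E))))))"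
  by (simp only: check_rules target_defs)

lemma cert_8_13: "certified [A,B,C,D,E,F,G,H] 2 26 (V (Some tH1) (Some tH2) (Some tH3) None None None None None None None) [Lem A A [(A,D),(A,H),(B,H),(D,E),(D,G),(D,H),(G,H)] [] (S A G (X (T A Z)) (S A B (X (T A Z)) (S A C (X (T A Z)) (S A E (X (T A Z)) (T A Z))))),
Lem A B [(A,H),(B,H),(C,D),(D,F),(D,G),(D,H),(G,H)] [(F,G)] (S B G (X (T G Z)) (S A G (X (T G Z)) (S C G (X (T G Z)) (T G Z)))),
Lem A B [(A,H),(B,H),(D,F),(D,G),(D,H),(G,H)] [(A,D),(B,D)] (S C D (S F G (X (T G Z)) (Q A B)) (S D E (S F G (X (T G Z)) (R A B (V5 A B E D C))) (T D Z))),
Lem A C [(A,H),(B,H),(D,G),(D,H),(G,H)] [(A,D)] (S D F (S B D (R A A (V6 B A C D F E)) (Q A B)) (S B D (S C D (R A A (V6 B A F D C E)) (S D E (R A A (V5 B A C D E)) (T D Z))) (S D E (R A B (V6 A B C D F E)) (T D Z)))),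
Lem A D [(A,C),(A,E),(A,F),(A,H),(B,E),(B,F),(B,H),(D,H),(G,H)] [(D,G)] (X (S F G (X (T D (T C (M C [] (V B E A F G C D H A A))))) (T G (X (T D (M C [] (V B E A F D C G H A A))))))),
Lem A E [(A,C),(A,E),(A,H),(B,E),(B,H),(D,H),(E,G),(G,H)] [(A,B),(A,D),(A,F),(A,G),(B,D),(C,E),(C,H),(D,G)] (S D E (S C G (X (P [B,D,F] [A,G] [C,E,H])) (S B C (X (P [A,B] [D,F,G] [C,E,H])) (T C (P [B,F,G] [A,D] [C,E,H])))) (T D (S E F (S B F (X (T B Z)) (T F Z)) (T F (S B C (M C [] (V A C B E G F D H A A)) (T C (M C [] (V A C G E B F D H A A)))))))),
Lem A F [(A,H),(B,H),(D,H)] [(A,F),(A,G),(B,E),(B,G),(C,E),(C,F),(C,G),(C,H),(D,G)] (T C (T G (T E (T F (M C [] (V A C D E G F B H A A)))))),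
Lem A F [(B,H),(D,H),(G,H)] [(A,B),(A,D),(A,F),(A,G),(B,D),(B,G),(D,G)] (T A (S E G (S B E (Q A E) (T B (S C G (R A E (V5 A B E D C)) (Q A F)))) (T G (S C D (R A E (V7 A G E B C F D)) (R A F (V7 A G C B E F D)))))),
Lem A F [(A,H),(B,H),(D,H),(G,H)] [(A,B),(A,D),(A,G),(D,G)] (S B D (R A C (V7 A G C B E F D)) (S B G (R A C (V5 A D C B E)) (S A E (S A C (S A F (S B E (S B F (Q A D) (T B (R A D (V6 A B F D C E)))) (T B (R A D (V5 A B E D C)))) (Q A F)) (R A F (V6 A B E D F C))) (R A F (V6 A B C D F E))))),
Lem A D [(A,H),(B,H),(D,H),(G,H)] [(A,G),(D,G)] (S A D (R A C (V7 G B C A E F D)) (S A B (R A C (V7 D G C A E F B)) (Q A F))),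
Lem A C [(A,H),(B,H),(D,H),(G,H)] [] (S D G (S A D (S B D (X (P [C,E,F] [D,H] [A,B,G])) (S D E (Q A A) (S C D (R A A (V5 A B E D C)) (S D F (R A A (V6 A B C D F E)) (T D Z))))) (Q A C)) (S A G (R A C (V7 D B C G E F A)) (Q A D))),
Lem A A [(A,E),(B,E),(E,G)] [(A,B),(A,G),(B,D),(B,G),(C,E),(C,H),(D,H),(E,F),(F,H)] (S D E (R A F (V8 B D C A F H G E)) (P [C,D,F] [E,H] [A,B,G])),
Lem A E [(A,C),(A,F),(A,H)] [(A,B),(A,E),(A,G),(B,D),(B,F),(B,G),(C,E),(C,G),(C,H),(D,E),(D,H),(E,H),(F,G)] (S A D (R A D (V8 C F B D E G H A)) (T A (L Z))),
Lem A E [(A,H),(B,E),(E,G),(G,H)] [(A,B),(A,E),(A,G),(B,D),(B,F),(B,G),(C,E),(C,H),(D,H),(E,H),(F,H)] (S C G (S G F (R A F (V8 H F A C D B E G)) (R A A (V8 C H A D G F E B))) (S A C (S D G (S F G (R A D (V8 D F C E A B H G)) (T G (S A F (Q A E) (T A (L Z))))) (T G (S A D (R A E (V6 A B C F E D)) (T A (L Z))))) (T A (T C (S F G (S E F (R A B (V8 A C D E H B G F)) (T E (L Z))) (T G (L Z))))))),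
Lem A E [(A,H),(G,H)] [(A,B),(A,G),(B,D),(B,F),(B,G),(D,H),(F,H)] (T B (S E G (S A E (S E F (R A F (V8 B F C A D H G E)) (Q A A)) (Q A E)) (S A E (R A E (V7 G B C D E F A)) (T E (S A F (S F G (S C F (R A F (V8 E C B A D H G F)) (S D G (R A E (V8 B F A C G H D E)) (T D (L Z)))) (T F (T G (L Z)))) (T A (T F (L Z)))))))),
Lem A E [] [(C,H),(D,H),(E,H),(F,H)] (T H (S B C (S B E (S B F (R A D (V8 C F A E D G H B)) (S B D (R A D (V8 C E A D F G H B)) (Q A E))) (S B F (S B D (R A D (V8 C F A D E G H B)) (R A E (V6 A B C D F E))) (T B (R A E (V8 C H A E G F D B))))) (S B E (S B F (S B D (R A D (V8 E F A D C G H B)) (R A E (V6 A B E D F C))) (T B (R A E (V8 E H A C G F D B)))) (T B (R A E (V8 D H A C G E F B)))))),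
Lem A D [(A,H),(B,H),(G,H)] [(D,H)] (S F H (R A C (V6 A B C F E D)) (S C H (R A C (V5 A B D C E)) (S E H (R A C (V5 A B C E D)) (Q A E)))),
Lem A A [(A,H),(B,H)] [(C,H),(E,H),(G,H)] (S F H (S D H (R A C (V7 A B C D E G F)) (R A E (V7 A B C E D G F))) (R A E (V7 A B C E F G D))),
Lem A F [(A,H),(B,H)] [(E,H),(G,H)] (S C H (S D H (R A C (V7 A B E D F G C)) (S F H (R A C (V7 A B D F E G C)) (R A E (V7 A B D E F G C)))) (Q A A)),
Lem A B [(A,H)] [(B,H),(F,H)] (S D H (R A F (V7 A D C E B G F)) (S C H (R A A (V7 A C B E D G F)) (R A E (V5 A E B C D)))),
Lem A G [(A,H)] [(B,H)] (S F H (S E H (R A D (V7 A F C B D G E)) (R A F (V7 A F C D E G B))) (Q A B))] (S A H (S B H (S G H (S D H (Q A C) (Q A D)) (S E H (R A D (V7 A B C G D F E)) (Q A F))) (Q A G)) (S A E (R A G (V8 E H C D B F G A)) (S A C (R A B (V8 C E B D F H G A)) (S A G (S B A (R A A (V8 G B C D E F H A)) (R A E (V8 G D C B E H F A))) (R A E (V8 B D C E G H F A))))))"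
  by (simp only: check_rules target_defs)

section \<open>Graphs with 14 edges\<close>

text \<open>Only one of the fifteen pairs is missing. The branches locate it, and H1 is a subgraph
  in every case.\<close>

lemma cert_6_14: "certified [A,B,C,D,E,F] 10 28 (V (Some tH1) (Some tH2) (Some tH3) (Some tQML7) (Some tQ3x) (Some tY9) None None None None) [] (S B D (S B E (S B F (S A B (S B C (S A D (S D F (S D E (S A C (S C E (S C F (S A F (S A E (M A [] (V C A E D B F A A A A)) (L (M A [] (V A B D E C F A A A A)))) (L (M A [] (V A B D F C E A A A A)))) (L (M A [] (V C A D F B E A A A A)))) (L (M A [] (V C A D E B F A A A A)))) (L (M A [] (V A B E C D F A A A A)))) (L (M A [] (V C A D F B E A A A A)))) (L (M A [] (V C A D E B F A A A A)))) (L (M A [] (V A B E D C F A A A A)))) (L (M A [] (V B A E C D F A A A A)))) (L (M A [] (V A C E B D F A A A A)))) (L (M A [] (V B A D F C E A A A A)))) (L (M A [] (V B A D E C F A A A A)))) (L (M A [] (V B A E D C F A A A A))))"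
  by (simp only: check_rules target_defs)

lemma cert_7_14: "certified [A,B,C,D,E,F,G] 7 28 (V (Some tH1) (Some tH2) (Some tH3) (Some tQML7) (Some tQ3x) (Some tY9) None None None None) [Lem A A [(A,C),(A,D),(A,E),(B,C),(B,D),(B,E),(B,G),(C,E),(C,F),(C,G),(D,G),(E,F),(F,G)] [] (S C D (X (T A Z)) (S D F (X (T A Z)) (S D E (X (T A Z)) (T D Z)))),
Lem A B [(A,D),(A,E),(A,G),(B,C),(B,D),(B,E),(B,G),(C,E),(C,F),(C,G),(D,G),(E,F),(F,G)] [] (S C D (X (T A Z)) (S D F (X (T A Z)) (S D E (X (T A Z)) (T D Z)))),
Lem A C [(A,D),(A,E),(B,C),(B,D),(B,E),(B,G),(C,E),(C,F),(C,G),(D,G),(E,F),(F,G)] [] (S A C (Q A A) (S A G (Q A B) (S A F (S A B (X (T D Z)) (T A Z)) (T A Z)))),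
Lem A D [(A,C),(A,D),(A,E),(B,C),(B,D),(B,E),(B,G),(C,F),(C,G),(D,G),(E,F),(E,G),(F,G)] [(C,D),(D,E)] (S D F (M A [(A,C)] (V B A D F G E A A A A)) (T D Z)),
Lem A D [(A,D),(A,E),(B,C),(B,D),(B,E),(B,G),(C,F),(C,G),(D,G),(E,F),(F,G)] [(C,E)] (S E G (S C D (R A C (V7 A B G D E F C)) (S A C (S D E (X (T A Z)) (Q A D)) (T C Z))) (S D E (S A G (R A B (V6 F B D C E A)) (S A C (S A F (M D [] (V A C B E F G D A A A)) (S A B (X (T F Z)) (T A Z))) (P [A,E] [C,G] [B,D,F]))) (T E (S A C (S A G (R A D (V6 E C A F B D)) (T A (L Z))) (T A Z))))),
Lem A C [(A,D),(A,E),(B,C),(B,D),(B,E),(B,G),(C,F),(C,G),(D,G),(E,F),(F,G)] [] (S C E (Q A C) (Q A D)),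
Lem A D [(A,D),(A,E),(B,D),(B,E),(B,G),(C,F),(C,G),(D,G),(E,F)] [(A,F),(A,G),(F,G)] (S D F (S A B (R A D (V7 C D A G F E B)) (T A (L (M A [(A,C)] (V D A F E B G A A A A))))) (T F Z)),
Lem A A [(A,D),(A,E),(B,C),(B,D),(B,E),(B,G),(C,F),(C,G),(D,G),(E,F)] [(F,G)] (S A G (R A C (V6 F B D C E A)) (S E G (S A F (S A C (S B F (X (T D Z)) (S D F (X (P [A,F] [B,G] [C,D,E])) (T F Z))) (S A B (R A A (V7 C E B F G D A)) (T A Z))) (Q A D)) (T G Z))),
Lem A B [(A,D),(A,E),(B,C),(B,D),(B,E),(B,G),(C,F),(C,G),(D,G),(E,F)] [] (S F G (Q A C) (Q A A)),
Lem A C [(A,D),(A,E),(B,D),(B,E),(B,G),(C,F),(C,G),(D,G),(E,F)] [(B,C)] (S B F (S A B (R A B (V7 C B A G F E D)) (S A C (S A F (R A C (V7 G A E C D B F)) (S A G (R A C (V6 F A D C E B)) (T A (T C (L Z))))) (S A F (S C E (R A B (V7 G E A C B D F)) (T C Z)) (T A Z)))) (S A B (S A C (R A C (V7 F A D E C G B)) (S C D (S C E (S A F (R A C (V7 G A F B D C E)) (P [A,B] [C,F] [D,E,G])) (T C Z)) (T C Z))) (T B Z))),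
Lem A E [(A,D),(A,E),(B,D),(B,E),(B,G),(C,F),(C,G),(D,G),(E,F)] [] (S B C (Q A B) (Q A C)),
Lem A D [(A,D),(A,E),(B,D),(B,E),(B,G),(C,F),(D,G),(E,F)] [] (S C G (Q A E) (S E G (S A C (S C D (R A E (V7 F A B C E G D)) (S B C (R A B (V6 F B D E C A)) (T C Z))) (S B C (R A C (V7 A G C D E F B)) (T C Z))) (S F G (S A G (S C E (R A E (V6 B A F D E C)) (S A C (R A D (V6 E D F B A C)) (T C Z))) (T G Z)) (T G Z)))),
Lem A C [(A,D),(A,E),(B,D),(B,E),(B,G),(C,F),(D,G)] [] (S E F (Q A D) (S B F (S D E (R A D (V7 G E C D B F A)) (S C E (R A D (V6 A B F D E C)) (T E Z))) (S A F (R A D (V5 E D C B A)) (T F Z)))),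
Lem A B [(A,B),(A,D),(A,E),(B,C),(B,D),(B,E),(C,F),(D,G)] [(B,G)] (S A G (R A D (V6 E D F A B C)) (S E G (R A C (V7 G A C D E F B)) (T G Z))),
Lem A A [(A,D),(A,E),(C,F),(D,G)] [(A,B),(B,C),(B,G)] (T B (S A F (S E G (S C E (S A G (R A A (V6 C A D E F B)) (L (M A [(B,D)] (V A B E G C F A A A A)))) (T E (L Z))) (T E (L Z))) (T F (L Z)))),
Lem A B [(A,D),(A,E),(B,D),(B,E),(C,F),(D,G)] [] (S B G (Q A C) (S A B (S B F (R A B (V6 A B F D E C)) (S B C (Q A B) (T B Z))) (S B F (S B C (S A G (R A D (V6 E D F A B C)) (S A F (R A D (V7 E F G B A D C)) (T A (L (M A [(A,C)] (V B A D G F E A A A A)))))) (Q A A)) (R A A (V6 A B F D E C))))),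
Lem A F [(A,E),(B,F),(C,D),(D,F),(D,G)] [(B,D),(B,G)] (S B C (R A B (V6 C F A D B E)) (T B Z)),
Lem A A [(A,E),(C,F),(D,G)] [(A,B),(B,D),(B,F)] (T B (S C D (R A A (V7 D B A C G E F)) (T C (L Z)))),
Lem A F [(A,D),(A,E),(B,E),(C,F),(D,G)] [] (S B D (Q A B) (S A B (S B F (S D E (R A B (V5 A E C D B)) (S C D (S D F (S B G (R A D (V7 G A F B D C E)) (Q A F)) (T D (S E G (R A E (V7 G A F E D C B)) (T G Z)))) (T D (S E F (R A B (V7 B E D F A G C)) (T F (L Z)))))) (S B G (R A C (V7 G A C B D F E)) (T B Z))) (S B C (S B G (S B F (S D F (R A D (V7 G F E B D A C)) (R A F (V7 A D C B E G F))) (Q A A)) (T B Z)) (R A A (V7 A B G C E D F))))),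
Lem A B [(A,D),(B,E),(C,F),(D,G)] [(A,E),(A,F)] (S A B (R A F (V7 A G C B D F E)) (T A Z)),
Lem A C [(A,D),(B,E),(C,F),(D,G)] [(A,E)] (S A F (R A F (V6 A C B D F E)) (Q A B)),
Lem A B [(B,E),(C,F),(D,G)] [(A,D),(A,E)] (S A F (R A B (V7 A G B F D E C)) (R A A (V7 D A C E G F B))),
Lem A A [(B,E),(C,F),(D,G)] [(A,D)] (S A E (R A C (V7 A G C E D F B)) (Q A B)),
Lem A A [(B,E),(C,F)] [] (S D G (S A D (S A E (Q A F) (Q A C)) (Q A A)) (S A D (R A A (V7 G B C D E F A)) (S D F (S C D (S B D (S A G (R A F (V7 D F A B C G E)) (S C G (R A B (V7 A C B D G E F)) (T G Z))) (T D Z)) (T D Z)) (T D Z)))),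
Lem A B [(B,E)] [(C,F)] (S D F (R A A (V5 A B D C E)) (S F G (R A A (V7 A B F D E G C)) (T F Z))),
Lem A A [(B,E)] [] (S C F (Q A A) (Q A B))] (S B E (Q A A) (S C E (R A A (V5 A C B D E)) (S E G (R A A (V7 A E C D G F B)) (T E (R A B (V5 B A D C E))))))"
  by (simp only: check_rules target_defs)

lemma cert_8_14: "certified [A,B,C,D,E,F,G,H] 4 28 (V (Some tH1) (Some tH2) (Some tH3) (Some tQML7) (Some tQ3x) (Some tY9) None None None None) [Lem A A [(A,B),(A,H),(B,D),(B,E),(B,G),(B,H),(D,G),(D,H),(G,H)] [(A,D),(D,E)] (S D F (X (T G Z)) (S C D (X (T G Z)) (T D Z))),
Lem A B [(A,B),(A,H),(B,D),(B,E),(B,G),(B,H),(D,E),(D,F),(D,H),(G,H)] [(A,D),(A,E)] (S A G (X (T A Z)) (S A F (X (T A Z)) (T A Z))),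
Lem A A [(A,B),(A,H),(B,D),(B,E),(B,G),(B,H),(D,H),(G,H)] [] (S D G (S A D (X (T A Z)) (S D E (X (T G Z)) (Q A A))) (S A D (S D E (X (T A Z)) (R A A (V7 G B C D E F A))) (S D E (S D F (S A E (X (T A Z)) (Q A B)) (S C D (S A E (X (T A Z)) (R A B (V6 A B F D E C))) (T D Z))) (S C D (S D F (S A G (X (T A Z)) (S C G (X (T G Z)) (S F G (X (T G Z)) (T G Z)))) (T D Z)) (T D Z))))),
Lem A C [(A,B),(B,D),(B,E),(B,G),(B,H),(D,E),(D,F),(D,H),(F,H),(G,H)] [(E,F),(E,H)] (S E G (X (T C Z)) (S A E (X (T E Z)) (T E Z))),
Lem A D [(A,B),(B,D),(B,E),(B,G),(B,H),(D,E),(D,H),(F,H),(G,H)] [(A,D),(D,G),(E,H)] (S D F (S E F (X (T A Z)) (Q A C)) (S C D (S E G (X (T E Z)) (S A E (X (T E Z)) (S E F (X (T E Z)) (T E Z)))) (T D Z))),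
Lem A E [(A,B),(B,D),(B,E),(B,G),(B,H),(C,D),(D,F),(D,H),(F,H),(G,H)] [(D,G),(F,G)] (S E G (X (T G Z)) (S C G (X (T G Z)) (T G Z))),
Lem A D [(A,B),(B,D),(B,E),(B,G),(B,H),(D,H),(F,H),(G,H)] [(A,H),(E,H)] (S D G (S A G (X (T D Z)) (S E G (X (T D Z)) (S F G (X (T D Z)) (S C G (X (T D Z)) (T G Z))))) (S D E (S A D (S A G (X (T A Z)) (R A B (V8 A B C H G F E D))) (Q A D)) (S A D (R A D (V5 E B C D A)) (S D F (S C D (S F G (X (T A Z)) (Q A E)) (T D Z)) (T D Z))))),
Lem A B [(A,B),(B,D),(B,E),(B,G),(B,H),(D,H),(G,H)] [(A,H)] (S E H (R A A (V5 D B C E A)) (S F H (Q A D) (S C H (R A D (V6 A B F D E C)) (T H Z)))),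
Lem A F [(A,B),(B,D),(B,E),(B,G),(B,H),(G,H)] [(A,G),(F,G)] (S D G (R A B (V8 A B C D E F H G)) (S E G (S F G (R A D (V8 A B C E D F H G)) (S C G (R A D (V8 A B F E D C H G)) (T G Z))) (T G Z))),
Lem A E [(A,B),(B,D),(B,E),(B,G),(B,H),(C,H),(F,H),(G,H)] [(A,H),(D,H),(E,H)] (S A G (S D G (R A A (V8 D B C A E F H G)) (R A B (V8 D B C A E F H G))) (S F G (S E G (S F E (X (T A Z)) (R A E (V8 A B C H D F E G))) (S D G (S F D (X (T A Z)) (R A E (V8 A B C H E F D G))) (P [A,D,E] [G,H] [B,C,F]))) (Q A F))),
Lem A G [(A,B),(B,D),(B,E),(B,G),(B,H),(G,H)] [(A,H),(D,H)] (S E H (S F H (R A D (V5 A B C E D)) (S C H (R A D (V6 A B F E D C)) (T H Z))) (S C H (S F H (Q A E) (T H Z)) (T H Z))),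
Lem A H [(A,B),(B,D),(B,E),(B,G),(B,H)] [(A,H),(C,E),(D,H),(E,H),(G,H)] (S D G (S A D (R A B (V8 H B C A E F G D)) (R A G (V8 A B C H E F G D))) (S A D (R A G (V8 G B C H E F A D)) (S D E (R A F (V8 H B F A G C E D)) (P [A,E,G] [D,H] [B,C,F])))),
Lem A G [(A,B),(B,D),(B,E),(B,G),(B,H)] [] (S G H (S D H (S A H (Q A A) (Q A B)) (S A H (R A B (V5 D B C A E)) (Q A G))) (S E H (S A H (R A B (V7 G B C A D F E)) (R A G (V7 A B C G D F E))) (S A H (R A G (V7 E B C G D F A)) (S D H (S C H (S F H (R A E (V7 A B C E G F D)) (T H Z)) (T H Z)) (T H (S A C (S C G (S C D (S C E (S A D (X (T A Z)) (S D G (X (T D Z)) (S D E (X (T D Z)) (P [A,E,G] [D,H] [B,C,F])))) (Q A H)) (R A H (V5 A B C E D))) (R A H (V7 A B C D G F E))) (R A H (V5 D B C E A)))))))),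
Lem A B [(A,B),(A,E),(B,E),(B,G),(B,H),(E,G),(E,H)] [(B,C),(B,D),(B,F),(C,E),(D,E)] (S E F (R A A (V8 A E C G F D H B)) (P [B,E] [C,D,F] [A,G,H])),
Lem A I [(A,B),(A,E),(B,E),(B,G),(B,H),(E,G),(E,H)] [(B,C),(B,D),(B,F)] (S C E (R A A (V8 A E D G C F H B)) (S D E (R A A (V8 A E C G D F H B)) (Q A B))),
Lem A J [(A,B),(B,E),(B,G),(B,H),(C,H),(D,E),(E,G),(E,H),(G,H)] [(A,E),(B,C),(B,D),(C,E),(D,H)] (S A G (X (T F (T A Z))) (S C G (X (T F (T A Z))) (S D G (X (T F (T A Z))) (S F G (S C D (S C F (X (T A (M E [] (V F A B E D C H G A A)))) (T C (T A (T D (M E [] (V C A B G F D E H A A)))))) (T C (T D (M E [] (V C A B E D F G H A A))))) (T G Z))))),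
Lem B A [(A,B),(B,E),(B,G),(B,H),(C,H),(D,E),(D,H),(E,G),(E,H)] [(B,D),(G,H)] (S D G (S A G (X (T D Z)) (S C G (X (T D Z)) (S F G (X (T D Z)) (T G Z)))) (S A G (S C G (X (T F (T A Z))) (S F G (S A D (X (T A Z)) (S C D (X (T D Z)) (T D Z))) (T G Z))) (S C G (S F G (S C D (X (T A Z)) (S A D (X (T D Z)) (T D Z))) (T G Z)) (T G Z)))),
Lem A C [(A,B),(B,E),(B,G),(B,H),(D,E),(D,H),(E,G),(E,H)] [(B,C),(B,D),(B,F),(C,E),(E,F),(G,H)] (S A H (S F H (S D G (X (T F Z)) (R A C (V8 F H C E D G A B))) (S C H (S D G (X (T C Z)) (R A C (V8 C H F E D G A B))) (P [B,E,H] [C,F] [A,D,G]))) (S C H (Q B A) (S F H (R B A (V6 A B F D E C)) (T H Z)))),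
Lem A C [(A,B),(B,E),(B,G),(B,H),(D,E),(E,G),(E,H)] [(A,E),(B,C),(B,D),(B,F),(C,E),(E,F)] (S G H (S D H (R A I (V8 B E A C H F D G)) (S A H (S C H (R A A (V8 A H D E C F G B)) (R A B (V8 A B D C H F E G))) (S C H (Q A J) (S F H (R A J (V6 A B F D E C)) (T H Z))))) (S D H (Q A C) (S A H (S C H (R B A (V5 D E C A B)) (S F H (R B A (V6 D E F A B C)) (T H Z))) (S F H (S C H (S D G (R A C (V8 A B C D E F H G)) (S A G (S C G (R B A (V8 D E C A B F H G)) (S F G (R B A (V8 D E F A B C H G)) (T G Z))) (S C G (S F G (S A F (X (T D (M B [(A,F)] (V D A G E H C B A A A)))) (T A (T D (M B [(A,C)] (V D A G E H F B A A A))))) (T G Z)) (T G Z)))) (T H Z)) (T H Z))))),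
Lem B A [(A,B),(B,E),(B,G),(B,H),(D,E),(E,G),(E,H)] [(A,E),(B,C),(B,D),(B,F)] (S E F (R A D (V8 D E C G F A H B)) (S C E (R A D (V8 C E F G D A H B)) (Q A C))),
Lem A D [(A,B),(B,E),(B,G),(B,H),(E,G),(E,H)] [(A,E),(B,C),(B,D),(B,F),(D,E)] (S E F (S C E (R A D (V8 C E D G F A H B)) (R A C (V6 A B C F E D))) (S C E (R A C (V5 A B D C E)) (T E Z))),
Lem A I [(A,B),(B,E),(B,G),(B,H),(E,G),(E,H)] [(B,C),(B,D),(B,F)] (S A E (Q A I) (S D E (Q B A) (Q A D))),
Lem A C [(A,B),(B,E),(B,G),(B,H),(C,E),(D,E),(E,G)] [(A,E),(B,C),(B,D),(B,F),(E,F),(E,H)] (S G H (R A I (V7 A B C D G F E)) (S C G (R A I (V8 D E A F G H B C)) (S D G (R A D (V8 C E A H G F B D)) (S A G (R A D (V8 H B D C G F A E)) (T G Z))))),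
Lem A J [(A,B),(B,E),(B,G),(B,H),(D,E),(E,G)] [(A,E),(B,C),(B,D),(B,F),(E,H)] (S C E (S E F (R A E (V8 C E A D F H G B)) (Q A C)) (S E F (R A C (V6 A B D F E C)) (T E Z))),
Lem B A [(A,B),(B,E),(B,G),(B,H),(E,G)] [(B,C),(B,D),(B,F),(E,H)] (S A E (S D E (R B A (V8 H B C D E F A G)) (R A D (V8 H B C D E F A G))) (S D E (Q A J) (S C E (R A J (V5 A B D C E)) (T E Z)))),
Lem A B [(A,B),(B,E),(B,G),(B,H),(C,E),(C,G),(D,E),(D,G),(D,H),(E,F),(F,G)] [(A,D),(A,E),(A,G),(E,H),(G,H)] (S C H (S A C (X (T A (M B [(A,F)] (V H B E C G D A A A A)))) (T A Z)) (S F H (S A H (X (T A Z)) (T A (M B [(A,C)] (V H B E F G D A A A A)))) (T H Z))),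
Lem A A [(A,B),(A,F),(B,E),(B,G),(C,G),(D,E),(D,G),(E,F),(F,G)] [(A,E),(A,G),(B,C),(B,D),(B,F),(C,E),(C,F),(D,F),(E,G),(E,H),(F,H),(G,H)] (S A D (S C D (S D H (R A E (V8 A D B E H F C G)) (R A C (V8 B G A E D H C F))) (T C (T H (M B [(C,H)] (V F A B G D E C A A A))))) (S C D (R A J (V8 B G A E D H C F)) (T C (L Z)))),
Lem A D [(A,B),(B,G),(B,H),(C,G),(D,G),(F,G)] [(A,E),(A,G),(B,C),(C,E),(E,G),(E,H),(G,H)] (T E (S A F (S F H (S C F (R A F (V8 E F D A H B C G)) (R A B (V8 C G A E B H F D))) (S C F (S D C (R A D (V8 B G A E C H F D)) (S A C (R A D (V8 E F D B C H A G)) (T C Z))) (Q A A))) (S C F (R A J (V8 B G A E F H C D)) (T F (R A A (V8 D G A H F E B C)))))),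
Lem A D [(A,B),(B,E),(B,G),(B,H),(C,G),(D,E),(D,G),(F,G)] [(A,E),(A,G),(B,C),(B,D),(B,F),(E,G),(G,H)] (S E H (R A J (V8 A B C D E F H G)) (S E F (S C E (S C D (R B A (V8 F E A G C H D B)) (S D F (R A J (V8 B E A G D H F C)) (S D H (S A D (S A C (X (T F (M B [(A,C)] (V H B E D G F A A A A)))) (S A F (X (T C (M B [(A,F)] (V H B E D G C A A A A)))) (T A Z))) (Q A B)) (T D (R A B (V8 H B C D E F G A)))))) (Q A D)) (R A D (V6 A B F C E D)))),
Lem A F [(A,B),(A,F),(B,E),(B,G),(B,H),(C,F),(F,G),(F,H)] [(A,G),(B,C),(B,D),(B,F),(C,G),(D,F),(E,F),(E,G),(G,H)] (S A H (R B A (V8 E B C D A F H G)) (S C H (R A J (V8 A F D B H E C G)) (S E H (R A J (V8 A B C F H D E G)) (P [A,C,E] [G,H] [B,D,F])))),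
Lem A C [(A,B),(B,E),(B,G),(B,H),(D,G)] [(B,C),(B,D),(B,F),(C,F),(C,G),(D,F),(E,F),(E,G)] (T F (S D H (S E H (S H C (R A E (V8 D H A F C G E B)) (R A C (V8 A B D F H C E G))) (R A A (V8 D H E A F G B C))) (S E H (R A J (V8 A B C F H D E G)) (S A E (R A J (V7 G B C F A D E)) (T E (L Z)))))),
Lem A A [(A,B),(B,E),(B,G),(B,H)] [(A,F),(A,G),(B,C),(B,D),(B,F),(D,F),(E,F),(E,G)] (T F (S E H (R B A (V8 A B C D E F H G)) (S A H (R A J (V8 E B C F H D A G)) (P [E,C,A] [G,H] [B,D,F])))),
Lem A E [(A,B),(B,E),(B,G),(B,H),(D,G),(F,G),(F,H)] [(A,F),(A,G),(B,C),(B,D),(B,F),(C,G),(D,F),(E,G),(G,H)] (S E F (S C F (R A F (V5 E B C D A)) (R A C (V5 E B C D A))) (Q A A)),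
Lem A F [(A,B),(B,E),(B,H)] [(A,G),(B,C),(C,G),(E,G),(G,H)] (T G (S F H (S A F (S E F (S C F (R A H (V8 A F B E C D H G)) (S A E (R B A (V8 H B C D A F E G)) (S E H (R A J (V8 A B C F E D H G)) (S D E (S C E (R A B (V8 C E A G B H F D)) (T C (L Z))) (T E (S A H (R A J (V8 E B C F A D H G)) (S A C (S D A (R A B (V8 D A G E B H F C)) (T D (L Z))) (T C (L Z))))))))) (S C F (Q A F) (Q A C))) (Q A E)) (S E F (R A E (V8 H B C D A F G E)) (R A A (V8 E B C D H F G A))))),
Lem A D [(A,B),(B,E),(B,G),(B,H)] [(B,C),(B,D),(B,F)] (S E G (S E H (Q A I) (Q B A)) (S G H (R B A (V8 A B C D G F H E)) (S A G (S D G (R A J (V7 E B C D G F A)) (S C G (R A J (V7 E B D C G F A)) (T G Z))) (S F G (S D G (S C G (S A E (R B A (V8 H B C D A F E G)) (S D E (Q A D) (S C E (R A D (V5 A B D C E)) (T E Z)))) (Q A F)) (R A F (V5 A B D C E))) (R A F (V6 A B F D E C)))))),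
Lem B A [(A,B),(A,D),(D,E)] [(A,E),(A,F),(A,G),(B,C),(B,F),(B,H),(C,E),(D,F),(E,G),(E,H)] (S A H (S A C (R A A (V8 C A F G H E B D)) (T A (S D G (S D C (R A C (V8 E D F H C B A G)) (P [C,H,F] [D,B] [A,E,G])) (L (M E [] (V A D C F E B G H A A)))))) (T A (T E (S D G (S D H (R A C (V8 A D C F H B E G)) (P [H,F,C] [D,B] [A,E,G])) (L (M E [] (V E D H C A B G F A A))))))),
Lem A A [(A,B),(B,G)] [(A,E),(A,G),(B,C),(B,H),(C,E),(E,G),(E,H)] (T E (S A D (S A F (S A H (S A C (R A G (V7 B A E C D G F)) (R A D (V7 B A C E D G F))) (S A C (R A C (V8 D A H G C E B F)) (P [C,G,H] [A,E] [B,D,F]))) (Q B A)) (S A F (R B A (V6 A B C F E D)) (T A (S D H (S C D (S D G (R A A (V8 C D A F H B E G)) (L (M B [(A,B)] (V E A C F H D G A A A)))) (T C (L Z))) (T D (L Z))))))),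
Lem A A [] [(B,C),(B,D),(B,F),(B,H)] (T B (S D E (S E F (S C E (S E H (R A G (V8 B E A H C G D F)) (R A D (V8 B E H A C G D F))) (S E H (R A F (V7 D E C A F G B)) (Q A A))) (S E H (S E C (R A F (V8 D E F A H G B C)) (R A A (V8 A B F D E H G C))) (R A A (V6 A B F D E C)))) (S E F (S E H (S E C (R A F (V8 F E D A H G B C)) (R A A (V8 A B D F E H G C))) (R A A (V6 A B D F E C))) (R A A (V8 A B D C E H G F))))),
Lem A F [(A,B),(B,E),(B,G)] [(B,F),(B,H)] (S B C (S B D (R A G (V8 A B F D C H E G)) (R A D (V8 A B D F C H E G))) (S B D (R A D (V8 A B C F D H E G)) (Q A A))),
Lem A C [(A,B),(B,E),(B,G)] [(B,H)] (S B F (S B D (R A G (V8 A B C E D H F G)) (S B C (R A G (V8 A B H C E D F G)) (R A D (V8 A B C H E D F G)))) (Q A F)),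
Lem B A [(B,E),(B,G)] [(A,B),(B,D),(B,F)] (S B C (S B H (R A D (V8 C B A D H F E G)) (R A A (V8 C B A H E D G F))) (R A A (V8 E B A C G D H F))),
Lem A J [(B,E),(B,G)] [(A,B)] (S B D (R A C (V8 D B C F E H G A)) (S B F (R A F (V8 E B C H F A G D)) (Q B A))),
Lem A F [(B,G)] [(B,C),(B,E)] (S B H (S B F (R A F (V8 G B A D F C H E)) (R B A (V8 C B A E G F H D))) (S A B (R B A (V8 C B D E A H G F)) (R A A (V6 D B A C F E))))] (S B G (S B E (S A B (S B H (S B D (Q A G) (S B F (R A G (V6 A B C E F D)) (S B C (R A G (V5 A B D C E)) (Q A D)))) (Q A C)) (Q A J)) (S B C (R A J (V5 E B A D C)) (Q A F))) (S B E (S B C (R A J (V7 G B A D C F E)) (R A F (V7 A B C D G F E))) (S B C (R A F (V7 A B E D G F C)) (S B H (S A B (R B A (V8 C B D E A G H F)) (R A A (V8 D B A C F E H G))) (R A A (V7 A B C E D G F))))))"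
  by (simp only: check_rules target_defs)

text \<open>The excess 1 means one vertex of degree four and eight cubic ones.\<close>

lemma cert_9_14: "certified [A,B,C,D,E,F,G,H,I] 1 28 (V (Some tH1) (Some tH2) (Some tH3) (Some tQML7) (Some tQ3x) (Some tY9) None None None None) [Lem A A [(A,I),(B,C),(C,F),(C,H),(C,I),(D,H),(F,G),(G,H),(G,I)] [(A,C),(A,G),(A,H),(B,G),(B,H),(C,D),(D,F),(D,G),(D,I),(F,H),(F,I)] (S B F (X (T F Z)) (S A F (X (T E (T B Z))) (T F (S A D (S A E (X (T B (M C [(A,I)] (V B D A E F G H C A A)))) (T A (T B (T D (M C [(D,H)] (V A B C I G F E D A A)))))) (T A (T D (M C [(E,F)] (V A B C I G H D E A A)))))))),
Lem A A [(B,C),(C,F),(C,H),(C,I),(D,H),(F,G),(G,H),(G,I)] [(D,F),(F,I)] (X (S D I (X (P [A,E] [C,G,H,I] [B,D,F])) (S B I (X (T I Z)) (S A I (Q A A) (T I (R A A (V5 E B C D A))))))),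
Lem A B [(A,D),(A,F),(B,C),(B,D),(C,F),(C,H),(C,I),(D,H),(E,G),(F,G),(G,H)] [(A,B)] (X (S A E (X (T I Z)) (T A (T E (M F [] (V C B D H G F A I E A)))))),
Lem A C [(B,C),(C,F),(C,H),(C,I),(E,G),(F,G),(G,H)] [(A,B),(A,C),(A,D),(A,G),(A,H),(B,F),(B,G),(B,H)] (T A (S B E (X (T D (M C [(B,E)] (V F A B G H D I C A A)))) (T B Z))),
Lem A C [(A,F),(B,C),(C,F),(C,H),(C,I),(D,H),(E,G),(F,G),(G,H)] [] (X (S B D (S A B (X (T B (S D I (X (T E (M C [(E,I)] (V A B C F G H D E A A)))) (T D (T I (M C [(E,I)] (V A B C F G H D E A A))))))) (S A D (Q A B) (Q A C))) (S A B (S D A (R A B (V8 D B C A E H G F)) (R A C (V8 D B C A E H G F))) (T B Z)))),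
Lem A B [(B,C),(C,F),(C,H),(C,I),(D,H),(F,G),(G,H)] [(D,F),(D,G),(F,H),(F,I),(G,I)] (S B F (X (T F Z)) (S A F (X (T F (S E G (Q A C) (T G (R A A (V9 A I C D E F G H B)))))) (T F (X (T F (S A G (R A C (V5 E B C D A)) (T G (R A A (V9 E I C D A F G H B))))))))),
Lem A D [(B,C),(C,F),(C,H),(C,I),(D,H),(F,G),(G,H)] [(D,F),(D,G),(F,H),(F,I)] (S G I (Q A A) (Q A B)),
Lem A E [(B,C),(C,F),(C,H),(C,I),(D,H),(F,G),(G,H)] [(D,G),(F,H)] (S D F (X (P [A,B,E,I] [F,H] [C,D,G])) (S F I (X (T F Z)) (Q A D))),
Lem A F [(B,C),(C,F),(C,H),(C,I),(F,I)] [(D,I),(H,I)] (S G I (X (T I Z)) (S B I (X (T I Z)) (S A I (X (T I Z)) (T I Z)))),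
Lem A G [(B,C),(C,F),(C,H),(C,I),(D,H),(G,H)] [] (X (T H (S F G (Q A E) (S D F (S F I (X (T F Z)) (R A D (V7 A B C G E F D))) (S F I (S D I (X (T I Z)) (Q A F)) (S D I (R A E (V9 A B C G E I D H F)) (S G I (R A B (V9 A B C D E I G H F)) (S B G (R A E (V6 A F C D E B)) (T G (S E I (S A I (S E F (X (T D (T B Z))) (T F Z)) (T I Z)) (T I Z))))))))))),
Lem A H [(B,C),(C,F),(C,H),(C,I),(G,H)] [(B,H),(D,H),(H,I)] (S A H (R A G (V5 D B C A E)) (S F H (X (T H Z)) (T H (R A G (V5 A B C E D))))),
Lem A F [(B,C),(C,F),(C,H),(C,I)] [] (S G H (S H I (X (T H Z)) (S B H (X (T H Z)) (S D H (Q A G) (Q A H)))) (S F H (S H I (X (T H Z)) (R A F (V9 A B C G E F D I H))) (S B H (R A F (V9 A I C G E B D F H)) (S H I (R A F (V9 A F C G E I D B H)) (S D H (R A H (V9 A B C G E I D H F)) (T H (R A G (V7 D B C A G F E)))))))),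
Lem A D [(A,F),(A,G),(A,I),(B,I),(C,F),(C,H),(C,I),(D,F)] [(A,B),(A,C),(A,D),(A,E),(A,H),(B,C),(B,F),(C,D),(C,E),(C,G),(D,I),(E,F),(E,I),(F,G),(F,H),(G,I),(H,I)] (S B D (S B H (S D H (S G H (X (T B Z)) (S D G (X (T B Z)) (T G (T E Z)))) (S B G (X (T E (M C [(D,F)] (V A G B I C H E D A A)))) (S B E (R A B (V9 F E B A G H C I D)) (T E (T G Z))))) (S B E (S B G (S G E (X (T G Z)) (R A D (V9 F D B C H G A I E))) (T B (T E (T G (T H (M C [(B,I)] (V F A B C H E G D A A))))))) (T E (T H Z)))) (S D E (S D G (S D H (S G H (X (T G Z)) (R A D (V9 B E D C I G A F H))) (T D (T E (T B (T H (M C [(C,H)] (V A F C I B E D G A A))))))) (T D (T E (T B (T G (M C [(A,G)] (V B E A I C F D H A A))))))) (T E (T B Z)))),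
Lem A D [(A,F),(C,F),(C,H),(D,F)] [(A,D),(B,F),(C,D),(C,E),(C,G),(D,I),(E,F),(E,I),(F,G),(F,H),(F,I),(G,I),(H,I)] (T I (S A G (S A H (R A A (V9 D G A B E F C I H)) (S A E (R A C (V9 D E A B H F C I G)) (Q A D))) (S A H (S E A (R A E (V9 B I A D G H C F E)) (P [B,G,E,D] [C,A] [F,H,I])) (T A (R A D (V7 A B C D G F E)))))),
Lem A C [(A,F),(A,I),(C,F),(C,H),(C,I),(D,F)] [(A,C),(A,D),(B,C),(B,F),(C,D),(C,E),(C,G),(D,I),(E,F),(F,G),(F,H),(F,I),(H,I)] (S B I (S E I (R A E (V9 D B I H G A F C E)) (S G I (R A E (V9 D B I H E A F C G)) (Q A D))) (S E I (S G I (R A E (V9 D E I H B A F C G)) (R A D (V5 A E C D B))) (R A D (V7 A G C D B F E)))),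
Lem A D [(C,F),(D,F)] [(A,C),(A,D),(A,E),(A,H),(A,I),(B,C),(C,D),(D,H),(D,I),(E,F),(F,H),(F,I)] (T A (S B D (R A C (V9 D E A C H F I G B)) (R A D (V9 G E F B H A I C D)))),
Lem A E [(C,H),(C,I)] [(B,C),(B,F),(C,E),(C,G),(E,F),(F,G),(F,H),(F,I),(H,I)] (T F (S A I (S D I (S B I (R A E (V9 E B I H G A F C D)) (S E I (R A E (V9 B D I H G A F C E)) (S G I (R A E (V9 B D I H E A F C G)) (P [B,E,G,H] [F,I] [A,C,D])))) (Q A C)) (S A H (R A C (V9 H B F I E C G D A)) (S D I (R A C (V5 D B C A E)) (S D H (R A C (V9 D B C A E F G I H)) (S E I (S E H (S D E (S A E (R A H (V9 B D E C G I F A H)) (Q A D)) (R A D (V5 D B C A E))) (R A D (V9 H B F I E C G A D))) (R A D (V9 I B F H E C G A D)))))))),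
Lem A C [(C,F),(C,H),(C,I),(D,F)] [(A,C),(A,F),(B,C),(C,E),(C,G),(F,H),(F,I),(H,I)] (S B F (S F G (R A G (V9 A B F H E D I C G)) (S E F (R A G (V9 A B F H G D I C E)) (R A E (V5 B A C D E)))) (S E F (S G F (R A G (V9 A D F H B E I C G)) (R A E (V7 D A C E G F B))) (R A E (V7 D A C G B F E)))),
Lem A D [(C,F),(C,H),(C,I)] [(A,C),(B,C),(C,D),(C,E),(C,G),(D,F),(F,H),(F,I),(H,I)] (S F G (R A C (V7 D A C G B F E)) (S B F (S A F (S E F (R A G (V9 D B F H G A I C E)) (R A E (V5 B D C A E))) (R A E (V7 B D C E G F A))) (R A E (V5 A B C E D)))),
Lem A C [] [(A,C),(B,C),(C,D),(C,E),(C,G)] (T C (S D F (S A F (S B F (R A G (V9 E A F H G B I C D)) (S F G (R A G (V9 B A F H E D I C G)) (S E F (R A G (V9 B A F H G D I C E)) (Q A E)))) (Q A C)) (Q A D))),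
Lem A G [(C,F),(C,H),(C,I)] [(B,C),(C,E)] (S C G (R A F (V7 A F C D E G B)) (S C D (R A F (V5 A D C B E)) (S A C (R A F (V5 B A C D E)) (Q A C)))),
Lem A E [(C,F),(C,H),(C,I)] [] (S B C (Q A F) (S C E (R A F (V5 A E C D B)) (Q A G))),
Lem A H [(C,F),(C,I)] [(B,C),(C,E),(C,G),(C,H)] (S C D (S A C (R A F (V8 B A C E G D H F)) (R A C (V8 A B C E G D H F))) (R A C (V8 B D C E G F H A))),
Lem A A [(C,F),(C,I)] [(B,C),(C,E),(C,H)] (S C G (S C D (R A F (V8 A D C B E F H G)) (S A C (R A F (V8 B A C D E F H G)) (R A C (V8 A B C D E F H G)))) (Q A H)),
Lem A F [(C,F),(C,I)] [(C,H)] (S C E (S C B (R A F (V8 A B C D H E G F)) (R A G (V8 A H C D B E G F))) (S B C (R A G (V8 A E C D H B G F)) (Q A A))),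
Lem A A [(C,I)] [(C,F)] (S F I (S I H (R A E (V9 A B I D E C G H F)) (R A F (V9 A B I D E C G H F))) (S A C (R A F (V8 B D C E G A H F)) (S C D (S E C (R A G (V8 B A C G F E H D)) (R A A (V8 B E C G A D H F))) (S B C (R A A (V8 E A C G D B H F)) (S C E (R A H (V8 G A C H B E D F)) (T C (R A D (V9 A B C F D I E G H))))))))] (S C I (S C F (S C H (Q A E) (Q A F)) (Q A A)) (S F I (R A A (V9 A B I D E C G H F)) (S A I (R A A (V9 B D I E F C G H A)) (S H I (R A A (V9 B C I D E A G F H)) (S G I (R A A (V9 B C I D E A F H G)) (R A C (V9 A C I F G B H D E)))))))"
  by (simp only: check_rules target_defs)

section \<open>Graphs with 15 edges\<close>

text \<open>The graph is K6, which contains H1.\<close>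

lemma cert_6_15: "certified [A,B,C,D,E,F] 12 30 (V (Some tH1) (Some tH2) (Some tH3) (Some tY9) (Some tP7) (Some tPrism) (Some tCML10) None None None) [] (L (M A [] (V C A D E B F A A A A)))"
  by (simp only: check_rules target_defs)

lemma cert_7_15: "certified [A,B,C,D,E,F,G] 9 30 (V (Some tH1) (Some tH2) (Some tH3) (Some tY9) (Some tP7) (Some tPrism) (Some tCML10) None None None) [Lem A A [(A,B),(A,D),(A,E),(A,F),(B,C),(B,D),(B,E),(B,G),(C,E),(C,F),(C,G),(D,G),(E,F),(F,G)] [] (S C D (M A [(A,D)] (V B A E F C G A A A A)) (S D E (M A [(A,F)] (V C A E D B G A A A A)) (S D F (M E [] (V B A D E G C F A A A)) (T D Z)))),
Lem A A [(A,D),(A,E),(B,C),(B,D),(B,E),(B,G),(C,E),(C,F),(C,G),(D,G),(E,F),(F,G)] [] (S A C (S C D (S B F (X (T A Z)) (S A F (M A [(A,D)] (V B A E F C G A A A A)) (S D F (X (T A Z)) (T F Z)))) (S D E (S D F (X (T A Z)) (S A F (M A [(A,D)] (V B A E F C G A A A A)) (S B F (X (T A Z)) (T F Z)))) (S D F (M A [(A,D)] (V B A E F C G A A A A)) (T D Z)))) (S A B (S A F (Q A A) (S A G (S D F (M A [(A,E)] (V B A C F G D A A A A)) (S B F (X (T D Z)) (T F Z))) (T A Z))) (S A G (S A F (R A A (V7 A G C D F E B)) (T A Z)) (T A Z)))),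
Lem A B [(A,C),(A,D),(A,E),(B,C),(B,D),(B,E),(B,G),(C,F),(C,G),(D,E),(D,G),(E,F),(F,G)] [(A,G),(C,D),(C,E),(E,G)] (S A F (S D F (M A [(A,C)] (V B A E F D G A A A A)) (S B F (M A [(A,C)] (V D A E F B G A A A A)) (L (M A [(D,G)] (V B A C F D E A A A A))))) (S A B (M A [(E,F)] (V A B C G E D A A A A)) (T A Z))),
Lem A C [(A,C),(A,D),(A,E),(B,C),(B,D),(B,E),(B,G),(C,F),(C,G),(D,E),(D,G),(E,F),(F,G)] [(C,D),(C,E),(E,G)] (S A G (M A [(E,F)] (V A E C B G D A A A A)) (Q A B)),
Lem A D [(A,D),(A,E),(B,C),(B,D),(B,E),(B,G),(C,F),(C,G),(D,G),(E,F),(F,G)] [] (S C E (Q A A) (S E G (S D E (S C D (R A A (V7 A B G D E F C)) (S A C (R A A (V7 A B G D C F E)) (T C Z))) (S C D (R A A (V7 A B G D E F C)) (S A C (S D F (M A [(A,C)] (V B A D F G E A A A A)) (T D Z)) (T C Z)))) (S D E (S C D (S A G (R A A (V6 F B D C E A)) (S A C (R A A (V7 F B D G E A C)) (P [A,E] [C,G] [B,D,F]))) (S A C (Q A C) (T C Z))) (T E (L (M A [(A,E)] (V B A D F C G A A A A))))))),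
Lem A C [(A,D),(A,E),(B,C),(B,D),(B,E),(B,G),(C,F),(C,G),(D,G),(E,F)] [] (S F G (Q A D) (S A F (S B F (R A D (V7 G B E C D A F)) (S D F (S A B (R A A (V7 C D A G F E B)) (S A G (R A C (V6 E D B A F C)) (P [A,F] [B,G] [C,D,E]))) (T F Z))) (S D F (S B F (R A D (V7 A F C E D G B)) (T F (L (M A [(C,F)] (V C A D G B E A A A A))))) (T F Z)))),
Lem A E [(A,D),(A,E),(B,D),(B,E),(B,G),(C,D),(C,F),(C,G),(D,G),(E,F)] [(B,C)] (S A C (S A B (R A A (V7 F A D E C G B)) (S B F (R A D (V7 E C G A F B D)) (T B Z))) (S C E (S A B (S B F (R A D (V7 E B G A F C D)) (S A F (R A D (V7 G A F B D C E)) (P [A,B] [C,F] [D,E,G]))) (S A F (R A C (V6 F D B C A E)) (T A Z))) (T C Z))),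
Lem A B [(A,D),(A,E),(B,D),(B,E),(B,G),(C,F),(C,G),(D,G),(E,F)] [(B,C),(C,D)] (S A C (S C E (S D E (S D F (S B F (R A A (V7 G F E B C A D)) (R A E (V7 A F B D C G E))) (S B F (R A D (V7 B C A F G D E)) (P [B,D] [C,F] [A,E,G]))) (S D F (S E G (R A C (V7 A G D E C F B)) (S B F (R A B (V7 G F C B D A E)) (S A B (R A B (V7 G A C B D F E)) (T B Z)))) (T D Z))) (T C (L (M A [(A,C)] (V D A F E B G A A A A))))) (T C Z)),
Lem A A [(A,D),(A,E),(B,D),(B,E),(B,G),(C,F),(C,G),(D,G),(E,F)] [] (S B C (Q A C) (S C D (Q A E) (Q A B))),
Lem A B [(A,D),(A,E),(B,D),(B,G),(C,F),(D,G),(E,F),(E,G)] [(C,G)] (S C D (S B C (R A E (V7 A G C D E F B)) (S A C (R A A (V7 F A B C E G D)) (T C Z))) (S B C (R A B (V7 A G C D E F B)) (T C Z))),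
Lem A D [(A,D),(A,E),(A,G),(B,D),(B,E),(C,F),(D,G),(E,F),(F,G)] [(C,G),(E,G)] (S C E (R A A (V6 B A F D E C)) (S D E (S B C (R A D (V7 C E A B F G D)) (T C Z)) (T E (L Z)))),
Lem A E [(A,D),(A,E),(B,D),(B,E),(B,G),(C,F),(D,G),(E,F)] [] (S C G (Q A A) (S E G (Q A B) (S F G (S A G (Q A D) (T G Z)) (T G Z)))),
Lem A C [(A,D),(A,E),(B,D),(B,E),(B,G),(C,F),(D,G)] [] (S E F (Q A E) (S A F (R A E (V5 E D C B A)) (S F G (S B F (S C E (R A C (V6 C B D F E A)) (S D E (R A B (V7 G A C D B F E)) (T E Z))) (T F Z)) (T F Z)))),
Lem A E [(A,D),(A,E),(B,D),(B,E),(C,F),(D,G)] [(B,G)] (S E G (S B F (S C G (S B C (R A E (V7 G B E C D A F)) (S A B (R A A (V7 E D F A G C B)) (T B (L (M A [(B,D)] (V C A E G B F A A A A)))))) (S F G (S A G (R A D (V5 D E C A B)) (T G (L (M A [(D,G)] (V C A E D B F A A A A))))) (T G Z))) (S A B (R A C (V7 G A C D E F B)) (T B (L (M A [(B,C)] (V D A F E B G A A A A)))))) (S A G (R A C (V5 B A C D E)) (T G Z))),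
Lem A D [(A,D),(A,E),(B,D),(B,E),(C,F),(D,G)] [] (S B G (Q A C) (Q A E)),
Lem A C [(A,D),(A,E),(B,E),(C,F),(D,E),(D,G)] [(A,B),(B,D)] (S B G (R A C (V7 B D C E G F A)) (T B Z)),
Lem A A [(A,D),(A,E),(B,E),(C,D),(C,F),(D,F),(D,G)] [(B,D),(D,E)] (S C E (S B F (R A D (V5 A C B D E)) (S B C (R A C (V6 F B A D C E)) (T B Z))) (S E G (R A D (V7 A G C E D F B)) (T E (L Z)))),
Lem A C [(A,D),(A,E),(B,E),(C,F),(D,G)] [(B,D)] (S D E (S A B (R A D (V5 A E C D B)) (Q A C)) (S C D (S D F (Q A A) (T D (L (M A [(A,D)] (V C A E G B F A A A A))))) (T D (L (M A [(A,D)] (V C A F E B G A A A A)))))),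
Lem A D [(A,D),(A,E),(B,E),(C,F),(D,G)] [] (S B D (Q A D) (Q A C)),
Lem A E [(A,D),(B,E),(C,F),(D,G)] [(A,E)] (S E G (R A C (V7 G A C E D F B)) (S E F (S C E (S D E (S A G (R A A (V7 D G C E A F B)) (S B G (R A E (V7 G E C D B F A)) (T G Z))) (T E Z)) (T E (L (M A [(B,E)] (V C A D G B F A A A A))))) (T E (L (M A [(B,E)] (V C A F D B G A A A A)))))),
Lem A C [(A,D),(B,E),(C,F),(D,G)] [] (S A E (Q A D) (Q A E)),
Lem A E [(B,E),(C,F),(D,G)] [(A,D)] (S A G (R A C (V7 A B C G E F D)) (S A F (R A E (V7 A G B F D E C)) (T A Z))),
Lem A A [(B,E),(C,D)] [(A,G),(D,G)] (S F G (R A E (V7 A B C G E D F)) (T G Z)),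
Lem A A [(B,E),(C,F)] [] (S D G (S A D (Q A C) (Q A E)) (S B D (S C D (S A G (R A D (V7 D F A B C G E)) (Q A A)) (R A A (V7 G B F C E A D))) (R A A (V7 G C E B F A D)))),
Lem A A [(B,E)] [] (S C F (Q A A) (S F G (R A A (V7 A B F D E G C)) (S D F (R A A (V5 A B D C E)) (T F Z))))] (S B E (Q A A) (S B D (R A A (V5 A B C E D)) (S B F (R A A (V6 A B C D F E)) (T B (L (M A [(A,B)] (V C A E G D F A A A A)))))))"
  by (simp only: check_rules target_defs)

lemma cert_8_15: "certified [A,B,C,D,E,F,G,H] 6 30 (V (Some tH1) (Some tH2) (Some tH3) (Some tY9) (Some tP7) (Some tPrism) (Some tCML10) None None None) [Lem A A [(A,C),(A,F),(A,H),(B,C),(C,D),(C,E),(C,F),(C,G),(C,H),(E,F),(F,H)] [(G,H)] (S E H (X (T A Z)) (S B H (X (T A Z)) (S D H (X (T A Z)) (T H Z)))),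
Lem A B [(A,C),(A,D),(A,F),(A,G),(B,C),(C,D),(C,E),(C,F),(C,G),(C,H),(E,F),(F,H)] [(A,E),(D,E)] (S E H (X (T B Z)) (S B E (X (T E Z)) (T E Z))),
Lem A B [(A,C),(A,F),(B,C),(C,D),(C,E),(C,F),(C,G),(C,H),(E,F),(F,H)] [] (S A H (S G H (X (T A Z)) (Q A A)) (S A E (S G E (X (T A Z)) (R A A (V8 A B C D H F G E))) (S A D (S A G (S D E (X (T B Z)) (Q A B)) (S A B (S B E (X (T G Z)) (R A B (V7 A G C B E F D))) (T A Z))) (S A G (S A B (S B E (X (T D Z)) (R A B (V5 A D C B E))) (T A Z)) (T A Z))))),
Lem A A [(A,C),(B,C),(C,D),(C,E),(C,F),(C,G),(C,H),(F,H)] [(B,F),(E,F)] (S A F (S F G (R A B (V7 A B C E G F D)) (S D F (R A B (V5 D B C E A)) (T F Z))) (S D F (S G F (R A B (V7 G A C B D F E)) (T F Z)) (T F Z))),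
Lem A C [(A,C),(B,C),(C,D),(C,E),(C,F),(C,G),(C,H),(F,H)] [(E,F)] (S B F (S A F (R A B (V5 A E C D B)) (S F G (R A B (V7 B E C A G F D)) (S D F (R A B (V5 D E C A B)) (T F Z)))) (Q A A)),
Lem A D [(A,C),(A,D),(A,E),(A,F),(A,G),(B,C),(C,D),(C,E),(C,F),(C,G),(D,E)] [(D,F),(D,G)] (S B D (X (T E Z)) (S D H (X (T E Z)) (T D Z))),
Lem A D [(A,C),(A,D),(A,E),(A,F),(A,G),(B,C),(C,D),(C,E),(C,F),(C,G)] [] (S D E (S D G (X (T B Z)) (S D F (X (T B Z)) (Q A D))) (S D F (S D G (X (T B Z)) (R A D (V7 A B C D F G E))) (S B D (S D H (S B E (X (T B Z)) (S E G (X (T E Z)) (S E F (X (T E Z)) (T E Z)))) (S D G (X (T G Z)) (T D Z))) (S D H (S D G (X (T G Z)) (T D Z)) (T D Z))))),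
Lem A E [(A,C),(A,D),(A,E),(A,G),(A,H),(B,C),(C,D),(C,E),(C,F),(C,G),(F,G)] [(A,B),(C,H)] (S D G (X (T D Z)) (S E G (X (T E Z)) (S G H (S D H (X (T B Z)) (S B H (X (T H Z)) (S F H (X (T B Z)) (T H Z)))) (S B G (S B E (X (T B Z)) (S B H (X (T B Z)) (S B F (X (T B Z)) (T B Z)))) (T G Z))))),
Lem A F [(A,C),(A,D),(A,E),(A,G),(A,H),(B,C),(C,D),(C,E),(C,F),(C,G)] [(A,B),(A,F),(C,H),(F,G)] (S D F (R A E (V7 A B C E G F D)) (S E F (R A E (V7 A B C D G F E)) (T F Z))),
Lem A G [(A,C),(A,D),(A,E),(A,G),(B,C),(B,D),(C,D),(C,E),(C,F),(C,G),(D,G)] [(A,B),(A,F),(D,F)] (S B F (S F G (X (T B Z)) (S E F (S F H (X (T B Z)) (T F Z)) (T F Z))) (S B G (X (T B Z)) (S B E (S B H (X (T E Z)) (T B Z)) (T B Z)))),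
Lem A H [(A,C),(A,D),(A,E),(A,G),(B,C),(C,D),(C,E),(C,F),(C,G),(D,G),(D,H)] [(A,B),(A,F)] (S F G (X (R A G (V7 A F C G E B D))) (S G H (X (P [B,E,F] [D,G] [A,C,H])) (S E G (X (T B Z)) (S B G (R A G (V7 A B C G E F D)) (T G Z))))),
Lem A I [(A,C),(A,D),(A,E),(A,G),(B,C),(C,D),(C,E),(C,F),(C,G),(D,G)] [(A,B),(A,F),(B,D),(D,E),(D,F)] (S D H (Q A H) (T D Z)),
Lem A J [(A,C),(A,D),(A,E),(A,G),(B,C),(C,D),(C,E),(C,F),(C,G),(D,F),(D,H)] [(A,B),(A,F),(D,G)] (S F G (S E G (X (T B Z)) (S G H (X (T B Z)) (S B G (X (T F Z)) (T G Z)))) (S E G (S G B (R A G (V7 A B C G D F E)) (R A I (V7 A F C G D B E))) (S B G (S G H (S E F (X (T B Z)) (S B F (X (T B Z)) (T F Z))) (T G Z)) (T G Z)))),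
Lem A I [(A,C),(A,D),(A,E),(A,G),(B,C),(C,D),(C,E),(C,F),(C,G)] [(A,B),(A,F),(C,H)] (S A H (S F G (Q A E) (Q A F)) (S D G (S B D (S D F (X (T G Z)) (Q A G)) (S D E (S D H (X (T B Z)) (S D F (X (T B Z)) (P [A,D] [B,F,H] [C,E,G]))) (S D F (R A G (V6 A F C D E B)) (Q A I)))) (S D F (S D E (S D B (X (T E Z)) (R A G (V7 A F C D G B E))) (S D H (Q A J) (S B D (S F G (S E F (X (T B Z)) (S B F (X (T B Z)) (S F H (X (T G Z)) (T F Z)))) (S E G (S G B (R A G (V7 A B C G D F E)) (R A I (V7 A F C G D B E))) (S B G (S G H (X (T B Z)) (T G Z)) (T G Z)))) (T D Z)))) (S D H (S D E (R A H (V7 A B C D G F E)) (S B D (R A J (V7 A F C D G B E)) (T D Z))) (S D E (S B D (R A G (V7 A B C D G F E)) (T D Z)) (T D Z)))))),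
Lem A G [(A,C),(A,D),(A,G),(A,H),(B,C),(B,D),(B,H),(C,D),(C,E),(C,F),(C,G),(D,H)] [(A,B),(B,G)] (S B E (X (T F Z)) (S B F (X (T E Z)) (T B Z))),
Lem A G [(A,C),(A,D),(A,G),(A,H),(B,C),(B,D),(C,D),(C,E),(C,F),(C,G),(D,H)] [(A,B),(C,H),(D,G)] (S B H (S B G (X (T E Z)) (Q A G)) (S G H (S G B (X (T E Z)) (R A G (V7 D G C A E F B))) (S E H (S F H (S B G (X (T B Z)) (S F G (X (T B Z)) (T G Z))) (T H Z)) (T H Z)))),
Lem A J [(A,C),(A,D),(A,G),(A,H),(B,C),(B,D),(C,D),(C,E),(C,F),(C,G)] [(A,B),(D,E),(D,G),(D,H)] (S D F (R A J (V7 D E C A F G B)) (T D Z)),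
Lem A J [(A,C),(A,D),(A,G),(A,H),(B,C),(C,D),(C,E),(C,F),(C,G)] [(A,B),(A,E),(A,F),(C,H)] (S B D (S D G (S D F (R A D (V5 D E C A B)) (S D E (R A D (V6 D F C E A B)) (R A I (V5 D E C A B)))) (S D E (S D F (R A D (V7 D G C F A B E)) (R A I (V7 D F C A B G E))) (S D H (Q A G) (Q A J)))) (S D G (S D E (S D F (R A D (V6 D B C F A E)) (R A I (V6 D F C A E B))) (S D F (R A H (V6 D B C A F E)) (P [A,D] [B,E,F] [C,G,H]))) (S D E (S D H (R A G (V5 A E C D B)) (R A J (V5 A E C D B))) (S D H (S D F (R A G (V6 A F C D B E)) (T D Z)) (T D Z))))),
Lem A G [(A,C),(A,D),(A,G),(B,C),(C,D),(C,E),(C,F),(C,G)] [(A,B),(A,E),(A,F),(C,H)] (S A H (Q A J) (T A Z)),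
Lem A H [(A,C),(A,D),(A,G),(B,C),(C,D),(C,E),(C,F),(C,G)] [(A,E),(C,H)] (S A B (S A F (R A D (V6 A E C F B D)) (R A I (V6 A F C B D E))) (S A F (R A I (V6 A B C D F E)) (Q A G))),
Lem A G [(A,C),(A,G),(B,C),(C,D),(C,E),(C,F),(C,G)] [(A,D),(C,H)] (S A H (S A E (R A H (V5 A B C E D)) (S A B (S A F (R A I (V6 A D C B F E)) (R A G (V5 A D C B E))) (S A F (R A J (V6 A B C F D E)) (T A Z)))) (S A E (R A H (V5 A B C E D)) (S A B (S A F (R A I (V6 A D C B F E)) (R A G (V5 A D C B E))) (T A Z)))),
Lem A G [(A,C),(B,C),(C,D),(C,E),(C,F),(C,G)] [(C,H)] (S A G (S A D (S A E (S A F (Q A D) (S A B (R A D (V6 A F C B D E)) (Q A I))) (Q A H)) (Q A G)) (S F G (R A G (V7 G B C A D E F)) (S E G (R A G (V7 G B C A D F E)) (S G H (S B G (S G D (R A J (V7 G A C D E F B)) (T G Z)) (T G Z)) (T G Z))))),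
Lem A H [(A,C),(A,D),(A,F),(A,G),(B,C),(B,F),(C,D),(C,E),(C,F),(D,E),(D,F),(D,H)] [(A,B),(B,D),(B,E)] (S B H (X (T B Z)) (T B Z)),
Lem A J [(A,C),(A,D),(A,F),(B,C),(B,F),(C,D),(C,E),(C,F),(D,E),(D,F),(D,H)] [(C,G),(D,G),(E,F),(F,G)] (S A E (X (T E Z)) (S A G (X (S B E (X (T B Z)) (Q A H))) (T G (T E Z)))),
Lem A I [(A,C),(A,D),(A,F),(B,C),(B,F),(C,D),(C,E),(C,F),(D,E),(D,F),(D,H)] [(C,G),(D,G)] (S E F (X (T A Z)) (S F G (X (T A Z)) (Q A J))),
Lem A H [(A,C),(A,D),(A,F),(B,C),(C,D),(C,E),(C,F),(D,E),(D,F),(D,H)] [(B,F),(C,G),(D,G),(E,F)] (S F G (S F H (X (T A Z)) (S A H (X (S H E (X (T H Z)) (R A H (V8 F H D C E A G B)))) (S A E (X (T E Z)) (S A B (X (S B E (X (T B Z)) (R A H (V6 F B C D E A)))) (P [A,F] [B,E,H] [C,D,G]))))) (S F H (R A J (V8 A H D C E F G B)) (T F Z))),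
Lem B A [(A,C),(A,D),(A,F),(B,C),(C,D),(C,E),(C,F),(D,E),(D,F),(D,H)] [(B,D),(B,F),(C,G),(D,G)] (S E F (S F G (X (T A Z)) (S E G (X (T A Z)) (T G (T B Z)))) (Q A H)),
Lem B B [(A,B),(A,C),(A,D),(A,H),(B,C),(B,E),(C,D),(C,E),(C,F),(D,E),(D,F),(D,H)] [(A,G),(C,G),(C,H),(D,G),(E,H)] (S E G (X (T B Z)) (T G (T H Z))),
Lem B B [(A,B),(A,C),(A,D),(A,H),(B,C),(C,D),(C,E),(C,F),(D,E),(D,F),(D,H)] [(A,G),(B,D),(C,G),(C,H),(D,G)] (S B E (S E H (X (T B Z)) (Q B B)) (S B F (S F H (X (T B Z)) (R B B (V6 A B C D F E))) (S B H (S B G (X (T H Z)) (T B Z)) (T B Z)))),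
Lem A H [(A,B),(A,C),(A,D),(A,G),(B,C),(C,D),(C,E),(C,F),(D,E),(D,F),(D,H)] [(A,E),(A,F),(B,D),(C,G),(D,G)] (S B E (S B F (X (T E Z)) (S B H (X (T E Z)) (S B G (X (T E Z)) (T B Z)))) (S E F (R A H (V6 F B C D A E)) (S E H (S E G (S F G (X (T B Z)) (S F H (X (T B Z)) (T F Z))) (T E Z)) (T E Z)))),
Lem B A [(A,C),(A,D),(B,C),(C,D),(C,E),(C,F),(D,E),(D,F),(D,H)] [(B,D),(C,G),(C,H)] (S D G (S H F (R A E (V8 C G D A E H F B)) (R A F (V8 C G D A E H F B))) (S A F (S B F (Q A I) (Q B A)) (S A E (S H E (R A I (V8 A H D C F E G B)) (R B A (V8 A H D C F E G B))) (S A B (S A H (S A G (S F H (X (T F Z)) (S E H (X (T E Z)) (S B H (X (T B Z)) (T H Z)))) (Q B B)) (S A G (Q A H) (T A Z))) (S A H (S A G (R A H (V8 A H D C E F G B)) (T A Z)) (T A Z)))))),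
Lem A I [(A,B),(A,C),(A,D),(A,H),(B,C),(B,D),(C,D),(C,E),(C,F),(D,E),(D,F)] [(A,F)] (S E F (S B F (X Z) (S F H (X (T B Z)) (S F G (X (T B Z)) (T F Z)))) (S B F (X (T F Z)) (S F G (S F H (X (T B Z)) (T F Z)) (T F Z)))),
Lem A I [(A,B),(A,C),(A,D),(B,C),(B,D),(C,D),(C,E),(C,F),(D,E),(D,F)] [(A,E),(C,G),(C,H),(D,G),(D,H)] (S A H (S A F (X (T B Z)) (Q A I)) (S A F (S A G (X (T B Z)) (P [A,C,D] [H,G] [B,E,F])) (S A G (R A I (V8 A B C D F E H G)) (T A Z)))),
Lem A F [(A,C),(A,D),(A,E),(A,F),(B,C),(C,D),(C,E),(C,F),(D,E),(D,F)] [(B,D),(C,G),(C,H),(D,G),(D,H)] (S A H (S B A (R A D (V8 C H A D B E F G)) (R B A (V5 D B C A E))) (S A B (S A G (X (T E Z)) (P [A,C,D] [G,H] [B,E,F])) (S A G (S F H (X (T E Z)) (T H (T B Z))) (P [A,C,D] [G,H] [B,E,F])))),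
Lem A J [(A,B),(A,C),(A,D),(A,F),(B,C),(C,D),(C,E),(C,F),(D,E),(D,F)] [(A,E),(B,D),(C,G),(C,H),(D,G),(D,H)] (S A H (R B A (V5 B E C A D)) (S A G (R A J (V8 F E C A B D H G)) (P [A,C,D] [G,H] [B,E,F]))),
Lem A E [(A,C),(A,D),(A,F),(A,G),(A,H),(B,C),(C,D),(C,E),(C,F),(D,E),(D,F)] [] (S E F (X (T E Z)) (S F H (X (S E G (X (T E Z)) (T G Z))) (S B F (X (P [C,D,F] [G,H] [A,B,E])) (S F G (X (S E H (X (T E Z)) (T H Z))) (T F Z))))),
Lem B C [(A,C),(A,D),(A,F),(A,G),(B,C),(C,D),(C,E),(C,F),(D,E),(D,F),(E,G),(F,H)] [(A,B),(A,H),(B,D),(C,H),(D,H)] (S E H (X (T B (M A [(A,G),(B,H)] (V B A E D C F A A A A)))) (T H (T B Z))),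
Lem B D [(A,C),(A,D),(A,F),(A,G),(B,C),(C,D),(C,E),(C,F),(D,E),(D,F)] [(A,B),(A,H),(B,D),(C,G),(C,H),(D,G),(D,H)] (S E F (R A F (V6 F B C D A E)) (S B F (R A J (V6 F B C D E A)) (S F G (S F H (X (S G B (X (T G Z)) (T B Z))) (T H (T B Z))) (S F H (S E G (Q B C) (T G (T B Z))) (T F Z))))),
Lem B E [(A,B),(A,C),(A,D),(A,G),(A,H),(B,C),(C,D),(C,E),(C,F),(D,E),(D,F)] [(A,E),(B,D),(C,G),(C,H),(D,G),(D,H)] (S B E (S E F (X (T B Z)) (S E G (X (T B Z)) (S E H (X (T B Z)) (T E Z)))) (S E H (S E F (X (T F Z)) (S E G (S B H (X (T B Z)) (S B F (X (T B Z)) (T B Z))) (T E Z))) (S E F (S E G (R B D (V5 E B C D A)) (T E Z)) (T E Z)))),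
Lem B F [(A,B),(A,C),(A,D),(A,G),(B,C),(B,F),(C,D),(C,E),(C,F),(D,E),(D,F)] [(A,E),(A,F),(A,H),(C,G),(C,H),(D,G),(D,H),(E,F)] (S F G (S F H (X (T B Z)) (T H (T E Z))) (S F H (S B G (X (T H (T E Z))) (T G (T H Z))) (T F Z))),
Lem B G [(A,B),(A,C),(A,D),(A,G),(B,C),(C,D),(C,E),(C,F),(D,E),(D,F)] [(A,E),(A,F),(A,H),(B,D),(B,F),(C,G),(C,H),(D,G),(D,H)] (S B E (S F E (R A J (V5 E B C D A)) (R B F (V6 A B C D F E))) (S B G (S B H (S E F (S E G (S E H (R A E (V5 E B C D A)) (R B D (V5 E B C D A))) (S E H (R B D (V8 E B C D A F H G)) (T E Z))) (S E H (S E G (X (T F Z)) (T E Z)) (T E Z))) (T B Z)) (T B Z))),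
Lem B F [(A,B),(A,C),(A,D),(A,G),(B,C),(C,D),(C,E),(C,F),(D,E),(D,F)] [(A,E),(A,F),(A,H),(B,D),(C,G),(C,H),(D,G),(D,H)] (S B F (S E F (R A J (V6 F B C D A E)) (Q B F)) (Q B G)),
Lem B G [(A,C),(A,D),(B,C),(C,D),(C,E),(C,F),(D,E),(D,F)] [(B,D),(C,G),(C,H),(D,G),(D,H)] (S A F (S A E (Q A F) (S A B (Q A J) (S A G (S A H (Q A E) (Q B D)) (S A H (R B D (V8 A B C D E F H G)) (T A Z))))) (S A E (S A B (R A J (V6 A B C D F E)) (S A G (S A H (R A E (V6 A B C D F E)) (R B D (V6 A B C D F E))) (S A H (R B D (V8 A B C D F E H G)) (T A Z)))) (S A G (S A B (S A H (Q B E) (Q B F)) (S A H (S B E (S E F (R A J (V5 E B C D A)) (S E H (S E G (R B E (V8 E B C D A F H G)) (R B F (V8 E B C D A F H G))) (S E G (R B G (V6 E B C D F A)) (T E Z)))) (S E H (S E F (S E G (R A E (V8 E B C D A F H G)) (R B D (V8 E B C D A F H G))) (S E G (S F G (S B G (X (T F Z)) (T B Z)) (S F H (S B H (X (T F Z)) (T B Z)) (T F Z))) (T E Z))) (S E F (S E G (R B D (V5 E B C D A)) (T E Z)) (T E Z)))) (T A Z))) (S A B (S A H (R B F (V8 A B C D E F H G)) (T A Z)) (T A Z))))),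
Lem A I [(A,C),(A,D),(B,C),(C,D),(C,E),(C,F),(D,E),(D,F)] [(C,G),(C,H),(D,H)] (S D G (S B D (R A D (V7 C G D A B E F)) (R B A (V8 A B C D E F H G))) (S B D (S A B (S A E (S A G (X (T B Z)) (S A H (X (T B Z)) (P [A,C,D] [G,H] [B,E,F]))) (Q A I)) (S A E (R A I (V5 A E C D B)) (S A F (R A I (V6 A F C D B E)) (S A H (S A G (S E F (R A I (V6 E F C D A B)) (S B E (R A I (V5 B E C D A)) (S E G (S E H (S B G (X (T B Z)) (S F G (X (T B Z)) (T G Z))) (T E Z)) (T E Z)))) (T A Z)) (T A Z))))) (Q B G))),
Lem A J [(A,B),(A,C),(A,E),(A,H),(B,C),(C,D),(C,E),(C,F),(D,E),(D,F),(D,G),(D,H),(E,G)] [(A,G),(B,G),(C,G)] (S F G (X (T B Z)) (T G Z)),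
Lem A F [(A,C),(A,E),(B,C),(C,D),(C,E),(C,F),(D,E),(D,F),(D,G),(D,H),(E,G)] [(A,D),(E,F)] (S A F (S F H (X (T A Z)) (S B F (X (T A Z)) (S F G (X (T A Z)) (T F Z)))) (S A B (S A H (X (S B G (X (T B Z)) (Q A J))) (S A G (X (T G Z)) (T A Z))) (S A H (S A G (X (T B Z)) (T A Z)) (T A Z)))),
Lem B E [(A,C),(A,E),(B,C),(C,D),(C,E),(C,F),(D,E),(D,F),(D,G),(D,H)] [(A,D),(C,G),(C,H)] (S E F (R A E (V5 D B C E A)) (S E G (Q A F) (S E H (R A F (V8 H G D C E F A B)) (S B E (R B E (V6 D F C E A B)) (T E Z))))),
Lem A E [(A,B),(A,C),(A,E),(B,C),(B,F),(C,D),(C,E),(C,F),(D,E),(D,F),(D,G),(E,G),(F,H)] [(A,D),(A,F)] (S A G (X (T B Z)) (S A H (X (T B Z)) (T A Z))),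
Lem B H [(A,C),(A,E),(B,C),(B,F),(C,D),(C,E),(C,F),(D,E),(D,F),(D,G),(E,G),(F,H)] [(A,B),(B,D),(B,E)] (S B H (S B G (X (T A Z)) (T B Z)) (T B Z)),
Lem B I [(A,C),(B,C),(B,F),(C,D),(C,E),(C,F),(D,E),(D,F),(D,G),(F,G)] [(A,D),(A,F),(B,D),(C,G),(C,H),(D,H),(E,F),(F,H)] (S B E (S A E (S E H (S F E (R A D (V8 C H E A F B D G)) (R B A (V6 A F C E B D))) (R A I (V6 A F C E B D))) (S E G (S E H (X (T A Z)) (T H (T A Z))) (S E H (S B H (X (T A (T H Z))) (T H (T A Z))) (T E Z)))) (S E G (S A E (S E H (X (T G Z)) (T H (T A Z))) (S E H (S A G (X (T H (T B Z))) (T A Z)) (T E Z))) (S A E (S E H (S B A (R A E (V6 B A C D F E)) (R B H (V6 B A C D F E))) (T E Z)) (T E Z)))),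
Lem A H [(A,C),(B,C),(B,F),(C,D),(C,E),(C,F),(D,E),(D,F),(D,G)] [(A,D),(B,D),(C,G),(C,H),(D,H)] (S E F (S F H (S A F (R A D (V8 C H F B A D E G)) (R B A (V6 B A C F D E))) (R A I (V6 B A C F D E))) (S F H (S F G (R A F (V8 G H F C D B E A)) (S A F (R A H (V6 D E C F A B)) (S B E (S B H (S A B (X (T E Z)) (S B G (X (T E Z)) (S E G (X (T A (T G Z))) (T G (T A Z))))) (S A B (R A I (V5 A D C B E)) (S B G (S A G (S G H (X (T A Z)) (T H (M A [(A,G),(A,H)] (V B A E D C F A A A A)))) (T A Z)) (T B Z)))) (S E H (S E G (S A E (X (S B G (X (T B Z)) (R A J (V6 F B C E D A)))) (S B G (S A G (X (T B Z)) (T A Z)) (S A G (S G H (X (T A Z)) (T G Z)) (T A Z)))) (S A E (S A B (S B H (X (T A Z)) (S B G (X (T A Z)) (T B Z))) (S A H (S A G (X (T B Z)) (T A Z)) (T A Z))) (T E Z))) (S E G (S A E (S A B (Q A E) (Q B H)) (T E Z)) (T E Z)))))) (S F G (S A F (R B B (V8 D E C F A B H G)) (Q B I)) (S A F (R B F (V6 D E C F A B)) (T F Z))))),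
Lem B B [(A,C),(B,C),(C,D),(C,E),(C,F),(D,E),(D,F),(D,G)] [(A,D),(B,D),(B,F),(C,G),(C,H),(D,H)] (S B E (R A H (V6 A B C D F E)) (S A F (R A H (V5 B A C D E)) (S A E (R A H (V6 B A C D F E)) (P [A,B] [D,E,F] [C,G,H])))),
Lem B E [(A,C),(B,C),(C,D),(C,E),(C,F),(D,E),(D,F)] [(A,D),(C,G),(C,H)] (S D G (S B D (R B A (V8 B A C D E F H G)) (S D H (S F H (R B E (V8 H G D C F E A B)) (S E H (R B E (V8 H G D C E F A B)) (S F G (R B E (V8 G H D C F E A B)) (S E G (R B E (V8 G H D C E F A B)) (P [C,E,F] [G,H] [A,B,D]))))) (S B F (Q A H) (Q B B)))) (S B D (R A I (V8 B A C D E F H G)) (S D H (S B F (R A H (V8 A B C D E F H G)) (R B B (V8 A B C D E F H G))) (T D Z)))),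
Lem B H [(A,C),(B,C),(C,D),(C,E),(C,F),(D,F)] [(A,D),(A,F),(B,D),(B,F),(C,G),(C,H),(D,E)] (S E F (R B E (V6 A B C F D E)) (P [A,B,E] [D,F] [C,G,H])),
Lem A E [(A,C),(B,C),(C,D),(C,E),(C,F),(D,F)] [(A,D),(B,D),(C,G),(C,H),(D,E)] (S A F (S B F (S F H (S E F (R A D (V8 C H F B E A D G)) (R B A (V6 B E C F A D))) (R A I (V6 B E C F A D))) (R B E (V6 B E C F A D))) (S B F (R B E (V6 A E C F B D)) (Q B H))),
Lem B H [(A,C),(B,C),(C,D),(C,E),(C,F)] [(A,D),(B,D),(C,G),(C,H),(D,E),(D,F)] (S E F (S A E (R B E (V5 D B C E A)) (S B E (R B E (V5 A D C E B)) (R A E (V5 A B C E D)))) (S B E (S A E (R B E (V6 D F C E A B)) (R A E (V6 D A C E F B))) (S A E (S B A (R B E (V6 D F C A B E)) (R B H (V6 D B C E F A))) (P [A,B,F] [D,E] [C,G,H])))),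
Lem B A [(A,C),(B,C),(C,D),(C,E),(C,F)] [(C,G),(C,H)] (S D F (S D E (S A D (S D H (S B D (R A D (V8 C H D A B E F G)) (Q B A)) (Q A I)) (Q B E)) (S A D (R B E (V5 E B C D A)) (S B D (R B E (V5 A E C D B)) (Q A E)))) (S B D (S A D (R B E (V6 F E C D A B)) (S E D (R B E (V6 A F C D E B)) (R A E (V6 A E C D F B)))) (S A D (S E D (R B E (V6 B F C D E A)) (R A E (V6 B E C D F A))) (S D E (R A E (V6 A B C D F E)) (Q B H))))),
Lem B E [(A,C),(B,C),(C,D),(C,E),(C,F)] [(C,G)] (S C H (R A G (V8 A B C D E F H G)) (Q B A)),
Lem A G [(A,C),(B,C),(C,D),(C,E),(C,F)] [] (S C G (S C H (S F H (S E F (S A F (Q A B) (S B F (R A B (V5 B A C D E)) (S F G (R A B (V7 E A C B G F D)) (S D F (R A B (V5 D A C B E)) (T F Z))))) (Q A C)) (S F G (R A C (V8 A B C D H F E G)) (S B F (R A A (V8 A G C D H F E B)) (S E F (S A F (S D F (R A B (V8 D B C G A F H E)) (T F Z)) (T F Z)) (T F Z))))) (Q A G)) (Q B E)),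
Lem B G [(A,C),(A,D),(C,D),(C,E),(C,F),(D,E),(D,F)] [(B,C),(C,G),(C,H)] (S D G (R A G (V7 A C D E F G B)) (S B D (R B E (V5 A B D C E)) (S D H (R B G (V8 A H D C E F B G)) (P [B,G,H] [C,D] [A,E,F])))),
Lem A C [(A,C),(A,D),(A,E),(A,H),(B,D),(C,D),(C,E),(C,F),(D,F)] [(A,B),(A,F),(A,G),(B,C),(C,G),(C,H),(D,E),(D,G),(D,H)] (S E H (S F H (S B H (S G H (R A E (V8 B F H A G E C D)) (T G (M A [(B,D),(E,G)] (V A B C F E H A A A A)))) (S G H (S B F (S F G (X (T B Z)) (T G Z)) (T B (T G Z))) (T H Z))) (S B H (S G H (S B G (S E G (S F G (X (T B Z)) (T G Z)) (T G Z)) (T G Z)) (T H Z)) (T H Z))) (S B E (S E F (S E G (R B B (V7 G B E C F A D)) (T G (T H Z))) (S E G (S F H (S F G (S B F (X (T B Z)) (S G H (S B H (X (T G Z)) (T B Z)) (T G Z))) (T G Z)) (T H (L (M A [(A,H),(F,G)] (V B A D C F E A A A A))))) (T E Z))) (S E F (S E G (S F H (S F G (X (T B (T G Z))) (T G (T B Z))) (T H (T B Z))) (T E Z)) (T E Z)))),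
Lem B I [(A,C),(A,D),(A,E),(B,D),(C,D),(C,E),(C,F),(D,F)] [(A,F),(B,C),(C,G),(C,H),(D,E),(D,G),(D,H)] (S A H (S A B (R B E (V8 B C A D E H F G)) (S A G (R B B (V8 H G A C E D F B)) (Q A C))) (S A B (S A G (R B I (V7 G B A C E D F)) (P [A,C,D] [G,H] [B,E,F])) (S A G (R A C (V8 A B C D E F H G)) (T A Z)))),
Lem B D [(A,C),(A,D),(A,F),(A,H),(B,D),(C,D),(C,E),(C,F),(D,F)] [(A,E),(A,G),(B,C),(C,G),(C,H),(D,E),(D,G),(D,H)] (S A B (R B D (V8 C H A D B F E G)) (S F G (S B F (R A G (V7 A B F C D G E)) (S F H (R B E (V8 A C F D G H B E)) (S E F (S E H (R B C (V8 A G F C E D H B)) (T H (T G Z))) (S G H (S B H (S E H (S B E (S B G (X (T E Z)) (T B Z)) (T B Z)) (T E (L Z))) (T B (L Z))) (T G (L Z)))))) (T G (T B Z)))),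
Lem B C [(A,C),(A,D),(A,G),(A,H),(B,D),(C,D),(C,E),(C,F),(D,F)] [(A,B),(A,E),(A,F),(B,C),(C,G),(C,H),(D,E),(D,G),(D,H),(E,F)] (S B F (R B I (V6 F E D C B A)) (S F H (S F G (S B H (S E H (S E G (M B [(B,D)] (V G A C F H E B A A A)) (T E Z)) (T E (L (M A [(B,D),(E,G)] (V A B C F E H A A A A))))) (T B (L (M A [(B,D),(E,H)] (V A B C F E G A A A A))))) (T F Z)) (T F Z))),
Lem B D [(A,C),(A,D),(B,D),(C,D),(C,E),(C,F),(D,F)] [(B,C),(C,G),(C,H),(D,E),(D,G),(D,H)] (S A E (S A F (R B G (V5 D B C A E)) (Q B I)) (S A F (S A H (S A G (R B E (V8 C D A F G H E B)) (Q B D)) (S A G (R B D (V8 A B C D E F H G)) (P [A,D] [E,G,H] [B,C,F]))) (S A B (R B I (V5 A E D C B)) (S A G (S A H (S E F (R B I (V6 F B C D E A)) (Q B C)) (T A Z)) (T A Z))))),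
Lem B I [(A,C),(A,D),(C,D),(C,E),(C,F),(D,F)] [(B,C),(C,G),(C,H),(D,E)] (S B D (S D H (R B E (V8 A B D C F H E G)) (S D G (S G F (R A H (V7 B G D C A F E)) (R B B (V7 B G D C A F E))) (Q B D))) (S D G (S D H (S H F (R A H (V8 G H D C A F E B)) (R B B (V8 G H D C A F E B))) (R B D (V8 A G C D E F H B))) (S D H (R B D (V8 A H C D E F B G)) (T D Z)))),
Lem B C [(A,C),(B,D),(C,D),(C,E),(C,F),(D,F),(D,H),(F,G)] [(A,D),(B,C),(B,G),(C,G),(C,H),(D,E),(D,G)] (S F H (S F B (R B G (V8 C A D F B H E G)) (R B I (V8 C A D F B H E G))) (S E F (S F A (R B G (V6 D B C F A E)) (R B I (V6 D B C F A E))) (S A F (S F B (S B D (R A H (V7 G B F C A D E)) (R B B (V7 G B F C A D E))) (R B D (V7 A G C F E D B))) (S B F (R B C (V8 C H F D G B A E)) (T F Z))))),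
Lem B B [(A,C),(B,D),(C,D),(C,E),(C,F),(D,F),(D,H)] [(A,D),(B,C),(C,G),(C,H),(D,E),(D,G)] (S F G (S G H (S E G (S A G (S B G (R B A (V8 A B G E F H C D)) (Q B C)) (R B C (V8 B A D C H F G E))) (R B C (V8 B E D C H F G A))) (R B C (V8 A H C D E F G B))) (S B F (S F H (R B G (V8 B A D F H C E G)) (R B I (V8 B A D F H C E G))) (S A F (S F E (R B G (V6 A B C F E D)) (R B I (V6 A B C F E D))) (S E F (S F H (R B D (V8 D H C F A E B G)) (T F Z)) (T F Z))))),
Lem A H [(A,C),(B,D),(C,D),(C,E),(C,F),(D,F)] [(A,D),(B,C),(C,G),(C,H),(D,E)] (S D H (S D G (R A E (V8 B G D C H F A E)) (Q B B)) (S D G (R B B (V8 A B C D E F H G)) (T D Z))),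
Lem A C [(A,C),(C,D),(C,E),(C,F),(D,F)] [(A,D),(B,C),(C,G),(C,H)] (S D E (R B I (V5 E B C D A)) (S B D (Q A H) (S D H (S D G (R B B (V8 A H C D E F B G)) (T D Z)) (T D Z)))),
Lem A A [] [(A,D),(A,E),(A,F),(B,C),(B,G),(B,H),(C,G),(C,H),(D,E),(D,F),(E,F),(F,H),(G,H)] (L (M A [(A,H),(B,F)] (V C A D G B E A A A A))),
Lem B C [(A,C),(B,F),(C,D),(C,E),(C,F)] [(A,D),(A,E),(A,F),(B,C),(B,E),(B,G),(B,H),(C,G),(C,H),(D,E),(D,F)] (S E G (S E H (S E F (R B C (V7 A G C E D F B)) (T E (L (M A [(A,B),(C,E)] (V D A G F C H A A A A))))) (T E Z)) (T E Z)),
Lem A B [(B,D),(C,D),(D,G),(D,H)] [(A,D),(A,E),(A,F),(A,G),(C,G),(D,E),(D,F)] (T A (S G H (R A H (V8 B A D H C G E F)) (R B C (V8 C A D H G B E F)))),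
Lem A I [(A,C),(A,H),(C,D),(C,E),(C,F),(D,H),(F,H)] [(A,D),(B,C),(B,D),(C,G),(C,H),(D,E),(D,F),(E,H),(G,H)] (S B H (S F G (S A F (R A C (V5 D B C A E)) (S E F (S F B (R A E (V8 G B F C H E A D)) (R B B (V7 A G C F D E B))) (S B F (R B B (V8 C A F H G B E D)) (P [A,B,E] [D,F] [C,G,H])))) (S E F (R A C (V5 D B C E A)) (S A F (S B F (S F C (R B D (V8 A C H F D B E G)) (T F Z)) (T F Z)) (T F Z)))) (R A B (V8 H A D C B G E F))),
Lem B D [(A,C),(C,D),(C,E),(C,F)] [(A,D),(A,H),(B,C),(C,G),(C,H),(D,E),(E,H),(G,H)] (T H (S F G (S E F (R A C (V5 D B C E A)) (S A F (R B B (V8 G E F C H A B D)) (P [E,A,B] [D,F] [C,G,H]))) (S A F (S E F (S F H (R B D (V8 A H C F D E B G)) (T F Z)) (T F Z)) (T F Z)))),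
Lem B H [(A,C),(C,E),(C,F)] [(A,D),(B,C),(B,D),(D,E),(D,F)] (T D (S F H (S A H (S E H (S B H (R B H (V8 A B H D E F C G)) (S E F (R A C (V5 D B C E A)) (S A E (R A H (V8 D H C E F A B G)) (S E G (S B E (R B C (V8 C D E H B G A F)) (T B (L Z))) (S A F (R A H (V8 D H C A E F B G)) (L (M A [(B,E),(C,D)] (V A B G F C H A A A A)))))))) (Q A I)) (S E H (R A I (V5 E B C D A)) (Q B D))) (S A H (S E H (R A I (V6 E B C D F A)) (R B D (V6 F B C D E A))) (R B D (V6 A B C D F E))))),
Lem A E [(A,C),(C,D),(C,E),(C,F),(D,G)] [(B,C),(C,G),(C,H),(D,E),(D,F)] (S A D (R A H (V7 E G C D F A B)) (S D H (S B D (S A E (R A C (V6 D B C A F E)) (S A H (S A F (R A H (V8 D H C A E F B G)) (S A B (S A G (S B G (R A C (V8 C D A B H G E F)) (S B H (R A H (V8 C D A B G H E F)) (S B F (S B E (S E F (R A H (V5 A C B E D)) (S F G (S F H (S E G (M A [(A,H),(B,E)] (V C A D G B F A A A A)) (T E (M A [(A,G),(B,E)] (V C A D H B F A A A A)))) (S G H (S G E (R A E (V8 D E G A F H B C)) (R B B (V8 B D A G C H E F))) (Q A A))) (T F (S H G (S H E (R A E (V8 D E H A F G B C)) (R B B (V8 B D A H C G E F))) (R A A (V8 A B C D E F H G)))))) (Q B C)) (T B (R B C (V6 A B C D F E)))))) (Q A B)) (R A B (V7 A G C D E F B)))) (S A F (S A G (S A B (R B B (V8 D G C A E F H B)) (T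 A Z)) (T A Z)) (R A B (V8 A B C D E F H G))))) (Q B H)) (R B H (V8 A H C D E F G B)))),
Lem A C [(A,C),(C,D),(C,E),(C,F)] [(B,C),(C,G),(C,H)] (S D F (S A D (S D E (Q B G) (Q B I)) (Q A C)) (S D E (R A C (V6 F B C D A E)) (S D G (Q A E) (S D H (R A E (V8 A B C D E F H G)) (T D Z))))),
Lem B D [(A,C),(A,H)] [(A,D),(A,E),(A,G),(B,C),(B,D),(C,F),(C,G),(D,E),(D,F),(G,H)] (S A F (S A B (R B D (V8 B G A C F H E D)) (T A (L (M A [(A,C),(D,G)] (V A D F B E H A A A A))))) (T A (L (M A [(A,B),(C,D)] (V C A G F E H A A A A))))),
Lem B D [(A,C)] [(A,D),(A,E),(B,C),(B,D),(C,F),(D,E),(D,F)] (T D (S A H (S A G (S A B (S A F (R B A (V8 B C A G H F D E)) (R A C (V8 B D A C G H F E))) (S A F (R A B (V7 D G C A B E F)) (P [B,E,F] [A,D] [C,G,H]))) (Q B D)) (S E H (R B D (V8 H B D C G F A E)) (T H (L (M A [(A,C),(D,H)] (V B A D F G E A A A A))))))),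
Lem B D [] [(B,C),(C,F),(C,G),(C,H)] (T C (S D H (S D G (S B D (S D F (R B A (V8 B C D G H F A E)) (R A C (V8 B A D C G H F E))) (S D F (R B H (V8 F B D C G H A E)) (Q B D))) (S D F (S D B (R B H (V8 B G D C F H A E)) (R B D (V7 A G C D E B F))) (R B D (V7 A F C D E G B)))) (S B D (S D G (S D F (R B H (V8 F H D C G B A E)) (R B D (V8 A H C D E F G B))) (R B D (V8 A G C D E H F B))) (R B D (V8 A B C D E H G F))))),
Lem B H [(A,C),(C,D),(C,E)] [(B,C),(C,F)] (S C G (S C H (R B A (V8 A D C E G H B F)) (R A C (V8 A B C D E G H F))) (S C H (R A C (V8 A B C D E H F G)) (Q B D))),
Lem A B [(A,C),(C,D),(C,E)] [(C,F)] (S B C (S C H (R B E (V8 A B C D E H F G)) (S C G (R B A (V7 A B C D E G F)) (R A C (V6 A F C B D E)))) (Q B H)),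
Lem A E [(C,D),(C,E)] [(A,C),(B,C),(C,H)] (S C G (S C F (R A C (V7 D A C E G F B)) (R B D (V8 D A C E G B H F))) (R B D (V6 D A C E F B))),
Lem B G [(C,D),(C,E)] [(A,C)] (S C H (R A B (V8 D B C E H A G F)) (S B C (R B H (V8 B A C D E H G F)) (Q A E))),
Lem B H [(C,E)] [(C,D),(C,F)] (S C H (S B C (R B H (V8 B D C E H F G A)) (R A E (V8 D B C E H A G F))) (S B C (R A E (V6 D F C B E A)) (R B D (V7 A B C E G D F))))] (S C E (S C D (S A C (S C F (S B C (Q A G) (S C H (R B E (V8 A D C E F H B G)) (S C G (R B A (V7 A D C E F G B)) (Q A C)))) (Q A B)) (Q B G)) (S C F (R B G (V6 D B C E F A)) (Q B H))) (S E G (S E F (R B G (V7 C B E G F A D)) (R B H (V7 A B E C G F D))) (S D E (R B H (V7 A B E C D G F)) (S B E (S F E (R A E (V8 C D E F B A H G)) (R B D (V8 A F E B H C D G))) (R B D (V8 A B E F H C D G))))))"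
  by (simp only: check_rules target_defs)

lemma cert_9_15: "certified [A,B,C,D,E,F,G,H,I] 3 30 (V (Some tH1) (Some tH2) (Some tH3) (Some tY9) (Some tP7) (Some tPrism) (Some tCML10) None None None) [Lem A A [(B,H),(C,D),(C,H),(D,E),(D,G),(D,H),(E,H),(G,H)] [(C,E)] (S E G (X (T E Z)) (S B E (X (T E Z)) (S E F (X (T E Z)) (S E I (X (T E Z)) (T E Z))))),
Lem A B [(A,D),(B,H),(C,H),(D,E),(D,G),(D,H),(E,H),(G,H)] [] (S E G (X (T E Z)) (S B E (X (T E Z)) (S A E (X (T E Z)) (S E I (X (T E Z)) (S C E (X (T E Z)) (T E Z)))))),
Lem A C [(B,H),(C,H),(D,E),(D,G),(D,H),(E,H),(G,H)] [(A,D),(B,D),(C,D)] (S D I (R A B (V9 I B C D E F G H A)) (S D F (R A B (V6 F B C D E A)) (T D Z))),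
Lem A D [(B,H),(C,H),(D,E),(D,G),(D,H),(E,H),(G,H)] [(C,D)] (S B D (S B E (X (T B Z)) (R A A (V5 A C B D E))) (S A D (Q A B) (Q A C))),
Lem A E [(A,D),(B,H),(C,H),(D,E),(D,F),(D,H),(E,H),(G,H)] [] (S A E (X (T E Z)) (S E F (X (T E Z)) (S B E (X (T E Z)) (S C E (X (T E Z)) (S E G (X (T E Z)) (T E Z)))))),
Lem A F [(B,H),(C,H),(D,E),(D,H),(E,H),(G,H)] [(B,D),(C,D),(D,G)] (S D F (S A D (Q A E) (S D I (R A E (V9 F B C D E I G H A)) (T D Z))) (S A D (S F D (R A E (V6 F B C D E A)) (S D I (R A E (V9 A B C D E I G H F)) (T D Z))) (T D Z))),
Lem A C [(B,H),(C,H),(D,E),(D,H),(E,H),(G,H)] [(B,D),(D,G)] (S C D (S A D (R A B (V7 A B G D C F E)) (R A C (V7 A B G D C F E))) (Q A F)),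
Lem A B [(B,F),(B,H),(C,H),(C,I),(D,F),(D,H),(E,F),(E,H),(F,G),(G,H),(G,I)] [(B,C),(B,D),(B,E),(C,D),(C,E),(D,G),(E,G),(E,I)] (S D I (X (P [C,D,G,I] [B,E] [A,F,H])) (P [B,C,G,I] [D,E] [A,F,H])),
Lem A B [(B,F),(B,H),(C,H),(D,F),(D,H),(E,F),(E,H),(F,G),(G,H)] [(B,C),(B,D),(B,E),(B,G),(C,D),(C,E),(C,G),(D,E),(D,G),(E,G)] (X (T C (S G I (S E I (X (P [C,E,G,I] [B,D] [A,F,H])) (Q A B)) (T G (S E A (X (P [C,E,G,A] [D,B] [F,H,I])) (R A B (V9 I D C B E F G H A))))))),
Lem A B [(B,H),(C,H),(D,F),(D,H),(E,F),(E,H),(G,H)] [(B,C),(B,D),(B,E),(B,G),(C,D),(C,E),(C,G),(D,E),(D,G),(E,G)] (S B F (S F G (Q A B) (S C F (R A B (V7 A B G C D F E)) (P [B,D,E,F] [C,G] [A,H,I]))) (S C F (S G F (R A B (V7 A C B G D F E)) (P [C,D,E,F] [G,B] [A,H,I])) (P [B,C] [D,E,F,G] [A,H,I]))),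
Lem A B [(B,H),(C,H),(D,H),(E,H),(G,H)] [(B,D),(B,E),(B,G),(C,G),(D,E),(D,G),(E,G)] (S C E (R A F (V5 A B D E C)) (S C D (R A F (V5 A B E D C)) (S B C (R A F (V5 A D E B C)) (S D F (S E F (Q A B) (T E (S D I (R A B (V9 A B C D E I G H F)) (T D (R A B (V6 F B C D E A)))))) (T D (S E I (R A B (V9 A B C E D I G H F)) (T E (R A B (V6 F B C E D A))))))))),
Lem A F [(B,H),(C,H),(D,H),(E,H),(G,H)] [(D,E),(E,G)] (S D G (S B D (R A D (V5 A C E D B)) (R A C (V7 A B C D G F E))) (S B E (R A C (V5 A D C E B)) (S B G (R A C (V7 A D C G B F E)) (S B D (R A C (V5 A E C B D)) (S C G (R A F (V7 A B D G C F E)) (Q A B)))))),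
Lem A C [(B,H),(C,H),(D,H),(E,H),(G,H)] [] (S D E (S D G (S C D (S C E (X (T C Z)) (Q A A)) (Q A D)) (S B D (R A D (V7 A C G D B F E)) (Q A C))) (S E G (S B E (R A D (V5 A C D E B)) (R A C (V7 A B C E G F D))) (Q A F))),
Lem A D [(B,D),(B,E),(B,F),(B,H),(C,H),(D,E),(D,H),(E,H)] [] (S C E (X (T D Z)) (S E F (X (T D Z)) (S E G (X (T D Z)) (S E I (X (T D Z)) (S A E (X (T D Z)) (T E Z)))))),
Lem A G [(B,E),(B,H),(C,H),(D,E),(D,F),(D,G),(D,H),(E,F),(E,H)] [(B,D),(B,F),(B,G)] (S B C (X (T B Z)) (S A B (X (T B Z)) (T B Z))),
Lem A G [(B,E),(B,H),(C,H),(D,E),(D,F),(D,H),(E,F),(E,H)] [(B,D)] (S B F (S C D (X (T B Z)) (S D I (X (T B Z)) (S A D (X (T B Z)) (S D G (X (T B Z)) (T D Z))))) (S C D (X (P [A,G,I] [D,E,H] [B,C,F])) (S D G (S B G (X (T B Z)) (Q A G)) (S A D (S B A (X (T B Z)) (R A G (V7 G B C D E F A))) (S D I (S B I (X (T B Z)) (R A G (V9 A B C D E F I H G))) (T D Z)))))),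
Lem A H [(B,E),(B,H),(C,H),(D,E),(D,G),(D,H),(D,I),(E,F),(E,H)] [(B,D)] (S B G (X (T B Z)) (S B I (X (T B Z)) (S B F (X (T B Z)) (S B C (X (T B Z)) (T B Z))))),
Lem A G [(B,E),(B,H),(C,H),(D,E),(D,H),(E,F),(E,H)] [(B,D)] (S D F (Q A G) (S C D (R A G (V8 A B F D H C G E)) (S D G (S D I (Q A H) (S A D (R A H (V9 I B C D E F A H G)) (T D Z))) (S A D (S D I (R A H (V7 G B C D E F A)) (S G D (R A H (V9 I B C D E F G H A)) (T D Z))) (T D Z))))),
Lem A I [(B,E),(B,H),(C,H),(D,E),(D,H),(E,H)] [(B,D),(C,E),(E,F)] (S A E (R A G (V6 F B C D E A)) (S E I (R A G (V9 A B C D E I G H F)) (S E G (R A G (V7 A B C D E G F)) (T E Z)))),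
Lem A A [(B,E),(B,H),(C,H),(D,E),(D,H),(E,H)] [(A,H),(B,D),(E,F),(F,H),(G,H),(H,I)] (S C E (S A E (R A A (V8 F A B H D G C E)) (S E I (R A A (V9 A I B H D F C E G)) (S E G (R A A (V8 A G B H D F C E)) (P [A,F,G,I] [E,H] [B,C,D])))) (Q A I)),
Lem A D [(B,E),(B,H),(C,H),(D,E),(D,H),(E,H)] [(A,H),(F,H),(G,H),(H,I)] (S B D (S B F (Q A D) (S B C (S A B (X (T D Z)) (S B G (X (T D Z)) (S B I (X (T D Z)) (P [A,F,G,I] [B,H] [C,D,E])))) (S B G (R A D (V7 A B C D E G F)) (S B I (R A D (V9 A B C D E I G H F)) (S A B (R A D (V6 F B C D E A)) (T B Z)))))) (S E F (Q A G) (Q A A))),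
Lem A J [(B,G),(B,H),(B,I),(C,H),(D,E),(D,H),(E,G),(E,H),(E,I)] [(A,B),(A,E),(A,F),(A,H),(A,I),(B,F),(E,F),(F,G),(F,H)] (T A (T F (M B [(A,C),(F,I)] (V G A F E H B D A A A)))),
Lem B A [(A,D),(B,G),(B,H),(B,I),(C,H),(D,E),(D,F),(D,H),(E,G),(E,H),(E,I)] [(C,G),(D,G),(G,H),(G,I)] (S A G (X (S A I (X (T C Z)) (S A F (X (T A Z)) (Q A J)))) (T G (X (S F I (X (T C Z)) (S F A (X (T F Z)) (R A J (V6 F B C D E A))))))),
Lem A J [(A,D),(B,H),(B,I),(C,H),(D,E),(D,F),(D,H),(E,G),(E,H),(E,I),(F,I)] [(B,G)] (X (T I (S F G (X (S B C (X (T B Z)) (R A J (V9 B F A H E C I D G)))) (T G (S A F (X (T A Z)) (T A (T F (M B [(A,B),(C,G)] (V I A C E D F H A A A))))))))),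
Lem A J [(A,D),(B,H),(B,I),(C,H),(D,E),(D,F),(D,H),(E,G),(E,H),(E,I)] [(B,D),(B,G),(D,I),(G,I),(H,I)] (S F I (Q A J) (S A I (R A J (V6 F B C D E A)) (T I (R B A (V9 A I G D H F B E C))))),
Lem B A [(A,D),(B,H),(B,I),(C,H),(D,E),(D,F),(D,H),(E,G),(E,H),(E,I)] [(B,D),(D,I),(H,I)] (S B G (X (T B (S C G (X (P [A,F] [B,E,G,H] [C,D,I])) (Q B A)))) (S G I (X (T I Z)) (Q A J))),
Lem A J [(A,D),(B,H),(C,H),(D,E),(D,H),(E,G),(E,H),(E,I)] [(A,H),(B,D),(C,D),(C,E),(D,I),(G,H),(H,I)] (S D G (R A H (V9 F G I H D A B E C)) (S D F (S B I (Q B A) (S A I (R B A (V8 B A F H E C G D)) (S C I (S B C (X (T C Z)) (R A J (V9 A I G D H F B E C))) (T I Z)))) (T D Z))),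
Lem A J [(B,H),(C,H),(D,E),(D,H),(E,G),(E,H),(E,I)] [(A,H),(B,E),(C,D),(C,E),(D,I),(F,H),(G,H),(H,I)] (S B D (R A I (V9 A B C E D I G H F)) (S A D (Q A J) (S D F (R A J (V6 F C B D E A)) (T D Z)))),
Lem A I [(B,H),(C,H),(D,E),(D,H),(E,G),(E,H),(E,I)] [(A,E),(A,H),(B,E),(C,D),(C,E),(E,F),(F,H),(G,H),(H,I)] (S D I (R A A (V9 A H G I D C B E F)) (Q A J)),
Lem B A [(B,H),(C,H),(D,E),(D,H),(E,G),(E,H),(E,I)] [(A,H),(B,E),(C,E),(E,F),(F,H),(G,H),(H,I)] (S A E (R A E (V9 B A G H D C I E F)) (S C D (S D F (R A G (V5 A C B E D)) (R A A (V5 A C B E D))) (Q A I))),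
Lem A I [(B,H),(C,H),(D,E),(D,H),(E,H),(E,I)] [(A,H),(B,E),(C,E),(E,G),(F,H),(G,H),(H,I)] (S A E (R B A (V7 F B C D E G A)) (S E F (S C D (S D G (R A G (V7 A C B E D G F)) (R A A (V7 A C B E D G F))) (R A I (V7 A B C D E G F))) (T E Z))),
Lem B A [(B,H),(C,H),(D,E),(D,H),(E,H)] [(A,H),(B,E),(C,E),(F,H),(G,H),(H,I)] (S E I (S E G (S E F (R A E (V9 B F G H D C I E A)) (Q B A)) (Q A I)) (S E G (R A I (V9 A B C D E F I H G)) (S A E (R A I (V9 F B C D E I G H A)) (T E Z)))),
Lem A E [(A,B),(A,E),(B,F),(B,G),(B,H),(C,H),(D,F),(D,H),(D,I),(E,F),(E,G),(E,H)] [(A,G),(B,I),(D,G),(E,I),(F,G),(F,I),(G,H),(H,I)] (S G I (X (T C (M B [(A,C),(D,F)] (V I A B D E G H A A A)))) (T G (T I (M B [(A,I),(C,G)] (V D A B H E F C A A A))))),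
Lem A A [(A,B),(A,D),(A,E),(B,F),(B,G),(B,H),(C,F),(C,G),(C,H),(D,H),(E,F),(E,H),(E,I)] [] (X (T I (M B [(A,D),(G,I)] (V F B G E H C A A A A)))),
Lem A G [(A,B),(A,D),(A,E),(B,F),(B,H),(D,H),(E,F),(E,H),(E,I)] [(A,C),(A,G),(B,C),(C,D),(C,E),(C,G),(E,G),(F,G),(G,H)] (T C (T G (M B [(A,D),(G,I)] (V F B G E H C A A A A)))),
Lem A H [(A,B),(A,D),(A,E),(B,F),(B,G),(B,H),(C,H),(D,H),(E,F),(E,H),(E,I)] [(A,F),(C,D),(D,F),(F,H)] (S C F (X (S C G (Q A A) (Q A G))) (S F I (X (T F Z)) (T F Z))),
Lem B B [(A,B),(A,E),(B,F),(B,G),(B,H),(C,F),(C,H),(D,F),(D,H),(E,F),(E,H)] [(A,C),(A,D),(A,F),(A,H),(B,D),(C,D),(D,E)] (S D G (X (T I (M B [(A,E),(C,I)] (V G B F C H D A A A A)))) (T D (S A I (X (T G (M B [(A,E),(C,G)] (V I A F C H D B A A A)))) (T A Z)))),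
Lem B C [(A,B),(A,E),(B,F),(B,G),(B,H),(C,F),(C,H),(D,F),(D,H),(E,F),(E,H)] [(A,F),(A,H),(B,D),(C,D),(D,E)] (S A C (X (T I Z)) (S A D (X (T I Z)) (Q B B))),
Lem A G [(A,B),(A,E),(B,F),(B,G),(B,H),(C,H),(D,F),(D,H),(E,F),(E,H)] [(A,F),(B,C),(B,D),(B,E),(B,I),(C,D),(C,E),(C,F),(D,E),(E,G),(E,I),(F,H),(G,H),(H,I)] (S F G (R A J (V9 C A H G F I D B E)) (S F I (S A D (X (T C (T G Z))) (S D I (X (T D Z)) (T D (S A G (X (T A Z)) (X (S A I (R A A (V9 D F A G H E I B C)) (R A G (V9 D F A G H E I B C)))))))) (S A C (S A I (R A H (V9 E A G F H C I B D)) (T I (T G Z))) (T C (T I (S D G (M B [(A,I),(C,G)] (V E A B H D F C A A A)) (T G Z))))))),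
Lem A A [(A,B),(A,E),(B,F),(B,G),(B,H),(C,H),(D,H),(E,F),(E,H)] [(A,F),(A,H),(B,C),(B,D),(B,E),(B,I),(C,D),(C,E),(C,F),(D,E),(D,F),(E,G),(F,H),(G,H),(H,I)] (S F G (R A I (V9 D A H G F I C B E)) (T F (S A C (S D A (R B C (V6 F B D C E A)) (R A G (V6 F B D C E A))) (T C (S A G (R A I (V9 D F H G A I C B E)) (T G (S A D (M C [(C,I)] (V C F B G D A E H A A)) (P [C,D,G,H] [A,F] [B,E,I])))))))),
Lem B C [(A,B),(A,E),(B,F),(B,G),(B,H),(C,H),(D,H),(E,F),(E,H)] [(A,H),(B,C),(B,D),(B,E),(B,I),(C,D),(C,E),(D,E),(E,G),(G,H),(H,I)] (S E I (S A D (X (S D F (X (T C (T G Z))) (Q A H))) (S A C (X (S C F (X (T D (T G Z))) (R A H (V5 A B D C E)))) (S A F (X (T A Z)) (S A I (X (T A Z)) (T A Z))))) (T E (S D F (S C F (Q B C) (Q A G)) (S C F (R A G (V5 A B D C E)) (Q A A))))),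
Lem A E [(A,B),(A,E),(B,F),(B,G),(B,H),(C,H),(D,H),(E,F),(E,H)] [(A,H),(B,C),(B,D),(B,E),(B,I),(C,D),(C,E),(D,E),(G,H),(H,I)] (S E G (S D F (X (S A D (X (T I Z)) (S D G (X (T I Z)) (T D (S A G (X (T A Z)) (Q A E)))))) (S D G (X (S D A (X (T I Z)) (T D (S F A (X (T F Z)) (R A E (V7 F B C D E G A)))))) (T D (X (T D (S G F (X (T G Z)) (R A E (V7 G B C D E A F)))))))) (Q B C)),
Lem A H [(A,B),(A,D),(A,E),(B,F),(B,G),(B,H),(C,H),(D,H),(E,H)] [(A,C),(A,G),(A,H),(A,I),(B,C),(B,D),(B,E),(B,I),(C,D),(C,E),(D,E),(E,F),(E,G),(F,H),(G,H),(H,I)] (S A F (R A J (V9 C D E F B I G A H)) (S D G (R A E (V7 A B C E D G F)) (S D F (R B C (V5 A B C E D)) (P [A,D,E,H] [F,G] [B,C,I])))),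
Lem B D [(A,B),(A,E),(B,F),(B,G),(B,H),(C,H),(D,H),(E,H)] [(A,D),(A,H),(A,I),(B,C),(B,D),(B,E),(B,I),(C,D),(C,E),(D,E),(E,F),(E,G),(F,H),(G,H),(H,I)] (S A C (S A G (X (R A J (V9 D C E G B I F A H))) (R A H (V5 A B D C E))) (S A F (S G A (R A D (V8 C G H F A D E B)) (R B A (V8 C H G F A D E B))) (T A Z))),
Lem A J [(A,B),(B,F),(B,G),(B,H),(C,H),(D,H)] [(B,C),(B,D),(B,E),(B,I),(C,D),(C,E),(D,E),(E,F),(E,G),(F,H),(G,H)] (T E (S A D (S A C (X (S C F (S F D (X (T I Z)) (R B B (V6 F B E D C A))) (S C I (X (P [A,C,E,H] [F,G] [B,D,I])) (T C (S G D (X (T I Z)) (R B B (V7 G B E D C A F))))))) (S A G (X (R A J (V9 C D E G B I F A H))) (Q A H))) (Q B D))),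
Lem A H [(A,B),(A,E),(B,F),(B,G),(B,H),(C,H),(D,H),(E,H)] [(A,H),(B,C),(B,D),(B,E),(B,I),(C,D),(C,E),(D,E),(F,H),(G,H),(H,I)] (S E F (Q A E) (S E G (R B C (V7 A B C D E G F)) (Q A J))),
Lem A J [(A,B),(B,F),(B,G),(B,H),(C,H),(D,H),(E,H)] [(A,E),(A,H),(B,C),(B,D),(B,E),(B,I),(C,D),(C,E),(D,E),(F,H),(G,H),(H,I)] (S E F (S E G (R B C (V7 F B C D E G A)) (R A J (V6 F B C D E A))) (R A J (V7 G B C D E A F))),
Lem A F [(A,B),(B,F),(B,G),(B,H),(C,H),(D,H),(E,H)] [(A,H),(B,C),(B,D),(B,E),(C,D),(C,E),(D,E),(F,H),(G,H),(H,I)] (S B I (R A F (V9 C G I A H D F B E)) (S A E (Q A H) (Q A J))),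
Lem B C [(A,B),(A,C),(A,D),(A,E),(B,F),(B,H),(C,H),(D,F),(D,H),(E,H)] [(A,F),(A,G),(A,I),(B,C),(B,G),(B,I),(C,D),(C,E),(C,F),(D,G),(E,F),(F,H),(G,H),(H,I)] (S D I (R B B (V9 F D E C B A I H G)) (P [A,B,D,H] [G,I] [C,E,F])),
Lem B E [(A,B),(A,C),(A,E),(B,F),(B,H),(C,G),(C,H),(E,G),(E,H),(F,G),(F,I)] [(B,D),(B,I),(C,D),(D,E),(D,F),(D,G),(G,I)] (T D (S C I (M B [(B,F),(D,I)] (V E A B H C G D A A A)) (T I (M B [(B,F),(C,G)] (V D A B H E I C A A A))))),
Lem B D [(A,B),(A,C),(A,D),(B,F),(B,H),(C,H),(D,G),(D,H),(E,F),(E,H)] [(A,E),(A,F),(A,H),(B,C),(B,D),(B,E),(B,G),(B,I),(C,D),(C,E),(C,F),(D,E),(D,F),(F,H),(G,H),(H,I)] (S C G (S F G (S A G (X (T C Z)) (S D I (R A E (V9 A D B E C G I H F)) (S C I (R A G (V9 G C E B D A I H F)) (P [B,E,F,I] [D,C] [A,G,H])))) (T F (T E (S A G (X (T C Z)) (S D I (R A E (V9 A D B E C G I H F)) (S C I (R A G (V9 G C E B D A I H F)) (P [B,E,F,I] [D,C] [A,G,H]))))))) (T C (S D I (R A G (V9 I D E B C A G H F)) (T D (S E I (S E G (R B D (V9 F E D C B G I H A)) (T E (L Z))) (T E (L Z))))))),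
Lem A G [(A,B),(A,C),(A,D),(B,F),(B,H),(C,H),(D,H),(E,H)] [(A,E),(A,F),(A,H),(B,C),(B,D),(B,E),(B,G),(B,I),(C,D),(C,E),(D,E),(F,H),(G,H),(H,I)] (S D F (S D G (R A F (V5 A D B C E)) (S D I (R A G (V9 F D E C B A I H G)) (P [C,E,G,I] [B,D] [A,F,H]))) (S C F (S C G (R A F (V5 A C B D E)) (S C I (R A G (V9 F C E D B A I H G)) (P [D,E,G,I] [B,C] [A,F,H]))) (S E F (S D G (Q B D) (T D (R B D (V9 A B C D E F I H G)))) (T E (T F (S A G (S C G (X (T C Z)) (T C (S D I (X (P [B,E,F,G] [C,D] [A,H,I])) (T D Z)))) (S D G (S C G (S D I (R A E (V9 H D E F C A I G B)) (S C I (R A G (V9 A C F E D H I G B)) (P [E,F,B,I] [D,C] [A,G,H]))) (T C (L (M B [(A,C),(B,F)] (V G B H D I E A A A A))))) (T D (L (M B [(A,D),(B,F)] (V G B H C I E A A A A))))))))))),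
Lem A E [(A,B),(A,D),(A,I),(B,H),(C,G),(C,H),(D,H),(E,G),(E,H)] [(A,C),(A,E),(A,F),(A,H),(B,C),(B,D),(B,E),(B,G),(C,D),(C,E),(C,F),(D,E),(D,F),(E,I),(F,G),(F,H),(G,H),(G,I),(H,I)] (S A G (S D G (X (T D Z)) (T D Z)) (T A (L Z))),
Lem A E [(A,B),(A,D),(B,F),(B,H),(C,H),(D,H),(E,F),(E,H)] [(A,C),(A,E),(A,F),(A,H),(B,C),(B,D),(B,E),(B,G),(B,I),(C,D),(C,E),(D,E),(D,F),(F,H),(G,H),(H,I)] (S C F (S E G (R B D (V6 F B C E D A)) (T E (R B D (V9 F B C E D A I H G)))) (T C (S E G (S F G (S A G (S D G (X (T A Z)) (R A I (V9 D A C F E I B G H))) (T A (T D (R A I (V9 B C D F E I A G H))))) (T F (S A I (Q A E) (T A (L Z))))) (T E (T F (S A G (R A E (V9 A B C D E F I H G)) (T A (L Z)))))))),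
Lem A I [(A,B),(A,D),(B,F),(B,H),(C,H),(D,H),(E,H)] [(A,C),(A,E),(A,F),(A,H),(B,C),(B,D),(B,E),(B,G),(B,I),(C,D),(C,E),(D,E),(F,H),(G,H),(H,I)] (S D F (S D G (R A F (V5 A D B C E)) (S D I (R A A (V9 F D C E B A I H G)) (P [C,E,G,I] [B,D] [A,F,H]))) (S E F (Q A E) (T E (S A I (S A G (S D I (R A I (V9 C B G D I F H A E)) (T D Z)) (T A (T D (R A E (V7 A D C B E G F))))) (T A (T D (R A E (V9 A D C B E I F H G)))))))),
Lem B E [(A,B),(A,D),(B,F),(B,H),(C,H),(D,H),(E,H)] [(A,F),(A,H),(B,C),(B,D),(B,E),(B,G),(B,I),(C,D),(C,E),(D,E),(F,H),(G,H),(H,I)] (S A C (S A E (S A G (R A B (V8 F C G D E H B A)) (S A I (R A B (V9 F C I D E G B A H)) (S D F (S C F (S F I (X (T G Z)) (S F G (X (T I Z)) (P [A,B,F,H] [G,I] [C,D,E]))) (S E F (S F I (X (T G Z)) (S F G (X (T I Z)) (P [A,B,F,H] [G,I] [C,D,E]))) (S D G (R B B (V6 F D E C B A)) (Q B C)))) (S C F (S E F (S F I (X (T G Z)) (S F G (X (T I Z)) (P [A,B,F,H] [G,I] [C,D,E]))) (S C G (R B B (V6 F C E D B A)) (R B C (V5 A B D C E)))) (S E F (S E G (R B B (V6 F E D C B A)) (R B C (V5 A B C E D))) (T F (S C G (S E G (S D G (X (T I Z)) (Q B E)) (T G (R B E (V5 A B C E D)))) (T G (R B E (V5 A B D C E))))))))))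 (Q A G)) (S A E (R A G (V5 A B D E C)) (Q A I))),
Lem B E [(C,H),(D,H),(E,H)] [(B,C),(B,D),(B,E),(B,G),(B,I),(C,D),(C,E),(D,E),(G,H),(H,I)] (T B (S A D (Q B E) (S A C (S A E (R A G (V5 A B C E D)) (R A I (V5 A B D C E))) (S A E (R A I (V5 A B C E D)) (T A (S D I (S C I (S E I (S F I (R A B (V9 B C F D E G A I H)) (S D G (R B E (V9 G A C D E B F I H)) (T D (R A G (V9 I D C E B F A H G))))) (T E (R B E (V6 F B C E D A)))) (T C (R B E (V6 F B D C E A)))) (T D (R B E (V6 F B C D E A))))))))),
Lem A J [(A,B),(B,F),(B,H),(C,H),(D,H),(E,H)] [(A,H),(B,C),(B,D),(B,E),(B,G),(C,D),(C,E),(D,E),(F,H),(G,H),(H,I)] (S B I (S A E (R A H (V9 A B C D E F I H G)) (R A J (V9 A B C D E F I H G))) (Q B E)),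
Lem A F [(B,H),(C,H),(D,H),(E,H)] [(A,H),(B,C),(B,E),(C,D),(C,E),(D,E),(F,H),(G,H),(H,I)] (S B D (R B A (V5 A C E D B)) (S E F (S A E (S E G (R A F (V5 A E B C D)) (R A J (V5 A E B C D))) (S E G (R A J (V7 F E B C D G A)) (R B E (V9 F E B C D I A H G)))) (S A E (S E G (R A J (V7 A E B C D G F)) (R B E (V9 A E B C D I F H G))) (R B E (V9 G E B C D I A H F))))),
Lem A J [(B,H),(C,H),(D,H),(E,H)] [(A,H),(C,E),(D,E),(F,H),(G,H),(H,I)] (S C D (S B C (R A D (V5 A B E D C)) (R B A (V5 A E B D C))) (S B C (R B A (V5 A D E B C)) (S B E (R B A (V5 A C D B E)) (Q A F)))),
Lem A D [(B,H),(C,H),(D,H),(E,H)] [(A,H),(F,H),(G,H),(H,I)] (S D E (S B E (Q A D) (S C E (R A D (V5 A C B D E)) (Q B A))) (S C E (S B E (R A D (V5 A B D C E)) (R B A (V5 A D B C E))) (Q A J))),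
Lem B E [(B,H),(C,H),(D,H),(E,H)] [(A,H),(F,H),(G,H)] (S H I (R A C (V9 A B C D E F I H G)) (Q A D)),
Lem B A [(A,E),(E,H),(E,I)] [(A,H),(A,I),(B,D),(B,E),(B,F),(B,G),(C,E),(D,E),(D,H),(E,F),(F,H),(G,H),(H,I)] (S E G (S G I (R B A (V9 B H A G I C D E F)) (R A F (V9 B G H A I C D E F))) (P [B,E,H] [D,F,G] [A,C,I])),
Lem A H [(B,I),(C,H),(E,I)] [(A,E),(A,H),(A,I),(B,C),(B,D),(B,E),(B,F),(B,G),(C,E),(C,I),(D,E),(D,H),(E,G),(F,H),(F,I),(G,H),(G,I),(H,I)] (S A C (S C D (S C F (R B E (V9 B A D F H E I C G)) (S C G (R A J (V8 B G A D H E F C)) (T G (T F Z)))) (S C F (S C G (R A J (V8 B G A F H E D C)) (T G (T D Z))) (T C (T G (L Z))))) (S C D (S C F (S C G (R A J (V8 E G D F H B A C)) (T G (T A Z))) (T C (T G (L Z)))) (T C (T G (L Z))))),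
Lem A F [(B,I),(C,H),(D,I),(E,I)] [(A,E),(A,H),(A,I),(B,C),(B,D),(B,E),(B,F),(B,G),(C,E),(C,I),(D,E),(D,H),(E,G),(F,H),(F,I),(G,H),(H,I)] (S G I (R A F (V9 A D B G E C F I H)) (Q A H)),
Lem A I [(B,H),(B,I),(C,H)] [(A,E),(A,H),(A,I),(B,C),(B,D),(B,E),(B,F),(B,G),(C,E),(D,E),(D,H),(E,G),(G,H)] (T E (S C I (S D I (R B E (V9 H C D B E A F I G)) (R B A (V9 C H A D I F G B E))) (S D I (Q A F) (R A H (V9 C H F A I G D E B))))),
Lem A I [(B,H),(B,I),(C,H),(E,H),(E,I)] [(A,E),(A,H),(A,I),(B,C),(B,D),(B,E),(B,F),(B,G),(C,E),(D,H),(F,H),(G,H)] (S E F (S E G (R B E (V9 A F G H I B C E D)) (S D E (R A J (V9 A I D F H B C E G)) (Q A I))) (S E G (S D E (R A J (V9 A I D G H B C E F)) (R A I (V7 A B C D E G F))) (R A I (V6 A B C F E D)))),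
Lem A H [(B,H),(B,I)] [(A,C),(A,E),(A,G),(A,H),(A,I),(B,C),(B,E),(B,G),(C,I),(D,H),(E,I),(F,H),(H,I)] (T A (S D I (R A I (V8 H B F C D E G A)) (T I (S C F (R A F (V9 D A H C I G E B F)) (R A H (V9 H B G D F E C I A)))))),
Lem B A [(C,H),(E,H)] [(B,C),(B,D),(B,E),(B,F),(B,G),(C,E),(D,H),(F,H),(G,H)] (T B (S E I (S A E (S E F (S D E (R A C (V9 B A F H I C D E G)) (R B E (V9 B A F H I D C E G))) (S D E (R B E (V9 B A D H I C F E G)) (Q B A))) (Q A I)) (S C I (R A I (V9 E H A D I F G B C)) (S A C (R A I (V9 I B E D C F G H A)) (S A E (R A I (V9 C H I D A F G B E)) (S A D (S A F (S A G (R A J (V8 C G D F B E H A)) (Q A H)) (R A H (V7 A B C D E G F))) (R A H (V7 A B C F E G D)))))))),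
Lem A H [(B,H),(B,I),(C,H),(E,H)] [(A,B),(A,H),(B,C),(B,E),(C,E),(D,H),(F,H),(G,H)] (S B G (S B F (R B E (V9 C G F H I E A B D)) (S B D (R A J (V9 C I G D H E A B F)) (R B A (V7 G B C D E A F)))) (S B F (S B D (R A J (V9 C I F D H E A B G)) (R B A (V6 F B C D E A))) (T B (R B A (V9 C H D A I F G B E))))),
Lem A J [] [(A,H),(D,H),(F,H),(G,H),(H,I)] (T H (S B I (S A B (S B F (S D B (R A C (V9 C A F H I E D B G)) (R B E (V9 C A F H I D E B G))) (S B G (R B E (V9 C A G H I E F B D)) (S B D (R A J (V9 C I A D H E F B G)) (Q B A)))) (Q A H)) (S B F (R A H (V9 I B C A E D G H F)) (S B D (S B G (S B A (R A J (V8 C D G A H E F B)) (R B A (V9 G B C A E F I H D))) (T B (R B A (V9 C H A F D G I B E)))) (T B (R B A (V9 C H A D G F I B E))))))),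
Lem A H [(B,H),(C,H),(E,H)] [(A,H),(D,H)] (S G H (S F H (R A C (V7 A B C E G D F)) (R B E (V7 A B C E G F D))) (S F H (R B E (V6 A B C E F D)) (S H I (R A D (V9 A B C E I D F H G)) (Q A J)))),
Lem B A [(B,H),(C,H),(E,H)] [(D,H)] (S A H (S F H (R A C (V7 G F A B C D E)) (S G H (R A C (V6 F A B C E D)) (R B E (V7 F A B C E G D)))) (Q A H)),
Lem A I [(B,H),(C,H)] [(D,H),(E,H),(F,H),(H,I)] (S G H (S H A (R A D (V7 D B C G A E F)) (R A J (V9 D B C E G F I H A))) (R A J (V5 D B C E A))),
Lem A D [(B,H),(C,H)] [(D,H),(E,H),(H,I)] (S F H (S A H (R B E (V9 D B C F A E I H G)) (S H G (R A D (V7 D B C F G E A)) (R A J (V9 D B C E F A I H G)))) (Q A I)),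
Lem A F [(B,H),(C,H)] [(E,H)] (S H I (R B A (V9 A B C E I F G H D)) (S D H (R A H (V9 E B C I D F G H A)) (Q A D))),
Lem A G [(B,H)] [(C,H),(G,H),(H,I)] (S D H (R A D (V7 A B D C G F E)) (S A H (R A I (V7 E A B C D G F)) (R A J (V6 A B E C F D)))),
Lem A H [(B,H)] [(C,H),(G,H)] (S H I (S D H (R A H (V9 C B I G D F E H A)) (R A D (V9 A B I D C F E H G))) (Q A G))] (S B H (S C H (S E H (S D H (S G H (Q A C) (S A H (R A C (V7 F A B C D G E)) (S F H (R A C (V7 A B C D E G F)) (Q B E)))) (Q B A)) (Q A F)) (S G H (R A F (V7 A B G D C F E)) (Q A H))) (S D H (S G H (R A F (V7 A D G C B F E)) (R A H (V5 A D B C E))) (S A H (R A H (V7 C A B E F G D)) (S G H (R A G (V9 C G A E F I B H D)) (S H I (S C H (R A I (V9 E C I A B D F H G)) (R A J (V9 C I E A F B D H G))) (R A J (V6 A C E B F D)))))))"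
  by (simp only: check_rules target_defs)

lemma cert_10_15: "certified [A,B,C,D,E,F,G,H,I,J] 0 30 (V (Some tH1) (Some tH2) (Some tH3) (Some tY9) (Some tP7) (Some tPrism) (Some tCML10) None None None) [Lem A A [(A,E),(B,D),(C,E),(C,H),(D,G),(D,H),(E,F),(F,J),(G,I),(G,J),(H,J)] [] (X (T E (T A (S C I (X (T B (M C [(B,D),(C,H)] (V E A B F J G I C A A)))) (T C (T I (M F [] (V A B D G I E C H J F)))))))),
Lem A B [(A,E),(B,D),(C,E),(C,H),(D,G),(D,H),(E,I),(F,J),(G,I),(G,J),(H,J)] [] (X (T E (T A (S B C (X (T F (M G [] (V A B D G I E C H J F)))) (T B (T C (M G [] (V A B D H C E I G J F)))))))),
Lem A C [(B,D),(B,E),(C,H),(D,G),(D,H),(E,F),(E,I),(F,J),(G,I),(G,J),(H,J)] [] (X (S B C (X (T A (M C [(A,C),(G,I)] (V D B A H J F E G A A)))) (S C F (X (T A (M C [(A,C),(G,I)] (V D B A H J F E G A A)))) (T C (T A (M C [(A,C),(G,I)] (V D B A H J F E G A A))))))),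
Lem A C [(B,D),(C,H),(D,G),(D,H),(F,J),(G,I),(G,J),(H,J)] [] (X (S A E (S C E (S E F (Q A A) (S E I (Q A B) (T E (T A (R A A (V9 E B I D A F H G C)))))) (S E F (S E B (R A B (V A I F G E C D J B H)) (T E (T A (R A A (V E I B G A C J D F H))))) (T E (T A (R A A (V5 E B C D A)))))) (S E I (S E F (S B E (Q A C) (T E (R A C (V A I B G E C J D F H)))) (T E (R A C (V A I F G E C D J B H)))) (T E (R A C (V9 A B I D E F H G C)))))),
Lem A B [(C,H),(D,G),(D,H),(F,J),(G,I),(G,J),(H,J)] [(B,D),(C,D),(D,I),(D,J)] (S D E (R A C (V5 A E C D B)) (S D F (X (P [A,B,E,I] [D,H,J] [C,F,G])) (T D (R A C (V5 B A C D E))))),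
Lem A C [(C,H),(D,G),(D,H),(F,J),(G,I),(G,J),(H,J)] [(C,D)] (X (T G (S B D (Q A C) (Q A B)))),
Lem A A [(A,F),(A,G),(F,J),(G,I),(G,J),(H,J)] [(A,C),(A,H),(A,I),(A,J),(F,H)] (S A D (R A C (V B C H F E I A J D G)) (S A E (R A C (V B C H F D I A J E G)) (T A (R A C (V C D H F E I A J B G))))),
Lem A D [(A,B),(A,C),(A,G),(C,H),(D,H),(F,J),(G,I),(G,J),(H,J)] [(C,D)] (X (T A (S C I (R A C (V D E J I F B C G H A)) (S C E (X (S D F (R A A (V9 D B A E I F H G C)) (S D E (S D I (R A C (V B F A E G J D C I H)) (T D (R A C (V F G A E I J D C B H)))) (T D (S F I (X (T E (M C [(B,D),(H,J)] (V C A B E F I G H A A)))) (T F (T E (M D [(A,B)] (V A C E F J G I D H A))))))))) (T C (R A C (V B E G F I D C J A H))))))),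
Lem A D [(A,G),(C,H),(D,H),(F,J),(G,I),(G,J),(H,J)] [(C,D)] (X (T G (S A F (S A C (R A C (V B D H F E I A J C G)) (Q A A)) (S A C (S A D (X (S D E (R A C (V B F J C I E A H G D)) (S B D (R A C (V E F J C I B A H G D)) (P [A,D,G,H,J] [B,E] [C,F,I])))) (S A B (Q A D) (T A (R A D (V5 A E C D B))))) (S A D (S A B (R A D (V5 A B D C E)) (T A (R A D (V5 A E D C B)))) (T A (S D F (R A A (V9 D B A E I F H G C)) (S B D (S D I (R A D (V9 D B I A E F H G C)) (T D (S B C (R A B (V F G J C I E B H A D)) (S B I (R A B (V C J H E F I A D G B)) (T B (R A B (V C J H E I F A D G B))))))) (T D (R A D (V9 D E I A B F H G C))))))))))),
Lem A D [(C,H),(D,H),(F,J),(G,I),(G,J),(H,J)] [(C,D),(F,G),(G,H)] (S D G (Q A C) (S A G (Q A D) (S B G (R A D (V5 B A C D E)) (S C G (R A C (V5 A B D C E)) (T G (R A D (V5 E B C D A))))))),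
Lem A C [(C,H),(D,H),(F,J),(G,J),(H,J)] [(C,D)] (X (T J (S G I (Q A D) (S B G (R A D (V9 A E C D I F G H B)) (S A G (R A D (V9 B E C D I F G H A)) (S D G (S E G (R A C (V9 A B C D I F G H E)) (P [A,B,E,I] [G,H,J] [C,D,F])) (T G (R A C (V9 A B D C I F G H E))))))))),
Lem A D [(C,H),(D,H),(F,J),(H,J)] [(C,D),(C,J),(D,J),(G,J)] (S B J (R A C (V7 A E C D G B F)) (S E J (R A C (V7 A B C D G E F)) (S A J (R A C (V7 B E C D G A F)) (T J (R A C (V9 A B C D E F I H G)))))),
Lem A D [(C,H),(D,H),(H,J)] [] (X (T H (S F J (S G J (Q A C) (Q A D)) (S I J (R A D (V9 A B C D E I F H G)) (S A J (S E J (R A C (V9 B F C D I E A H G)) (S B J (R A C (V9 F E C D I B A H G)) (T J (R A C (V6 B F C D E A))))) (S B J (S E J (R A C (V9 A F C D I E B H G)) (T J (R A C (V6 E A C D F B)))) (T J (R A C (V6 A B C D F E))))))))),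
Lem A C [(C,H),(H,J)] [(A,H),(D,H),(E,H),(H,I)] (S B H (R A D (V5 A D B C E)) (S G H (R A D (V7 A B C G E F D)) (T H (R A D (V6 A B C F E D))))),
Lem A A [(C,H),(H,J)] [(D,H)] (S E H (R A D (V5 A B C E D)) (S H I (R A D (V9 A B C I E F G H D)) (S A H (R A D (V5 B D A C E)) (Q A C)))),
Lem A B [(C,H)] [(A,H),(B,H),(F,H),(H,I),(H,J)] (S D H (S G H (R A D (V A B C G I E F H J D)) (T H (R A D (V A B C E I F G H J D)))) (T H (R A D (V A B C E D F I H J G)))),
Lem A E [(C,H)] [(A,H),(B,H),(H,J)] (S H I (S D H (R A D (V E A D C B F G H J I)) (R A C (V D E C A B F G H J I))) (S F H (R A C (V A D C B I E G H J F)) (Q A B))),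
Lem A F [(C,H)] [(B,H),(H,J)] (S A H (S H I (R A D (V D E A I J F G H B C)) (S D H (R A D (V E B D A J F G H I C)) (R A C (V D E A B J F G H I C)))) (Q A E))] (S C H (S H J (S D H (Q A D) (Q A A)) (S B H (R A A (V A D B J E F G H I C)) (Q A F))) (S G H (S B H (R A A (V A D B C E F I H J G)) (R A F (V A B G D E F I H J C))) (S F H (R A F (V A C F D E B I H J G)) (S H I (R A E (V C F I D E A B H J G)) (S B H (S A H (R A C (V C D B F G E J H I A)) (R A B (V C F B D E A J H G I))) (S E H (R A B (V B C E D A F J H G I)) (T H (R A D (V5 B C A D E)))))))))"
  by (simp only: check_rules target_defs)

section \<open>Classification by the number of edges\<close>

text \<open>Spells out the ten slots of a target vector, so that the simplifier can read off each
  entry.\<close>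

lemma ex_vx: "(\<exists>i. q i) \<longleftrightarrow> q A \<or> q B \<or> q C \<or> q D \<or> q E \<or> q F \<or> q G \<or> q H \<or> q I \<or> q J"
  by (rule iffI, erule exE, case_tac i) blast+

lemma all_vx: "(\<forall>i. q i) \<longleftrightarrow> q A \<and> q B \<and> q C \<and> q D \<and> q E \<and> q F \<and> q G \<and> q H \<and> q I \<and> q J"
  by (rule iffI, blast, rule allI, case_tac i) blast+

lemma checked_wf: "checked tg m \<Longrightarrow> wf_target tg"
  by (simp add: checked_def)

lemmas targets_wf = checked_K33[THEN checked_wf] checked_K5[THEN checked_wf] checked_O[THEN checked_wf] checked_Q3[THEN checked_wf] checked_V8[THEN checked_wf] checked_H1[THEN checked_wf] checked_H2[THEN checked_wf] checked_H3[THEN checked_wf] checked_QML7[THEN checked_wf] checked_Q3x[THEN checked_wf] checked_Y9[THEN checked_wf] checked_P7[THEN checked_wf] checked_Prism[THEN checked_wf] checked_CML10[THEN checked_wf]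

section \<open>Bounds on the number of vertices\<close>

lemma i4c_simple: "internally_4_connected \<Gamma> \<Longrightarrow> simple_graph \<Gamma>"
  by (simp add: internally_4_connected_def)

lemma i4c_min_degree:
  assumes "internally_4_connected \<Gamma>" "v \<in> verts \<Gamma>" shows "3 \<le> card (nbr \<Gamma> v)"
proof -
  have "k_connected 3 \<Gamma>" using assms(1) by (simp add: internally_4_connected_def)
  then show ?thesis by (rule k_connected_min_degree[OF i4c_simple[OF assms(1)] _ assms(2)])
qed

lemma i4c_no_isolated:
  assumes "internally_4_connected \<Gamma>" shows "\<forall>v\<in>verts \<Gamma>. \<exists>e\<in>edges \<Gamma>. v \<in> e"
proof
  fix v assume "v \<in> verts \<Gamma>"
  then have "nbr \<Gamma> v \<noteq> {}" using i4c_min_degree[OF assms] by fastforce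
  then obtain w where "{v, w} \<in> edges \<Gamma>" by (auto simp: nbr_def)
  then show "\<exists>e\<in>edges \<Gamma>. v \<in> e" by blast
qed

lemma i4c_bounds:
  assumes "internally_4_connected \<Gamma>"
  shows "3 < card (verts \<Gamma>)" "3 * card (verts \<Gamma>) \<le> 2 * card (edges \<Gamma>)"
    "2 * card (edges \<Gamma>) \<le> card (verts \<Gamma>) * (card (verts \<Gamma>) - 1)"
proof -
  have sg: "simple_graph \<Gamma>" and k: "k_connected 3 \<Gamma>" using assms by (simp_all add: internally_4_connected_def)
  show "3 < card (verts \<Gamma>)" using k_connected_card[OF k] .
  have "(\<Sum>v\<in>verts \<Gamma>. 3) \<le> (\<Sum>v\<in>verts \<Gamma>. card (nbr \<Gamma> v))"
    by (intro sum_mono i4c_min_degree[OF assms])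
  then show "3 * card (verts \<Gamma>) \<le> 2 * card (edges \<Gamma>)" using handshake[OF sg] by simp
  have "card (nbr \<Gamma> v) \<le> card (verts \<Gamma>) - 1" if "v \<in> verts \<Gamma>" for v
  proof -
    have fin: "finite (verts \<Gamma>)" using sg by (simp add: simple_graph_def)
    then have "card (nbr \<Gamma> v) \<le> card (verts \<Gamma> - {v})" using nbr_subset[OF sg] by (intro card_mono) auto
    then show ?thesis using that fin by simp
  qed
  then have "(\<Sum>v\<in>verts \<Gamma>. card (nbr \<Gamma> v)) \<le> (\<Sum>v\<in>verts \<Gamma>. card (verts \<Gamma>) - 1)" by (rule sum_mono)
  then show "2 * card (edges \<Gamma>) \<le> card (verts \<Gamma>) * (card (verts \<Gamma>) - 1)" using handshake[OF sg] by simp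
qed

lemma small_cases:
  "3 < n \<Longrightarrow> n \<le> 10 \<Longrightarrow> n = 4 \<or> n = 5 \<or> n = 6 \<or> n = 7 \<or> n = 8 \<or> n = 9 \<or> n = (10 :: nat)"
  by presburger

text \<open>Hides the certificate behind an existential quantifier, so that later proofs do not
  carry a huge term along.\<close>

definition classifies :: "nat \<Rightarrow> nat \<Rightarrow> target option vec \<Rightarrow> bool" where
  "classifies n m t \<longleftrightarrow> (\<exists>vs e ls c. certified vs e (2 * m) t ls c \<and> e + 3 * length vs = 2 * m \<and>
     distinct vs \<and> length vs = n)"

lemma classifiesI:
  assumes "certified vs e k t ls c" "k = 2 * m" "e + 3 * length vs = 2 * m" "distinct vs" "length vs = n"
  shows "classifies n m t"
  using assms unfolding classifies_def by blast

text \<open>Internal 4-connectivity enters only through the assumptions of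
  \<open>labelled_graph\<close>; the bound 8 is that of the triangle condition.\<close>

lemma classify:
  assumes i4c: "internally_4_connected \<Gamma>" and m: "card (edges \<Gamma>) = m" "8 \<le> m"
    and n: "card (verts \<Gamma>) = n" and cls: "classifies n m t"
    and targets: "\<forall>i. \<forall>tg. get t i = Some tg \<longrightarrow> wf_target tg"
  shows "\<exists>i. \<exists>tg. get t i = Some tg \<and> has_minor \<Gamma> (target_graph tg)"
proof -
  obtain vs e ls c where cert: "certified vs e (2 * m) t ls c" "e + 3 * length vs = 2 * m"
    and vs: "distinct vs" "length vs = n" using cls unfolding classifies_def by blast
  interpret labelled_graph \<Gamma> vs
  proof
    show "distinct vs" "length vs = card (verts \<Gamma>)" using vs n by simp_all
  next
    fix v a b assume "v \<in> verts \<Gamma>" "card (nbr \<Gamma> v) = 3" "a \<in> nbr \<Gamma> v" "b \<in> nbr \<Gamma> v"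
    then show "{a, b} \<notin> edges \<Gamma>"
      using internally_4_connected_no_triangle[OF i4c] m by blast
  next
    fix U W assume "U \<subseteq> verts \<Gamma>" "W \<subseteq> verts \<Gamma>" "U \<inter> W = {}"
      "\<And>a b. a \<in> U \<Longrightarrow> b \<in> W \<Longrightarrow> {a, b} \<notin> edges \<Gamma>" "2 \<le> card U" "2 \<le> card W"
    then show "3 < card (verts \<Gamma> - U - W)" by (rule internally_4_connected_separation[OF i4c])
  qed (rule i4c_simple[OF i4c], rule i4c_min_degree[OF i4c])
  have "hits t" by (rule certified_sound[OF cert]) (use m targets in auto)
  then show ?thesis unfolding hits_def .
qed

section \<open>Unavoidable minors for each number of edges\<close>

lemma classifies_5_8: "classifies 5 8 (V None None None None None None None None None None)"
  by (rule classifiesI[OF cert_5_8]) simp_all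

text \<open>Sixteen edge ends and minimum degree three allow at most five vertices, while four
  vertices carry at most six edges.\<close>

lemma classify_8:
  assumes "internally_4_connected \<Gamma>" "card (edges \<Gamma>) = 8"
  shows "False"
proof -
  have "card (verts \<Gamma>) = 5"
    using small_cases[of "card (verts \<Gamma>)"] i4c_bounds[OF assms(1)] assms(2) by auto
  then show ?thesis
    using classify[OF assms _ _ classifies_5_8] by (simp add: ex_vx all_vx targets_wf)
qed

lemma classifies_5_9: "classifies 5 9 (V (Some tK33) None None None None None None None None None)"
  by (rule classifiesI[OF cert_5_9]) simp_all

lemma classifies_6_9: "classifies 6 9 (V (Some tK33) None None None None None None None None None)"
  by (rule classifiesI[OF cert_6_9]) simp_all

lemma classify_9:
  assumes "internally_4_connected \<Gamma>" "card (edges \<Gamma>) = 9"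
  shows "has_minor \<Gamma> (target_graph tK33)"
proof -
  have "card (verts \<Gamma>) = 5 \<or> card (verts \<Gamma>) = 6"
    using small_cases[of "card (verts \<Gamma>)"] i4c_bounds[OF assms(1)] assms(2) by auto
  then show ?thesis
  proof (elim disjE)
    assume "card (verts \<Gamma>) = 5"
    then show ?thesis
      using classify[OF assms _ _ classifies_5_9] by (simp add: ex_vx all_vx targets_wf)
  next
    assume "card (verts \<Gamma>) = 6"
    then show ?thesis
      using classify[OF assms _ _ classifies_6_9] by (simp add: ex_vx all_vx targets_wf)
  qed
qed

lemma classifies_5_10: "classifies 5 10 (V (Some tK5) None None None None None None None None None)"
  by (rule classifiesI[OF cert_5_10]) simp_all

lemma classifies_6_10: "classifies 6 10 (V (Some tK5) None None None None None None None None None)"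
  by (rule classifiesI[OF cert_6_10]) simp_all

lemma classify_10:
  assumes "internally_4_connected \<Gamma>" "card (edges \<Gamma>) = 10"
  shows "has_minor \<Gamma> (target_graph tK5)"
proof -
  have "card (verts \<Gamma>) = 5 \<or> card (verts \<Gamma>) = 6"
    using small_cases[of "card (verts \<Gamma>)"] i4c_bounds[OF assms(1)] assms(2) by auto
  then show ?thesis
  proof (elim disjE)
    assume "card (verts \<Gamma>) = 5"
    then show ?thesis
      using classify[OF assms _ _ classifies_5_10] by (simp add: ex_vx all_vx targets_wf)
  next
    assume "card (verts \<Gamma>) = 6"
    then show ?thesis
      using classify[OF assms _ _ classifies_6_10] by (simp add: ex_vx all_vx targets_wf)
  qed
qed

lemma classifies_6_11: "classifies 6 11 (V None None None None None None None None None None)"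
  by (rule classifiesI[OF cert_6_11]) simp_all

lemma classifies_7_11: "classifies 7 11 (V None None None None None None None None None None)"
  by (rule classifiesI[OF cert_7_11]) simp_all

lemma classify_11:
  assumes "internally_4_connected \<Gamma>" "card (edges \<Gamma>) = 11"
  shows "False"
proof -
  have "card (verts \<Gamma>) = 6 \<or> card (verts \<Gamma>) = 7"
    using small_cases[of "card (verts \<Gamma>)"] i4c_bounds[OF assms(1)] assms(2) by auto
  then show ?thesis
  proof (elim disjE)
    assume "card (verts \<Gamma>) = 6"
    then show ?thesis
      using classify[OF assms _ _ classifies_6_11] by (simp add: ex_vx all_vx targets_wf)
  next
    assume "card (verts \<Gamma>) = 7"
    then show ?thesis
      using classify[OF assms _ _ classifies_7_11] by (simp add: ex_vx all_vx targets_wf)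
  qed
qed

lemma classifies_6_12: "classifies 6 12 (V (Some tO) (Some tQ3) (Some tV8) None None None None None None None)"
  by (rule classifiesI[OF cert_6_12]) simp_all

lemma classifies_7_12: "classifies 7 12 (V (Some tO) (Some tQ3) (Some tV8) None None None None None None None)"
  by (rule classifiesI[OF cert_7_12]) simp_all

lemma classifies_8_12: "classifies 8 12 (V (Some tO) (Some tQ3) (Some tV8) None None None None None None None)"
  by (rule classifiesI[OF cert_8_12]) simp_all

lemma classify_12:
  assumes "internally_4_connected \<Gamma>" "card (edges \<Gamma>) = 12"
  shows "has_minor \<Gamma> (target_graph tO) \<or> has_minor \<Gamma> (target_graph tQ3) \<or> has_minor \<Gamma> (target_graph tV8)"
proof -
  have "card (verts \<Gamma>) = 6 \<or> card (verts \<Gamma>) = 7 \<or> card (verts \<Gamma>) = 8"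
    using small_cases[of "card (verts \<Gamma>)"] i4c_bounds[OF assms(1)] assms(2) by auto
  then show ?thesis
  proof (elim disjE)
    assume "card (verts \<Gamma>) = 6"
    then show ?thesis
      using classify[OF assms _ _ classifies_6_12] by (simp add: ex_vx all_vx targets_wf)
  next
    assume "card (verts \<Gamma>) = 7"
    then show ?thesis
      using classify[OF assms _ _ classifies_7_12] by (simp add: ex_vx all_vx targets_wf)
  next
    assume "card (verts \<Gamma>) = 8"
    then show ?thesis
      using classify[OF assms _ _ classifies_8_12] by (simp add: ex_vx all_vx targets_wf)
  qed
qed

lemma classifies_6_13: "classifies 6 13 (V (Some tH1) (Some tH2) (Some tH3) None None None None None None None)"
  by (rule classifiesI[OF cert_6_13]) simp_all

lemma classifies_7_13: "classifies 7 13 (V (Some tH1) (Some tH2) (Some tH3) None None None None None None None)"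
  by (rule classifiesI[OF cert_7_13]) simp_all

lemma classifies_8_13: "classifies 8 13 (V (Some tH1) (Some tH2) (Some tH3) None None None None None None None)"
  by (rule classifiesI[OF cert_8_13]) simp_all

lemma classify_13:
  assumes "internally_4_connected \<Gamma>" "card (edges \<Gamma>) = 13"
  shows "has_minor \<Gamma> (target_graph tH1) \<or> has_minor \<Gamma> (target_graph tH2) \<or> has_minor \<Gamma> (target_graph tH3)"
proof -
  have "card (verts \<Gamma>) = 6 \<or> card (verts \<Gamma>) = 7 \<or> card (verts \<Gamma>) = 8"
    using small_cases[of "card (verts \<Gamma>)"] i4c_bounds[OF assms(1)] assms(2) by auto
  then show ?thesis
  proof (elim disjE)
    assume "card (verts \<Gamma>) = 6"
    then show ?thesis
      using classify[OF assms _ _ classifies_6_13] by (simp add: ex_vx all_vx targets_wf)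
  next
    assume "card (verts \<Gamma>) = 7"
    then show ?thesis
      using classify[OF assms _ _ classifies_7_13] by (simp add: ex_vx all_vx targets_wf)
  next
    assume "card (verts \<Gamma>) = 8"
    then show ?thesis
      using classify[OF assms _ _ classifies_8_13] by (simp add: ex_vx all_vx targets_wf)
  qed
qed

lemma classifies_6_14: "classifies 6 14 (V (Some tH1) (Some tH2) (Some tH3) (Some tQML7) (Some tQ3x) (Some tY9) None None None None)"
  by (rule classifiesI[OF cert_6_14]) simp_all

lemma classifies_7_14: "classifies 7 14 (V (Some tH1) (Some tH2) (Some tH3) (Some tQML7) (Some tQ3x) (Some tY9) None None None None)"
  by (rule classifiesI[OF cert_7_14]) simp_all

lemma classifies_8_14: "classifies 8 14 (V (Some tH1) (Some tH2) (Some tH3) (Some tQML7) (Some tQ3x) (Some tY9) None None None None)"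
  by (rule classifiesI[OF cert_8_14]) simp_all

lemma classifies_9_14: "classifies 9 14 (V (Some tH1) (Some tH2) (Some tH3) (Some tQML7) (Some tQ3x) (Some tY9) None None None None)"
  by (rule classifiesI[OF cert_9_14]) simp_all

lemma classify_14:
  assumes "internally_4_connected \<Gamma>" "card (edges \<Gamma>) = 14"
  shows "has_minor \<Gamma> (target_graph tH1) \<or> has_minor \<Gamma> (target_graph tH2) \<or> has_minor \<Gamma> (target_graph tH3) \<or> has_minor \<Gamma> (target_graph tQML7) \<or> has_minor \<Gamma> (target_graph tQ3x) \<or> has_minor \<Gamma> (target_graph tY9)"
proof -
  have "card (verts \<Gamma>) = 6 \<or> card (verts \<Gamma>) = 7 \<or> card (verts \<Gamma>) = 8 \<or> card (verts \<Gamma>) = 9"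
    using small_cases[of "card (verts \<Gamma>)"] i4c_bounds[OF assms(1)] assms(2) by auto
  then show ?thesis
  proof (elim disjE)
    assume "card (verts \<Gamma>) = 6"
    then show ?thesis
      using classify[OF assms _ _ classifies_6_14] by (simp add: ex_vx all_vx targets_wf)
  next
    assume "card (verts \<Gamma>) = 7"
    then show ?thesis
      using classify[OF assms _ _ classifies_7_14] by (simp add: ex_vx all_vx targets_wf)
  next
    assume "card (verts \<Gamma>) = 8"
    then show ?thesis
      using classify[OF assms _ _ classifies_8_14] by (simp add: ex_vx all_vx targets_wf)
  next
    assume "card (verts \<Gamma>) = 9"
    then show ?thesis
      using classify[OF assms _ _ classifies_9_14] by (simp add: ex_vx all_vx targets_wf)
  qed
qed

lemma classifies_6_15: "classifies 6 15 (V (Some tH1) (Some tH2) (Some tH3) (Some tY9) (Some tP7) (Some tPrism) (Some tCML10) None None None)"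
  by (rule classifiesI[OF cert_6_15]) simp_all

lemma classifies_7_15: "classifies 7 15 (V (Some tH1) (Some tH2) (Some tH3) (Some tY9) (Some tP7) (Some tPrism) (Some tCML10) None None None)"
  by (rule classifiesI[OF cert_7_15]) simp_all

lemma classifies_8_15: "classifies 8 15 (V (Some tH1) (Some tH2) (Some tH3) (Some tY9) (Some tP7) (Some tPrism) (Some tCML10) None None None)"
  by (rule classifiesI[OF cert_8_15]) simp_all

lemma classifies_9_15: "classifies 9 15 (V (Some tH1) (Some tH2) (Some tH3) (Some tY9) (Some tP7) (Some tPrism) (Some tCML10) None None None)"
  by (rule classifiesI[OF cert_9_15]) simp_all

lemma classifies_10_15: "classifies 10 15 (V (Some tH1) (Some tH2) (Some tH3) (Some tY9) (Some tP7) (Some tPrism) (Some tCML10) None None None)"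
  by (rule classifiesI[OF cert_10_15]) simp_all

lemma classify_15:
  assumes "internally_4_connected \<Gamma>" "card (edges \<Gamma>) = 15"
  shows "has_minor \<Gamma> (target_graph tH1) \<or> has_minor \<Gamma> (target_graph tH2) \<or> has_minor \<Gamma> (target_graph tH3) \<or> has_minor \<Gamma> (target_graph tY9) \<or> has_minor \<Gamma> (target_graph tP7) \<or> has_minor \<Gamma> (target_graph tPrism) \<or> has_minor \<Gamma> (target_graph tCML10)"
proof -
  have "card (verts \<Gamma>) = 6 \<or> card (verts \<Gamma>) = 7 \<or> card (verts \<Gamma>) = 8 \<or> card (verts \<Gamma>) = 9 \<or> card (verts \<Gamma>) = 10"
    using small_cases[of "card (verts \<Gamma>)"] i4c_bounds[OF assms(1)] assms(2) by auto
  then show ?thesis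
  proof (elim disjE)
    assume "card (verts \<Gamma>) = 6"
    then show ?thesis
      using classify[OF assms _ _ classifies_6_15] by (simp add: ex_vx all_vx targets_wf)
  next
    assume "card (verts \<Gamma>) = 7"
    then show ?thesis
      using classify[OF assms _ _ classifies_7_15] by (simp add: ex_vx all_vx targets_wf)
  next
    assume "card (verts \<Gamma>) = 8"
    then show ?thesis
      using classify[OF assms _ _ classifies_8_15] by (simp add: ex_vx all_vx targets_wf)
  next
    assume "card (verts \<Gamma>) = 9"
    then show ?thesis
      using classify[OF assms _ _ classifies_9_15] by (simp add: ex_vx all_vx targets_wf)
  next
    assume "card (verts \<Gamma>) = 10"
    then show ?thesis
      using classify[OF assms _ _ classifies_10_15] by (simp add: ex_vx all_vx targets_wf)
  qed
qed

section \<open>Identification with the graphs of the statement\<close>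

text \<open>Turns comprehensions over pairs into images, which can be enumerated once the pairs come
  from a list.\<close>

lemma image_pairs: "(\<lambda>(i, j). h i j) ` U = {h i j | i j. (i, j) \<in> U}"
  unfolding image_def Bex_def split_paired_Ex by (simp add: conj_commute)

lemma graph_of_list_edges: "edges (graph_of_list n es) = (\<lambda>(i, j). {i, j}) ` set es"
  unfolding image_pairs by (simp add: graph_of_list_def)

lemma lessThan_sets:
  "{..<4 :: nat} = {0,1,2,3}" "{..<5 :: nat} = {0,1,2,3,4}" "{..<6 :: nat} = {0,1,2,3,4,5}"
  "{..<7 :: nat} = {0,1,2,3,4,5,6}" "{..<8 :: nat} = {0,1,2,3,4,5,6,7}"
  "{..<9 :: nat} = {0,1,2,3,4,5,6,7,8}" "{..<10 :: nat} = {0,1,2,3,4,5,6,7,8,9}"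
  by auto

lemma upt_lists:
  "[0..<4] = [0,1,2,3]" "[0..<5] = [0,1,2,3,4]" "[0..<6] = [0,1,2,3,4,5]" "[0..<7] = [0,1,2,3,4,5,6]"
  "[0..<10] = [0,1,2,3,4,5,6,7,8,9]"
  by code_simp+

lemma tH1_eq: "target_graph tH1 = H1" and tH2_eq: "target_graph tH2 = H2"
  and tH3_eq: "target_graph tH3 = H3" and tQ3x_eq: "target_graph tQ3x = Q3_times"
  and tY9_eq: "target_graph tY9 = Y9"
  by (rule graph.equality; simp add: graph_of_list_edges target_defs H1_def H2_def H3_def Q3_times_def Y9_def;
      simp add: graph_of_list_def lessThan_sets)+

lemma pairs_eq:
  "{{i, j} | i j. i < n \<and> j < n \<and> q i j} =
     (\<lambda>(i, j). {i, j}) ` set (filter (\<lambda>(i, j). q i j) (List.product [0..<n] [0..<n :: nat]))"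
  unfolding image_pairs by (simp add: conj_ac)

lemma tK4_eq: "target_graph tK4 = complete_graph 4"
  by (rule graph.equality) (simp_all add: complete_graph_def pairs_eq target_defs lessThan_sets upt_lists insert_commute del: One_nat_def)

lemma tK5_eq: "target_graph tK5 = complete_graph 5"
  by (rule graph.equality) (simp_all add: complete_graph_def pairs_eq target_defs lessThan_sets upt_lists insert_commute del: One_nat_def)

lemma tO_eq: "target_graph tO = octahedron"
  by (rule graph.equality) (simp_all add: octahedron_def pairs_eq target_defs lessThan_sets upt_lists insert_commute del: One_nat_def)

lemma tK33_eq: "target_graph tK33 = complete_bipartite 3 3"
proof (rule graph.equality)
  have "{{i, j} | i j. i < 3 \<and> 3 \<le> j \<and> j < (6 :: nat)} = {{i, j} | i j. i < 6 \<and> j < 6 \<and> (i < 3 \<and> 3 \<le> j)}"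
  proof -
    have "i < 3 \<and> 3 \<le> j \<and> j < 6 \<longleftrightarrow> i < 6 \<and> j < 6 \<and> (i < 3 \<and> 3 \<le> j)" for i j :: nat by arith
    then show ?thesis by (simp only:)
  qed
  then show "edges (target_graph tK33) = edges (complete_bipartite 3 3)"
    by (simp add: complete_bipartite_def pairs_eq target_defs upt_lists insert_commute del: One_nat_def)
qed (simp_all add: complete_bipartite_def target_defs lessThan_sets)

lemma circulant_edges:
  "edges (circulant n (set ds)) = (\<lambda>(i, d). {i, (i + d) mod n}) ` set (List.product [0..<n] ds)"
  unfolding image_pairs by (simp add: circulant_def)

lemma tQML7_eq: "target_graph tQML7 = QML7"
proof (rule graph.equality)
  show "edges (target_graph tQML7) = edges QML7"
    unfolding QML7_def list.set(2)[symmetric] list.set(1)[symmetric] circulant_edges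
    by (simp add: target_defs upt_lists insert_commute One_nat_def[symmetric] del: One_nat_def)
qed (simp_all add: QML7_def circulant_def target_defs lessThan_sets)

lemma tCML10_eq: "target_graph tCML10 = CML10"
proof (rule graph.equality)
  show "edges (target_graph tCML10) = edges CML10"
    unfolding CML10_def list.set(2)[symmetric] list.set(1)[symmetric] circulant_edges
    by (simp add: target_defs upt_lists insert_commute del: One_nat_def)
qed (simp_all add: CML10_def circulant_def target_defs lessThan_sets)

text \<open>The cube has sets as vertices, so only an isomorphism is available here.\<close>

lemma tQ3_iso: "target_graph tQ3 \<cong>\<^sub>G cube"
proof (rule graph_isoI)
  \<comment> \<open>The cycle A, B, C, D runs around the face of the subsets of {0, 1}; E, F, G, H
    are the same sets with 2 added.\<close>
  let ?f = "\<lambda>n. [{}, {0}, {0, 1}, {1}, {2}, {0, 2}, {0, 1, 2}, {1, 2}] ! n :: nat set"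
  have three: "{..<3 :: nat} = {0, 1, 2}" by auto
  have V: "verts (target_graph tQ3) = {0,1,2,3,4,5,6,7}" by (simp add: target_defs)
  show "bij_betw ?f (verts (target_graph tQ3)) (verts cube)"
    unfolding bij_betw_def
  proof
    show "inj_on ?f (verts (target_graph tQ3))"
      unfolding V
      \<comment> \<open>The inverse is a nested table indexed by membership of 0, 1 and 2.\<close>
      by (rule inj_on_inverseI[where g = "\<lambda>U. [[[0, 4], [3, 7]], [[1, 5], [2, 6]]]
        ! of_bool (0 \<in> U) ! of_bool (1 \<in> U) ! of_bool (2 \<in> U)"]) auto
    show "?f ` verts (target_graph tQ3) = verts cube"
      unfolding V cube_def three by (simp add: Pow_insert insert_commute)
  qed
  have "edges cube = (\<Union>U\<in>Pow {..<3}. (\<lambda>i. {U, insert i U}) ` ({..<3} - U))"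
    by (auto simp: cube_def)
  then show "edges cube = (`) ?f ` edges (target_graph tQ3)"
    unfolding three by (simp add: Pow_insert target_defs insert_commute insert_Diff_if)
qed

section \<open>Minors with a gap\<close>

lemma four_vertices_complete:
  assumes "simple_graph \<Theta>" "card (verts \<Theta>) = 4" "card (edges \<Theta>) = 6"
  shows "edges \<Theta> = {e. e \<subseteq> verts \<Theta> \<and> card e = 2}"
proof -
  have fin: "finite (verts \<Theta>)" using assms(1) by (simp add: simple_graph_def)
  have "edges \<Theta> \<subseteq> {e. e \<subseteq> verts \<Theta> \<and> card e = 2}" using assms(1) by (auto simp: simple_graph_def)
  moreover have "card {e. e \<subseteq> verts \<Theta> \<and> card e = 2} = 6"
    using n_subsets[OF fin, of 2] assms(2) by (simp add: choose_two)
  ultimately show ?thesis using assms(3) fin by (intro card_subset_eq) auto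
qed

text \<open>The vertex criterion requires seven edges, so K4 is treated directly. Both sides of a
  partition have three edges. If X misses a vertex, it is a triangle; if Y misses one, X is its
  star; otherwise all four vertices are in the boundary.\<close>

lemma i4c_four_vertices:
  assumes sg: "simple_graph \<Theta>" and V: "card (verts \<Theta>) = 4" and E: "card (edges \<Theta>) = 6"
  shows "internally_4_connected \<Theta>"
proof -
  have fin: "finite (verts \<Theta>)" "finite (edges \<Theta>)"
    using sg simple_graph_finite_edges by (auto simp: simple_graph_def)
  have adj: "{x, y} \<in> edges \<Theta>" if "x \<in> verts \<Theta>" "y \<in> verts \<Theta>" "x \<noteq> y" for x y
    unfolding four_vertices_complete[OF assms] using that by simp
  have "connected_graph (delete_verts \<Theta> S)" if S: "S \<subseteq> verts \<Theta>" "card S < 3" for S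
    unfolding connected_graph_def
  proof (intro conjI ballI)
    have "card (verts \<Theta> - S) \<noteq> 0" using card_Diff_subset[OF finite_subset[OF S(1) fin(1)] S(1)] S(2) V by simp
    then have "verts \<Theta> - S \<noteq> {}" by (metis card.empty)
    then show "verts (delete_verts \<Theta> S) \<noteq> {}" by (simp add: delete_verts_def)
    fix x y assume "x \<in> verts (delete_verts \<Theta> S)" "y \<in> verts (delete_verts \<Theta> S)"
    then show "(x, y) \<in> {(x, y). {x, y} \<in> edges (delete_verts \<Theta> S)}\<^sup>*"
      using adj[of x y] by (cases "x = y") (auto simp: delete_verts_def intro!: r_into_rtrancl)
  qed
  then have k: "k_connected 3 \<Theta>" using V by (simp add: k_connected_def)
  have "3 \<le> card (boundary X Y) \<and> (card (boundary X Y) = 3 \<longrightarrow>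
      is_triangle X \<or> (\<exists>v\<in>verts \<Theta>. degree \<Theta> v = 3 \<and> X = incident_edges \<Theta> v))"
    if XY: "X \<union> Y = edges \<Theta>" "X \<inter> Y = {}" "3 \<le> card X" "card X \<le> card Y" for X Y
  proof -
    have "card X + card Y = 6" using XY(1,2) fin(2) E card_Un_disjoint[of X Y] by (metis finite_Un)
    then have X: "card X = 3" using XY(3,4) by linarith
    have D: "boundary X Y = \<Union>X \<inter> \<Union>Y" unfolding boundary_def by blast
    have in_XY: "{x, y} \<in> X \<or> {x, y} \<in> Y" if "x \<in> verts \<Theta>" "y \<in> verts \<Theta>" "x \<noteq> y" for x y
      using adj[OF that] XY(1) by blast
    have "\<Union>X \<subseteq> verts \<Theta>" using XY(1) sg by (auto simp: simple_graph_def)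
    then have sub: "boundary X Y \<subseteq> verts \<Theta>" using D by blast
    have three: "card (verts \<Theta> - {v}) = 3" if "v \<in> verts \<Theta>" for v using that V fin(1) by simp
    have deg: "card (nbr \<Theta> v) = 3" if v: "v \<in> verts \<Theta>" for v
    proof -
      have "nbr \<Theta> v = verts \<Theta> - {v}" using nbr_subset[OF sg, of v] adj[OF v] by (auto simp: nbr_def)
      then show ?thesis using three[OF v] by simp
    qed
    consider v where "v \<in> verts \<Theta>" "v \<notin> \<Union>X" | v where "v \<in> verts \<Theta>" "v \<notin> \<Union>Y"
      | "verts \<Theta> \<subseteq> \<Union>X \<inter> \<Union>Y" by blast
    then show ?thesis
    proof cases
      case 1
      have "X \<subseteq> {e. e \<subseteq> verts \<Theta> - {v} \<and> card e = 2}"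
        using 1(2) XY(1) sg unfolding simple_graph_def by blast
      then have t: "is_triangle X" using edges_within_three(2)[of "verts \<Theta> - {v}" X] three[OF 1(1)] X fin(1) by simp
      then obtain a b c where abc: "a \<noteq> b" "b \<noteq> c" "a \<noteq> c" "X = {{a, b}, {b, c}, {a, c}}"
        unfolding is_triangle_def by blast
      then have "{a, b, c} \<subseteq> verts \<Theta> - {v}" using 1(2) \<open>\<Union>X \<subseteq> verts \<Theta>\<close> by auto
      then have "{v, a} \<in> Y" "{v, b} \<in> Y" "{v, c} \<in> Y" using in_XY[OF 1(1)] 1(2) by blast+
      then have "{a, b, c} \<subseteq> \<Union>X \<inter> \<Union>Y" unfolding abc(4) by blast
      then have "{a, b, c} \<subseteq> boundary X Y" unfolding D .
      then have "card {a, b, c} \<le> card (boundary X Y)" using finite_subset[OF sub fin(1)] by (rule card_mono[rotated])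
      then show ?thesis using t abc(1-3) by simp
    next
      case 2
      have "incident_edges \<Theta> v \<subseteq> X" using 2(2) XY(1) unfolding incident_edges_def by blast
      moreover have d: "card (incident_edges \<Theta> v) = 3" using deg[OF 2(1)] degree_eq[OF sg] by (simp add: degree_def)
      moreover have "finite X" using X card.infinite by fastforce
      ultimately have XI: "X = incident_edges \<Theta> v" using X card_subset_eq by metis
      have "verts \<Theta> - {v} \<subseteq> boundary X Y"
      proof
        fix w assume w: "w \<in> verts \<Theta> - {v}"
        have "card (verts \<Theta> - {v} - {w}) = 2" using w three[OF 2(1)] fin(1) by simp
        then obtain u where u: "u \<in> verts \<Theta>" "u \<noteq> v" "u \<noteq> w" by (metis Diff_iff card.empty equals0I insertCI zero_neq_numeral)
        have "{u, w} \<notin> X" using u w unfolding XI incident_edges_def by blast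
        then have "{u, w} \<in> Y" using in_XY[of u w] u w by blast
        moreover have "{v, w} \<in> X" unfolding XI incident_edges_def using adj[of v w] 2(1) w by blast
        ultimately show "w \<in> boundary X Y" unfolding D by blast
      qed
      then have "3 \<le> card (boundary X Y)"
        using card_mono[OF finite_subset[OF sub fin(1)]] three[OF 2(1)] by metis
      then show ?thesis using XI 2(1) deg[OF 2(1)] degree_eq[OF sg] by metis
    next
      case 3
      then have "boundary X Y = verts \<Theta>" using sub D by blast
      then show ?thesis using V by simp
    qed
  qed
  then show ?thesis using sg k unfolding internally_4_connected_def by blast
qed

lemma K4_of_four_vertices:
  assumes "simple_graph \<Gamma>" "card (verts \<Gamma>) = 4" "card (edges \<Gamma>) = 6"
  shows "\<Gamma> \<cong>\<^sub>G target_graph tK4"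
proof -
  let ?\<Delta> = "target_graph tK4"
  have D: "simple_graph ?\<Delta>" "card (verts ?\<Delta>) = 4" "card (edges ?\<Delta>) = 6"
    using checked_simple[OF checked_K4] checked_card_edges[OF checked_K4] by (simp_all add: tK4_eq complete_graph_def)
  have "finite (verts \<Gamma>)" "finite (verts ?\<Delta>)" using assms(1) D(1) by (simp_all add: simple_graph_def)
  then obtain f where f: "bij_betw f (verts \<Gamma>) (verts ?\<Delta>)"
    using finite_same_card_bij assms(2) D(2) by metis
  then have inj: "inj_on f (verts \<Gamma>)" and img: "f ` verts \<Gamma> = verts ?\<Delta>" by (simp_all add: bij_betw_def)
  have "(`) f ` {e. e \<subseteq> verts \<Gamma> \<and> card e = 2} = {e. e \<subseteq> verts ?\<Delta> \<and> card e = 2}"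
  proof
    show "(`) f ` {e. e \<subseteq> verts \<Gamma> \<and> card e = 2} \<subseteq> {e. e \<subseteq> verts ?\<Delta> \<and> card e = 2}"
    proof clarify
      fix e assume e: "e \<subseteq> verts \<Gamma>" "card e = 2"
      show "f ` e \<subseteq> verts ?\<Delta> \<and> card (f ` e) = 2"
        using e card_image[OF inj_on_subset[OF inj e(1)]] unfolding img[symmetric] by (simp add: image_mono)
    qed
    show "{e. e \<subseteq> verts ?\<Delta> \<and> card e = 2} \<subseteq> (`) f ` {e. e \<subseteq> verts \<Gamma> \<and> card e = 2}"
    proof clarify
      fix e assume e: "e \<subseteq> verts ?\<Delta>" "card e = 2"
      then have "e \<subseteq> f ` verts \<Gamma>" using img by simp
      then obtain d where d: "d \<subseteq> verts \<Gamma>" "e = f ` d" by (rule subset_imageE)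
      then have "card d = 2" using e(2) card_image[OF inj_on_subset[OF inj d(1)]] by simp
      then show "e \<in> (`) f ` {e. e \<subseteq> verts \<Gamma> \<and> card e = 2}" using d by blast
    qed
  qed
  then show ?thesis using four_vertices_complete[OF assms] four_vertices_complete[OF D] f by (intro graph_isoI[of f]) simp_all
qed

text \<open>Minimum degree three excludes isolated vertices, so a proper minor has fewer edges; a
  minor with equally many is the graph itself.\<close>

lemma has_minor_equal_edges:
  assumes "internally_4_connected \<Gamma>" "has_minor \<Gamma> (target_graph tg)" "checked tg (card (edges \<Gamma>))"
  shows "\<Gamma> \<cong>\<^sub>G target_graph tg"
  using has_minor_cases[OF assms(2)]
proof
  assume "has_proper_minor \<Gamma> (target_graph tg)"
  then have "card (edges (target_graph tg)) < card (edges \<Gamma>)"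
    using has_proper_minor_card_edges[OF _ simple_graph_wf simple_graph_finite_edges i4c_no_isolated]
      i4c_simple assms(1) by blast
  then show ?thesis using checked_card_edges[OF assms(3)] by simp
qed

text \<open>Six or seven edges force four vertices, since 3n \<le> 14, and these carry at most six
  edges. The remaining numbers are settled by the searches.\<close>

lemma few_edges:
  assumes "internally_4_connected \<Gamma>" "card (edges \<Gamma>) \<le> 11"
  shows "card (edges \<Gamma>) = 6 \<and> \<Gamma> \<cong>\<^sub>G target_graph tK4 \<or> card (edges \<Gamma>) = 9 \<and> \<Gamma> \<cong>\<^sub>G target_graph tK33 \<or>
    card (edges \<Gamma>) = 10 \<and> \<Gamma> \<cong>\<^sub>G target_graph tK5"
proof -
  have "6 \<le> card (edges \<Gamma>)" using i4c_bounds(1,2)[OF assms(1)] by linarith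
  then consider "card (edges \<Gamma>) = 6 \<or> card (edges \<Gamma>) = 7" | "card (edges \<Gamma>) = 8" | "card (edges \<Gamma>) = 9"
    | "card (edges \<Gamma>) = 10" | "card (edges \<Gamma>) = 11"
    using assms(2) by linarith
  then show ?thesis
  proof cases
    case 1
    then have V: "card (verts \<Gamma>) = 4" using i4c_bounds(1,2)[OF assms(1)] by linarith
    then have E: "card (edges \<Gamma>) = 6" using i4c_bounds(3)[OF assms(1)] 1 by auto
    then show ?thesis using K4_of_four_vertices[OF i4c_simple[OF assms(1)] V] by blast
  next
    case 2
    then show ?thesis using classify_8[OF assms(1)] by blast
  next
    case 3
    then show ?thesis using has_minor_equal_edges[OF assms(1) classify_9[OF assms(1) 3]] checked_K33 by simp
  next
    case 4
    then show ?thesis using has_minor_equal_edges[OF assms(1) classify_10[OF assms(1) 4]] checked_K5 by simp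
  next
    case 5
    then show ?thesis using classify_11[OF assms(1)] by blast
  qed
qed

section \<open>Consequences of the gap\<close>

locale minor_gap =
  fixes G1 :: "'a graph" and G2 :: "'b graph"
  assumes i4c1: "internally_4_connected G1" and i4c2: "internally_4_connected G2"
    and small: "card (edges G1) \<le> 15" and proper: "has_proper_minor G1 G2"
    and gap: "\<And>\<Gamma> :: nat graph. internally_4_connected \<Gamma> \<Longrightarrow> has_proper_minor G1 \<Gamma> \<Longrightarrow> has_minor \<Gamma> G2 \<Longrightarrow>
      int (card (edges G1)) - int (card (edges \<Gamma>)) > 3"
begin

lemma wf1: "wf_graph G1" and wf2: "wf_graph G2"
  using simple_graph_wf i4c_simple i4c1 i4c2 by blast+

text \<open>\<open>G2\<close> itself is an eligible intermediate graph once copied to the natural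
  numbers. The copy inherits internal 4-connectivity only from 8 edges on; below that
  \<open>G2\<close> is K4, for which the property is available directly.\<close>

lemma edges_gap: "card (edges G2) + 4 \<le> card (edges G1)"
proof (cases "8 \<le> card (edges G2)")
  case True
  have "finite (verts G2)" using i4c_simple[OF i4c2] by (simp add: simple_graph_def)
  then obtain \<Gamma> :: "nat graph" where iso: "G2 \<cong>\<^sub>G \<Gamma>" using nat_copy by blast
  have "has_proper_minor G1 \<Gamma>"
    using proper graph_iso_trans[OF _ iso] unfolding has_proper_minor_def by blast
  then have "int (card (edges G1)) - int (card (edges \<Gamma>)) > 3"
    using gap graph_iso_i4c[OF i4c2 True iso] graph_iso_has_minor[OF graph_iso_sym[OF wf2 iso]] by blast
  then show ?thesis using graph_iso_card_edges[OF wf2 iso] by linarith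
next
  case False
  then have K4: "card (edges G2) = 6" "G2 \<cong>\<^sub>G target_graph tK4" using few_edges[OF i4c2] by auto
  have "internally_4_connected (target_graph tK4)"
    using i4c_four_vertices[OF checked_simple[OF checked_K4]] checked_card_edges[OF checked_K4]
    by (simp add: tK4_eq complete_graph_def)
  moreover have "has_proper_minor G1 (target_graph tK4)"
    using proper graph_iso_trans[OF _ K4(2)] unfolding has_proper_minor_def by blast
  ultimately have "int (card (edges G1)) - int (card (edges (target_graph tK4))) > 3"
    using gap graph_iso_has_minor[OF graph_iso_sym[OF wf2 K4(2)]] by blast
  then show ?thesis using K4(1) checked_card_edges[OF checked_K4] by simp
qed

lemma G2_cases:
  obtains "card (edges G2) = 6" "G2 \<cong>\<^sub>G target_graph tK4"
  | "card (edges G2) = 9" "G2 \<cong>\<^sub>G target_graph tK33"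
  | "card (edges G2) = 10" "G2 \<cong>\<^sub>G target_graph tK5"
  using few_edges[OF i4c2] edges_gap small by linarith

text \<open>An internally 4-connected \<open>s\<close> between \<open>G1\<close> and
  \<open>G2\<close> that is smaller than \<open>G1\<close> by at most three edges violates the
  gap.\<close>

lemma no_intermediate:
  assumes "has_minor G1 (target_graph s)" "checked s k" "i4c_target s" "7 \<le> k" "k < card (edges G1)"
    "card (edges G1) \<le> k + 3" "has_minor (target_graph s) (target_graph t)" "G2 \<cong>\<^sub>G target_graph t"
  shows False
proof -
  have k: "card (edges (target_graph s)) = k" using checked_card_edges[OF assms(2)] .
  have "\<not> G1 \<cong>\<^sub>G target_graph s" using graph_iso_card_edges[OF wf1] k assms(5) by fastforce
  then have "has_proper_minor G1 (target_graph s)" using has_minor_cases[OF assms(1)] by blast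
  moreover have "has_minor (target_graph s) G2"
    using has_minor_trans[OF simple_graph_wf[OF checked_simple[OF assms(2)]] assms(7)]
      graph_iso_has_minor[OF graph_iso_sym[OF wf2 assms(8)]] by blast
  ultimately have "int (card (edges G1)) - int (card (edges (target_graph s))) > 3"
    using gap checked_i4c[OF assms(2,4,3)] by blast
  then show False using k assms(5,6) by linarith
qed

lemma G1_iso: "has_minor G1 (target_graph t) \<Longrightarrow> checked t (card (edges G1)) \<Longrightarrow> G1 \<cong>\<^sub>G target_graph t"
  using has_minor_equal_edges[OF i4c1] .

lemma G1_minor: "has_minor G1 (target_graph s) \<Longrightarrow> has_minor (target_graph s) (target_graph t) \<Longrightarrow>
    has_minor G1 (target_graph t)"
  using has_minor_trans[OF wf1] .

lemma not_minor:
  assumes "G1 \<cong>\<^sub>G target_graph s" "G2 \<cong>\<^sub>G target_graph t"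
    "\<not> has_minor (target_graph s) (target_graph t)"
  shows False
proof -
  have "has_minor G1 (target_graph t)"
    using has_minor_trans[OF wf1 has_proper_minor_has_minor[OF proper] graph_iso_has_minor[OF assms(2)]] .
  moreover have "has_minor (target_graph s) G1" "wf_graph (target_graph s)"
    using graph_iso_has_minor[OF graph_iso_sym[OF wf1 assms(1)]] graph_iso_wf[OF assms(1) wf1] .
  ultimately show False using has_minor_trans assms(3) by blast
qed

text \<open>Numbered for later use: 1 is K33, 2 is V8, 3 is O, 4 is Q3, 5 to 7 are H1 to H3, and 8
  is Y9.\<close>

lemmas mids = no_intermediate[OF _ checked_K33 i4c_K33] no_intermediate[OF _ checked_V8 i4c_V8]
  no_intermediate[OF _ checked_O i4c_O] no_intermediate[OF _ checked_Q3 i4c_Q3]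
  no_intermediate[OF _ checked_H1 i4c_H1] no_intermediate[OF _ checked_H2 i4c_H2]
  no_intermediate[OF _ checked_H3 i4c_H3] no_intermediate[OF _ checked_Y9 i4c_Y9]

end

lemma target_minor_trans:
  "checked r k \<Longrightarrow> has_minor (target_graph r) (target_graph s) \<Longrightarrow>
    has_minor (target_graph s) (target_graph t) \<Longrightarrow> has_minor (target_graph r) (target_graph t)"
  using has_minor_trans[OF simple_graph_wf[OF checked_simple]] .

lemmas V8_K4 = target_minor_trans[OF checked_V8 V8_K33 K33_K4]
  and H1_K4 = target_minor_trans[OF checked_H1 H1_O O_K4]
  and H2_K4 = target_minor_trans[OF checked_H2 H2_O O_K4]
  and H3_K4 = target_minor_trans[OF checked_H3 H3_Q3 Q3_K4]
  and Y9_K33 = target_minor_trans[OF checked_Y9 Y9_V8 V8_K33]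

lemmas Y9_K4 = target_minor_trans[OF checked_Y9 Y9_K33 K33_K4]

text \<open>The graphs named have all of K4, K33 and K5 as minors, so the gap is violated whatever
  \<open>G2\<close> is. H1, H2, H3 have 13 edges, fewer than \<open>G1\<close>; Y9 has 14, hence the
  extra condition on it.\<close>

lemma (in minor_gap) no_rich_minor:
  assumes "14 \<le> card (edges G1)"
  shows "\<not> has_minor G1 (target_graph tH1)" "\<not> has_minor G1 (target_graph tH2)"
    "\<not> has_minor G1 (target_graph tH3)" "card (edges G1) = 15 \<Longrightarrow> \<not> has_minor G1 (target_graph tY9)"
proof -
  show "\<not> has_minor G1 (target_graph tH1)"
    by (rule notI, rule G2_cases)
      (use assms small mids(5) H1_K4 H1_K33 H1_K5 in \<open>force+\<close>)
  show "\<not> has_minor G1 (target_graph tH2)"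
    by (rule notI, rule G2_cases)
      (use assms small mids(6) H2_K4 H2_K33 H2_K5 in \<open>force+\<close>)
  show "\<not> has_minor G1 (target_graph tH3)"
    by (rule notI, rule G2_cases)
      (use assms small mids(7) H3_K4 H3_K33 H3_K5 in \<open>force+\<close>)
  show "\<not> has_minor G1 (target_graph tY9)" if "card (edges G1) = 15"
    by (rule notI, rule G2_cases)
      (use that mids(8) Y9_K4 Y9_K33 Y9_K5 in \<open>force+\<close>)
qed

theorem theorem1p3:
  fixes G1 :: "'a graph" and G2 :: "'b graph"
  assumes "internally_4_connected G1" and "internally_4_connected G2"
    and "card (edges G1) \<le> 15"
    and "has_proper_minor G1 G2"
    and "\<And>G :: nat graph.
           internally_4_connected G \<Longrightarrow> has_proper_minor G1 G \<Longrightarrow> has_minor G G2 \<Longrightarrow>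
           int (card (edges G1)) - int (card (edges G)) > 3"
  shows
    "((G1 \<cong>\<^sub>G complete_graph 5 \<or> G1 \<cong>\<^sub>G cube \<or> G1 \<cong>\<^sub>G octahedron \<or> G1 \<cong>\<^sub>G QML7) \<and>
        G2 \<cong>\<^sub>G complete_graph 4) \<or>
     ((G1 \<cong>\<^sub>G H1 \<or> G1 \<cong>\<^sub>G H2 \<or> G1 \<cong>\<^sub>G H3 \<or> G1 \<cong>\<^sub>G QML7) \<and>
        G2 \<cong>\<^sub>G complete_bipartite 3 3) \<or>
     ((G1 \<cong>\<^sub>G Q3_times \<or> G1 \<cong>\<^sub>G Y9 \<or> G1 \<cong>\<^sub>G QML7 \<or> G1 \<cong>\<^sub>G CML10) \<and>
        G2 \<cong>\<^sub>G complete_graph 5)"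
proof -
  interpret minor_gap G1 G2 by unfold_locales (use assms in blast)+
  let ?g = target_graph
  note eqs = tK4_eq[symmetric] tK5_eq[symmetric] tK33_eq[symmetric] tO_eq[symmetric] tH1_eq[symmetric]
    tH2_eq[symmetric] tH3_eq[symmetric] tQML7_eq[symmetric] tQ3x_eq[symmetric] tY9_eq[symmetric] tCML10_eq[symmetric]
  have Q3: "G1 \<cong>\<^sub>G ?g tQ3 \<Longrightarrow> G1 \<cong>\<^sub>G cube" using graph_iso_trans[OF _ tQ3_iso] .
  \<comment> \<open>With 12 edges V8 is at most three below \<open>G1\<close> and contains K4 and
    K33, so only K5 can be \<open>G2\<close>.\<close>
  have V8: ?thesis if V: "has_minor G1 (?g tV8)" and E: "13 \<le> card (edges G1)"
    and K5: "G2 \<cong>\<^sub>G ?g tK5 \<Longrightarrow> ?thesis"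
  proof (cases rule: G2_cases)
    case 1
    then show ?thesis using mids(2)[OF V _ _ _ V8_K4] E small by simp
  next
    case 2
    then show ?thesis using mids(2)[OF V _ _ _ V8_K33] E small by simp
  qed (rule K5)
  \<comment> \<open>\<open>G2\<close> has at least six edges, and the gap adds four.\<close>
  consider "card (edges G1) = 10" | "card (edges G1) = 11" | "card (edges G1) = 12" | "card (edges G1) = 13"
    | "card (edges G1) = 14" | "card (edges G1) = 15"
    using edges_gap small by (cases rule: G2_cases) linarith+
  then show ?thesis
  proof cases
    case 1
    then have "G1 \<cong>\<^sub>G ?g tK5" using G1_iso[OF classify_10[OF i4c1 1]] checked_K5 by simp
    moreover have "G2 \<cong>\<^sub>G ?g tK4" using edges_gap 1 by (cases rule: G2_cases) auto
    ultimately show ?thesis unfolding eqs by blast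
  next
    case 2
    then show ?thesis using classify_11[OF i4c1] by blast
  next
    case 3
    have K4: "G2 \<cong>\<^sub>G ?g tK4" using edges_gap 3 by (cases rule: G2_cases) auto
    from classify_12[OF i4c1 3] show ?thesis
    proof (elim disjE)
      assume "has_minor G1 (?g tO)"
      then have "G1 \<cong>\<^sub>G ?g tO" using G1_iso checked_O 3 by simp
      then show ?thesis using K4 unfolding eqs by blast
    next
      assume "has_minor G1 (?g tQ3)"
      then have "G1 \<cong>\<^sub>G cube" using G1_iso checked_Q3 3 Q3 by simp
      then show ?thesis using K4 unfolding eqs by blast
    next
      assume "has_minor G1 (?g tV8)"
      \<comment> \<open>Here \<open>G1\<close> would be V8; K33 lies exactly three edges below it
        and contains K4.\<close>
      then have "has_minor G1 (?g tK33)" using G1_minor V8_K33 by blast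
      then show ?thesis using mids(1)[OF _ _ _ _ K33_K4 K4] 3 by simp
    qed
  next
    case 4
    \<comment> \<open>A graph \<open>G2\<close> with ten edges would need at least fourteen in
      \<open>G1\<close>.\<close>
    have K5: "\<not> card (edges G2) = 10" using edges_gap 4 by linarith
    \<comment> \<open>One of O and Q3 lies one edge below \<open>G1\<close> and contains K4, so K33
      is the only possible \<open>G2\<close>.\<close>
    have thin: ?thesis if "has_minor G1 (?g t)" "checked t 13" "has_minor (?g t) (?g tO) \<or> has_minor (?g t) (?g tQ3)"
      "G1 \<cong>\<^sub>G ?g t \<Longrightarrow> G2 \<cong>\<^sub>G ?g tK33 \<Longrightarrow> ?thesis" for t
    proof (cases rule: G2_cases)
      case 1
      from that(3) show ?thesis
      proof
        assume "has_minor (?g t) (?g tO)"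
        then show ?thesis using mids(3)[OF G1_minor[OF that(1)] _ _ _ O_K4 1(2)] 4 by simp
      next
        assume "has_minor (?g t) (?g tQ3)"
        then show ?thesis using mids(4)[OF G1_minor[OF that(1)] _ _ _ Q3_K4 1(2)] 4 by simp
      qed
    next
      case 2
      then show ?thesis using that(4) G1_iso[OF that(1)] that(2) 4 by simp
    next
      case 3
      then show ?thesis using K5 by blast
    qed
    from classify_13[OF i4c1 4] show ?thesis
    proof (elim disjE)
      assume "has_minor G1 (?g tH1)"
      then show ?thesis by (rule thin[OF _ checked_H1]) (use H1_O in blast, unfold eqs, blast)
    next
      assume "has_minor G1 (?g tH2)"
      then show ?thesis by (rule thin[OF _ checked_H2]) (use H2_O in blast, unfold eqs, blast)
    next
      assume "has_minor G1 (?g tH3)"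
      then show ?thesis by (rule thin[OF _ checked_H3]) (use H3_Q3 in blast, unfold eqs, blast)
    qed
  next
    case 5
    have "14 \<le> card (edges G1)" using 5 by simp
    note rich = no_rich_minor[OF this]
    from classify_14[OF i4c1 5] show ?thesis
    proof (elim disjE)
      assume "has_minor G1 (?g tQML7)"
      then have "G1 \<cong>\<^sub>G ?g tQML7" using G1_iso checked_QML7 5 by simp
      then show ?thesis unfolding eqs by (cases rule: G2_cases) blast+
    next
      assume Q: "has_minor G1 (?g tQ3x)"
      then have "G1 \<cong>\<^sub>G ?g tQ3x" using G1_iso checked_Q3x 5 by simp
      then show ?thesis using V8[OF G1_minor[OF Q Q3x_V8]] 5 unfolding eqs by simp
    next
      assume Y: "has_minor G1 (?g tY9)"
      then have "G1 \<cong>\<^sub>G ?g tY9" using G1_iso checked_Y9 5 by simp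
      then show ?thesis using V8[OF G1_minor[OF Y Y9_V8]] 5 unfolding eqs by simp
    qed (use rich in blast)+
  next
    case 6
    have "14 \<le> card (edges G1)" using 6 by simp
    note rich = no_rich_minor(1-3)[OF this] no_rich_minor(4)[OF this 6]
    from classify_15[OF i4c1 6] show ?thesis
    proof (elim disjE)
      assume P: "has_minor G1 (?g tP7)"
      then have iso: "G1 \<cong>\<^sub>G ?g tP7" using G1_iso checked_P7 6 by simp
      show ?thesis
      proof (cases rule: G2_cases)
        case 1
        \<comment> \<open>The octahedron has 12 edges, exactly three fewer than \<open>G1\<close>;
          the cube does the same for the prism.\<close>
        then show ?thesis using mids(3)[OF G1_minor[OF P P7_O] _ _ _ O_K4] 6 by simp
      next
        case 2
        then show ?thesis using not_minor[OF iso] P7_not_K33 unfolding eqs by blast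
      next
        case 3
        then show ?thesis using not_minor[OF iso] P7_not_K5 unfolding eqs by blast
      qed
    next
      assume P: "has_minor G1 (?g tPrism)"
      then have iso: "G1 \<cong>\<^sub>G ?g tPrism" using G1_iso checked_Prism 6 by simp
      show ?thesis
      proof (cases rule: G2_cases)
        case 1
        then show ?thesis using mids(4)[OF G1_minor[OF P Prism_Q3] _ _ _ Q3_K4] 6 by simp
      next
        case 2
        then show ?thesis using not_minor[OF iso] Prism_not_K33 unfolding eqs by blast
      next
        case 3
        then show ?thesis using not_minor[OF iso] Prism_not_K5 unfolding eqs by blast
      qed
    next
      assume C: "has_minor G1 (?g tCML10)"
      then have "G1 \<cong>\<^sub>G ?g tCML10" using G1_iso checked_CML10 6 by simp
      then show ?thesis using V8[OF G1_minor[OF C CML10_V8]] 6 unfolding eqs by simp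
    qed (use rich in blast)+
  qed
qed

end
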